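(* Let $(M,g)$ be a Kasner-type spacetime. Assume that $\mathrm P$ is a linear wave operator on $\mathbb C^m$-valued functions, for some $m\in\mathbb N$, such that $[\mathrm T,t^2\mathrm P]=0$ and $[\partial_{x_j},\mathrm P]=0$ for $j=1,\dots,n$. Let $v_1$ be a generalized quasinormal mode of $\mathrm P$ whose frequency $\sigma_{v_1}$ has the largest imaginary part among all quasinormal mode frequencies of $\mathrm P$. Then, for any $f\in C_c^\infty(M;\mathbb C^m)$, the unique backward propagated solution $u\in C^\infty(M;\mathbb C^m)$ to $\mathrm Pu=f$ satisfies $$\big|(t\partial_t)^k(\partial_x)^\alpha u(t,x)\big|\le C_{k,\alpha,\epsilon}\,t^{-\mathrm{Im}(\sigma_{v_1})-\epsilon}$$ for all $k\in\mathbb N_0$ and $\alpha\in\mathbb N_0^n$, any $\epsilon>0$, some $C_{k,\alpha,\epsilon}>0$, and all $(t,x)\in J^+(\gamma)$.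
   Context: Kasner-type spacetime: for $n\ge1$, $M=(0,\infty)_t\times\mathbb R^n_x$, $g=-\mathrm dt^2+\sum_{j=1}^nt^{2p_j}\mathrm dx_j^2$, with $p_1,\dots,p_n\in\mathbb R$ and $p_j<1$ for all $j$. $\mathrm T:=-t\partial_t-\sum_{j=1}^n(1-p_j)x_j\partial_{x_j}$, acting componentwise. A linear wave operator on $\mathbb C^m$-valued functions is a linear second-order $m\times m$ system with smooth coefficients and principal symbol $g^{-1}(\xi,\xi)\,\mathrm{id}$. A generalized quasinormal mode of $\mathrm P$ with frequency $\sigma\in\mathbb C$ is a $u\in C^\infty(M;\mathbb C^m)$ with $\mathrm Pu=0$ and $(\mathrm T+i\sigma)^ku=0$ for some $k\in\mathbb N$; $\sigma$ is a quasinormal mode frequency if a non-trivial such $u$ exists. Only finitely many frequencies satisfy $\mathrm{Im}(\sigma)\ge-\alpha$ for each $\alpha>0$. Time orientation: $\partial_t$ is future-directed. The backward propagated solution to $\mathrm Pu=f$ is the one with support in the causal past of $\mathrm{supp}(f)$ (in particular vanishing for large $t$). $\gamma(\tau)=(\tau,0,\dots,0)$, $\tau>0$, and $J^+(\gamma):=\overline{\bigcup_{\tau>0}J^+(\gamma(\tau))}$, where $J^+(p)$ is the causal future of $p$. $(\partial_x)^\alpha:=\partial_{x_1}^{\alpha_1}\cdots\partial_{x_n}^{\alpha_n}$. *)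

theory Defs
  imports "HOL-Analysis.Analysis"
begin

text \<open>
  A point of spacetime is a pair \<open>(t, x)\<close> of type \<open>real \<times> real ^ 'n\<close>; the dimension \<open>n \<ge> 1\<close> is
  \<open>CARD('n)\<close>, and \<open>m \<ge> 1\<close> is \<open>CARD('m)\<close>. Functions on the open set \<open>spacetime\<close> are total functions
  whose values outside \<open>spacetime\<close> are irrelevant.
\<close>

type_synonym 'n point = "real \<times> (real ^ 'n)"

definition spacetime :: "('n::finite) point set" where
  "spacetime = {z. 0 < fst z}"


subsection \<open>Smooth functions\<close>

primrec times_differentiable ::
  "nat \<Rightarrow> ('a::real_normed_vector) set \<Rightarrow> ('a \<Rightarrow> 'b::real_normed_vector) \<Rightarrow> bool" where
  "times_differentiable 0 S f \<longleftrightarrow> continuous_on S f"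
| "times_differentiable (Suc k) S f \<longleftrightarrow>
     (\<forall>z\<in>S. f differentiable (at z)) \<and>
     (\<forall>v. times_differentiable k S (\<lambda>z. frechet_derivative f (at z) v))"

text \<open>Only meant for open \<open>S\<close> in finite-dimensional spaces.\<close>

definition smooth_on :: "('a::real_normed_vector) set \<Rightarrow> ('a \<Rightarrow> 'b::real_normed_vector) \<Rightarrow> bool" where
  "smooth_on S f \<longleftrightarrow> (\<forall>k. times_differentiable k S f)"

definition dir_deriv :: "'a \<Rightarrow> ('a::real_normed_vector \<Rightarrow> 'b::real_normed_vector) \<Rightarrow> 'a \<Rightarrow> 'b" where
  "dir_deriv v f z = frechet_derivative f (at z) v"

abbreviation deriv_t ::
  "(('n::finite) point \<Rightarrow> 'b::real_normed_vector) \<Rightarrow> 'n point \<Rightarrow> 'b" where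
  "deriv_t \<equiv> dir_deriv (1, 0)"

abbreviation deriv_x ::
  "'n \<Rightarrow> (('n::finite) point \<Rightarrow> 'b::real_normed_vector) \<Rightarrow> 'n point \<Rightarrow> 'b" where
  "deriv_x j \<equiv> dir_deriv (0, axis j 1)"

text \<open>
  Since \<open>'n\<close> carries no order, an arbitrary enumeration of the coordinates is chosen for the
  composition of the \<open>\<partial>\<^sub>x\<^sub>j ^ \<alpha>\<^sub>j\<close>. On smooth functions the choice does not matter, because partial
  derivatives commute.
\<close>

definition multi_deriv_x ::
  "('n \<Rightarrow> nat) \<Rightarrow> (('n::finite) point \<Rightarrow> 'b::real_normed_vector) \<Rightarrow> 'n point \<Rightarrow> 'b" where
  "multi_deriv_x \<alpha> u =
     foldr (\<lambda>j. deriv_x j ^^ \<alpha> j) (SOME js. distinct js \<and> set js = UNIV) u"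

definition t_deriv_t ::
  "(('n::finite) point \<Rightarrow> 'b::real_normed_vector) \<Rightarrow> 'n point \<Rightarrow> 'b" where
  "t_deriv_t u z = fst z *\<^sub>R deriv_t u z"


subsection \<open>Kasner metric and causality\<close>

definition kasner_metric :: "real ^ 'n \<Rightarrow> ('n::finite) point \<Rightarrow> 'n point \<Rightarrow> 'n point \<Rightarrow> real" where
  "kasner_metric p z v w =
     - (fst v * fst w) + (\<Sum>j\<in>UNIV. fst z powr (2 * p $ j) * (snd v $ j * snd w $ j))"

text \<open>
  The inverse metric at \<open>z\<close> on covectors \<open>\<xi> = \<xi>\<^sub>t dt + (\<Sum>j. \<xi>\<^sub>j dx\<^sub>j)\<close>, written as pairs
  \<open>(\<xi>\<^sub>t, (\<xi>\<^sub>j)\<^sub>j)\<close>.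
\<close>

definition kasner_dual_metric :: "real ^ 'n \<Rightarrow> ('n::finite) point \<Rightarrow> 'n point \<Rightarrow> 'n point \<Rightarrow> real" where
  "kasner_dual_metric p z \<xi> \<eta> =
     - (fst \<xi> * fst \<eta>) + (\<Sum>j\<in>UNIV. fst z powr (- 2 * p $ j) * (snd \<xi> $ j * snd \<eta> $ j))"

definition future_causal :: "real ^ 'n \<Rightarrow> ('n::finite) point \<Rightarrow> 'n point \<Rightarrow> bool" where
  "future_causal p z v \<longleftrightarrow>
     v \<noteq> 0 \<and> kasner_metric p z v v \<le> 0 \<and> kasner_metric p z v (1, 0) < 0"

definition future_causal_curve :: "real ^ 'n \<Rightarrow> (real \<Rightarrow> ('n::finite) point) \<Rightarrow> bool" where
  "future_causal_curve p c \<longleftrightarrow>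
     continuous_on {0..1} c \<and> path_image c \<subseteq> spacetime \<and>
     (\<exists>F. finite F \<and> c C1_differentiable_on ({0..1} - F) \<and>
       (\<forall>s\<in>{0..1} - F. future_causal p (c s) (vector_derivative c (at s))))"

definition causal_future :: "real ^ 'n \<Rightarrow> ('n::finite) point \<Rightarrow> 'n point set" where
  "causal_future p z =
     insert z {w. \<exists>c. future_causal_curve p c \<and> pathstart c = z \<and> pathfinish c = w}"

definition causal_past_of_set :: "real ^ 'n \<Rightarrow> ('n::finite) point set \<Rightarrow> 'n point set" where
  "causal_past_of_set p K = {w\<in>spacetime. \<exists>z\<in>K. z \<in> causal_future p w}"

text \<open>\<open>J\<^sup>+(\<gamma>)\<close> for \<open>\<gamma>(\<tau>) = (\<tau>, 0)\<close>; the closure is the one in the topological space \<open>spacetime\<close>.\<close>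

definition causal_future_axis :: "real ^ 'n \<Rightarrow> ('n::finite) point set" where
  "causal_future_axis p = spacetime \<inter> closure (\<Union>\<tau>\<in>{0<..}. causal_future p (\<tau>, 0))"


subsection \<open>Linear wave operators\<close>

definition second_order_operator ::
  "('n point \<Rightarrow> 'n point \<Rightarrow> 'n point \<Rightarrow> complex ^ 'm ^ 'm) \<Rightarrow>
   ('n point \<Rightarrow> 'n point \<Rightarrow> complex ^ 'm ^ 'm) \<Rightarrow>
   ('n point \<Rightarrow> complex ^ 'm ^ 'm) \<Rightarrow>
   (('n::finite) point \<Rightarrow> complex ^ ('m::finite)) \<Rightarrow> 'n point \<Rightarrow> complex ^ 'm" where
  "second_order_operator A B C u z =
     (\<Sum>a\<in>Basis. \<Sum>b\<in>Basis. A a b z *v dir_deriv a (dir_deriv b u) z)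
     + (\<Sum>b\<in>Basis. B b z *v dir_deriv b u z)
     + C z *v u z"

text \<open>
  The principal symbol is obtained by replacing \<open>\<partial>\<^sub>a\<close> by \<open>\<i> \<xi>\<^sub>a\<close>, whence the sign
  \<open>\<i> \<xi>\<^sub>a * \<i> \<xi>\<^sub>b = - \<xi>\<^sub>a \<xi>\<^sub>b\<close>.
\<close>

definition principal_symbol ::
  "('n point \<Rightarrow> 'n point \<Rightarrow> 'n point \<Rightarrow> complex ^ 'm ^ 'm) \<Rightarrow>
   ('n::finite) point \<Rightarrow> 'n point \<Rightarrow> complex ^ ('m::finite) ^ 'm" where
  "principal_symbol A z \<xi> = (\<Sum>a\<in>Basis. \<Sum>b\<in>Basis. - ((\<xi> \<bullet> a) * (\<xi> \<bullet> b)) *\<^sub>R A a b z)"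

definition linear_wave_operator ::
  "real ^ 'n \<Rightarrow>
   ((('n::finite) point \<Rightarrow> complex ^ ('m::finite)) \<Rightarrow> 'n point \<Rightarrow> complex ^ 'm) \<Rightarrow> bool" where
  "linear_wave_operator p P \<longleftrightarrow>
     (\<exists>A B C.
       (\<forall>a\<in>Basis. \<forall>b\<in>Basis. smooth_on spacetime (A a b)) \<and>
       (\<forall>b\<in>Basis. smooth_on spacetime (B b)) \<and>
       smooth_on spacetime C \<and>
       (\<forall>u. smooth_on spacetime u \<longrightarrow>
          (\<forall>z\<in>spacetime. P u z = second_order_operator A B C u z)) \<and>
       (\<forall>z\<in>spacetime. \<forall>\<xi>.
          principal_symbol A z \<xi> = mat (complex_of_real (kasner_dual_metric p z \<xi> \<xi>))))"

definition operators_commute ::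
  "((('n::finite) point \<Rightarrow> complex ^ ('m::finite)) \<Rightarrow> 'n point \<Rightarrow> complex ^ 'm) \<Rightarrow>
   (('n point \<Rightarrow> complex ^ 'm) \<Rightarrow> 'n point \<Rightarrow> complex ^ 'm) \<Rightarrow> bool" where
  "operators_commute Q R \<longleftrightarrow>
     (\<forall>u. smooth_on spacetime u \<longrightarrow> (\<forall>z\<in>spacetime. Q (R u) z - R (Q u) z = 0))"

definition scaling_field ::
  "real ^ 'n \<Rightarrow> (('n::finite) point \<Rightarrow> complex ^ ('m::finite)) \<Rightarrow> 'n point \<Rightarrow> complex ^ 'm" where
  "scaling_field p u z =
     - (fst z *\<^sub>R deriv_t u z) - (\<Sum>j\<in>UNIV. ((1 - p $ j) * snd z $ j) *\<^sub>R deriv_x j u z)"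


subsection \<open>Generalized quasinormal modes and backward solutions\<close>

definition generalized_qnm ::
  "real ^ 'n \<Rightarrow>
   ((('n::finite) point \<Rightarrow> complex ^ ('m::finite)) \<Rightarrow> 'n point \<Rightarrow> complex ^ 'm) \<Rightarrow>
   complex \<Rightarrow> ('n point \<Rightarrow> complex ^ 'm) \<Rightarrow> bool" where
  "generalized_qnm p P \<sigma> u \<longleftrightarrow>
     smooth_on spacetime u \<and>
     (\<forall>z\<in>spacetime. P u z = 0) \<and>
     (\<exists>k\<ge>1. \<forall>z\<in>spacetime. ((\<lambda>w z. scaling_field p w z + (\<i> * \<sigma>) *s w z) ^^ k) u z = 0)"

definition nontrivial :: "(('n::finite) point \<Rightarrow> complex ^ ('m::finite)) \<Rightarrow> bool" where
  "nontrivial u \<longleftrightarrow> (\<exists>z\<in>spacetime. u z \<noteq> 0)"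

definition qnm_frequency ::
  "real ^ 'n \<Rightarrow>
   ((('n::finite) point \<Rightarrow> complex ^ ('m::finite)) \<Rightarrow> 'n point \<Rightarrow> complex ^ 'm) \<Rightarrow>
   complex \<Rightarrow> bool" where
  "qnm_frequency p P \<sigma> \<longleftrightarrow> (\<exists>u. generalized_qnm p P \<sigma> u \<and> nontrivial u)"

definition spacetime_support :: "(('n::finite) point \<Rightarrow> complex ^ ('m::finite)) \<Rightarrow> 'n point set" where
  "spacetime_support f = spacetime \<inter> closure {z\<in>spacetime. f z \<noteq> 0}"

definition backward_solution ::
  "real ^ 'n \<Rightarrow>
   ((('n::finite) point \<Rightarrow> complex ^ ('m::finite)) \<Rightarrow> 'n point \<Rightarrow> complex ^ 'm) \<Rightarrow>
   ('n point \<Rightarrow> complex ^ 'm) \<Rightarrow> ('n point \<Rightarrow> complex ^ 'm) \<Rightarrow> bool" where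
  "backward_solution p P f u \<longleftrightarrow>
     smooth_on spacetime u \<and>
     (\<forall>z\<in>spacetime. P u z = f z) \<and>
     spacetime_support u \<subseteq> causal_past_of_set p (spacetime_support f)"

end

theory Submission
  imports Defs "HOL-Computational_Algebra.Fundamental_Theorem_Algebra"
begin

text \<open>
  Multiplied by \<open>t\<^sup>2\<close>, the operator becomes very rigid: translation invariance makes its coefficients
  functions of \<open>t\<close> alone, and commutation with the scaling field fixes their powers of \<open>t\<close>
  (\<open>wave_operator_normal_form\<close>). With \<open>q j = 1 - p j > 0\<close>,
  \<open>t\<^sup>2 P = (t \<partial>\<^sub>t)\<^sup>2 + b (t \<partial>\<^sub>t) + c + (\<Sum>j. t powr q j * bx j \<partial>\<^sub>j) - (\<Sum>j. t powr (2 q j) * \<partial>\<^sub>j\<^sup>2)\<close>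
  for constant matrices. All spatial terms carry positive powers of \<open>t\<close>, so at \<open>t = 0\<close> the operator
  is governed by the indicial equation \<open>l\<^sup>2 w + l b w + c w = 0\<close>. Each root \<open>l\<close> gives a mode
  \<open>t powr l * w\<close> with frequency \<open>- \<i> l\<close> (\<open>indicial_root_gives_frequency\<close>); hence every
  \<open>\<nu> < - Im \<sigma>\<^sub>1\<close> lies strictly to the left of the real parts of all roots, and \<open>t powr \<nu>\<close> is the
  decay to be proved.

  Light rays travel at the coordinate speed \<open>t powr (q j - 1)\<close>, which is integrable at \<open>t = 0\<close>. So
  the solution stays in a bounded spatial region, and space may be replaced by a large torus: a
  periodic solution vanishes in a shell around the source, by finite speed of propagation
  (\<open>vanishing_from_fronts\<close>, an energy estimate with weights that vanish outside of an intersection of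
  characteristic half spaces), and cutting it off in the shell gives the solution itself.

  On the torus, in the time \<open>s = ln t\<close>, the equation decouples into linear ordinary differential
  equations for the Fourier modes. An energy estimate whose constant does not depend on the mode gives
  some exponential rate for all modes together (\<open>modes_energy_bound\<close>). The rate is then improved in steps of
  \<open>min q j\<close>, because the spatial terms gain this much relative to the solution: they are moved to
  the right hand side of an equation with constant coefficients, whose solutions grow no worse than
  its inhomogeneity as long as the rate stays below the indicial roots (\<open>modes_growth\<close>).
  Multiplication of the modes by powers of the frequency and derivatives in \<open>s\<close> preserve the rate, which gives the
  smoothness of the Fourier series and the bounds for all derivatives. Since the solution is
  bounded uniformly in \<open>x\<close>, the estimate holds on all of spacetime.

  Support in the causal past, and with it uniqueness, is reduced to \<open>vanishing_from_fronts\<close> too: a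
  point whose causal future avoids a compact set is separated from it by finitely many
  characteristic half spaces (\<open>support_in_causal_past\<close>).
\<close>

section \<open>Smooth functions\<close>

lemma dir_deriv_eqI: "(f has_derivative f') (at z) \<Longrightarrow> dir_deriv v f z = f' v"
  unfolding dir_deriv_def using frechet_derivative_at by fastforce

lemma dir_deriv_cong:
  assumes "open S" "z \<in> S" "\<And>y. y \<in> S \<Longrightarrow> f y = g y" "f differentiable (at z)"
  shows "dir_deriv v f z = dir_deriv v g z"
  unfolding dir_deriv_def
  using frechet_derivative_transform_within_open[OF assms(4,1,2)] assms(3) by metis

lemma differentiable_cong_open:
  assumes "open S" "z \<in> S" "\<And>y. y \<in> S \<Longrightarrow> f y = g y" "f differentiable (at z)"
  shows "g differentiable (at z)"
  using assms has_derivative_transform_within_open unfolding differentiable_def by metis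

lemma times_differentiable_cong:
  assumes "open S" "\<And>z. z \<in> S \<Longrightarrow> f z = g z" "times_differentiable k S f"
  shows "times_differentiable k S g"
  using assms(2,3)
proof (induction k arbitrary: f g)
  case 0
  then show ?case using continuous_on_cong by force
next
  case (Suc k)
  have d: "f differentiable (at z)" if "z \<in> S" for z using Suc.prems that by auto
  have "times_differentiable k S (\<lambda>z. frechet_derivative g (at z) v)" for v
  proof (rule Suc.IH)
    show "times_differentiable k S (\<lambda>z. frechet_derivative f (at z) v)" using Suc.prems by auto
    show "frechet_derivative f (at z) v = frechet_derivative g (at z) v" if "z \<in> S" for z
      using dir_deriv_cong[OF assms(1) that Suc.prems(1) d[OF that]] unfolding dir_deriv_def by auto
  qed
  moreover have "g differentiable (at z)" if "z \<in> S" for z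
    using differentiable_cong_open[OF assms(1) that Suc.prems(1) d[OF that]] .
  ultimately show ?case by auto
qed

lemma times_differentiable_SucD: "times_differentiable (Suc k) S f \<Longrightarrow> times_differentiable k S f"
proof (induction k arbitrary: f)
  case 0
  then show ?case
    by (auto intro!: continuous_at_imp_continuous_on differentiable_imp_continuous_within)
next
  case (Suc k)
  then show ?case by simp
qed

lemma times_differentiable_Un:
  assumes "open S" "open T" "times_differentiable k S f" "times_differentiable k T f"
  shows "times_differentiable k (S \<union> T) f"
  using assms(3,4) by (induction k arbitrary: f) (auto intro: continuous_on_open_Un assms)

lemma smooth_on_Un:
  "open S \<Longrightarrow> open T \<Longrightarrow> smooth_on S f \<Longrightarrow> smooth_on T f \<Longrightarrow> smooth_on (S \<union> T) f"
  unfolding smooth_on_def by (auto intro: times_differentiable_Un)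

lemma times_differentiable_subset:
  "T \<subseteq> S \<Longrightarrow> times_differentiable k S f \<Longrightarrow> times_differentiable k T f"
  by (induction k arbitrary: f) (auto intro: continuous_on_subset)

lemma smooth_on_subset: "smooth_on S f \<Longrightarrow> T \<subseteq> S \<Longrightarrow> smooth_on T f"
  unfolding smooth_on_def by (auto intro: times_differentiable_subset)

lemma smooth_on_cong:
  "open S \<Longrightarrow> (\<And>z. z \<in> S \<Longrightarrow> f z = g z) \<Longrightarrow> smooth_on S f \<Longrightarrow> smooth_on S g"
  unfolding smooth_on_def using times_differentiable_cong by blast

lemma smooth_on_differentiable: "smooth_on S f \<Longrightarrow> z \<in> S \<Longrightarrow> f differentiable (at z)"
  unfolding smooth_on_def by (drule spec[where x="Suc 0"]) auto

lemma smooth_on_continuous_on: "smooth_on S f \<Longrightarrow> continuous_on S f"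
  unfolding smooth_on_def by (drule spec[where x=0]) auto

lemma smooth_on_dir_deriv: "smooth_on S f \<Longrightarrow> smooth_on S (dir_deriv v f)"
  unfolding smooth_on_def dir_deriv_def
proof
  fix k assume "\<forall>k. times_differentiable k S f"
  then have "times_differentiable (Suc k) S f" by blast
  then show "times_differentiable k S (\<lambda>z. frechet_derivative f (at z) v)" by auto
qed

lemma smooth_on_has_derivative:
  "smooth_on S f \<Longrightarrow> z \<in> S \<Longrightarrow> (f has_derivative (\<lambda>v. dir_deriv v f z)) (at z)"
  unfolding dir_deriv_def using smooth_on_differentiable frechet_derivative_works by fastforce

lemma dir_deriv_basis_sum:
  fixes f :: "'a::euclidean_space \<Rightarrow> 'b::real_normed_vector"
  assumes "f differentiable (at z)"
  shows "dir_deriv v f z = (\<Sum>b\<in>Basis. (v \<bullet> b) *\<^sub>R dir_deriv b f z)"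
proof -
  have l: "linear (frechet_derivative f (at z))" using assms linear_frechet_derivative by blast
  have "frechet_derivative f (at z) v = frechet_derivative f (at z) (\<Sum>b\<in>Basis. (v \<bullet> b) *\<^sub>R b)"
    by (simp add: euclidean_representation)
  also have "\<dots> = (\<Sum>b\<in>Basis. (v \<bullet> b) *\<^sub>R frechet_derivative f (at z) b)"
    using l by (simp add: linear_sum linear_scale)
  finally show ?thesis by (simp add: dir_deriv_def)
qed

text \<open>
  A class of functions that is closed under directional derivatives on \<open>S\<close> consists of smooth
  functions. This spares any formula for the higher derivatives of exponentials or Fourier series.
\<close>

lemma smooth_on_coinduct:
  assumes "open S" "f \<in> C"
    and "\<And>g z. g \<in> C \<Longrightarrow> z \<in> S \<Longrightarrow> g differentiable (at z)"
    and "\<And>g v. g \<in> C \<Longrightarrow> \<exists>h\<in>C. \<forall>z\<in>S. dir_deriv v g z = h z"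
  shows "smooth_on S f"
proof -
  have "times_differentiable k S g" if "g \<in> C" for g k
    using that
  proof (induction k arbitrary: g)
    case 0
    then show ?case using assms(3) 
      by (auto intro!: continuous_at_imp_continuous_on differentiable_imp_continuous_within)
  next
    case (Suc k)
    have "times_differentiable k S (\<lambda>z. frechet_derivative g (at z) v)" for v
    proof -
      obtain h where h: "h \<in> C" "\<forall>z\<in>S. dir_deriv v g z = h z" using assms(4) Suc.prems by blast
      show ?thesis
        by (rule times_differentiable_cong[OF assms(1) _ Suc.IH[OF h(1)]])
           (use h(2) in \<open>auto simp: dir_deriv_def\<close>)
    qed
    then show ?case using assms(3) Suc.prems by auto
  qed
  then show ?thesis using assms(2) unfolding smooth_on_def by blast
qed

lemma times_differentiable_const: "times_differentiable k S (\<lambda>_. c)"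
  by (induction k arbitrary: c) auto

lemma smooth_on_const: "smooth_on S (\<lambda>_. c)"
  unfolding smooth_on_def using times_differentiable_const by blast

lemma smooth_on_bounded_linear: "bounded_linear f \<Longrightarrow> smooth_on S f"
proof -
  assume bl: "bounded_linear f"
  then have "frechet_derivative f (at z) = f" for z
    using bounded_linear_imp_has_derivative frechet_derivative_at by metis
  then have "times_differentiable (Suc k) S f" for k
    using times_differentiable_const[of k S] bl bounded_linear_imp_differentiable by auto
  then show ?thesis unfolding smooth_on_def using times_differentiable_SucD by blast
qed

lemma times_differentiable_add:
  assumes "open S" "times_differentiable k S f" "times_differentiable k S g"
  shows "times_differentiable k S (\<lambda>z. f z + g z)"
  using assms(2,3)
proof (induction k arbitrary: f g)
  case 0
  then show ?case by (auto intro: continuous_intros)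
next
  case (Suc k)
  have "times_differentiable k S (\<lambda>z. frechet_derivative (\<lambda>z. f z + g z) (at z) v)" for v
  proof (rule times_differentiable_cong[OF assms(1)])
    show "times_differentiable k S (\<lambda>z. frechet_derivative f (at z) v + frechet_derivative g (at z) v)"
      using Suc by auto
    show "frechet_derivative f (at z) v + frechet_derivative g (at z) v
        = frechet_derivative (\<lambda>z. f z + g z) (at z) v" if "z \<in> S" for z
    proof -
      have "(f has_derivative frechet_derivative f (at z)) (at z)" "(g has_derivative frechet_derivative g (at z)) (at z)"
        using Suc.prems that by (auto simp: frechet_derivative_works[symmetric])
      from frechet_derivative_at[OF has_derivative_add[OF this]] show ?thesis by metis
    qed
  qed
  then show ?case using Suc.prems by auto
qed

lemma smooth_on_add: "open S \<Longrightarrow> smooth_on S f \<Longrightarrow> smooth_on S g \<Longrightarrow> smooth_on S (\<lambda>z. f z + g z)"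
  unfolding smooth_on_def by (auto intro: times_differentiable_add)

lemma times_differentiable_bilinear:
  assumes "bounded_bilinear B" "open S" "times_differentiable k S f" "times_differentiable k S g"
  shows "times_differentiable k S (\<lambda>z. B (f z) (g z))"
  using assms(3,4)
proof (induction k arbitrary: f g)
  case 0
  then show ?case using bounded_bilinear.continuous_on[OF assms(1)] by auto
next
  case (Suc k)
  have fd: "((\<lambda>z. B (f z) (g z)) has_derivative (\<lambda>v. B (f z) (frechet_derivative g (at z) v)
       + B (frechet_derivative f (at z) v) (g z))) (at z)" if "z \<in> S" for z
    by (rule bounded_bilinear.FDERIV[OF assms(1)])
       (use Suc.prems that in \<open>auto simp: frechet_derivative_works[symmetric]\<close>)
  have "times_differentiable k S (\<lambda>z. frechet_derivative (\<lambda>z. B (f z) (g z)) (at z) v)" for v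
  proof (rule times_differentiable_cong[OF assms(2)])
    show "times_differentiable k S (\<lambda>z. B (f z) (frechet_derivative g (at z) v)
       + B (frechet_derivative f (at z) v) (g z))"
      using Suc.prems times_differentiable_SucD[OF Suc.prems(1)] times_differentiable_SucD[OF Suc.prems(2)]
      by (intro times_differentiable_add assms(2) Suc.IH) auto
    show "B (f z) (frechet_derivative g (at z) v) + B (frechet_derivative f (at z) v) (g z)
        = frechet_derivative (\<lambda>z. B (f z) (g z)) (at z) v" if "z \<in> S" for z
      using frechet_derivative_at[OF fd[OF that]] by metis
  qed
  then show ?case using fd unfolding times_differentiable.simps differentiable_def by blast
qed

lemma smooth_on_bilinear:
  assumes "bounded_bilinear B" "open S" "smooth_on S f" "smooth_on S g"
  shows "smooth_on S (\<lambda>z. B (f z) (g z))"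
  using assms unfolding smooth_on_def by (auto intro: times_differentiable_bilinear)

lemma smooth_on_scaleR:
  "open S \<Longrightarrow> smooth_on S f \<Longrightarrow> smooth_on S g \<Longrightarrow> smooth_on S (\<lambda>z. f z *\<^sub>R g z)"
  using smooth_on_bilinear[OF bounded_bilinear_scaleR] .

lemma smooth_on_sum:
  assumes "open S" "\<And>i. i \<in> I \<Longrightarrow> smooth_on S (f i)"
  shows "smooth_on S (\<lambda>z. \<Sum>i\<in>I. f i z)"
  using assms(2) by (induction I rule: infinite_finite_induct)
    (auto intro: smooth_on_const smooth_on_add assms(1))

lemma smooth_on_diff:
  assumes "open S" "smooth_on S f" "smooth_on S g" shows "smooth_on S (\<lambda>z. f z - g z)"
  using smooth_on_add[OF assms(1,2) smooth_on_scaleR[OF assms(1) smooth_on_const[of S "-1::real"] assms(3)]]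
  by simp

lemma smooth_on_linear_comp:
  assumes "bounded_linear h" "open S" "smooth_on S f"
  shows "smooth_on S (\<lambda>z. h (f z))"
proof (rule smooth_on_coinduct[where C="{\<lambda>z. h (g z) | g. smooth_on S g}"])
  show "open S" by fact
  show "(\<lambda>z. h (f z)) \<in> {\<lambda>z. h (g z) | g. smooth_on S g}" using assms by blast
  fix g' v assume "g' \<in> {\<lambda>z. h (g z) | g. smooth_on S g}"
  then obtain g where g: "g' = (\<lambda>z. h (g z))" "smooth_on S g" by blast
  have d: "(g' has_derivative (\<lambda>v. h (dir_deriv v g z))) (at z)" if "z \<in> S" for z
    unfolding g(1) by (rule bounded_linear.has_derivative[OF assms(1) smooth_on_has_derivative[OF g(2) that]])
  then show "g' differentiable at z" if "z \<in> S" for z using that differentiable_def by blast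
  show "\<exists>h'\<in>{\<lambda>z. h (g z) | g. smooth_on S g}. \<forall>z\<in>S. dir_deriv v g' z = h' z"
  proof (intro bexI ballI)
    show "dir_deriv v g' z = (\<lambda>z. h (dir_deriv v g z)) z" if "z \<in> S" for z
      by (simp add: dir_deriv_eqI[OF d[OF that]])
    show "(\<lambda>z. h (dir_deriv v g z)) \<in> {\<lambda>z. h (g z) | g. smooth_on S g}"
      using smooth_on_dir_deriv[OF g(2)] by blast
  qed
qed

text \<open>Both mixed derivatives are limits of the same second difference quotient.\<close>

lemma real_mixed_difference:
  fixes f :: "'a::real_normed_vector \<Rightarrow> real"
  assumes "smooth_on S f" "h > 0"
    and seg: "\<And>r s. 0 \<le> r \<Longrightarrow> r \<le> h \<Longrightarrow> 0 \<le> s \<Longrightarrow> s \<le> h \<Longrightarrow> z + r *\<^sub>R a + s *\<^sub>R b \<in> S"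
  obtains r s where "0 \<le> r" "r \<le> h" "0 \<le> s" "s \<le> h"
    "f (z + h *\<^sub>R a + h *\<^sub>R b) - f (z + h *\<^sub>R b) - f (z + h *\<^sub>R a) + f z
      = h * h * dir_deriv a (dir_deriv b f) (z + r *\<^sub>R a + s *\<^sub>R b)"
proof -
  have D: "DERIV (\<lambda>s. f (y + s *\<^sub>R v)) s :> dir_deriv v f (y + s *\<^sub>R v)"
    if "smooth_on S f" "y + s *\<^sub>R v \<in> S" for f :: "'a \<Rightarrow> real" and y v s
  proof -
    have "((\<lambda>s. y + s *\<^sub>R v) has_derivative (\<lambda>x. x *\<^sub>R v)) (at s)"
      by (auto intro!: derivative_eq_intros)
    from has_derivative_compose[OF this smooth_on_has_derivative[OF that]]
    have "((\<lambda>s. f (y + s *\<^sub>R v)) has_derivative (\<lambda>x. dir_deriv (x *\<^sub>R v) f (y + s *\<^sub>R v))) (at s)" .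
    moreover have "dir_deriv (x *\<^sub>R v) f (y + s *\<^sub>R v) = x * dir_deriv v f (y + s *\<^sub>R v)" for x
      using linear_scale[OF has_derivative_linear[OF smooth_on_has_derivative[OF that]], of x v] by simp
    ultimately show ?thesis unfolding has_field_derivative_def
      by (elim has_derivative_eq_rhs) (auto simp: fun_eq_iff)
  qed
  let ?g = "\<lambda>s. f ((z + h *\<^sub>R a) + s *\<^sub>R b) - f (z + s *\<^sub>R b)"
  have "\<exists>s>0. s < h \<and> ?g h - ?g 0 = (h - 0) * (dir_deriv b f ((z + h *\<^sub>R a) + s *\<^sub>R b) - dir_deriv b f (z + s *\<^sub>R b))"
  proof (rule MVT2)
    fix s assume "0 \<le> s" "s \<le> h"
    then have "z + h *\<^sub>R a + s *\<^sub>R b \<in> S" "z + s *\<^sub>R b \<in> S"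
      using seg[of h s] seg[of 0 s] assms(2) \<open>0 \<le> s\<close> \<open>s \<le> h\<close> by auto
    then show "DERIV ?g s :> (dir_deriv b f ((z + h *\<^sub>R a) + s *\<^sub>R b) - dir_deriv b f (z + s *\<^sub>R b))"
      by (intro DERIV_diff D assms(1))
  qed (use assms in auto)
  then obtain s where s: "s > 0" "s < h" "?g h - ?g 0 = h * (dir_deriv b f ((z + h *\<^sub>R a) + s *\<^sub>R b) - dir_deriv b f (z + s *\<^sub>R b))"
    by auto
  let ?k = "\<lambda>r. dir_deriv b f ((z + s *\<^sub>R b) + r *\<^sub>R a)"
  have "\<exists>r>0. r < h \<and> ?k h - ?k 0 = (h - 0) * dir_deriv a (dir_deriv b f) ((z + s *\<^sub>R b) + r *\<^sub>R a)"
  proof (rule MVT2)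
    fix r assume r: "0 \<le> r" "r \<le> h"
    then have "z + s *\<^sub>R b + r *\<^sub>R a \<in> S"
      using seg[of r s] s by (simp add: algebra_simps)
    then show "DERIV ?k r :> dir_deriv a (dir_deriv b f) ((z + s *\<^sub>R b) + r *\<^sub>R a)"
      by (intro D smooth_on_dir_deriv assms(1))
  qed (use assms in auto)
  then obtain r where r: "r > 0" "r < h" "?k h - ?k 0 = h * dir_deriv a (dir_deriv b f) ((z + s *\<^sub>R b) + r *\<^sub>R a)"
    by auto
  have e: "?k h = dir_deriv b f ((z + h *\<^sub>R a) + s *\<^sub>R b)" "?k 0 = dir_deriv b f (z + s *\<^sub>R b)"
    "z + s *\<^sub>R b + r *\<^sub>R a = z + r *\<^sub>R a + s *\<^sub>R b"
    by (simp_all add: algebra_simps)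
  have "f (z + h *\<^sub>R a + h *\<^sub>R b) - f (z + h *\<^sub>R b) - f (z + h *\<^sub>R a) + f z
      = h * h * dir_deriv a (dir_deriv b f) (z + r *\<^sub>R a + s *\<^sub>R b)"
  proof -
    have "?g h - ?g 0 = h * (h * dir_deriv a (dir_deriv b f) (z + r *\<^sub>R a + s *\<^sub>R b))"
      unfolding s(3) using r(3) e by metis
    then show ?thesis by (simp only: mult.assoc) (simp add: add.assoc)
  qed
  with r s show thesis by (intro that[of r s]) auto
qed

lemma dir_deriv_commute_real:
  fixes f :: "'a::real_normed_vector \<Rightarrow> real"
  assumes S: "open S" and f: "smooth_on S f" and z: "z \<in> S"
  shows "dir_deriv a (dir_deriv b f) z = dir_deriv b (dir_deriv a f) z"
proof (rule ccontr)
  let ?F = "dir_deriv a (dir_deriv b f)" and ?G = "dir_deriv b (dir_deriv a f)"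
  assume ne: "?F z \<noteq> ?G z"
  define e where "e = \<bar>?F z - ?G z\<bar> / 2"
  have e: "e > 0" using ne by (simp add: e_def)
  have "continuous_on S ?F" "continuous_on S ?G"
    using f smooth_on_continuous_on smooth_on_dir_deriv by blast+
  then have "isCont ?F z" "isCont ?G z" using S z continuous_on_eq_continuous_at by blast+
  then obtain d1 d2 where d: "d1 > 0" "d2 > 0" "\<And>y. dist y z < d1 \<Longrightarrow> dist (?F y) (?F z) < e"
    "\<And>y. dist y z < d2 \<Longrightarrow> dist (?G y) (?G z) < e"
    unfolding continuous_at_eps_delta using e by metis
  obtain d3 where d3: "d3 > 0" "ball z d3 \<subseteq> S" using S z open_contains_ball by blast
  define d where "d = min d1 (min d2 d3)"
  define h where "h = d / (2 * (1 + norm a + norm b))"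
  have dpos: "d > 0" using d d3 by (simp add: d_def)
  then have h: "h > 0" by (simp add: h_def add_pos_nonneg)
  have close: "dist (z + r *\<^sub>R a + s *\<^sub>R b) z < d" if "0 \<le> r" "r \<le> h" "0 \<le> s" "s \<le> h" for r s
  proof -
    have "dist (z + r *\<^sub>R a + s *\<^sub>R b) z \<le> norm (r *\<^sub>R a) + norm (s *\<^sub>R b)"
      by (simp add: dist_norm add.assoc norm_triangle_ineq del: norm_scaleR)
    also have "\<dots> \<le> h * norm a + h * norm b"
      using that by (auto intro!: add_mono mult_right_mono)
    also have "\<dots> < h * (2 * (1 + norm a + norm b))"
      using h norm_ge_zero[of a] norm_ge_zero[of b] 
      by (simp add: distrib_left[symmetric] add_pos_nonneg add_nonneg_pos)
    also have "\<dots> = d"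
      using norm_ge_zero[of a] norm_ge_zero[of b] unfolding h_def by (simp add: add_nonneg_eq_0_iff)
    finally show ?thesis .
  qed
  have inS: "z + r *\<^sub>R a + s *\<^sub>R b \<in> S" if "0 \<le> r" "r \<le> h" "0 \<le> s" "s \<le> h" for r s
    using close[OF that] d3 by (auto simp: d_def dist_commute)
  have inS': "z + r *\<^sub>R b + s *\<^sub>R a \<in> S" if "0 \<le> r" "r \<le> h" "0 \<le> s" "s \<le> h" for r s
    using inS[OF that(3,4,1,2)] by (simp add: algebra_simps)
  obtain r s where 1: "0 \<le> r" "r \<le> h" "0 \<le> s" "s \<le> h"
    "f (z + h *\<^sub>R a + h *\<^sub>R b) - f (z + h *\<^sub>R b) - f (z + h *\<^sub>R a) + f z = h * h * ?F (z + r *\<^sub>R a + s *\<^sub>R b)"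
    using real_mixed_difference[OF f h inS] by blast
  obtain r' s' where 2: "0 \<le> r'" "r' \<le> h" "0 \<le> s'" "s' \<le> h"
    "f (z + h *\<^sub>R b + h *\<^sub>R a) - f (z + h *\<^sub>R a) - f (z + h *\<^sub>R b) + f z = h * h * ?G (z + r' *\<^sub>R b + s' *\<^sub>R a)"
    using real_mixed_difference[OF f h inS'] by blast
  have "h * h * ?F (z + r *\<^sub>R a + s *\<^sub>R b) = h * h * ?G (z + s' *\<^sub>R a + r' *\<^sub>R b)"
    using 1(5) 2(5) by (simp add: algebra_simps)
  then have "?F (z + r *\<^sub>R a + s *\<^sub>R b) = ?G (z + s' *\<^sub>R a + r' *\<^sub>R b)" using h by simp
  moreover have "dist (?F (z + r *\<^sub>R a + s *\<^sub>R b)) (?F z) < e"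
    using d(3) close[OF 1(1-4)] by (simp add: d_def)
  moreover have "dist (?G (z + s' *\<^sub>R a + r' *\<^sub>R b)) (?G z) < e"
    using d(4) close[OF 2(3,4,1,2)] by (simp add: d_def)
  ultimately have "\<bar>?F z - ?G z\<bar> < e + e" unfolding dist_real_def by linarith
  then show False unfolding e_def by simp
qed

lemma dir_deriv_inner:
  assumes "f differentiable (at z)"
  shows "dir_deriv v (\<lambda>z. f z \<bullet> e) z = dir_deriv v f z \<bullet> e"
  by (rule dir_deriv_eqI[where f'="\<lambda>v. dir_deriv v f z \<bullet> e"])
     (use assms frechet_derivative_works in \<open>auto simp: dir_deriv_def intro!: has_derivative_inner_left\<close>)

lemma dir_deriv_commute:
  fixes f :: "'a::real_normed_vector \<Rightarrow> 'b::euclidean_space"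
  assumes S: "open S" and f: "smooth_on S f" and z: "z \<in> S"
  shows "dir_deriv a (dir_deriv b f) z = dir_deriv b (dir_deriv a f) z"
proof (rule euclidean_eqI)
  fix e :: 'b assume "e \<in> Basis"
  have sm: "smooth_on S (\<lambda>z. f z \<bullet> e)"
    using smooth_on_linear_comp[OF bounded_linear_inner_left S f] .
  have *: "dir_deriv a (dir_deriv b f) z \<bullet> e = dir_deriv a (dir_deriv b (\<lambda>z. f z \<bullet> e)) z" for a b
  proof -
    have "dir_deriv a (dir_deriv b f) z \<bullet> e = dir_deriv a (\<lambda>z. dir_deriv b f z \<bullet> e) z"
      using dir_deriv_inner[OF smooth_on_differentiable[OF smooth_on_dir_deriv[OF f] z]] by simp
    also have "\<dots> = dir_deriv a (dir_deriv b (\<lambda>z. f z \<bullet> e)) z"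
    proof (rule dir_deriv_cong[OF S z])
      show "dir_deriv b f y \<bullet> e = dir_deriv b (\<lambda>z. f z \<bullet> e) y" if "y \<in> S" for y
        using dir_deriv_inner[OF smooth_on_differentiable[OF f that]] by simp
      show "(\<lambda>z. dir_deriv b f z \<bullet> e) differentiable at z"
        using smooth_on_differentiable[OF smooth_on_linear_comp[OF bounded_linear_inner_left S smooth_on_dir_deriv[OF f]] z] .
    qed
    finally show ?thesis .
  qed
  show "dir_deriv a (dir_deriv b f) z \<bullet> e = dir_deriv b (dir_deriv a f) z \<bullet> e"
    unfolding * using dir_deriv_commute_real[OF S sm z] .
qed

section \<open>Normal form of the operator\<close>

lemma open_spacetime: "open (spacetime :: ('n::finite) point set)"
  unfolding spacetime_def by (intro open_Collect_less continuous_intros)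

lemma convex_spacetime: "convex (spacetime :: ('n::finite) point set)"
proof -
  have "spacetime = {z :: 'n point. (1, 0) \<bullet> z > 0}" by (auto simp: spacetime_def)
  then show ?thesis using convex_halfspace_gt by metis
qed

lemma bounded_bilinear_matrix_vector:
  "bounded_bilinear ((*v) :: complex ^ 'm ^ 'k \<Rightarrow> complex ^ ('m::finite) \<Rightarrow> complex ^ ('k::finite))"
proof -
  have "bilinear ((*v) :: complex ^ 'm ^ 'k \<Rightarrow> complex ^ 'm \<Rightarrow> complex ^ 'k)"
    unfolding bilinear_def
    by (intro conjI allI linearI; simp add: matrix_vector_mult_def vec_eq_iff sum.distrib algebra_simps
      sum_distrib_left scaleR_sum_right)
  then show ?thesis using bilinear_conv_bounded_bilinear by blast
qed

lemmas matvec_simps =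
  bounded_bilinear.add_left[OF bounded_bilinear_matrix_vector]
  bounded_bilinear.add_right[OF bounded_bilinear_matrix_vector]
  bounded_bilinear.diff_left[OF bounded_bilinear_matrix_vector]
  bounded_bilinear.diff_right[OF bounded_bilinear_matrix_vector]
  bounded_bilinear.minus_left[OF bounded_bilinear_matrix_vector]
  bounded_bilinear.minus_right[OF bounded_bilinear_matrix_vector]
  bounded_bilinear.zero_left[OF bounded_bilinear_matrix_vector]
  bounded_bilinear.zero_right[OF bounded_bilinear_matrix_vector]
  bounded_bilinear.scaleR_left[OF bounded_bilinear_matrix_vector]
  bounded_bilinear.scaleR_right[OF bounded_bilinear_matrix_vector]
  bounded_bilinear.sum_left[OF bounded_bilinear_matrix_vector]
  bounded_bilinear.sum_right[OF bounded_bilinear_matrix_vector]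

lemma sum_Basis_vec:
  fixes f :: "real ^ 'n::finite \<Rightarrow> 'x::comm_monoid_add"
  shows "(\<Sum>b\<in>Basis. f b) = (\<Sum>j\<in>UNIV. f (axis j 1))"
proof -
  have B: "(Basis :: (real ^ 'n) set) = (\<lambda>j. axis j 1) ` UNIV" by (auto simp: Basis_vec_def)
  have inj: "inj (\<lambda>j::'n. axis j (1::real) :: real ^ 'n)" by (auto simp: inj_on_def axis_eq_axis)
  show ?thesis unfolding B sum.reindex[OF inj] by simp
qed

lemma sum_Basis_point:
  fixes f :: "('n::finite) point \<Rightarrow> 'x::comm_monoid_add"
  shows "(\<Sum>b\<in>Basis. f b) = f (1, 0) + (\<Sum>j\<in>UNIV. f (0, axis j 1))"
proof -
  have B: "(Basis :: 'n point set) = insert (1, 0) ((\<lambda>u. (0, u)) ` Basis)"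
    by (auto simp: Basis_prod_def)
  have "(\<Sum>b\<in>(\<lambda>u. (0::real, u)) ` (Basis :: (real ^ 'n) set). f b) = (\<Sum>u\<in>Basis. f (0, u))"
    by (subst sum.reindex) (auto simp: inj_on_def)
  then show ?thesis unfolding B by (subst sum.insert) (auto simp: sum_Basis_vec)
qed

lemma dir_deriv_point:
  fixes u :: "('n::finite) point \<Rightarrow> 'b::real_normed_vector"
  assumes "u differentiable (at z)"
  shows "dir_deriv v u z = fst v *\<^sub>R deriv_t u z + (\<Sum>j\<in>UNIV. snd v $ j *\<^sub>R deriv_x j u z)"
  unfolding dir_deriv_basis_sum[OF assms, of v] sum_Basis_point
  by (cases v) (simp add: inner_axis)

lemma Basis_point_cases:
  assumes "e \<in> (Basis :: ('n::finite) point set)"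
  obtains "e = (1, 0)" | j where "e = (0, axis j 1)"
  using assms by (auto simp: Basis_prod_def Basis_vec_def)

text \<open>
  In dimension one a function with \<open>t f' = \<lambda> f\<close> is a multiple of \<open>t\<^sup>\<lambda>\<close>; the conditions on \<open>\<partial>\<^sub>x\<close>
  reduce the statement to this case.
\<close>

lemma homogeneous_in_time:
  fixes G :: "('n::finite) point \<Rightarrow> 'b::real_normed_vector"
  assumes d: "\<And>z. z \<in> spacetime \<Longrightarrow> G differentiable (at z)"
    and x: "\<And>z j. z \<in> spacetime \<Longrightarrow> deriv_x j G z = 0"
    and t: "\<And>z. z \<in> spacetime \<Longrightarrow> fst z *\<^sub>R deriv_t G z = l *\<^sub>R G z"
    and z: "z \<in> spacetime"
  shows "G z = fst z powr l *\<^sub>R G (1, 0)"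
proof -
  define H where "H y = fst y powr (-l) *\<^sub>R G y" for y
  have H0: "(H has_derivative (\<lambda>_. 0)) (at y within spacetime)" if y: "y \<in> spacetime" for y
  proof -
    have pos: "fst y > 0" using y by (simp add: spacetime_def)
    have G: "(G has_derivative (\<lambda>v. dir_deriv v G y)) (at y)"
      using d[OF y] unfolding dir_deriv_def frechet_derivative_works by (simp add: eta_contract_eq)
    have *: "dir_deriv v G y = (fst v * l / fst y) *\<^sub>R G y" for v
    proof -
      have "deriv_t G y = (l / fst y) *\<^sub>R G y"
      proof -
        have "(1 / fst y) *\<^sub>R (fst y *\<^sub>R deriv_t G y) = (1 / fst y) *\<^sub>R (l *\<^sub>R G y)" using t[OF y] by simp
        then show ?thesis using pos by simp
      qed
      then show ?thesis unfolding dir_deriv_point[OF d[OF y], of v] using x[OF y] by simp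
    qed
    have "((\<lambda>y. fst y powr (-l)) has_derivative (\<lambda>v. - l * fst y powr (-l) * fst v / fst y)) (at y)"
      using pos by (auto intro!: derivative_eq_intros simp: powr_diff)
    from has_derivative_scaleR[OF this G]
    have "(H has_derivative (\<lambda>v. fst y powr (-l) *\<^sub>R dir_deriv v G y + (- l * fst y powr (-l) * fst v / fst y) *\<^sub>R G y)) (at y)"
      unfolding H_def .
    moreover have "fst y powr (-l) *\<^sub>R dir_deriv v G y + (- l * fst y powr (-l) * fst v / fst y) *\<^sub>R G y = 0" for v
      unfolding * by (simp add: scaleR_left_distrib[symmetric] algebra_simps)
    ultimately show ?thesis by (simp add: has_derivative_at_withinI)
  qed
  obtain c where c: "\<And>y. y \<in> spacetime \<Longrightarrow> H y = c"
    using has_derivative_zero_constant[OF convex_spacetime H0] by blast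
  have "(1, 0) \<in> (spacetime :: 'n point set)" by (simp add: spacetime_def)
  then have "H z = H (1, 0)" using c z by metis
  then have "fst z powr l *\<^sub>R H z = fst z powr l *\<^sub>R G (1, 0)" by (simp add: H_def)
  moreover have "fst z powr l *\<^sub>R H z = G z"
    using z by (simp add: H_def spacetime_def powr_minus)
  ultimately show ?thesis by simp
qed

text \<open>
  The rates at which the coordinate directions expand under the scaling \<open>(t, x j) \<mapsto> (r t, r powr (1 - p j) x j)\<close>
  that is generated by minus the scaling field; \<open>e\<close> ranges over the standard basis.
\<close>

definition scaling_weight :: "real ^ 'n \<Rightarrow> ('n::finite) point \<Rightarrow> real" where
  "scaling_weight p e = (if e = (1, 0) then 1 else \<Sum>j\<in>UNIV. (1 - p $ j) * snd e $ j)"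

text \<open>
  The normal form of \<open>t\<^sup>2 P\<close> for an operator with both symmetries; \<open>q\<close> stands for \<open>1 - p\<close>.
\<close>

definition kasner_op ::
  "real ^ 'n \<Rightarrow> complex ^ 'm ^ 'm \<Rightarrow> ('n \<Rightarrow> complex ^ 'm ^ 'm) \<Rightarrow> complex ^ 'm ^ 'm \<Rightarrow>
   (('n::finite) point \<Rightarrow> complex ^ ('m::finite)) \<Rightarrow> 'n point \<Rightarrow> complex ^ 'm" where
  "kasner_op q b bx c u z =
     t_deriv_t (t_deriv_t u) z
     - (\<Sum>j\<in>UNIV. fst z powr (2 * q $ j) *\<^sub>R deriv_x j (deriv_x j u) z)
     + b *v t_deriv_t u z + (\<Sum>j\<in>UNIV. fst z powr (q $ j) *\<^sub>R (bx j *v deriv_x j u z)) + c *v u z"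

lemma has_derivative_coordinate:
  "((\<lambda>z. (z \<bullet> e) *\<^sub>R w) has_derivative (\<lambda>v. (v \<bullet> e) *\<^sub>R w)) (at z)"
  by (auto intro!: derivative_eq_intros)

lemma dir_deriv_coordinate: "dir_deriv v (\<lambda>z. (z \<bullet> e) *\<^sub>R w) = (\<lambda>_. (v \<bullet> e) *\<^sub>R w)"
  using dir_deriv_eqI[OF has_derivative_coordinate] by blast

lemma dir_deriv_const: "dir_deriv v (\<lambda>_. w) = (\<lambda>_. 0)"
  using dir_deriv_eqI[OF has_derivative_const] by blast

lemma scaling_field_dir_deriv:
  assumes "u differentiable (at z)"
  shows "scaling_field p u z = - dir_deriv (fst z, \<chi> j. (1 - p $ j) * snd z $ j) u z"
  unfolding scaling_field_def dir_deriv_point[OF assms, of "(fst z, \<chi> j. (1 - p $ j) * snd z $ j)"]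
  by simp

lemma double_sum_delta:
  assumes "finite S" "a \<in> S" "b \<in> S"
  shows "(\<Sum>a'\<in>S. \<Sum>b'\<in>S. if a' = a then if b' = b then x else 0 else 0) = (x :: 'x::comm_monoid_add)"
proof -
  have "(\<Sum>b'\<in>S. if a' = a then if b' = b then x else 0 else 0) = (if a' = a then x else 0)" for a'
    using assms by (cases "a' = a") auto
  then show ?thesis using assms by simp
qed

text \<open>
  The symbol determines the symmetric part of the coefficients by polarization, and only that part
  acts, because directional derivatives commute.
\<close>

lemma second_order_part:
  fixes u :: "('n::finite) point \<Rightarrow> complex ^ ('m::finite)"
  assumes sym: "principal_symbol A z = (\<lambda>\<xi>. mat (complex_of_real (kasner_dual_metric p z \<xi> \<xi>)))"
    and u: "smooth_on spacetime u" and z: "z \<in> spacetime"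
  shows "(\<Sum>a\<in>Basis. \<Sum>b\<in>Basis. A a b z *v dir_deriv a (dir_deriv b u) z)
    = deriv_t (deriv_t u) z - (\<Sum>j\<in>UNIV. fst z powr (- 2 * p $ j) *\<^sub>R deriv_x j (deriv_x j u) z)"
proof -
  let ?g = "\<lambda>\<xi>. kasner_dual_metric p z \<xi> \<xi>"
  let ?U = "\<lambda>a b. dir_deriv a (dir_deriv b u) z"
  have ps: "principal_symbol A z \<xi> = mat (complex_of_real (?g \<xi>))" for \<xi> using sym by simp
  have diag: "A a a z = mat (complex_of_real (- ?g a))" if a: "a \<in> Basis" for a
  proof -
    have "principal_symbol A z a = (\<Sum>a'\<in>Basis. \<Sum>b'\<in>Basis. if a' = a then if b' = a then - A a a z else 0 else 0)"
      unfolding principal_symbol_def using a by (intro sum.cong refl) (auto simp: inner_Basis)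
    also have "\<dots> = - A a a z" using a by (intro double_sum_delta) auto
    finally have "A a a z = - mat (complex_of_real (?g a))" using ps[of a] by simp
    then show ?thesis by (simp add: mat_def vec_eq_iff)
  qed
  have off: "A a b z + A b a z = 0" if a: "a \<in> Basis" and b: "b \<in> Basis" and ne: "a \<noteq> b" for a b
  proof -
    have "principal_symbol A z (a + b) = (\<Sum>a'\<in>Basis. \<Sum>b'\<in>Basis.
       (if a' = a then if b' = a then - A a a z else 0 else 0)
       + (if a' = b then if b' = b then - A b b z else 0 else 0)
       + (if a' = a then if b' = b then - A a b z else 0 else 0)
       + (if a' = b then if b' = a then - A b a z else 0 else 0))"
      unfolding principal_symbol_def using a b ne
      by (intro sum.cong refl) (auto simp: inner_Basis inner_add_left)
    also have "\<dots> = - (A a a z + A b b z + (A a b z + A b a z))"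
      using a b by (simp only: sum.distrib double_sum_delta finite_Basis) simp
    finally have "A a a z + A b b z + (A a b z + A b a z) = - mat (complex_of_real (?g (a + b)))"
      using ps[of "a + b"] by (metis minus_minus)
    moreover have "?g (a + b) = ?g a + ?g b"
    proof -
      have orth: "snd a $ j * snd b $ j = 0 \<and> fst a * fst b = 0" for j
        by (rule Basis_point_cases[OF a]; rule Basis_point_cases[OF b]) (use ne in \<open>auto simp: axis_def\<close>)
      have "snd (a + b) $ j * snd (a + b) $ j = snd a $ j * snd a $ j + snd b $ j * snd b $ j" for j
        using orth[of j] by (auto simp: algebra_simps)
      moreover have "fst (a + b) * fst (a + b) = fst a * fst a + fst b * fst b"
        using orth by (auto simp: algebra_simps)
      ultimately show ?thesis unfolding kasner_dual_metric_def
        by (simp add: distrib_left sum.distrib del: snd_add fst_add)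
    qed
    moreover have "mat (complex_of_real (- r)) = - (mat (complex_of_real r) :: complex ^ 'm ^ 'm)"
      and "mat (complex_of_real (r + s)) = (mat (complex_of_real r) + mat (complex_of_real s) :: complex ^ 'm ^ 'm)"
      for r s
      by (simp_all add: mat_def vec_eq_iff)
    ultimately show ?thesis unfolding diag[OF a] diag[OF b] by simp
  qed
  have comm: "?U a b = ?U b a" for a b using dir_deriv_commute[OF open_spacetime u z] .
  have *: "(A a b z + A b a z) *v ?U a b = (if a = b then 2 *\<^sub>R (A a a z *v ?U a a) else 0)"
    if "a \<in> Basis" "b \<in> Basis" for a b
    using off[OF that] by (cases "a = b") (simp_all add: scaleR_2 matvec_simps(1)[symmetric] matvec_simps(7))
  let ?S = "\<Sum>a\<in>Basis. \<Sum>b\<in>Basis. A a b z *v ?U a b"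
  have "?S = (\<Sum>a\<in>Basis. \<Sum>b\<in>Basis. A b a z *v ?U a b)"
    by (subst sum.swap) (simp add: comm)
  then have "2 *\<^sub>R ?S = (\<Sum>a\<in>Basis. \<Sum>b\<in>Basis. (A a b z + A b a z) *v ?U a b)"
    by (simp add: scaleR_2 sum.distrib matvec_simps)
  also have "\<dots> = (\<Sum>a\<in>Basis. \<Sum>b\<in>Basis. if a = b then 2 *\<^sub>R (A a a z *v ?U a a) else 0)"
    by (intro sum.cong refl *)
  also have "\<dots> = 2 *\<^sub>R (\<Sum>a\<in>Basis. A a a z *v ?U a a)"
    by (simp add: sum.delta scaleR_sum_right)
  finally have "?S = (\<Sum>a\<in>Basis. A a a z *v ?U a a)" by simp
  also have "\<dots> = (\<Sum>a\<in>Basis. - ?g a *\<^sub>R ?U a a)"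
  proof (intro sum.cong refl)
    fix a :: "'n point" assume "a \<in> Basis"
    have "mat (complex_of_real r) *v w = r *\<^sub>R w" for r and w :: "complex ^ 'm"
      by (simp add: vec_eq_iff matrix_vector_mult_def mat_def if_distrib sum.delta if_distribR cong: if_cong)
        (simp add: scaleR_conv_of_real)
    then show "A a a z *v ?U a a = - ?g a *\<^sub>R ?U a a" unfolding diag[OF \<open>a \<in> Basis\<close>] by blast
  qed
  also have "\<dots> = deriv_t (deriv_t u) z - (\<Sum>j\<in>UNIV. fst z powr (- 2 * p $ j) *\<^sub>R deriv_x j (deriv_x j u) z)"
    unfolding sum_Basis_point kasner_dual_metric_def
    by (simp add: axis_def if_distrib sum.delta if_distribR sum_negf cong: if_cong)
  finally show ?thesis .
qed


text \<open>
  The coefficients are read off from the values of the operator on constants and on coordinate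
  functions. The commutation with \<open>\<partial>\<^sub>x\<close> makes them independent of \<open>x\<close>, and the commutation with the
  scaling field fixes their homogeneity degree in \<open>t\<close>.
\<close>

theorem wave_operator_normal_form:
  fixes p :: "real ^ 'n::finite"
    and P :: "('n point \<Rightarrow> complex ^ 'm::finite) \<Rightarrow> 'n point \<Rightarrow> complex ^ 'm"
  assumes wave: "linear_wave_operator p P"
    and comm_T: "operators_commute (scaling_field p) (\<lambda>u z. (fst z)\<^sup>2 *\<^sub>R P u z)"
    and comm_x: "\<forall>j. operators_commute (deriv_x j) P"
  obtains b bx c where
    "\<And>u z. smooth_on spacetime u \<Longrightarrow> z \<in> spacetime \<Longrightarrow>
       (fst z)\<^sup>2 *\<^sub>R P u z = kasner_op (\<chi> j. 1 - p $ j) b bx c u z"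
proof -
  obtain A B C where
    smB: "\<And>b. b \<in> Basis \<Longrightarrow> smooth_on spacetime (B b)"
    and smC: "smooth_on spacetime C"
    and P: "\<And>u z. smooth_on spacetime u \<Longrightarrow> z \<in> spacetime \<Longrightarrow> P u z = second_order_operator A B C u z"
    and ps: "\<And>z \<xi>. z \<in> spacetime \<Longrightarrow> principal_symbol A z \<xi> = mat (complex_of_real (kasner_dual_metric p z \<xi> \<xi>))"
    using wave unfolding linear_wave_operator_def by blast
  let ?S = "spacetime :: 'n point set"
  let ?L = "\<lambda>z::'n point. (fst z, \<chi> j. (1 - p $ j) * snd z $ j)"
  have posS: "fst z > 0" if "z \<in> ?S" for z using that by (simp add: spacetime_def)
  have smooth_lin: "smooth_on ?S (\<lambda>z. (z \<bullet> e) *\<^sub>R (w :: complex ^ 'm))" for e w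
    by (intro smooth_on_bounded_linear bounded_linear_scaleR_const bounded_linear_inner_left)
  have P0: "P (\<lambda>_. w) z = C z *v w" if "z \<in> ?S" for w z
    using P[OF smooth_on_const that] by (simp add: second_order_operator_def dir_deriv_const matvec_simps)
  have P1: "P (\<lambda>z. (z \<bullet> e) *\<^sub>R w) z = B e z *v w + (z \<bullet> e) *\<^sub>R (C z *v w)" if "z \<in> ?S" "e \<in> Basis" for w z e
  proof -
    have "(\<Sum>b\<in>Basis. (b \<bullet> e) *\<^sub>R (B b z *v w)) = B e z *v w"
      using that by (simp add: inner_Basis if_distrib if_distribR sum.delta' cong: if_cong)
    then show ?thesis
      using P[OF smooth_lin that(1)]
      by (simp add: second_order_operator_def dir_deriv_const dir_deriv_coordinate matvec_simps)
  qed
  have smM: "smooth_on ?S (\<lambda>z. M z *v w)" if "smooth_on ?S M" for M and w :: "complex ^ 'm"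
    using smooth_on_bilinear[OF bounded_bilinear_matrix_vector open_spacetime that smooth_on_const] .
  have sm2: "smooth_on ?S (\<lambda>z. (fst z)\<^sup>2)"
    unfolding power2_eq_square using smooth_on_bilinear[OF bounded_bilinear_mult open_spacetime]
      smooth_on_bounded_linear[OF bounded_linear_fst] by blast
  have smM2: "smooth_on ?S (\<lambda>z. (fst z)\<^sup>2 *\<^sub>R (M z *v w))" if "smooth_on ?S M" for M and w :: "complex ^ 'm"
    by (intro smooth_on_scaleR sm2 smM that open_spacetime)
  have sq_x: "deriv_x j (\<lambda>z. (fst z)\<^sup>2 *\<^sub>R G z) z = (fst z)\<^sup>2 *\<^sub>R deriv_x j G z"
    if "smooth_on ?S G" "z \<in> ?S" for G :: "'n point \<Rightarrow> complex ^ 'm" and j z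
  proof -
    have "((\<lambda>z. (fst z)\<^sup>2 *\<^sub>R G z) has_derivative (\<lambda>v. (fst z)\<^sup>2 *\<^sub>R dir_deriv v G z + (2 * fst z * fst v) *\<^sub>R G z)) (at z)"
      by (rule has_derivative_scaleR[OF _ smooth_on_has_derivative[OF that]])
         (auto intro!: derivative_eq_intros)
    from dir_deriv_eqI[OF this] show ?thesis by simp
  qed
  have euler: "fst z *\<^sub>R deriv_t G z = l *\<^sub>R G z"
    if G: "smooth_on ?S G" "\<And>j. deriv_x j G z = 0" "dir_deriv (?L z) G z = l *\<^sub>R G z" "z \<in> ?S"
    for G :: "'n point \<Rightarrow> complex ^ 'm" and z l
    using dir_deriv_point[OF smooth_on_differentiable[OF G(1,4)], of "?L z"] G by simp
  \<comment> \<open>the zeroth order coefficient\<close>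
  have C: "(fst z)\<^sup>2 *\<^sub>R (C z *v w) = C (1, 0) *v w" if z: "z \<in> ?S" for z w
  proof -
    let ?G = "\<lambda>z. (fst z)\<^sup>2 *\<^sub>R (C z *v w)"
    note sm = smM2[OF smC, of w]
    have x: "deriv_x j ?G z = 0" if z: "z \<in> ?S" for z j
    proof -
      have "deriv_x j (P (\<lambda>_. w)) z = P (deriv_x j (\<lambda>_. w)) z"
        using comm_x[unfolded operators_commute_def, rule_format, OF smooth_on_const[of _ w] z] by (simp only: right_minus_eq)
      also have "\<dots> = 0" using z by (simp add: dir_deriv_const P0 matvec_simps)
      also have "deriv_x j (P (\<lambda>_. w)) z = deriv_x j (\<lambda>z. C z *v w) z"
        using dir_deriv_cong[OF open_spacetime z P0[symmetric] smooth_on_differentiable[OF smM[OF smC] z]] by simp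
      finally show ?thesis using sq_x[OF smM[OF smC] z] by simp
    qed
    have t: "dir_deriv (?L z) ?G z = 0 *\<^sub>R ?G z" if z: "z \<in> ?S" for z
    proof -
      let ?R = "\<lambda>u z. (fst z)\<^sup>2 *\<^sub>R P u z"
      have eq: "?G y = ?R (\<lambda>_. w) y" if "y \<in> ?S" for y using P0[OF that] by simp
      have "scaling_field p (?R (\<lambda>_. w)) z = ?R (scaling_field p (\<lambda>_. w)) z"
        using comm_T[unfolded operators_commute_def, rule_format, OF smooth_on_const[of _ w] z] by (simp only: right_minus_eq)
      also have "scaling_field p (\<lambda>_. w) = (\<lambda>_. 0)"
        by (simp add: scaling_field_def dir_deriv_const fun_eq_iff)
      also have "?R (\<lambda>_. 0) z = 0" using z by (simp add: P0 matvec_simps)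
      also have "scaling_field p (?R (\<lambda>_. w)) z = - dir_deriv (?L z) (?R (\<lambda>_. w)) z"
        by (rule scaling_field_dir_deriv, rule differentiable_cong_open[OF open_spacetime z eq smooth_on_differentiable[OF sm z]])
      also have "dir_deriv (?L z) (?R (\<lambda>_. w)) z = dir_deriv (?L z) ?G z"
        using dir_deriv_cong[OF open_spacetime z eq smooth_on_differentiable[OF sm z]] by simp
      finally show ?thesis by simp
    qed
    have "?G z = fst z powr 0 *\<^sub>R ?G (1, 0)"
      using homogeneous_in_time[of ?G 0, OF smooth_on_differentiable[OF sm] x euler[OF sm x t] z] .
    then show ?thesis using posS[OF z] by simp
  qed
  \<comment> \<open>the first order coefficients\<close>
  have B: "(fst z)\<^sup>2 *\<^sub>R (B e z *v w) = fst z powr (scaling_weight p e) *\<^sub>R (B e (1, 0) *v w)"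
    if e: "e \<in> Basis" and z: "z \<in> ?S" for e z w
  proof -
    let ?G = "\<lambda>z. (fst z)\<^sup>2 *\<^sub>R (B e z *v w)" and ?u = "\<lambda>z. (z \<bullet> e) *\<^sub>R w"
    let ?R = "\<lambda>u z. (fst z)\<^sup>2 *\<^sub>R P u z"
    note smB' = smM[OF smB[OF e], of w]
    note sm = smM2[OF smB[OF e], of w]
    note smC' = smM[OF smC, of w]
    have Cx: "deriv_x j (\<lambda>z. C z *v w) z = 0" if z: "z \<in> ?S" for z j
    proof -
      have "deriv_x j (\<lambda>z. (fst z)\<^sup>2 *\<^sub>R (C z *v w)) z = deriv_x j (\<lambda>_. C (1, 0) *v w) z"
        by (rule dir_deriv_cong[OF open_spacetime z C]) (use smooth_on_differentiable[OF smM2[OF smC] z] in auto)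
      then show ?thesis using sq_x[OF smC' z] posS[OF z] by (simp add: dir_deriv_const)
    qed
    have x: "deriv_x j ?G z = 0" if z: "z \<in> ?S" for z j
    proof -
      let ?v = "(0, axis j 1) :: 'n point"
      have "deriv_x j (P ?u) z = P (deriv_x j ?u) z"
        using comm_x[unfolded operators_commute_def, rule_format, OF smooth_lin[of e w] z] by (simp only: right_minus_eq)
      also have "\<dots> = (?v \<bullet> e) *\<^sub>R (C z *v w)" using z by (simp add: dir_deriv_coordinate P0 matvec_simps)
      also have "deriv_x j (P ?u) z = deriv_x j (\<lambda>z. B e z *v w + (z \<bullet> e) *\<^sub>R (C z *v w)) z"
      proof (rule dir_deriv_cong[OF open_spacetime z, symmetric])
        show "B e y *v w + (y \<bullet> e) *\<^sub>R (C y *v w) = P ?u y" if "y \<in> ?S" for y using P1[OF that e] by simp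
        show "(\<lambda>z. B e z *v w + (z \<bullet> e) *\<^sub>R (C z *v w)) differentiable at z"
          by (intro differentiable_add smooth_on_differentiable[OF smB' z] differentiable_scaleR
              smooth_on_differentiable[OF smC' z] bounded_linear_imp_differentiable bounded_linear_inner_left)
      qed
      also have "\<dots> = deriv_x j (\<lambda>z. B e z *v w) z + (?v \<bullet> e) *\<^sub>R (C z *v w)"
      proof -
        have "((\<lambda>z. B e z *v w + (z \<bullet> e) *\<^sub>R (C z *v w)) has_derivative
          (\<lambda>v. dir_deriv v (\<lambda>z. B e z *v w) z + ((z \<bullet> e) *\<^sub>R dir_deriv v (\<lambda>z. C z *v w) z + (v \<bullet> e) *\<^sub>R (C z *v w)))) (at z)"
          by (intro has_derivative_add has_derivative_scaleR smooth_on_has_derivative[OF smB' z]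
               smooth_on_has_derivative[OF smC' z] bounded_linear_imp_has_derivative bounded_linear_inner_left)
        from dir_deriv_eqI[OF this] show ?thesis using Cx[OF z] by simp
      qed
      finally have "deriv_x j (\<lambda>z. B e z *v w) z = 0" by simp
      then show ?thesis using sq_x[OF smB' z] by simp
    qed
    have t: "dir_deriv (?L z) ?G z = scaling_weight p e *\<^sub>R ?G z" if z: "z \<in> ?S" for z
    proof -
      have wt: "?L y \<bullet> e = scaling_weight p e * (y \<bullet> e)" for y
      proof (rule Basis_point_cases[OF e])
        assume "e = (1, 0)"
        then show ?thesis by (simp add: scaling_weight_def inner_prod_def)
      next
        fix j assume "e = (0, axis j 1)"
        then show ?thesis
          by (simp add: scaling_weight_def inner_prod_def inner_axis) (simp add: axis_def if_distrib sum.delta cong: if_cong)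
      qed
      let ?H = "\<lambda>z. ?G z + (z \<bullet> e) *\<^sub>R (C (1, 0) *v w)"
      have eq: "?H y = ?R ?u y" if "y \<in> ?S" for y
        unfolding P1[OF that e] scaleR_right_distrib scaleR_left_commute[of "(fst y)\<^sup>2"] C[OF that] ..
      have Hd: "(?H has_derivative (\<lambda>v. dir_deriv v ?G z + (v \<bullet> e) *\<^sub>R (C (1, 0) *v w))) (at z)"
        by (intro has_derivative_add smooth_on_has_derivative[OF sm z] has_derivative_coordinate)
      have Hdf: "?H differentiable (at z)" by (rule differentiableI[OF Hd])
      have su: "scaling_field p ?u = (\<lambda>y. (y \<bullet> e) *\<^sub>R (- scaling_weight p e *\<^sub>R w))"
      proof
        fix y
        have "scaling_field p ?u y = - dir_deriv (?L y) ?u y"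
          by (rule scaling_field_dir_deriv) (use has_derivative_coordinate differentiable_def in blast)
        then show "scaling_field p ?u y = (y \<bullet> e) *\<^sub>R (- scaling_weight p e *\<^sub>R w)"
          unfolding dir_deriv_coordinate wt by simp
      qed
      have "scaling_field p (?R ?u) z = ?R (scaling_field p ?u) z"
        using comm_T[unfolded operators_commute_def, rule_format, OF smooth_lin[of e w] z] by (simp only: right_minus_eq)
      also have "\<dots> = - scaling_weight p e *\<^sub>R ?H z"
        unfolding su P1[OF z e] scaleR_right_distrib matvec_simps
          scaleR_left_commute[of "(fst z)\<^sup>2"] scaleR_left_commute[of "z \<bullet> e"] C[OF z] ..
      also have "scaling_field p (?R ?u) z = - dir_deriv (?L z) (?R ?u) z"
        by (rule scaling_field_dir_deriv, rule differentiable_cong_open[OF open_spacetime z eq Hdf])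
      also have "dir_deriv (?L z) (?R ?u) z = dir_deriv (?L z) ?H z"
        by (rule dir_deriv_cong[OF open_spacetime z eq Hdf, symmetric])
      also have "\<dots> = dir_deriv (?L z) ?G z + (scaling_weight p e * (z \<bullet> e)) *\<^sub>R (C (1, 0) *v w)"
        using dir_deriv_eqI[OF Hd, of "?L z"] unfolding wt .
      finally show ?thesis by (simp add: scaleR_right_distrib)
    qed
    have "?G z = fst z powr (scaling_weight p e) *\<^sub>R ?G (1, 0)"
      using homogeneous_in_time[of ?G, OF smooth_on_differentiable[OF sm] x euler[OF sm x t] z] .
    then show ?thesis by simp
  qed
  define b where "b = B (1, 0) (1, 0) - mat 1"
  define bx where "bx j = B (0, axis j 1) (1, 0)" for j
  define c where "c = C (1, 0)"
  show thesis
  proof (rule that)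
    fix u :: "'n point \<Rightarrow> complex ^ 'm" and z :: "'n point" assume u: "smooth_on ?S u" and z: "z \<in> ?S"
    have pos: "fst z > 0" using posS[OF z] .
    have DD: "t_deriv_t (t_deriv_t u) z = fst z *\<^sub>R deriv_t u z + (fst z)\<^sup>2 *\<^sub>R deriv_t (deriv_t u) z"
    proof -
      have "(t_deriv_t u has_derivative (\<lambda>v. fst z *\<^sub>R dir_deriv v (deriv_t u) z + fst v *\<^sub>R deriv_t u z)) (at z)"
        unfolding t_deriv_t_def
        by (intro has_derivative_scaleR smooth_on_has_derivative[OF smooth_on_dir_deriv[OF u] z]
            bounded_linear_imp_has_derivative bounded_linear_fst)
      from dir_deriv_eqI[OF this, of "(1, 0)"] show ?thesis
        by (simp add: t_deriv_t_def[of "t_deriv_t u"] power2_eq_square scaleR_right_distrib)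
    qed
    have w0: "scaling_weight p (1, 0) = 1" by (simp add: scaling_weight_def)
    have wj: "scaling_weight p (0, axis j 1) = 1 - p $ j" for j
      by (simp add: scaling_weight_def axis_def if_distrib sum.delta cong: if_cong)
    have pw: "(fst z)\<^sup>2 * fst z powr (- 2 * p $ j) = fst z powr (2 * (1 - p $ j))" for j
      using pos by (simp add: powr_diff powr_minus divide_simps algebra_simps power2_eq_square powr_add[symmetric])
    have eP: "P u z = (deriv_t (deriv_t u) z - (\<Sum>j\<in>UNIV. fst z powr (- 2 * p $ j) *\<^sub>R deriv_x j (deriv_x j u) z))
       + (B (1, 0) z *v deriv_t u z + (\<Sum>j\<in>UNIV. B (0, axis j 1) z *v deriv_x j u z)) + C z *v u z"
      unfolding P[OF u z] second_order_operator_def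
      by (subst second_order_part[OF _ u z]) (use ps[OF z] in \<open>auto simp: sum_Basis_point\<close>)
    have "(fst z)\<^sup>2 *\<^sub>R P u z =
      ((fst z)\<^sup>2 *\<^sub>R deriv_t (deriv_t u) z - (\<Sum>j\<in>UNIV. ((fst z)\<^sup>2 * fst z powr (- 2 * p $ j)) *\<^sub>R deriv_x j (deriv_x j u) z))
       + ((fst z)\<^sup>2 *\<^sub>R (B (1, 0) z *v deriv_t u z) + (\<Sum>j\<in>UNIV. (fst z)\<^sup>2 *\<^sub>R (B (0, axis j 1) z *v deriv_x j u z)))
       + (fst z)\<^sup>2 *\<^sub>R (C z *v u z)"
      unfolding eP by (simp add: scaleR_right_distrib scaleR_diff_right scaleR_sum_right)
    also have "\<dots> = ((fst z)\<^sup>2 *\<^sub>R deriv_t (deriv_t u) z - (\<Sum>j\<in>UNIV. fst z powr (2 * (1 - p $ j)) *\<^sub>R deriv_x j (deriv_x j u) z))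
       + (fst z *\<^sub>R (B (1, 0) (1, 0) *v deriv_t u z) + (\<Sum>j\<in>UNIV. fst z powr (1 - p $ j) *\<^sub>R (bx j *v deriv_x j u z)))
       + c *v u z"
    proof -
      have e1: "(1, 0) \<in> (Basis :: 'n point set)" and ej: "(0, axis j 1) \<in> (Basis :: 'n point set)" for j
        by (auto simp: Basis_prod_def)
      show ?thesis unfolding pw C[OF z] B[OF e1 z] B[OF ej z] w0 wj bx_def c_def using pos by simp
    qed
    finally show "(fst z)\<^sup>2 *\<^sub>R P u z = kasner_op (\<chi> j. 1 - p $ j) b bx c u z"
      unfolding kasner_op_def DD b_def by (simp add: t_deriv_t_def matvec_simps scaleR_diff_right)
  qed
qed

section \<open>Integrating a divergence inequality\<close>

lemma integral_directional_derivative_eq_0: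
  fixes w wx :: "'a::euclidean_space \<Rightarrow> 'b::banach"
  assumes d: "\<And>x. ((\<lambda>r. w (x + r *\<^sub>R e)) has_vector_derivative wx x) (at 0)"
    and w: "continuous_on UNIV w" and wx: "continuous_on UNIV wx"
    and supp: "\<And>x. x \<notin> cbox a b \<Longrightarrow> w x = 0"
    and supp': "\<And>x. x \<notin> cbox a b \<Longrightarrow> wx x = 0"
    and e: "norm e \<le> 1"
  shows "integral (cbox a b) wx = 0"
proof -
  define B where "B = cbox (a - One) (b + One)"
  have sub: "cbox a b \<subseteq> cbox (a - One + r *\<^sub>R e) (b + One + r *\<^sub>R e)" if r: "r \<in> {-1..1}" for r
  proof -
    have "\<bar>r * (e \<bullet> i)\<bar> \<le> 1" if "i \<in> Basis" for i
      unfolding abs_mult using r e Basis_le_norm[OF that, of e]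
      by (intro mult_le_one) auto
    then show ?thesis
      by (fastforce simp: mem_box inner_add_left inner_diff_left abs_le_iff)
  qed
  have shifted: "((\<lambda>x. w (x + r *\<^sub>R e)) has_integral integral (cbox a b) w) B" if "r \<in> {-1..1}" for r
  proof -
    have "(w has_integral integral (cbox a b) w) (cbox a b)"
      by (intro integrable_integral integrable_continuous continuous_on_subset[OF w]) auto
    then have "(w has_integral integral (cbox a b) w) (cbox (a - One + r *\<^sub>R e) (b + One + r *\<^sub>R e))"
      by (rule has_integral_on_superset) (use sub[OF that] supp in auto)
    then have "(w \<circ> (+) (r *\<^sub>R e) has_integral integral (cbox a b) w) (cbox (a - One) (b + One))"
      unfolding has_integral_shift_cbox_iff .
    then show ?thesis by (simp add: B_def o_def add.commute)
  qed
  have "((\<lambda>r. integral B (\<lambda>x. w (x + r *\<^sub>R e))) has_vector_derivative integral B (\<lambda>x. wx (x + 0 *\<^sub>R e)))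
      (at 0 within {-1..1})"
    unfolding B_def
  proof (rule leibniz_rule_vector_derivative[where U="{-1..1}" and f="\<lambda>r x. w (x + r *\<^sub>R e)" and fx="\<lambda>r x. wx (x + r *\<^sub>R e)"])
    fix r :: real and x :: 'a
    have shift1: "((\<lambda>s. s - r) has_vector_derivative 1) (at r')" for r' :: real
      by (auto intro!: derivative_eq_intros)
    have "((\<lambda>s. w ((x + r *\<^sub>R e) + s *\<^sub>R e)) has_vector_derivative wx (x + r *\<^sub>R e)) (at 0)" by (rule d)
    then have "((\<lambda>s. w ((x + r *\<^sub>R e) + (s - r) *\<^sub>R e)) has_vector_derivative wx (x + r *\<^sub>R e)) (at r)"
      using vector_diff_chain_at[OF shift1[of r], of "\<lambda>s. w ((x + r *\<^sub>R e) + s *\<^sub>R e)" "wx (x + r *\<^sub>R e)"]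
      by (auto simp: o_def)
    then show "((\<lambda>r. w (x + r *\<^sub>R e)) has_vector_derivative wx (x + r *\<^sub>R e)) (at r within {-1..1})"
      by (simp add: algebra_simps has_vector_derivative_at_within)
  next
    show "(\<lambda>x. w (x + r *\<^sub>R e)) integrable_on cbox (a - One) (b + One)" for r
      by (intro integrable_continuous continuous_on_compose2[OF w] continuous_intros) auto
    show "continuous_on ({-1..1} \<times> cbox (a - One) (b + One)) (\<lambda>(r, x). wx (x + r *\<^sub>R e))"
      unfolding split_beta by (intro continuous_on_compose2[OF wx] continuous_intros) auto
  qed auto
  then have D: "((\<lambda>r. integral B (\<lambda>x. w (x + r *\<^sub>R e))) has_vector_derivative integral B wx) (at 0)"
    by (simp add: at_within_Icc_at)
  have "((\<lambda>r. integral (cbox a b) w) has_vector_derivative integral B wx) (at 0)"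
    by (rule has_vector_derivative_transform_within_open[OF D open_greaterThanLessThan[of "-1" 1]])
       (use shifted integral_unique in auto)
  then have "integral B wx = 0"
    using vector_derivative_unique_at has_vector_derivative_const by blast
  moreover have "integral B wx = integral (cbox a b) wx"
  proof (rule integral_unique)
    have "(wx has_integral integral (cbox a b) wx) (cbox a b)"
      by (intro integrable_integral integrable_continuous continuous_on_subset[OF wx]) auto
    then show "(wx has_integral integral (cbox a b) wx) B"
      by (rule has_integral_on_superset) (use sub[of 0] supp' in \<open>auto simp: B_def\<close>)
  qed
  ultimately show ?thesis by simp
qed

text \<open>
  An energy argument in divergence form: the integral of \<open>g\<close> over space is nondecreasing in time,
  since the divergence integrates to zero, and it vanishes at the final time. So a nonnegative
  initial value has to vanish.
\<close>

lemma divergence_inequality_vanishing: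
  fixes g gt :: "real \<times> (real ^ 'n::finite) \<Rightarrow> real" and W Wx :: "'n \<Rightarrow> real \<times> (real ^ 'n) \<Rightarrow> real"
  assumes t: "t0 \<le> t1"
    and dg: "\<And>t x. t \<in> {t0..t1} \<Longrightarrow> ((\<lambda>t. g (t, x)) has_vector_derivative gt (t, x)) (at t within {t0..t1})"
    and cg: "continuous_on ({t0..t1} \<times> UNIV) g" and cgt: "continuous_on ({t0..t1} \<times> UNIV) gt"
    and dW: "\<And>t x j. t \<in> {t0..t1} \<Longrightarrow> ((\<lambda>r. W j (t, x + r *\<^sub>R axis j 1)) has_vector_derivative Wx j (t, x)) (at 0)"
    and cW: "\<And>j. continuous_on ({t0..t1} \<times> UNIV) (W j)" and cWx: "\<And>j. continuous_on ({t0..t1} \<times> UNIV) (Wx j)"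
    and supp: "\<And>t x j. t \<in> {t0..t1} \<Longrightarrow> x \<notin> cbox a b \<Longrightarrow> W j (t, x) = 0"
      "\<And>t x j. t \<in> {t0..t1} \<Longrightarrow> x \<notin> cbox a b \<Longrightarrow> Wx j (t, x) = 0"
    and ineq: "\<And>t x. t \<in> {t0..t1} \<Longrightarrow> (\<Sum>j\<in>UNIV. Wx j (t, x)) \<le> gt (t, x)"
    and nonneg: "\<And>x. 0 \<le> g (t0, x)" and final: "\<And>x. g (t1, x) = 0"
    and x: "x \<in> box a b"
  shows "g (t0, x) = 0"
proof -
  have sl: "continuous_on UNIV (\<lambda>x. h (t, x))" if "continuous_on ({t0..t1} \<times> UNIV) h" "t \<in> {t0..t1}"
    for h :: "real \<times> (real ^ 'n) \<Rightarrow> real" and t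
    by (rule continuous_on_compose2[OF that(1)]) (use that(2) in \<open>auto intro!: continuous_intros\<close>)
  have W0: "integral (cbox a b) (\<lambda>x. Wx j (t, x)) = 0" if "t \<in> {t0..t1}" for j t
    by (rule integral_directional_derivative_eq_0[where w="\<lambda>x. W j (t, x)" and e="axis j 1"])
       (use that dW supp sl cW cWx in auto)
  define S where "S = (\<lambda>z. \<Sum>j\<in>UNIV. Wx j z)"
  have cS: "continuous_on ({t0..t1} \<times> UNIV) S" unfolding S_def by (intro continuous_intros cWx)
  have SS: "integral (cbox a b) (\<lambda>x. S (t, x)) = 0" if "t \<in> {t0..t1}" for t
    unfolding S_def
    by (subst integral_sum) (use that W0 sl cWx in \<open>auto intro!: integrable_continuous continuous_on_subset[OF sl[OF cWx]]\<close>)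
  have cbt: "continuous_on (cbox (a, t0) (b, t1)) (\<lambda>(x, t). h (t, x))" if "continuous_on ({t0..t1} \<times> UNIV) h" for h :: "real \<times> (real ^ 'n) \<Rightarrow> real"
    unfolding split_beta
    by (rule continuous_on_compose2[OF that]) (auto intro!: continuous_intros simp: cbox_Pair_eq)
  have ct: "continuous_on (cbox t0 t1) (\<lambda>t. h (t, x))" if "continuous_on ({t0..t1} \<times> UNIV) h" for h :: "real \<times> (real ^ 'n) \<Rightarrow> real" and x
    by (rule continuous_on_compose2[OF that]) (auto intro!: continuous_intros)
  have ftc: "integral (cbox t0 t1) (\<lambda>t. gt (t, x)) = - g (t0, x)" for x
  proof -
    have "((\<lambda>t. gt (t, x)) has_integral (g (t1, x) - g (t0, x))) {t0..t1}"
      by (rule fundamental_theorem_of_calculus[OF t dg])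
    then show ?thesis using final by (simp add: integral_unique)
  qed
  have "integral (cbox a b) (\<lambda>x. integral (cbox t0 t1) (\<lambda>t. S (t, x))) \<le> integral (cbox a b) (\<lambda>x. integral (cbox t0 t1) (\<lambda>t. gt (t, x)))"
  proof (rule integral_le)
    show "(\<lambda>x. integral (cbox t0 t1) (\<lambda>t. S (t, x))) integrable_on cbox a b"
      using integral_integrable_2dim[OF cbt[OF cS]] by simp
    show "(\<lambda>x. integral (cbox t0 t1) (\<lambda>t. gt (t, x))) integrable_on cbox a b"
      using integral_integrable_2dim[OF cbt[OF cgt]] by simp
    show "integral (cbox t0 t1) (\<lambda>t. S (t, x)) \<le> integral (cbox t0 t1) (\<lambda>t. gt (t, x))" for x
      by (intro integral_le integrable_continuous ct cS cgt) (use ineq in \<open>auto simp: S_def\<close>)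
  qed
  also have "integral (cbox a b) (\<lambda>x. integral (cbox t0 t1) (\<lambda>t. S (t, x)))
     = integral (cbox t0 t1) (\<lambda>t. integral (cbox a b) (\<lambda>x. S (t, x)))"
    using integral_swap_continuous[OF cbt[OF cS]] by simp
  also have "\<dots> = integral (cbox t0 t1) (\<lambda>t. 0)" by (intro integral_cong) (use SS in auto)
  also have "integral (cbox a b) (\<lambda>x. integral (cbox t0 t1) (\<lambda>t. gt (t, x))) = - integral (cbox a b) (\<lambda>x. g (t0, x))"
    unfolding ftc by simp
  finally have le: "integral (cbox a b) (\<lambda>x. g (t0, x)) \<le> 0" by simp
  have cont: "continuous_on (cbox a b) (\<lambda>x. g (t0, x))" using sl[OF cg, of t0] t by (auto intro: continuous_on_subset)
  have "integral (cbox a b) (\<lambda>x. g (t0, x)) \<ge> 0"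
    by (intro integral_nonneg integrable_continuous cont nonneg)
  with le have "((\<lambda>x. g (t0, x)) has_integral 0) (cbox a b)"
    using integrable_integral[OF integrable_continuous[OF cont]] by simp
  then show ?thesis
    by (rule has_integral_0_cbox_imp_0[OF cont nonneg]) (use x box_subset_cbox in auto)
qed

section \<open>Energy estimate and finite speed of propagation\<close>

lemma inner_cross_bound:
  fixes x y :: "'a::real_inner" and m :: "'a \<Rightarrow> 'a"
  assumes "norm (m y) \<le> B * norm y" "0 \<le> B"
  shows "\<bar>2 * (x \<bullet> m y)\<bar> \<le> B * (x \<bullet> x + y \<bullet> y)"
proof -
  have "\<bar>x \<bullet> m y\<bar> \<le> norm x * norm (m y)" by (rule Cauchy_Schwarz_ineq2)
  also have "\<dots> \<le> norm x * (B * norm y)" using assms by (intro mult_left_mono) auto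
  finally have "\<bar>2 * (x \<bullet> m y)\<bar> \<le> B * (2 * norm x * norm y)"
    by (simp add: abs_mult algebra_simps)
  also have "\<dots> \<le> B * ((norm x)\<^sup>2 + (norm y)\<^sup>2)"
    using assms(2) sum_squares_bound[of "norm x" "norm y"] by (intro mult_left_mono) auto
  finally show ?thesis by (simp add: power2_norm_eq_inner)
qed

text \<open>
  The part of the time derivative of the energy density that is not a divergence is controlled by
  the density itself; the constant does not depend on the weights \<open>w\<close>, hence neither on time nor
  on a spatial frequency.
\<close>

lemma energy_density_inequality:
  fixes b c :: "complex ^ 'm ^ 'm::finite" and bx :: "'n::finite \<Rightarrow> complex ^ 'm ^ 'm"
  obtains K where "K \<ge> 0"
    "\<And>(w :: 'n \<Rightarrow> real) u us uss F ux uxs uxx.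
      uss - (\<Sum>j\<in>UNIV. (w j)\<^sup>2 *\<^sub>R uxx j) + b *v us + (\<Sum>j\<in>UNIV. w j *\<^sub>R (bx j *v ux j)) + c *v u = F \<Longrightarrow>
      2 * (us \<bullet> uss) + 2 * (u \<bullet> us) + (\<Sum>j\<in>UNIV. 2 * (w j)\<^sup>2 * (ux j \<bullet> uxs j))
        \<ge> (\<Sum>j\<in>UNIV. 2 * (w j)\<^sup>2 * (us \<bullet> uxx j + ux j \<bullet> uxs j))
          - K * (u \<bullet> u + us \<bullet> us + (\<Sum>j\<in>UNIV. (w j)\<^sup>2 * (ux j \<bullet> ux j))) - F \<bullet> F"
proof -
  note bb = bounded_bilinear.bounded_linear_right[OF bounded_bilinear_matrix_vector]
  have bnd: "\<exists>B\<ge>0. \<forall>y. norm (M *v y) \<le> B * norm y" for M :: "complex ^ 'm ^ 'm"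
    using bounded_linear.nonneg_bounded[OF bb[of M]] by (metis mult.commute)
  obtain Bb where Bb: "Bb \<ge> 0" "\<And>y. norm (b *v y) \<le> Bb * norm y" using bnd by blast
  obtain Bc where Bc: "Bc \<ge> 0" "\<And>y. norm (c *v y) \<le> Bc * norm y" using bnd by blast
  have "\<forall>j. \<exists>B\<ge>0. \<forall>y. norm (bx j *v y) \<le> B * norm y" using bnd by blast
  then obtain Bx where Bx: "\<And>j. Bx j \<ge> 0" "\<And>j y. norm (bx j *v y) \<le> Bx j * norm y" by metis
  define K where "K = 2 + 2 * Bb + Bc + (\<Sum>j\<in>UNIV. Bx j)"
  show thesis
  proof (rule that[of K])
    show "K \<ge> 0" using Bb Bc Bx by (auto simp: K_def intro!: add_nonneg_nonneg sum_nonneg)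
    fix w :: "'n \<Rightarrow> real" and u us uss F :: "complex ^ 'm" and ux uxs uxx :: "'n \<Rightarrow> complex ^ 'm"
    assume eq: "uss - (\<Sum>j\<in>UNIV. (w j)\<^sup>2 *\<^sub>R uxx j) + b *v us + (\<Sum>j\<in>UNIV. w j *\<^sub>R (bx j *v ux j)) + c *v u = F"
    let ?G = "\<Sum>j\<in>UNIV. (w j)\<^sup>2 * (ux j \<bullet> ux j)"
    let ?X = "u \<bullet> u" and ?Y = "us \<bullet> us"
    have nn: "?X \<ge> 0" "?Y \<ge> 0" "?G \<ge> 0" by (auto intro!: sum_nonneg)
    have uss: "uss = F + (\<Sum>j\<in>UNIV. (w j)\<^sup>2 *\<^sub>R uxx j) - b *v us - (\<Sum>j\<in>UNIV. w j *\<^sub>R (bx j *v ux j)) - c *v u"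
      using eq by (simp add: algebra_simps)
    have i1: "\<bar>2 * (us \<bullet> (b *v us))\<bar> \<le> Bb * (?Y + ?Y)" by (rule inner_cross_bound) (use Bb in auto)
    have i2: "\<bar>2 * (us \<bullet> (c *v u))\<bar> \<le> Bc * (?Y + ?X)" by (rule inner_cross_bound) (use Bc in auto)
    have i3: "\<bar>2 * (us \<bullet> F)\<bar> \<le> 1 * (?Y + F \<bullet> F)" by (rule inner_cross_bound[of "\<lambda>x. x"]) auto
    have i4: "\<bar>2 * (u \<bullet> us)\<bar> \<le> 1 * (?X + ?Y)" by (rule inner_cross_bound[of "\<lambda>x. x"]) auto
    have i5: "(\<Sum>j\<in>UNIV. 2 * (us \<bullet> (w j *\<^sub>R (bx j *v ux j)))) \<le> (\<Sum>j\<in>UNIV. Bx j) * (?Y + ?G)"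
    proof -
      have "2 * (us \<bullet> (w j *\<^sub>R (bx j *v ux j))) \<le> Bx j * (?Y + ?G)" for j
      proof -
        have "2 * (us \<bullet> (bx j *v (w j *\<^sub>R ux j))) \<le> Bx j * (?Y + (w j *\<^sub>R ux j) \<bullet> (w j *\<^sub>R ux j))"
          using inner_cross_bound[of "\<lambda>y. bx j *v y", OF Bx(2)[of j "w j *\<^sub>R ux j"] Bx(1), of us]
          by (rule order.trans[OF abs_ge_self])
        also have "(w j *\<^sub>R ux j) \<bullet> (w j *\<^sub>R ux j) = (w j)\<^sup>2 * (ux j \<bullet> ux j)" by (simp add: power2_eq_square)
        also have "Bx j * (?Y + (w j)\<^sup>2 * (ux j \<bullet> ux j)) \<le> Bx j * (?Y + ?G)"
          using Bx by (intro mult_left_mono add_left_mono member_le_sum) auto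
        finally show ?thesis by (simp add: matvec_simps)
      qed
      then show ?thesis by (simp add: sum_distrib_right sum_mono)
    qed
    have "2 * (us \<bullet> uss) = 2 * (us \<bullet> F) + (\<Sum>j\<in>UNIV. 2 * (w j)\<^sup>2 * (us \<bullet> uxx j)) - 2 * (us \<bullet> (b *v us))
       - (\<Sum>j\<in>UNIV. 2 * (us \<bullet> (w j *\<^sub>R (bx j *v ux j)))) - 2 * (us \<bullet> (c *v u))"
      unfolding uss by (simp add: inner_add_right inner_diff_right inner_sum_right sum_distrib_left algebra_simps)
    moreover have "(\<Sum>j\<in>UNIV. 2 * (w j)\<^sup>2 * (us \<bullet> uxx j + ux j \<bullet> uxs j))
       = (\<Sum>j\<in>UNIV. 2 * (w j)\<^sup>2 * (us \<bullet> uxx j)) + (\<Sum>j\<in>UNIV. 2 * (w j)\<^sup>2 * (ux j \<bullet> uxs j))"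
      by (simp add: distrib_left sum.distrib)
    moreover have "K * (?X + ?Y + ?G) = 2 * (?X + ?Y) + Bb * (?Y + ?Y) + Bc * (?Y + ?X) + (\<Sum>j\<in>UNIV. Bx j) * (?Y + ?G)
        + (2 * ?G + 2 * Bb * ?X + 2 * Bb * ?G + Bc * ?G + (\<Sum>j\<in>UNIV. Bx j) * ?X)"
      unfolding K_def by (simp add: algebra_simps)
    moreover have "2 * ?G + 2 * Bb * ?X + 2 * Bb * ?G + Bc * ?G + (\<Sum>j\<in>UNIV. Bx j) * ?X \<ge> 0"
      using nn Bb Bc Bx by (intro add_nonneg_nonneg mult_nonneg_nonneg sum_nonneg) auto
    ultimately show "2 * (us \<bullet> uss) + 2 * (u \<bullet> us) + (\<Sum>j\<in>UNIV. 2 * (w j)\<^sup>2 * (ux j \<bullet> uxs j))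
        \<ge> (\<Sum>j\<in>UNIV. 2 * (w j)\<^sup>2 * (us \<bullet> uxx j + ux j \<bullet> uxs j))
          - K * (?X + ?Y + ?G) - F \<bullet> F"
      using abs_le_D1[OF i1] abs_le_D1[OF i2] abs_le_D2[OF i3] abs_le_D2[OF i4] i5 nn(1) by argo
  qed
qed

text \<open>
  The largest coordinate speed of light in the direction \<open>\<eta>\<close> at the time \<open>t\<close>, that is
  \<open>sqrt (\<Sum>j. t powr (- 2 * p j) * (\<eta> j)\<^sup>2)\<close> with \<open>p = 1 - q\<close>.
\<close>

definition char_speed :: "real ^ 'n \<Rightarrow> real ^ ('n::finite) \<Rightarrow> real \<Rightarrow> real" where
  "char_speed q \<eta> t = sqrt (\<Sum>j\<in>UNIV. t powr (2 * q $ j) * (\<eta> $ j)\<^sup>2) / t"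

text \<open>
  The level sets of \<open>front\<close> are characteristic hypersurfaces, null hyperplane waves in the
  direction \<open>\<eta>\<close>. The function does not decrease along future causal curves.
\<close>

definition front :: "real ^ 'n \<Rightarrow> real \<Rightarrow> real ^ ('n::finite) \<Rightarrow> 'n point \<Rightarrow> real" where
  "front q a \<eta> z = integral {a..fst z} (char_speed q \<eta>) - snd z \<bullet> \<eta>"

lemma continuous_on_char_speed: "continuous_on {0<..} (char_speed q \<eta>)"
  unfolding char_speed_def by (intro continuous_intros) auto

lemma char_speed_nonneg: "0 < t \<Longrightarrow> 0 \<le> char_speed q \<eta> t"
  unfolding char_speed_def by (auto intro!: divide_nonneg_pos sum_nonneg)

lemma char_speed_axis:
  assumes "0 < t" shows "char_speed q (s *\<^sub>R axis j 1) t = \<bar>s\<bar> * t powr (q $ j - 1)"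
proof -
  have "(\<Sum>i\<in>UNIV. t powr (2 * q $ i) * ((s *\<^sub>R axis j 1) $ i)\<^sup>2) = (\<bar>s\<bar> * t powr (q $ j))\<^sup>2"
  proof -
    have "(\<Sum>i\<in>UNIV. t powr (2 * q $ i) * ((s *\<^sub>R axis j 1) $ i)\<^sup>2) = (\<Sum>i\<in>UNIV. if i = j then t powr (2 * q $ j) * s\<^sup>2 else 0)"
      by (intro sum.cong refl) (auto simp: axis_def)
    then show ?thesis using assms by (simp add: power_mult_distrib powr_power mult.commute)
  qed
  then show ?thesis using assms unfolding char_speed_def
    by (simp add: real_sqrt_mult powr_diff abs_mult)
qed

lemma has_derivative_front:
  assumes a: "0 < a" "a < fst z"
  shows "(front q a \<eta> has_derivative (\<lambda>v. char_speed q \<eta> (fst z) * fst v - snd v \<bullet> \<eta>)) (at z)"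
proof -
  have "((\<lambda>t. integral {a..t} (char_speed q \<eta>)) has_vector_derivative char_speed q \<eta> (fst z)) (at (fst z) within {a..fst z + 1})"
    by (rule integral_has_vector_derivative) (use a in \<open>auto intro!: continuous_on_subset[OF continuous_on_char_speed]\<close>)
  then have "((\<lambda>t. integral {a..t} (char_speed q \<eta>)) has_derivative (\<lambda>r. r * char_speed q \<eta> (fst z))) (at (fst z))"
    using a by (simp add: at_within_Icc_at has_vector_derivative_def)
  from has_derivative_compose[OF has_derivative_fst[OF has_derivative_ident] this]
  have "((\<lambda>z. integral {a..fst z} (char_speed q \<eta>)) has_derivative (\<lambda>v. fst v * char_speed q \<eta> (fst z))) (at z)" .
  then show ?thesis unfolding front_def
    by (auto intro!: derivative_eq_intros simp: mult.commute)
qed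

text \<open>
  The square makes the positive part continuously differentiable, so that it can be used for weights.
\<close>

definition pos_sq :: "real \<Rightarrow> real" where "pos_sq r = (max 0 r)\<^sup>2"

lemma DERIV_pos_sq: "DERIV pos_sq r :> 2 * max 0 r"
proof (cases "r = 0")
  case True
  have "((\<lambda>h. pos_sq h / h) \<longlongrightarrow> 0) (at 0)"
  proof (rule Lim_null_comparison)
    show "\<forall>\<^sub>F h in at 0. norm (pos_sq h / h) \<le> \<bar>h\<bar>"
      by (auto simp: pos_sq_def max_def power2_eq_square intro!: always_eventually)
    show "((\<lambda>h::real. \<bar>h\<bar>) \<longlongrightarrow> 0) (at 0)" by (simp add: tendsto_rabs_zero)
  qed
  then show ?thesis using True by (simp add: DERIV_def pos_sq_def)
next
  case False
  show ?thesis
  proof (cases "r > 0")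
    case True
    have "DERIV (\<lambda>r. r\<^sup>2) r :> 2 * max 0 r" using True by (auto intro!: derivative_eq_intros)
    then show ?thesis
      by (rule DERIV_cong_ev[THEN iffD1, rotated -1, OF _ refl]) 
        (use True in \<open>auto simp: pos_sq_def max_def eventually_at_filter intro!: eventually_mono[OF eventually_nhds_in_open[of "{0<..}"]]\<close>)
  next
    case F: False
    have "DERIV (\<lambda>r. 0) r :> 2 * max 0 r" using F False by (auto intro!: derivative_eq_intros)
    then show ?thesis
      by (rule DERIV_cong_ev[THEN iffD1, rotated -1, OF _ refl])
        (use F False in \<open>auto simp: pos_sq_def max_def intro!: eventually_mono[OF eventually_nhds_in_open[of "{..<0}"]]\<close>)
  qed
qed

text \<open>
  The dominant energy condition: by the Cauchy-Schwarz inequality the energy flux through a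
  characteristic hypersurface has a sign.
\<close>

lemma char_speed_flux_bound:
  fixes us :: "'b::real_inner"
  assumes "0 < t"
  shows "\<bar>\<Sum>j\<in>UNIV. \<eta> $ j * (2 * (t powr (q $ j))\<^sup>2 * (us \<bullet> ux j))\<bar>
     \<le> t * char_speed q \<eta> t * (us \<bullet> us + (\<Sum>j\<in>UNIV. (t powr (q $ j))\<^sup>2 * (ux j \<bullet> ux j)))"
proof -
  let ?w = "\<lambda>j. t powr (q $ j)"
  let ?s = "sqrt (\<Sum>j\<in>UNIV. (\<bar>\<eta> $ j\<bar> * ?w j)\<^sup>2)" and ?g = "sqrt (\<Sum>j\<in>UNIV. (?w j * norm (ux j))\<^sup>2)"
  have s: "t * char_speed q \<eta> t = ?s"
    using assms unfolding char_speed_def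
    by (simp add: power_mult_distrib powr_power mult.commute)
  have "\<bar>\<Sum>j\<in>UNIV. \<eta> $ j * (2 * (?w j)\<^sup>2 * (us \<bullet> ux j))\<bar> \<le> (\<Sum>j\<in>UNIV. 2 * norm us * \<bar>(\<bar>\<eta> $ j\<bar> * ?w j) * (?w j * norm (ux j))\<bar>)"
  proof (intro order.trans[OF sum_abs] sum_mono)
    fix j
    have "\<bar>us \<bullet> ux j\<bar> \<le> norm us * norm (ux j)" by (rule Cauchy_Schwarz_ineq2)
    then have "(\<bar>\<eta> $ j\<bar> * (2 * (?w j)\<^sup>2)) * \<bar>us \<bullet> ux j\<bar> \<le> (\<bar>\<eta> $ j\<bar> * (2 * (?w j)\<^sup>2)) * (norm us * norm (ux j))"
      by (intro mult_left_mono) auto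
    then show "\<bar>\<eta> $ j * (2 * (?w j)\<^sup>2 * (us \<bullet> ux j))\<bar> \<le> 2 * norm us * \<bar>(\<bar>\<eta> $ j\<bar> * ?w j) * (?w j * norm (ux j))\<bar>"
      by (simp add: abs_mult power2_eq_square algebra_simps)
  qed
  also have "\<dots> = 2 * norm us * (\<Sum>j\<in>UNIV. \<bar>(\<bar>\<eta> $ j\<bar> * ?w j) * (?w j * norm (ux j))\<bar>)"
    by (simp only: sum_distrib_left)
  also have "\<dots> \<le> 2 * norm us * (?s * ?g)"
    using L2_set_mult_ineq[where A=UNIV and f="\<lambda>j. \<bar>\<eta> $ j\<bar> * ?w j" and g="\<lambda>j. ?w j * norm (ux j)"]
    unfolding L2_set_def abs_mult by (intro mult_left_mono) auto
  also have "\<dots> = ?s * (2 * norm us * ?g)" by simp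
  also have "\<dots> \<le> ?s * ((norm us)\<^sup>2 + ?g\<^sup>2)"
    by (intro mult_left_mono sum_squares_bound) (auto intro!: sum_nonneg)
  also have "?g\<^sup>2 = (\<Sum>j\<in>UNIV. (?w j)\<^sup>2 * (ux j \<bullet> ux j))"
    by (subst real_sqrt_pow2) (auto intro!: sum_nonneg sum.cong simp: power_mult_distrib power2_norm_eq_inner)
  finally show ?thesis unfolding s by (simp add: power2_norm_eq_inner)
qed


lemma has_vector_derivative_time_slice:
  assumes "(f has_derivative f') (at (t, x))"
  shows "((\<lambda>t. f (t, x)) has_vector_derivative f' (1, 0)) (at t)"
proof -
  have "((\<lambda>t. (t, x)) has_derivative (\<lambda>r. (r, 0))) (at t)"
    by (rule has_derivative_Pair[OF has_derivative_ident has_derivative_const])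
  from has_derivative_compose[OF this assms]
  have "((\<lambda>t. f (t, x)) has_derivative (\<lambda>r. f' (r, 0))) (at t)" .
  moreover have "(\<lambda>r. f' (r, 0)) = (\<lambda>r. r *\<^sub>R f' (1, 0))"
  proof
    show "f' (r, 0) = r *\<^sub>R f' (1, 0)" for r
    using linear_scale[OF has_derivative_linear[OF assms], of r "(1, 0)"] by simp
  qed
  ultimately show ?thesis unfolding has_vector_derivative_def by simp
qed

lemma has_vector_derivative_space_slice:
  assumes "(f has_derivative f') (at (t, x))"
  shows "((\<lambda>r. f (t, x + r *\<^sub>R e)) has_vector_derivative f' (0, e)) (at 0)"
proof -
  have 1: "((\<lambda>r. (t, x + r *\<^sub>R e)) has_derivative (\<lambda>r. (0, r *\<^sub>R e))) (at 0)"
    by (rule has_derivative_Pair[OF has_derivative_const]) (auto intro!: derivative_eq_intros)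
  have "((\<lambda>r. f (t, x + r *\<^sub>R e)) has_derivative (\<lambda>r. f' (0, r *\<^sub>R e))) (at 0)"
    using has_derivative_compose[OF 1, of f f'] assms by simp
  moreover have "(\<lambda>r. f' (0, r *\<^sub>R e)) = (\<lambda>r. r *\<^sub>R f' (0, e))"
  proof
    show "f' (0, r *\<^sub>R e) = r *\<^sub>R f' (0, e)" for r
    using linear_scale[OF has_derivative_linear[OF assms], of r "(0, e)"] by simp
  qed
  ultimately show ?thesis unfolding has_vector_derivative_def by simp
qed

lemma smooth_on_t_deriv_t:
  "smooth_on spacetime u \<Longrightarrow> smooth_on spacetime (t_deriv_t u)"
  unfolding t_deriv_t_def
  by (rule smooth_on_scaleR[OF open_spacetime smooth_on_bounded_linear[OF bounded_linear_fst] smooth_on_dir_deriv])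

lemma t_deriv_t_deriv_x:
  fixes u :: "('n::finite) point \<Rightarrow> 'b::euclidean_space"
  assumes u: "smooth_on spacetime u" and z: "z \<in> spacetime"
  shows "t_deriv_t (deriv_x j u) z = deriv_x j (t_deriv_t u) z"
proof -
  have "(t_deriv_t u has_derivative (\<lambda>v. fst z *\<^sub>R dir_deriv v (deriv_t u) z + fst v *\<^sub>R deriv_t u z)) (at z)"
    unfolding t_deriv_t_def
    by (intro has_derivative_scaleR smooth_on_has_derivative[OF smooth_on_dir_deriv[OF u] z]
        bounded_linear_imp_has_derivative bounded_linear_fst)
  from dir_deriv_eqI[OF this, of "(0, axis j 1)"]
  show ?thesis by (simp add: t_deriv_t_def[of "deriv_x j u"] dir_deriv_commute[OF open_spacetime u z, of "(1, 0)"])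
qed

definition energy_density :: "real ^ 'n \<Rightarrow> (('n::finite) point \<Rightarrow> 'b::real_inner) \<Rightarrow> 'n point \<Rightarrow> real" where
  "energy_density q u z = u z \<bullet> u z + t_deriv_t u z \<bullet> t_deriv_t u z
     + (\<Sum>j\<in>UNIV. (fst z powr (q $ j))\<^sup>2 * (deriv_x j u z \<bullet> deriv_x j u z))"

lemma has_derivative_energy_density:
  fixes u :: "('n::finite) point \<Rightarrow> 'b::euclidean_space"
  assumes u: "smooth_on spacetime u" and z: "z \<in> spacetime"
  shows "(energy_density q u has_derivative (\<lambda>v. 2 * (u z \<bullet> dir_deriv v u z)
     + 2 * (t_deriv_t u z \<bullet> dir_deriv v (t_deriv_t u) z)
     + (\<Sum>j\<in>UNIV. (fst z powr (q $ j))\<^sup>2 * (2 * (deriv_x j u z \<bullet> dir_deriv v (deriv_x j u) z))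
         + (2 * q $ j * (fst z powr (q $ j))\<^sup>2 / fst z * fst v) * (deriv_x j u z \<bullet> deriv_x j u z)))) (at z)"
proof -
  have pos: "fst z > 0" using z by (simp add: spacetime_def)
  have sq: "((\<lambda>z. f z \<bullet> f z) has_derivative (\<lambda>v. 2 * (f z \<bullet> dir_deriv v f z))) (at z)"
    if "smooth_on spacetime f" for f :: "'n point \<Rightarrow> 'b"
    using has_derivative_inner[OF smooth_on_has_derivative[OF that z] smooth_on_has_derivative[OF that z]]
    by (simp add: inner_commute)
  have w: "((\<lambda>z. (fst z powr (q $ j))\<^sup>2) has_derivative (\<lambda>v. 2 * q $ j * (fst z powr (q $ j))\<^sup>2 / fst z * fst v)) (at z)" for j
    using pos by (auto intro!: derivative_eq_intros simp: powr_diff power2_eq_square)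
  show ?thesis unfolding energy_density_def
    by (intro has_derivative_add has_derivative_sum has_derivative_mult sq w u smooth_on_t_deriv_t smooth_on_dir_deriv)
qed

text \<open>
  The weight is a product of functions of the fronts \<open>front q a \<eta>\<close>. The level sets of a front are
  characteristic, so the loss of energy through the boundary of the support of the weight has a sign.
  The fronts in the coordinate directions are added to make the support of the weight bounded in \<open>x\<close>.
\<close>

theorem vanishing_from_fronts:
  fixes u :: "('n::finite) point \<Rightarrow> complex ^ ('m::finite)"
  assumes q: "\<And>j. 0 \<le> q $ j" and u: "smooth_on spacetime u"
    and a: "0 < a" "a < fst w" and H: "finite H" and eps: "0 < \<epsilon>"
    and late: "\<And>z. T \<le> fst z \<Longrightarrow> z \<in> spacetime \<Longrightarrow> u z = 0"
    and eq: "\<And>z. fst w \<le> fst z \<Longrightarrow> \<forall>\<eta>\<in>H. front q a \<eta> w - \<epsilon> < front q a \<eta> z \<Longrightarrow> kasner_op q b bx c u z = 0"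
  shows "u w = 0"
proof (cases "T \<le> fst w")
  case True
  then show ?thesis using late a by (auto simp: spacetime_def)
next
  case False
  define t0 t1 where "t0 = fst w" and "t1 = T + 1"
  have t01: "t0 \<le> t1" "0 < t0" "a < t0" using False a by (auto simp: t0_def t1_def)
  let ?S = "spacetime :: 'n point set"
  let ?Q = "{t0..t1} \<times> (UNIV :: (real ^ 'n) set)"
  have QS: "?Q \<subseteq> ?S" and Qa: "\<And>z. z \<in> ?Q \<Longrightarrow> a < fst z" using t01 by (auto simp: spacetime_def)
  obtain K where K: "K \<ge> 0"
    "\<And>(w :: 'n \<Rightarrow> real) u us uss F ux uxs uxx.
      uss - (\<Sum>j\<in>UNIV. (w j)\<^sup>2 *\<^sub>R uxx j) + b *v us + (\<Sum>j\<in>UNIV. w j *\<^sub>R (bx j *v ux j)) + c *v u = F \<Longrightarrow>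
      2 * (us \<bullet> uss) + 2 * (u \<bullet> us) + (\<Sum>j\<in>UNIV. 2 * (w j)\<^sup>2 * (ux j \<bullet> uxs j))
        \<ge> (\<Sum>j\<in>UNIV. 2 * (w j)\<^sup>2 * (us \<bullet> uxx j + ux j \<bullet> uxs j))
          - K * (u \<bullet> u + us \<bullet> us + (\<Sum>j\<in>UNIV. (w j)\<^sup>2 * (ux j \<bullet> ux j))) - F \<bullet> F"
    using energy_density_inequality[of b bx c] by blast
  define H' where "H' = H \<union> (\<lambda>(s, j). s *\<^sub>R axis j 1) ` ({1, -1} \<times> UNIV)"
  have fH': "finite H'" using H by (auto simp: H'_def)
  define \<rho> where "\<rho> \<eta> z = front q a \<eta> z - front q a \<eta> w + \<epsilon>" for \<eta> z
  define \<psi> where "\<psi> z = (\<Prod>\<eta>\<in>H'. pos_sq (\<rho> \<eta> z))" for z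
  define \<mu> where "\<mu> \<eta> z = 2 * max 0 (\<rho> \<eta> z) * (\<Prod>\<eta>'\<in>H' - {\<eta>}. pos_sq (\<rho> \<eta>' z))" for \<eta> z
  define D where "D = t_deriv_t u"
  define U where "U j = deriv_x j u" for j
  define e where "e = energy_density q u"
  define wt where "wt j z = (fst z powr (q $ j))\<^sup>2" for j and z :: "'n point"
  have sD: "smooth_on ?S D" and sDD: "smooth_on ?S (t_deriv_t D)" and sU: "smooth_on ?S (U j)"
    and sUj: "smooth_on ?S (deriv_x j (U j))" and sDj: "smooth_on ?S (deriv_x j D)" for j
    unfolding D_def U_def by (intro smooth_on_t_deriv_t smooth_on_dir_deriv u)+
  have d\<rho>: "(\<rho> \<eta> has_derivative (\<lambda>v. char_speed q \<eta> (fst z) * fst v - snd v \<bullet> \<eta>)) (at z)" if "z \<in> ?Q" for \<eta> z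
    unfolding \<rho>_def using has_derivative_add[OF has_derivative_front[OF a(1) Qa[OF that]] has_derivative_const, of q \<eta> "\<epsilon> - front q a \<eta> w"]
    by (simp add: algebra_simps)
  have dps: "((\<lambda>z. pos_sq (\<rho> \<eta> z)) has_derivative (\<lambda>v. 2 * max 0 (\<rho> \<eta> z) * (char_speed q \<eta> (fst z) * fst v - snd v \<bullet> \<eta>))) (at z)"
    if "z \<in> ?Q" for \<eta> z
    using has_derivative_compose[OF d\<rho>[OF that] DERIV_pos_sq[unfolded has_field_derivative_def]] .
  have d\<psi>: "(\<psi> has_derivative (\<lambda>v. \<Sum>\<eta>\<in>H'. \<mu> \<eta> z * (char_speed q \<eta> (fst z) * fst v - snd v \<bullet> \<eta>))) (at z)"
    if "z \<in> ?Q" for z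
    unfolding \<psi>_def
    by (rule has_derivative_eq_rhs[OF has_derivative_prod[OF dps[OF that]]])
       (auto simp: \<mu>_def fun_eq_iff intro!: sum.cong)
  have dwt: "(wt j has_derivative (\<lambda>v. 2 * q $ j * wt j z / fst z * fst v)) (at z)" if "z \<in> ?Q" for j z
    unfolding wt_def using Qa[OF that] a(1)
    by (auto intro!: derivative_eq_intros simp: powr_diff power2_eq_square)
  have dpw: "((\<lambda>z. fst z powr r) has_derivative (\<lambda>v. r * fst z powr r / fst z * fst v)) (at z)" if "z \<in> ?Q" for r z
    using Qa[OF that] a(1) by (auto intro!: derivative_eq_intros simp: powr_diff)
  \<comment> \<open>continuity of all the ingredients\<close>
  have c\<rho>: "continuous_on ?Q (\<rho> \<eta>)" for \<eta>
    by (intro continuous_at_imp_continuous_on ballI has_derivative_continuous[OF d\<rho>])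
  have c\<psi>: "continuous_on ?Q \<psi>"
    by (intro continuous_at_imp_continuous_on ballI has_derivative_continuous[OF d\<psi>])
  have cps: "continuous_on ?Q (\<lambda>z. pos_sq (\<rho> \<eta> z))" for \<eta>
    by (intro continuous_at_imp_continuous_on ballI has_derivative_continuous[OF dps])
  have c\<mu>: "continuous_on ?Q (\<mu> \<eta>)" for \<eta>
    unfolding \<mu>_def by (intro continuous_intros continuous_on_max c\<rho> cps)
  have cwt: "continuous_on ?Q (wt j)" for j
    by (intro continuous_at_imp_continuous_on ballI has_derivative_continuous[OF dwt])
  have cpw: "continuous_on ?Q (\<lambda>z. fst z powr r)" for r
    by (intro continuous_at_imp_continuous_on ballI has_derivative_continuous[OF dpw])
  have csp: "continuous_on ?Q (\<lambda>z. char_speed q \<eta> (fst z))" for \<eta>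
    by (rule continuous_on_compose2[OF continuous_on_char_speed[of q \<eta>]]) (use t01 in \<open>auto intro!: continuous_intros\<close>)
  have csm: "continuous_on ?Q f" if "smooth_on ?S f" for f :: "'n point \<Rightarrow> complex ^ 'm"
    using continuous_on_subset[OF smooth_on_continuous_on[OF that] QS] .
  have ce: "continuous_on ?Q e"
    unfolding e_def by (intro continuous_at_imp_continuous_on ballI has_derivative_continuous[OF has_derivative_energy_density[OF u]])
      (use QS in auto)
  have cfst: "continuous_on ?Q fst" by (intro continuous_intros)
  have fst0: "\<forall>z\<in>?Q. fst z \<noteq> 0" using t01 by auto
  note cont = c\<psi> c\<mu> cwt cpw csp ce cfst csm[OF u] csm[OF sD] csm[OF sDD] csm[OF sU] csm[OF sUj] csm[OF sDj]
  define g where "g z = fst z powr K * (\<psi> z * e z)" for z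
  define et where "et z = 2 * (D z \<bullet> t_deriv_t D z) + 2 * (u z \<bullet> D z) + (\<Sum>j\<in>UNIV. 2 * wt j z * (U j z \<bullet> deriv_x j D z))
     + (\<Sum>j\<in>UNIV. 2 * q $ j * wt j z * (U j z \<bullet> U j z))" for z
  define gt where "gt z = fst z powr K * (K * (\<psi> z * e z) + (\<Sum>\<eta>\<in>H'. \<mu> \<eta> z * (fst z * char_speed q \<eta> (fst z))) * e z + \<psi> z * et z) / fst z" for z
  define W where "W j z = fst z powr K / fst z * (\<psi> z * (2 * wt j z * (D z \<bullet> U j z)))" for j z
  define Wx where "Wx j z = fst z powr K * (\<psi> z * (2 * wt j z * (D z \<bullet> deriv_x j (U j) z + U j z \<bullet> deriv_x j D z))
     - (\<Sum>\<eta>\<in>H'. \<mu> \<eta> z * (\<eta> $ j * (2 * wt j z * (D z \<bullet> U j z))))) / fst z" for j z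
  have outside: "\<psi> z = 0 \<and> (\<forall>\<eta>\<in>H'. \<mu> \<eta> z = 0)" if "\<eta>0 \<in> H'" "\<rho> \<eta>0 z \<le> 0" for \<eta>0 z
  proof -
    have 0: "pos_sq (\<rho> \<eta>0 z) = 0" using that by (simp add: pos_sq_def)
    have "\<mu> \<eta> z = 0" if "\<eta> \<in> H'" for \<eta>
    proof (cases "\<eta> = \<eta>0")
      case True then show ?thesis using \<open>\<rho> \<eta>0 z \<le> 0\<close> by (simp add: \<mu>_def max_def)
    next
      case False
      then have "(\<Prod>\<eta>'\<in>H' - {\<eta>}. pos_sq (\<rho> \<eta>' z)) = 0"
        using 0 fH' \<open>\<eta>0 \<in> H'\<close> by (intro prod_zero) auto
      then show ?thesis by (simp add: \<mu>_def)
    qed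
    moreover have "\<psi> z = 0" unfolding \<psi>_def using 0 fH' that by (intro prod_zero) auto
    ultimately show ?thesis by blast
  qed
  have \<mu>nn: "\<mu> \<eta> z \<ge> 0" and \<psi>nn: "\<psi> z \<ge> 0" for \<eta> z
    unfolding \<mu>_def \<psi>_def pos_sq_def by (auto intro!: mult_nonneg_nonneg prod_nonneg)
  have enn: "e z \<ge> 0" for z unfolding e_def energy_density_def by (auto intro!: add_nonneg_nonneg sum_nonneg)
  \<comment> \<open>the weight is supported in a bounded set\<close>
  define I where "I j = integral {a..t1} (char_speed q (axis j 1))" for j
  define lo hi where "lo = (\<chi> j. snd w $ j - \<epsilon> - I j)" and "hi = (\<chi> j. snd w $ j + \<epsilon> + I j)"
  have speed_neg: "char_speed q (- axis j 1) = char_speed q (axis j 1)" for j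
    unfolding char_speed_def by (simp add: fun_eq_iff)
  have intg: "char_speed q \<eta> integrable_on {a..t}" for \<eta> t
    using a(1) by (intro integrable_continuous_real continuous_on_subset[OF continuous_on_char_speed]) auto
  have inn: "integral {a..t} (char_speed q \<eta>) \<ge> 0" for \<eta> t
    using a(1) by (intro integral_nonneg intg char_speed_nonneg) auto
  have imono: "integral {a..t} (char_speed q \<eta>) \<le> integral {a..t1} (char_speed q \<eta>)" if "t \<le> t1" for \<eta> t
    using a(1) that by (intro integral_subset_le intg char_speed_nonneg ballI) auto
  have box: "\<exists>\<eta>0\<in>H'. \<rho> \<eta>0 (t, x) \<le> 0" if tin: "t \<in> {t0..t1}" and xout: "x \<notin> cbox lo hi" for t x
  proof -
    obtain j where "x $ j < lo $ j \<or> x $ j > hi $ j" using xout by (auto simp: mem_box_cart not_le)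
    then show ?thesis
    proof
      assume "x $ j < lo $ j"
      moreover have "\<rho> (- axis j 1) (t, x) \<le> I j + \<epsilon> + (x $ j - snd w $ j)"
        using inn[of "fst w" "axis j 1"] imono[of t "axis j 1"] tin unfolding \<rho>_def front_def I_def
        by (simp add: speed_neg inner_axis)
      ultimately have "\<rho> (- axis j 1) (t, x) \<le> 0" by (simp add: lo_def)
      moreover have "- axis j 1 \<in> H'" unfolding H'_def by (intro UnI2 image_eqI[of _ _ "(-1, j)"]) auto
      ultimately show ?thesis by blast
    next
      assume "x $ j > hi $ j"
      moreover have "\<rho> (axis j 1) (t, x) \<le> I j + \<epsilon> - (x $ j - snd w $ j)"
        using inn[of "fst w" "axis j 1"] imono[of t "axis j 1"] tin unfolding \<rho>_def front_def I_def
        by (simp add: inner_axis)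
      ultimately have "\<rho> (axis j 1) (t, x) \<le> 0" by (simp add: hi_def)
      moreover have "axis j 1 \<in> H'" unfolding H'_def by (intro UnI2 image_eqI[of _ _ "(1, j)"]) auto
      ultimately show ?thesis by blast
    qed
  qed
  have I0: "I j \<ge> 0" for j using inn by (simp add: I_def)
  have "g (t0, snd w) = 0"
  proof (rule divergence_inequality_vanishing[where gt=gt and W=W and Wx=Wx and a=lo and b=hi])
    show "t0 \<le> t1" by (rule t01)
    show "snd w \<in> box lo hi" using eps I0 by (auto simp: mem_box_cart lo_def hi_def add_pos_nonneg intro: less_le_trans[of _ 0])
    show "continuous_on ?Q g" unfolding g_def by (intro continuous_intros cont)
    show "continuous_on ?Q gt" unfolding gt_def et_def by (intro continuous_intros cont fst0)
    show "continuous_on ?Q (W j)" for j unfolding W_def by (intro continuous_intros cont fst0)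
    show "continuous_on ?Q (Wx j)" for j unfolding Wx_def by (intro continuous_intros cont fst0)
    show "0 \<le> g (t0, x)" for x unfolding g_def using \<psi>nn enn by (intro mult_nonneg_nonneg) auto
    show "g (t1, x) = 0" for x
    proof -
      have op: "open {z :: 'n point. T < fst z \<and> 0 < fst z}" by (intro open_Collect_conj open_Collect_less continuous_intros)
      have in': "(t1, x) \<in> {z :: 'n point. T < fst z \<and> 0 < fst z}" using t01 by (auto simp: t1_def)
      have z: "(t1, x) \<in> ?S" using t01 by (auto simp: spacetime_def)
      have "dir_deriv v u (t1, x) = 0" for v
      proof -
        have "dir_deriv v u (t1, x) = dir_deriv v (\<lambda>_. 0) (t1, x)"
          by (rule dir_deriv_cong[OF op in' _ smooth_on_differentiable[OF u z]]) (use late in \<open>auto simp: spacetime_def\<close>)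
        then show ?thesis by (simp add: dir_deriv_const)
      qed
      moreover have "u (t1, x) = 0" using late[OF _ z] by (simp add: t1_def)
      ultimately show ?thesis by (simp add: g_def e_def energy_density_def t_deriv_t_def)
    qed
    show "W j (t, x) = 0" if "t \<in> {t0..t1}" "x \<notin> cbox lo hi" for t x j
      using box[OF that] outside by (auto simp: W_def)
    show "Wx j (t, x) = 0" if "t \<in> {t0..t1}" "x \<notin> cbox lo hi" for t x j
      using box[OF that] outside[of _ "(t, x)"] by (auto simp: Wx_def)
    fix t x assume t: "t \<in> {t0..t1}"
    let ?z = "(t, x) :: 'n point"
    have zQ: "?z \<in> ?Q" and z: "?z \<in> ?S" and tpos: "t > 0" using t QS t01 by auto
    have Dt: "deriv_t u ?z = (1 / t) *\<^sub>R D ?z" "deriv_t D ?z = (1 / t) *\<^sub>R t_deriv_t D ?z"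
      "deriv_t (U j) ?z = (1 / t) *\<^sub>R deriv_x j D ?z" for j
      using tpos t_deriv_t_deriv_x[OF u z, of j, symmetric] by (auto simp: D_def t_deriv_t_def[of _ ?z] U_def)
    have "(g has_derivative (\<lambda>v. fst ?z powr K * (\<psi> ?z * (2 * (u ?z \<bullet> dir_deriv v u ?z)
         + 2 * (t_deriv_t u ?z \<bullet> dir_deriv v (t_deriv_t u) ?z)
         + (\<Sum>j\<in>UNIV. (fst ?z powr (q $ j))\<^sup>2 * (2 * (deriv_x j u ?z \<bullet> dir_deriv v (deriv_x j u) ?z))
             + (2 * q $ j * (fst ?z powr (q $ j))\<^sup>2 / fst ?z * fst v) * (deriv_x j u ?z \<bullet> deriv_x j u ?z)))
         + (\<Sum>\<eta>\<in>H'. \<mu> \<eta> ?z * (char_speed q \<eta> (fst ?z) * fst v - snd v \<bullet> \<eta>)) * e ?z)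
        + (K * fst ?z powr K / fst ?z * fst v) * (\<psi> ?z * e ?z))) (at ?z)"
      unfolding g_def
      by (intro has_derivative_mult dpw[OF zQ] d\<psi>[OF zQ])
         (unfold e_def, rule has_derivative_energy_density[OF u z])
    from has_vector_derivative_time_slice[OF this]
    have "((\<lambda>t. g (t, x)) has_vector_derivative t powr K * (\<psi> ?z * (2 * (u ?z \<bullet> deriv_t u ?z)
         + 2 * (D ?z \<bullet> deriv_t D ?z)
         + (\<Sum>j\<in>UNIV. wt j ?z * (2 * (U j ?z \<bullet> deriv_t (U j) ?z)) + 2 * q $ j * wt j ?z / t * (U j ?z \<bullet> U j ?z)))
         + (\<Sum>\<eta>\<in>H'. \<mu> \<eta> ?z * char_speed q \<eta> t) * e ?z)
        + K * t powr K / t * (\<psi> ?z * e ?z)) (at t)"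
      unfolding D_def U_def wt_def by simp
    moreover have "2 * (u ?z \<bullet> deriv_t u ?z) + 2 * (D ?z \<bullet> deriv_t D ?z)
         + (\<Sum>j\<in>UNIV. wt j ?z * (2 * (U j ?z \<bullet> deriv_t (U j) ?z)) + 2 * q $ j * wt j ?z / t * (U j ?z \<bullet> U j ?z))
        = et ?z / t"
      unfolding et_def Dt using tpos
      by (simp add: sum.distrib add_divide_distrib sum_divide_distrib mult_ac)
    moreover have "t powr K * (\<psi> ?z * (et ?z / t) + (\<Sum>\<eta>\<in>H'. \<mu> \<eta> ?z * char_speed q \<eta> t) * e ?z)
        + K * t powr K / t * (\<psi> ?z * e ?z) = gt ?z"
    proof -
      have "(\<Sum>\<eta>\<in>H'. \<mu> \<eta> ?z * (t * char_speed q \<eta> t)) = t * (\<Sum>\<eta>\<in>H'. \<mu> \<eta> ?z * char_speed q \<eta> t)"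
        by (simp add: sum_distrib_left mult.left_commute)
      then show ?thesis unfolding gt_def using tpos by (simp add: field_simps)
    qed
    ultimately have "((\<lambda>t. g (t, x)) has_vector_derivative gt ?z) (at t)" by simp
    then show "((\<lambda>t. g (t, x)) has_vector_derivative gt (t, x)) (at t within {t0..t1})"
      by (rule has_vector_derivative_at_within)
    show "((\<lambda>r. W j (t, x + r *\<^sub>R axis j 1)) has_vector_derivative Wx j (t, x)) (at 0)" for j
    proof -
      have "((\<lambda>r. \<psi> (t, x + r *\<^sub>R axis j 1)) has_vector_derivative - (\<Sum>\<eta>\<in>H'. \<mu> \<eta> ?z * \<eta> $ j)) (at 0)"
        using has_vector_derivative_space_slice[OF d\<psi>[OF zQ], of "axis j 1"]
        by (simp add: inner_axis' sum_negf)
      moreover have "((\<lambda>r. D (t, x + r *\<^sub>R axis j 1) \<bullet> U j (t, x + r *\<^sub>R axis j 1)) has_vector_derivative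
          (D ?z \<bullet> deriv_x j (U j) ?z + U j ?z \<bullet> deriv_x j D ?z)) (at 0)"
        using has_vector_derivative_space_slice[OF has_derivative_inner[OF smooth_on_has_derivative[OF sD z] smooth_on_has_derivative[OF sU[of j] z]], of "axis j 1"]
        by (simp add: inner_commute)
      ultimately have "((\<lambda>r. t powr K / t * (\<psi> (t, x + r *\<^sub>R axis j 1) * (2 * wt j ?z * (D (t, x + r *\<^sub>R axis j 1) \<bullet> U j (t, x + r *\<^sub>R axis j 1)))))
          has_real_derivative t powr K / t * (- (\<Sum>\<eta>\<in>H'. \<mu> \<eta> ?z * \<eta> $ j) * (2 * wt j ?z * (D ?z \<bullet> U j ?z))
            + 2 * wt j ?z * (D ?z \<bullet> deriv_x j (U j) ?z + U j ?z \<bullet> deriv_x j D ?z) * \<psi> ?z)) (at 0)"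
        using tpos unfolding has_real_derivative_iff_has_vector_derivative[symmetric]
        by (auto intro!: DERIV_cmult DERIV_mult' derivative_eq_intros)
      moreover have "t powr K / t * (- (\<Sum>\<eta>\<in>H'. \<mu> \<eta> ?z * \<eta> $ j) * (2 * wt j ?z * (D ?z \<bullet> U j ?z))
            + 2 * wt j ?z * (D ?z \<bullet> deriv_x j (U j) ?z + U j ?z \<bullet> deriv_x j D ?z) * \<psi> ?z) = Wx j ?z"
      proof -
        have "(\<Sum>\<eta>\<in>H'. \<mu> \<eta> ?z * (\<eta> $ j * (2 * wt j ?z * (D ?z \<bullet> U j ?z)))) = (\<Sum>\<eta>\<in>H'. \<mu> \<eta> ?z * \<eta> $ j) * (2 * wt j ?z * (D ?z \<bullet> U j ?z))"
          by (simp add: sum_distrib_right mult.assoc)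
        then show ?thesis unfolding Wx_def using tpos by (simp add: field_simps)
      qed
      ultimately show ?thesis unfolding has_real_derivative_iff_has_vector_derivative W_def wt_def by simp
    qed
    show "(\<Sum>j\<in>UNIV. Wx j (t, x)) \<le> gt (t, x)"
    proof (cases "\<exists>\<eta>0\<in>H'. \<rho> \<eta>0 ?z \<le> 0")
      case True
      then have "\<psi> ?z = 0" "\<And>\<eta>. \<eta> \<in> H' \<Longrightarrow> \<mu> \<eta> ?z = 0" using outside by blast+
      then show ?thesis by (simp add: Wx_def gt_def)
    next
      case False
      then have "\<forall>\<eta>\<in>H. front q a \<eta> w - \<epsilon> < front q a \<eta> ?z"
        unfolding \<rho>_def H'_def by force
      then have P0: "kasner_op q b bx c u ?z = 0" using t by (intro eq) (auto simp: t0_def)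
      have sqw: "t powr (2 * q $ j) = (t powr (q $ j))\<^sup>2" for j using tpos by (simp add: powr_power mult.commute)
      have "et ?z \<ge> 2 * (D ?z \<bullet> t_deriv_t D ?z) + 2 * (u ?z \<bullet> D ?z) + (\<Sum>j\<in>UNIV. 2 * wt j ?z * (U j ?z \<bullet> deriv_x j D ?z))"
        unfolding et_def using q by (auto intro!: sum_nonneg mult_nonneg_nonneg simp: wt_def)
      moreover have "2 * (D ?z \<bullet> t_deriv_t D ?z) + 2 * (u ?z \<bullet> D ?z) + (\<Sum>j\<in>UNIV. 2 * wt j ?z * (U j ?z \<bullet> deriv_x j D ?z))
          \<ge> (\<Sum>j\<in>UNIV. 2 * wt j ?z * (D ?z \<bullet> deriv_x j (U j) ?z + U j ?z \<bullet> deriv_x j D ?z)) - K * e ?z"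
        using K(2)[of "t_deriv_t D ?z" "\<lambda>j. t powr (q $ j)" "\<lambda>j. deriv_x j (U j) ?z" "D ?z" "\<lambda>j. U j ?z" "u ?z" 0 "\<lambda>j. deriv_x j D ?z"] P0
        unfolding kasner_op_def e_def energy_density_def wt_def D_def[symmetric] U_def[symmetric] by (simp add: sqw)
      ultimately have et: "(\<Sum>j\<in>UNIV. 2 * wt j ?z * (D ?z \<bullet> deriv_x j (U j) ?z + U j ?z \<bullet> deriv_x j D ?z)) \<le> et ?z + K * e ?z"
        by linarith
      define f where "f \<eta> = (\<Sum>j\<in>UNIV. \<eta> $ j * (2 * wt j ?z * (D ?z \<bullet> U j ?z)))" for \<eta> :: "real ^ 'n"
      have f: "- f \<eta> \<le> t * char_speed q \<eta> t * e ?z" for \<eta>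
      proof -
        have "- f \<eta> \<le> t * char_speed q \<eta> t * (D ?z \<bullet> D ?z + (\<Sum>j\<in>UNIV. wt j ?z * (U j ?z \<bullet> U j ?z)))"
          using abs_le_D2[OF char_speed_flux_bound[OF tpos, of \<eta> q "D ?z" "\<lambda>j. U j ?z"]] by (simp add: f_def wt_def)
        also have "\<dots> \<le> t * char_speed q \<eta> t * e ?z"
          using tpos char_speed_nonneg[OF tpos, of q \<eta>]
          by (intro mult_left_mono) (auto simp: e_def energy_density_def D_def U_def wt_def)
        finally show ?thesis .
      qed
      have "(\<Sum>j\<in>UNIV. Wx j ?z) = t powr K / t * (\<psi> ?z * (\<Sum>j\<in>UNIV. 2 * wt j ?z * (D ?z \<bullet> deriv_x j (U j) ?z + U j ?z \<bullet> deriv_x j D ?z))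
          + (\<Sum>\<eta>\<in>H'. \<mu> \<eta> ?z * (- f \<eta>)))"
      proof -
        have "(\<Sum>\<eta>\<in>H'. \<mu> \<eta> ?z * (- f \<eta>)) = - (\<Sum>j\<in>UNIV. \<Sum>\<eta>\<in>H'. \<mu> \<eta> ?z * (\<eta> $ j * (2 * wt j ?z * (D ?z \<bullet> U j ?z))))"
          unfolding f_def by (subst sum.swap) (simp add: sum_distrib_left sum_negf)
        then show ?thesis unfolding Wx_def
          by (simp add: sum_subtractf sum_distrib_left[symmetric] sum_divide_distrib[symmetric])
      qed
      also have "\<dots> \<le> t powr K / t * (\<psi> ?z * (et ?z + K * e ?z) + (\<Sum>\<eta>\<in>H'. \<mu> \<eta> ?z * (t * char_speed q \<eta> t * e ?z)))"
        using tpos by (intro mult_left_mono add_mono sum_mono f et \<mu>nn \<psi>nn) auto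
      also have "(\<Sum>\<eta>\<in>H'. \<mu> \<eta> ?z * (t * char_speed q \<eta> t * e ?z)) = (\<Sum>\<eta>\<in>H'. \<mu> \<eta> ?z * (t * char_speed q \<eta> t)) * e ?z"
        unfolding sum_distrib_right by (simp only: mult_ac)
      also have "t powr K / t * (\<psi> ?z * (et ?z + K * e ?z) + (\<Sum>\<eta>\<in>H'. \<mu> \<eta> ?z * (t * char_speed q \<eta> t)) * e ?z) = gt ?z"
        unfolding gt_def by (simp add: algebra_simps add_divide_distrib)
      finally show ?thesis .
    qed
  qed
  moreover have "\<psi> (t0, snd w) > 0"
    unfolding \<psi>_def \<rho>_def t0_def using eps by (auto intro!: prod_pos simp: pos_sq_def)
  ultimately have "e w = 0" using t01 by (auto simp: g_def t0_def)
  moreover have "u w \<bullet> u w \<le> e w"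
    unfolding e_def energy_density_def by (auto intro!: add_nonneg_nonneg sum_nonneg)
  ultimately show ?thesis by (metis inner_ge_zero inner_eq_zero_iff order_antisym)
qed

section \<open>Causal futures described by fronts\<close>

lemma convex_square_sum:
  fixes r s :: "real" assumes "0 \<le> u" "u \<le> 1"
  shows "((1 - u) * r + u * s)\<^sup>2 \<le> (1 - u) * r\<^sup>2 + u * s\<^sup>2"
proof -
  have "(1 - u) * r\<^sup>2 + u * s\<^sup>2 - ((1 - u) * r + u * s)\<^sup>2 = u * (1 - u) * (r - s)\<^sup>2"
    by (simp add: power2_eq_square algebra_simps)
  moreover have "u * (1 - u) * (r - s)\<^sup>2 \<ge> 0" using assms by simp
  ultimately show ?thesis by linarith
qed

lemma sqrt_le_tangent:
  assumes "0 < N" "0 \<le> N\<^sup>2 + x" shows "sqrt (N\<^sup>2 + x) \<le> N + x / (2 * N)"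
proof (rule real_le_lsqrt)
  have "N + x / (2 * N) = (2 * N\<^sup>2 + x) / (2 * N)" using assms by (simp add: field_simps power2_eq_square)
  also have "\<dots> \<ge> 0" using assms by (intro divide_nonneg_pos) (auto simp: power2_eq_square add_nonneg_nonneg intro: order.trans[of _ "N * N + x"])
  finally show "0 \<le> N + x / (2 * N)" .
  have "(N + x / (2 * N))\<^sup>2 = N\<^sup>2 + x + (x / (2 * N))\<^sup>2" using assms by (simp add: power2_sum)
  then show "N\<^sup>2 + x \<le> (N + x / (2 * N))\<^sup>2" by simp
qed

lemma linear_coefficient_zero:
  fixes l C :: real assumes "\<And>\<tau>. 0 \<le> \<tau> * l + C * \<tau>\<^sup>2" "0 \<le> C" shows "l = 0"
proof -
  have "0 \<le> (- l / (1 + C)) * l + C * (- l / (1 + C))\<^sup>2" by (rule assms(1))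
  also have "\<dots> = - (l / (1 + C))\<^sup>2"
    using assms(2) by (simp add: power2_eq_square divide_simps add_nonneg_eq_0_iff) (simp add: algebra_simps)
  finally have "(l / (1 + C))\<^sup>2 \<le> 0" by simp
  then have "l / (1 + C) = 0" by simp
  then show ?thesis using assms(2) by simp
qed

text \<open>
  The set of points reachable at a given time is convex, with support function the integral of
  \<open>char_speed\<close>. A point that satisfies all the support inequalities is either not separated from the
  reachable set, or lies on a supporting hyperplane; in the second case the support function is
  differentiable in the normal direction and its gradient, which is attained by a curve, is the point.
\<close>

lemma reachable_displacement:
  fixes p y :: "real ^ 'n::finite"
  assumes t: "0 < t0" "t0 < t1"
    and y: "\<And>\<eta>. y \<bullet> \<eta> \<le> integral {t0..t1} (char_speed (\<chi> j. 1 - p $ j) \<eta>)"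
  obtains v where "continuous_on {t0..t1} v" "y = integral {t0..t1} v"
    "\<forall>s\<in>{t0..t1}. (\<Sum>j\<in>UNIV. s powr (2 * p $ j) * (v s $ j)\<^sup>2) \<le> 1"
proof -
  let ?I = "{t0..t1}"
  let ?q = "\<chi> j. 1 - p $ j"
  define adm where "adm v \<longleftrightarrow> continuous_on ?I v \<and> (\<forall>s\<in>?I. (\<Sum>j\<in>UNIV. s powr (2 * p $ j) * (v s $ j)\<^sup>2) \<le> 1)" for v :: "real \<Rightarrow> real ^ 'n"
  define R where "R = {integral ?I v | v. adm v}"
  define N where "N \<eta> s = sqrt (\<Sum>j\<in>UNIV. s powr (- 2 * p $ j) * (\<eta> $ j)\<^sup>2)" for \<eta> s
  have speed: "char_speed ?q \<eta> s = N \<eta> s" if "s \<in> ?I" for \<eta> s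
  proof -
    have s: "s > 0" using that t by auto
    have "(\<Sum>j\<in>UNIV. s powr (2 * ?q $ j) * (\<eta> $ j)\<^sup>2) = s\<^sup>2 * (\<Sum>j\<in>UNIV. s powr (- 2 * p $ j) * (\<eta> $ j)\<^sup>2)"
      using s by (simp add: sum_distrib_left powr_diff right_diff_distrib powr_minus divide_simps)
    then show ?thesis using s by (simp add: char_speed_def N_def real_sqrt_mult)
  qed
  have intN: "integral ?I (char_speed ?q \<eta>) = integral ?I (N \<eta>)" for \<eta>
    by (intro integral_cong speed)
  have contN: "continuous_on ?I (N \<eta>)" for \<eta>
    unfolding N_def using t by (intro continuous_intros) auto
  have cI: "f integrable_on ?I" if "continuous_on ?I f" for f :: "real \<Rightarrow> 'x::banach"
    by (rule integrable_continuous_real[OF that])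
  have "y \<in> R"
  proof (rule ccontr)
    assume yR: "y \<notin> R"
    have "convex R"
    proof (rule convexI)
      fix a b and u v :: real assume ab: "a \<in> R" "b \<in> R" and uv: "0 \<le> u" "0 \<le> v" "u + v = 1"
      then obtain f g where f: "adm f" "a = integral ?I f" and g: "adm g" "b = integral ?I g" unfolding R_def by blast
      have u: "u = 1 - v" using uv by simp
      let ?h = "\<lambda>s. u *\<^sub>R f s + v *\<^sub>R g s"
      have cf: "continuous_on ?I f" "continuous_on ?I g" using f g by (auto simp: adm_def)
      have "(\<Sum>j\<in>UNIV. s powr (2 * p $ j) * (?h s $ j)\<^sup>2) \<le> 1" if s: "s \<in> ?I" for s
      proof -
        have "(\<Sum>j\<in>UNIV. s powr (2 * p $ j) * (?h s $ j)\<^sup>2)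
            \<le> (\<Sum>j\<in>UNIV. s powr (2 * p $ j) * ((1 - v) * (f s $ j)\<^sup>2 + v * (g s $ j)\<^sup>2))"
          using uv unfolding u by (intro sum_mono mult_left_mono) (auto intro!: convex_square_sum)
        also have "\<dots> = (1 - v) * (\<Sum>j\<in>UNIV. s powr (2 * p $ j) * (f s $ j)\<^sup>2) + v * (\<Sum>j\<in>UNIV. s powr (2 * p $ j) * (g s $ j)\<^sup>2)"
          unfolding sum_distrib_left sum.distrib[symmetric]
          by (intro sum.cong refl) (simp add: algebra_simps)
        also have "\<dots> \<le> (1 - v) * 1 + v * 1"
          using f(1) g(1) s uv u by (intro add_mono mult_left_mono) (auto simp: adm_def)
        finally show ?thesis by simp
      qed
      then have "adm ?h" using cf by (auto simp: adm_def intro!: continuous_intros)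
      moreover have "integral ?I ?h = u *\<^sub>R a + v *\<^sub>R b"
        using cI[OF cf(1)] cI[OF cf(2)] unfolding f g
        by (subst integral_add) (auto intro!: integrable_cmul)
      ultimately show "u *\<^sub>R a + v *\<^sub>R b \<in> R" unfolding R_def by force
    qed
    moreover have "adm (\<lambda>_. 0)" by (simp add: adm_def)
    then have "R \<noteq> {}" unfolding R_def by blast
    ultimately obtain \<eta> b where \<eta>: "\<eta> \<noteq> 0" "\<forall>x\<in>R. \<eta> \<bullet> x \<le> b" "\<forall>x\<in>{y}. \<eta> \<bullet> x \<ge> b"
      using separating_hyperplane_sets[of R "{y}"] yR by auto
    have Npos: "N \<eta> s > 0" if "s \<in> ?I" for s
    proof -
      obtain j where "\<eta> $ j \<noteq> 0" using \<eta>(1) by (auto simp: vec_eq_iff)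
      moreover have "s > 0" using that t by auto
      ultimately have "0 < (\<Sum>j\<in>UNIV. s powr (- 2 * p $ j) * (\<eta> $ j)\<^sup>2)"
        by (intro sum_pos2[of _ j]) auto
      then show ?thesis by (simp add: N_def)
    qed
    define v where "v s = (\<chi> j. s powr (- 2 * p $ j) * \<eta> $ j / N \<eta> s)" for s
    have cv: "continuous_on ?I v" unfolding v_def
      using t Npos by (intro continuous_intros contN) force+
    have N2: "(N \<eta> s)\<^sup>2 = (\<Sum>j\<in>UNIV. s powr (- 2 * p $ j) * (\<eta> $ j)\<^sup>2)" for \<eta> s
      unfolding N_def by (subst real_sqrt_pow2) (auto intro!: sum_nonneg)
    have admv: "adm v"
      unfolding adm_def
    proof (intro conjI ballI cv)
      fix s assume s: "s \<in> ?I"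
      have "(\<Sum>j\<in>UNIV. s powr (2 * p $ j) * (v s $ j)\<^sup>2) = (\<Sum>j\<in>UNIV. s powr (- 2 * p $ j) * (\<eta> $ j)\<^sup>2) / (N \<eta> s)\<^sup>2"
        unfolding v_def sum_divide_distrib
        using s t by (intro sum.cong refl) (simp add: power_divide power_mult_distrib power2_eq_square powr_minus divide_simps)
      then show "(\<Sum>j\<in>UNIV. s powr (2 * p $ j) * (v s $ j)\<^sup>2) \<le> 1" using Npos[OF s] unfolding N2[symmetric] by simp
    qed
    define r where "r = integral ?I v"
    have inner_int: "integral ?I v \<bullet> e = integral ?I (\<lambda>s. v s \<bullet> e)" for e
      using integral_linear[OF cI[OF cv] bounded_linear_inner_left[of e]] by (simp add: o_def)
    have "v s \<bullet> \<eta> = N \<eta> s" if "s \<in> ?I" for s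
    proof -
      have "v s \<bullet> \<eta> = (N \<eta> s)\<^sup>2 / N \<eta> s"
        unfolding N2 by (simp add: v_def inner_vec_def sum_divide_distrib power2_eq_square mult.assoc)
      then show ?thesis using Npos[OF that] by (simp add: power2_eq_square)
    qed
    then have r\<eta>: "r \<bullet> \<eta> = integral ?I (N \<eta>)" unfolding r_def inner_int by (intro integral_cong)
    have "r \<in> R" using admv unfolding R_def r_def by blast
    then have "integral ?I (N \<eta>) \<le> y \<bullet> \<eta>" using \<eta>(2,3) r\<eta> by (force simp: inner_commute)
    then have y\<eta>: "y \<bullet> \<eta> = r \<bullet> \<eta>" using y[of \<eta>] intN r\<eta> by simp
    have "(r - y) \<bullet> e = 0" for e
    proof (rule linear_coefficient_zero)
      let ?C = "integral ?I (\<lambda>s. (N e s)\<^sup>2 / (2 * N \<eta> s))"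
      have cC: "continuous_on ?I (\<lambda>s. (N e s)\<^sup>2 / (2 * N \<eta> s))"
        using Npos by (intro continuous_intros contN) force
      show "0 \<le> ?C" using Npos by (intro integral_nonneg cI cC) (auto intro!: divide_nonneg_pos)
      fix \<tau> :: real
      have pt: "N (\<eta> + \<tau> *\<^sub>R e) s \<le> N \<eta> s + \<tau> * (v s \<bullet> e) + \<tau>\<^sup>2 * ((N e s)\<^sup>2 / (2 * N \<eta> s))" if s: "s \<in> ?I" for s
      proof -
        define x where "x = 2 * \<tau> * (N \<eta> s * (v s \<bullet> e)) + \<tau>\<^sup>2 * (N e s)\<^sup>2"
        have nv: "N \<eta> s * (v s \<bullet> e) = (\<Sum>j\<in>UNIV. s powr (- 2 * p $ j) * (\<eta> $ j * e $ j))"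
          using Npos[OF s] by (simp add: v_def inner_vec_def sum_distrib_left mult.assoc)
        have "(N (\<eta> + \<tau> *\<^sub>R e) s)\<^sup>2 = (N \<eta> s)\<^sup>2 + x"
          unfolding N2 x_def nv by (simp add: power2_eq_square algebra_simps sum.distrib sum_distrib_left)
        moreover have "N (\<eta> + \<tau> *\<^sub>R e) s \<ge> 0" by (auto simp: N_def intro!: sum_nonneg)
        ultimately have "N (\<eta> + \<tau> *\<^sub>R e) s = sqrt ((N \<eta> s)\<^sup>2 + x)" "0 \<le> (N \<eta> s)\<^sup>2 + x"
          by (metis real_sqrt_unique, metis zero_le_power2)
        then have "N (\<eta> + \<tau> *\<^sub>R e) s \<le> N \<eta> s + x / (2 * N \<eta> s)" using sqrt_le_tangent[OF Npos[OF s]] by simp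
        also have "x / (2 * N \<eta> s) = \<tau> * (v s \<bullet> e) + \<tau>\<^sup>2 * ((N e s)\<^sup>2 / (2 * N \<eta> s))"
          unfolding x_def using Npos[OF s] by (simp add: field_simps)
        finally show ?thesis by simp
      qed
      have cve: "continuous_on ?I (\<lambda>s. v s \<bullet> e)" by (intro continuous_intros cv)
      have "y \<bullet> (\<eta> + \<tau> *\<^sub>R e) \<le> integral ?I (N (\<eta> + \<tau> *\<^sub>R e))" using y intN by metis
      also have "\<dots> \<le> integral ?I (\<lambda>s. N \<eta> s + \<tau> * (v s \<bullet> e) + \<tau>\<^sup>2 * ((N e s)\<^sup>2 / (2 * N \<eta> s)))"
        by (intro integral_le cI continuous_on_add continuous_on_mult continuous_on_const contN cve cC pt)
      also have "\<dots> = integral ?I (N \<eta>) + \<tau> * (r \<bullet> e) + \<tau>\<^sup>2 * ?C"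
        unfolding r_def inner_int
        by (intro integral_unique has_integral_add has_integral_mult_right integrable_integral cI contN cve cC)
      finally show "0 \<le> \<tau> * ((r - y) \<bullet> e) + ?C * \<tau>\<^sup>2"
        using y\<eta> r\<eta> by (simp add: inner_add_right inner_diff_left algebra_simps)
    qed
    then have "r = y" by (metis inner_eq_zero_iff right_minus_eq)
    then show False using \<open>r \<in> R\<close> yR by simp
  qed
  then show thesis using that unfolding R_def adm_def by blast
qed

text \<open>
  The converse of the monotonicity of the fronts: a point that no front separates from \<open>w\<close> can be
  reached from \<open>w\<close> by the curves of \<open>reachable_displacement\<close>.
\<close>

lemma causal_future_if_fronts:
  fixes p :: "real ^ 'n::finite"
  assumes w: "w \<in> spacetime" and le: "fst w \<le> fst z"
    and h: "\<And>\<eta>. (snd z - snd w) \<bullet> \<eta> \<le> integral {fst w..fst z} (char_speed (\<chi> j. 1 - p $ j) \<eta>)"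
  shows "z \<in> causal_future p w"
proof (cases "fst w = fst z")
  case True
  have "(snd z - snd w) \<bullet> (snd z - snd w) \<le> 0" using h[of "snd z - snd w"] True by simp
  then have "snd z = snd w" by (metis inner_eq_zero_iff inner_ge_zero order_antisym right_minus_eq)
  then have "z = w" using True by (simp add: prod_eq_iff)
  then show ?thesis by (simp add: causal_future_def)
next
  case False
  define t0 t1 L where "t0 = fst w" and "t1 = fst z" and "L = t1 - t0"
  have t: "0 < t0" "t0 < t1" "0 < L" using w le False by (auto simp: spacetime_def t0_def t1_def L_def)
  have hy: "(snd z - snd w) \<bullet> \<eta> \<le> integral {t0..t1} (char_speed (\<chi> j. 1 - p $ j) \<eta>)" for \<eta>
    using h unfolding t0_def t1_def .
  obtain v where v: "continuous_on {t0..t1} v" "snd z - snd w = integral {t0..t1} v"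
    "\<forall>s\<in>{t0..t1}. (\<Sum>j\<in>UNIV. s powr (2 * p $ j) * (v s $ j)\<^sup>2) \<le> 1"
    using reachable_displacement[OF t(1,2) hy] by blast
  define V where "V t = integral {t0..t} v" for t
  define c where "c s = (t0 + s * L, snd w + V (t0 + s * L))" for s
  have cV: "continuous_on {t0..t1} V"
    unfolding V_def by (intro indefinite_integral_continuous_1 integrable_continuous_real v)
  have rng: "t0 + s * L \<in> {t0..t1}" if "s \<in> {0..1}" for s
  proof -
    have "0 \<le> s * L" "s * L \<le> L" using that t mult_left_le_one_le[of L s] by auto
    then show ?thesis by (auto simp: L_def)
  qed
  have cc: "continuous_on {0..1} c"
    unfolding c_def by (intro continuous_intros continuous_on_compose2[OF cV]) (use rng in auto)
  have dc: "(c has_vector_derivative (L, L *\<^sub>R v (t0 + s * L))) (at s)" if s: "s \<in> {0<..<1}" for s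
  proof -
    have "s * L < 1 * L" using s t by (intro mult_strict_right_mono) auto
    moreover have "0 < s * L" using s t by simp
    ultimately have in': "t0 < t0 + s * L" "t0 + s * L < t1" by (auto simp: L_def)
    have "(V has_vector_derivative v (t0 + s * L)) (at (t0 + s * L) within {t0..t1})"
      unfolding V_def by (rule integral_has_vector_derivative[OF v(1)]) (use in' in auto)
    then have dV: "(V has_vector_derivative v (t0 + s * L)) (at (t0 + s * L))"
      using in' by (simp add: at_within_Icc_at)
    have "((\<lambda>s. t0 + s * L) has_vector_derivative L) (at s)" by (auto intro!: derivative_eq_intros)
    from vector_diff_chain_at[OF this dV]
    have "((\<lambda>s. snd w + V (t0 + s * L)) has_vector_derivative L *\<^sub>R v (t0 + s * L)) (at s)"
      by (auto simp: o_def intro!: derivative_eq_intros)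
    then show ?thesis unfolding c_def
      using has_vector_derivative_Pair[OF \<open>((\<lambda>s. t0 + s * L) has_vector_derivative L) (at s)\<close>] by blast
  qed
  have "future_causal_curve p c"
    unfolding future_causal_curve_def
  proof (intro conjI exI[of _ "{0, 1}"] cc ballI)
    show "path_image c \<subseteq> spacetime"
      unfolding path_image_def spacetime_def c_def using t by (auto intro!: add_pos_nonneg)
    have S: "{0..1} - {0, 1} = {0<..<1::real}" by auto
    show "c C1_differentiable_on ({0..1} - {0, 1})"
      unfolding C1_differentiable_on_def S
    proof (intro exI[of _ "\<lambda>s. (L, L *\<^sub>R v (t0 + s * L))"] conjI ballI)
      show "continuous_on {0<..<1} (\<lambda>s. (L, L *\<^sub>R v (t0 + s * L)))"
        by (intro continuous_intros continuous_on_compose2[OF v(1)]) (use rng in auto)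
    qed (rule dc)
    fix s :: real assume "s \<in> {0..1} - {0, 1}"
    then have s: "s \<in> {0<..<1}" "s \<in> {0..1}" by auto
    have vd: "vector_derivative c (at s) = (L, L *\<^sub>R v (t0 + s * L))"
      by (rule vector_derivative_at[OF dc[OF s(1)]])
    have "kasner_metric p (c s) (L, L *\<^sub>R v (t0 + s * L)) (L, L *\<^sub>R v (t0 + s * L))
       = L\<^sup>2 * ((\<Sum>j\<in>UNIV. (t0 + s * L) powr (2 * p $ j) * (v (t0 + s * L) $ j)\<^sup>2) - 1)"
      by (simp add: kasner_metric_def c_def sum_distrib_left right_diff_distrib power2_eq_square algebra_simps)
    also have "\<dots> \<le> 0" using bspec[OF v(3) rng[OF s(2)]] by (simp add: mult_nonneg_nonpos)
    finally show "future_causal p (c s) (vector_derivative c (at s))"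
      unfolding future_causal_def vd using t by (auto simp: kasner_metric_def zero_prod_def)
  qed auto
  moreover have "pathstart c = w" by (simp add: pathstart_def c_def V_def t0_def prod_eq_iff)
  moreover have "pathfinish c = z"
    using v(2) by (simp add: pathfinish_def c_def V_def L_def prod_eq_iff t1_def algebra_simps)
  ultimately show ?thesis unfolding causal_future_def by blast
qed

lemma causal_future_time_le:
  assumes "z \<in> causal_future p w" shows "fst w \<le> fst z"
proof (cases "z = w")
  case False
  then obtain c where c: "future_causal_curve p c" "pathstart c = w" "pathfinish c = z"
    using assms by (auto simp: causal_future_def)
  then obtain F where F: "finite F" "continuous_on {0..1} c" "c C1_differentiable_on ({0..1} - F)"
    "\<And>s. s \<in> {0..1} - F \<Longrightarrow> future_causal p (c s) (vector_derivative c (at s))"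
    unfolding future_causal_curve_def by blast
  define f' where "f' s = (if s \<in> F then 0 else fst (vector_derivative c (at s)))" for s
  have "(f' has_integral (fst (c 1) - fst (c 0))) {0..1}"
  proof (rule fundamental_theorem_of_calculus_interior_strong[OF F(1)])
    fix s assume s: "s \<in> {0<..<1} - F"
    obtain D where "\<forall>x\<in>{0..1} - F. (c has_vector_derivative D x) (at x)"
      using F(3) unfolding C1_differentiable_on_def by blast
    then have "(c has_vector_derivative D s) (at s)" using s by auto
    then have "c differentiable (at s)" by (rule differentiableI_vector)
    then have "(c has_vector_derivative vector_derivative c (at s)) (at s)" using vector_derivative_works by blast
    from bounded_linear.has_vector_derivative[OF bounded_linear_fst this]
    show "((\<lambda>s. fst (c s)) has_vector_derivative f' s) (at s)"
      using s unfolding f'_def by simp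
  qed (use F(2) in \<open>auto intro!: continuous_intros\<close>)
  moreover have "f' s \<ge> 0" if "s \<in> {0..1}" for s
    using F(4)[of s] that by (auto simp: f'_def future_causal_def kasner_metric_def)
  ultimately have "fst (c 1) - fst (c 0) \<ge> 0" using has_integral_nonneg by blast
  then show ?thesis using c by (simp add: pathstart_def pathfinish_def)
qed auto


text \<open>
  By compactness finitely many fronts separate a point from a set outside its causal future, and they
  still do so, by a fixed margin, for all nearby points.
\<close>

lemma separating_fronts:
  fixes p :: "real ^ 'n::finite" and K :: "'n point set"
  defines "q \<equiv> (\<chi> j. 1 - p $ j)"
  assumes K: "compact K" "K \<subseteq> spacetime" and w: "w \<in> spacetime"
    and out: "\<And>z. z \<in> K \<Longrightarrow> z \<notin> causal_future p w"
  obtains a H \<epsilon> W where "0 < a" "finite H" "0 < \<epsilon>" "open W" "w \<in> W"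
    "\<forall>w'\<in>W. a < fst w' \<and> (\<forall>z\<in>K. fst z < fst w' \<or> (\<exists>\<eta>\<in>H. front q a \<eta> z \<le> front q a \<eta> w' - \<epsilon>))"
proof -
  define a where "a = fst w / 2"
  have a: "0 < a" "a < fst w" using w by (auto simp: a_def spacetime_def)
  define A where "A = {z :: 'n point. a < fst z}"
  have A: "open A" "w \<in> A" using a by (auto simp: A_def intro!: open_Collect_less continuous_intros)
  have cf: "continuous_on A (front q a \<eta>)" for \<eta>
    by (intro continuous_at_imp_continuous_on ballI has_derivative_continuous[OF has_derivative_front[OF a(1)]])
      (auto simp: A_def)
  have opn: "open {z \<in> A. front q a \<eta> z < r}" "open {z \<in> A. r < front q a \<eta> z}" for \<eta> r
    using continuous_open_preimage[OF cf A(1) open_lessThan[of r], of \<eta>]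
      continuous_open_preimage[OF cf A(1) open_greaterThan[of r], of \<eta>]
    by (simp_all add: vimage_def Int_def)
  have "\<exists>Z V \<eta> e. open Z \<and> z \<in> Z \<and> open V \<and> w \<in> V \<and> 0 < e \<and>
      (\<forall>z'\<in>Z. \<forall>w'\<in>V. fst z' < fst w' \<or> front q a \<eta> z' \<le> front q a \<eta> w' - e)" if z: "z \<in> K" for z
  proof (cases "fst z < fst w")
    case True
    define m where "m = (fst z + fst w) / 2"
    have "open {z :: 'n point. fst z < m}" "open {z :: 'n point. m < fst z}"
      by (intro open_Collect_less continuous_intros)+
    moreover have "z \<in> {z. fst z < m}" "w \<in> {z. m < fst z}" using True by (auto simp: m_def)
    ultimately show ?thesis
      by (intro exI[of _ "{z :: 'n point. fst z < m}"] exI[of _ "{z :: 'n point. m < fst z}"] exI[of _ 0] exI[of _ "1::real"]) auto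
  next
    case False
    then obtain \<eta> where "\<not> (snd z - snd w) \<bullet> \<eta> \<le> integral {fst w..fst z} (char_speed q \<eta>)"
      using causal_future_if_fronts[OF w, of z p] out[OF z] unfolding q_def by (metis not_le)
    moreover have "integral {a..fst w} (char_speed q \<eta>) + integral {fst w..fst z} (char_speed q \<eta>) = integral {a..fst z} (char_speed q \<eta>)"
      using a False by (intro Henstock_Kurzweil_Integration.integral_combine integrable_continuous_real continuous_on_subset[OF continuous_on_char_speed]) auto
    ultimately have lt: "front q a \<eta> z < front q a \<eta> w" by (simp add: front_def inner_diff_left)
    define d where "d = (front q a \<eta> w - front q a \<eta> z) / 3"
    have d: "d > 0" using lt by (simp add: d_def)
    let ?Z = "{z' \<in> A. front q a \<eta> z' < front q a \<eta> z + d}" and ?V = "{w' \<in> A. front q a \<eta> w - d < front q a \<eta> w'}"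
    have "z \<in> ?Z" "w \<in> ?V" using d a False A(2) by (auto simp: A_def)
    moreover have "front q a \<eta> z' \<le> front q a \<eta> w' - d" if "z' \<in> ?Z" "w' \<in> ?V" for z' w'
    proof -
      have "front q a \<eta> z' < front q a \<eta> z + d" "front q a \<eta> w - d < front q a \<eta> w'" using that by auto
      moreover have "3 * d = front q a \<eta> w - front q a \<eta> z" by (simp add: d_def)
      ultimately show ?thesis by linarith
    qed
    ultimately show ?thesis using opn d by (intro exI[of _ ?Z] exI[of _ ?V] exI[of _ \<eta>] exI[of _ d]) auto
  qed
  then have "\<forall>z\<in>K. \<exists>x. open (fst x) \<and> z \<in> fst x \<and> open (fst (snd x)) \<and> w \<in> fst (snd x) \<and> 0 < snd (snd (snd x)) \<and>
      (\<forall>z'\<in>fst x. \<forall>w'\<in>fst (snd x). fst z' < fst w' \<or>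
        front q a (fst (snd (snd x))) z' \<le> front q a (fst (snd (snd x))) w' - snd (snd (snd x)))"
    by (simp add: split_paired_Ex)
  then obtain F where F: "\<forall>z\<in>K. open (fst (F z)) \<and> z \<in> fst (F z) \<and> open (fst (snd (F z))) \<and> w \<in> fst (snd (F z)) \<and> 0 < snd (snd (snd (F z))) \<and>
      (\<forall>z'\<in>fst (F z). \<forall>w'\<in>fst (snd (F z)). fst z' < fst w' \<or>
        front q a (fst (snd (snd (F z)))) z' \<le> front q a (fst (snd (snd (F z)))) w' - snd (snd (snd (F z))))"
    by (rule bchoice[THEN exE])
  define Z V \<eta> e where "Z z = fst (F z)" and "V z = fst (snd (F z))" and "\<eta> z = fst (snd (snd (F z)))"
    and "e z = snd (snd (snd (F z)))" for z
  have ZV: "\<And>z. z \<in> K \<Longrightarrow> open (Z z)" "\<And>z. z \<in> K \<Longrightarrow> z \<in> Z z" "\<And>z. z \<in> K \<Longrightarrow> open (V z)" "\<And>z. z \<in> K \<Longrightarrow> w \<in> V z"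
      "\<And>z. z \<in> K \<Longrightarrow> 0 < e z"
      "\<And>z z' w'. z \<in> K \<Longrightarrow> z' \<in> Z z \<Longrightarrow> w' \<in> V z \<Longrightarrow> fst z' < fst w' \<or> front q a (\<eta> z) z' \<le> front q a (\<eta> z) w' - e z"
    using F unfolding Z_def V_def \<eta>_def e_def by blast+
  obtain T where T: "T \<subseteq> K" "finite T" "K \<subseteq> (\<Union>z\<in>T. Z z)"
    using compactE_image[OF K(1), of K Z] ZV(1,2) by blast
  define \<epsilon> where "\<epsilon> = Min (insert 1 (e ` T))"
  have eps: "\<epsilon> > 0" "\<And>z. z \<in> T \<Longrightarrow> \<epsilon> \<le> e z"
    using T ZV(5) by (auto simp: \<epsilon>_def)
  show thesis
  proof (rule that[of a "\<eta> ` T" \<epsilon> "A \<inter> (\<Inter>z\<in>T. V z)"])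
    show "open (A \<inter> (\<Inter>z\<in>T. V z))" using A T ZV(3) by (intro open_Int open_INT) auto
    show "w \<in> A \<inter> (\<Inter>z\<in>T. V z)" using A T ZV(4) by auto
    show "\<forall>w'\<in>A \<inter> (\<Inter>z\<in>T. V z). a < fst w' \<and> (\<forall>z\<in>K. fst z < fst w' \<or> (\<exists>\<eta>\<in>\<eta> ` T. front q a \<eta> z \<le> front q a \<eta> w' - \<epsilon>))"
    proof (intro ballI conjI)
      fix w' assume w': "w' \<in> A \<inter> (\<Inter>z\<in>T. V z)"
      then show "a < fst w'" by (simp add: A_def)
      fix z assume "z \<in> K"
      then obtain y where y: "y \<in> T" "z \<in> Z y" using T by auto
      have "fst z < fst w' \<or> front q a (\<eta> y) z \<le> front q a (\<eta> y) w' - e y"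
        using ZV(6)[of y z w'] y T w' by auto
      then show "fst z < fst w' \<or> (\<exists>\<eta>\<in>\<eta> ` T. front q a \<eta> z \<le> front q a \<eta> w' - \<epsilon>)"
        using eps(2)[OF y(1)] y(1) by force
    qed
  qed (use a eps T in auto)
qed

text \<open>
  Around a point whose causal future avoids \<open>K\<close>, finitely many fronts cut out a region that
  contains the future of the point and avoids \<open>K\<close> (\<open>separating_fronts\<close>). There the equation is homogeneous, so
  \<open>vanishing_from_fronts\<close> makes the function zero at this point and all nearby ones.
\<close>

theorem support_in_causal_past:
  fixes p :: "real ^ 'n::finite" and u :: "'n point \<Rightarrow> complex ^ 'm::finite"
  assumes p: "\<And>j. p $ j < 1" and u: "smooth_on spacetime u"
    and K: "compact K" "K \<subseteq> spacetime"
    and late: "\<And>z. T \<le> fst z \<Longrightarrow> z \<in> spacetime \<Longrightarrow> u z = 0"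
    and eq: "\<And>z. z \<in> spacetime \<Longrightarrow> z \<notin> K \<Longrightarrow> kasner_op (\<chi> j. 1 - p $ j) b bx c u z = 0"
  shows "spacetime_support u \<subseteq> causal_past_of_set p K"
proof
  fix w assume w: "w \<in> spacetime_support u"
  then have ws: "w \<in> spacetime" by (simp add: spacetime_support_def)
  show "w \<in> causal_past_of_set p K"
  proof (rule ccontr)
    assume "w \<notin> causal_past_of_set p K"
    then have out: "\<And>z. z \<in> K \<Longrightarrow> z \<notin> causal_future p w" using ws by (auto simp: causal_past_of_set_def)
    obtain a H \<epsilon> W where a: "0 < a" and H: "finite H" and eps: "0 < \<epsilon>" and W: "open W" "w \<in> W"
      and sep: "\<forall>w'\<in>W. a < fst w' \<and> (\<forall>z\<in>K. fst z < fst w' \<or>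
        (\<exists>\<eta>\<in>H. front (\<chi> j. 1 - p $ j) a \<eta> z \<le> front (\<chi> j. 1 - p $ j) a \<eta> w' - \<epsilon>))"
      by (rule separating_fronts[OF K ws out])
    have "u w' = 0" if w': "w' \<in> W" for w'
    proof (rule vanishing_from_fronts[OF _ u a _ H eps late])
      show "0 \<le> (\<chi> j. 1 - p $ j) $ j" for j using p[of j] by simp
      show aw: "a < fst w'" using sep w' by blast
      show "kasner_op (\<chi> j. 1 - p $ j) b bx c u z = 0"
        if "fst w' \<le> fst z" "\<forall>\<eta>\<in>H. front (\<chi> j. 1 - p $ j) a \<eta> w' - \<epsilon> < front (\<chi> j. 1 - p $ j) a \<eta> z" for z
      proof (rule eq)
        show "z \<in> spacetime" using that(1) aw a by (simp add: spacetime_def)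
        show "z \<notin> K" using sep w' that by (meson not_le)
      qed
    qed
    then have "{z \<in> spacetime. u z \<noteq> 0} \<inter> W = {}" by blast
    then have "W \<inter> closure {z \<in> spacetime. u z \<noteq> 0} = {}" using open_Int_closure_eq_empty[OF W(1)] by blast
    then show False using w W(2) by (auto simp: spacetime_support_def)
  qed
qed

section \<open>Linear ordinary differential equations\<close>

lemma norm_increment_le:
  fixes f :: "real \<Rightarrow> 'a::real_normed_vector"
  assumes "a \<le> b"
    and "\<And>x. x \<in> {a..b} \<Longrightarrow> (f has_vector_derivative f' x) (at x)"
    and "\<And>x. x \<in> {a..b} \<Longrightarrow> (g has_real_derivative g' x) (at x)"
    and "\<And>x. x \<in> {a..b} \<Longrightarrow> norm (f' x) \<le> g' x"
  shows "norm (f b - f a) \<le> g b - g a"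
proof (cases "a = b")
  case False
  show ?thesis
  proof (rule differentiable_bound_general[where f'=f' and \<phi>'=g'])
    show "a < b" using assms(1) False by simp
    show "continuous_on {a..b} f"
      by (intro continuous_at_imp_continuous_on ballI has_vector_derivative_continuous[OF assms(2)])
    show "continuous_on {a..b} g"
      by (intro continuous_at_imp_continuous_on ballI DERIV_isCont[OF assms(3)])
  qed (use assms in \<open>auto simp: has_real_derivative_iff_has_vector_derivative\<close>)
qed auto

lemma has_derivative_suminf_Mtest:
  fixes f :: "nat \<Rightarrow> 'a::real_normed_vector \<Rightarrow> 'b::banach"
  assumes S: "convex S" "open S" "x0 \<in> S"
    and d: "\<And>n x. x \<in> S \<Longrightarrow> (f n has_derivative f' n x) (at x)"
    and M: "\<And>n x h. x \<in> S \<Longrightarrow> norm (f' n x h) \<le> M n * norm h" "summable M"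
    and x0: "summable (\<lambda>n. f n x0)"
    and x: "x \<in> S"
  shows "summable (\<lambda>n. f n x)" "((\<lambda>x. \<Sum>n. f n x) has_derivative (\<lambda>h. \<Sum>n. f' n x h)) (at x)"
proof -
  have sf': "summable (\<lambda>n. f' n y h)" if "y \<in> S" for y h
    by (rule summable_comparison_test'[of "\<lambda>n. M n * norm h" 0])
       (use M that in \<open>auto intro: summable_mult2\<close>)
  have "\<exists>g. \<forall>x\<in>S. (\<lambda>n. f n x) sums (g x) \<and> (g has_derivative (\<lambda>h. \<Sum>n. f' n x h)) (at x within S)"
  proof (rule has_derivative_series[where f=f and f'=f' and g'="\<lambda>x h. \<Sum>n. f' n x h" and x=x0 and l="\<Sum>n. f n x0"])
    show "convex S" "x0 \<in> S" "(\<lambda>n. f n x0) sums (\<Sum>n. f n x0)" using S x0 by auto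
    show "(f n has_derivative f' n x) (at x within S)" if "x \<in> S" for n x
      using d[OF that] has_derivative_at_withinI by blast
    fix e :: real assume e: "e > 0"
    have "(\<lambda>n. \<Sum>i. M (i + n)) \<longlonglongrightarrow> 0" by (rule suminf_exist_split2[OF M(2)])
    then have "\<forall>\<^sub>F n in sequentially. (\<Sum>i. M (i + n)) < e" using e by (rule order_tendstoD(2))
    then show "\<forall>\<^sub>F n in sequentially. \<forall>x\<in>S. \<forall>h. norm (sum (\<lambda>i. f' i x h) {..<n} - (\<Sum>n. f' n x h)) \<le> e * norm h"
    proof eventually_elim
      case (elim n)
      show ?case
      proof (intro ballI allI)
        fix x h :: 'a assume x: "x \<in> S"
        have sM: "summable (\<lambda>i. M (i + n) * norm h)"
          using M(2) by (intro summable_mult2) (simp add: summable_iff_shift)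
        have "sum (\<lambda>i. f' i x h) {..<n} - (\<Sum>n. f' n x h) = - (\<Sum>i. f' (i + n) x h)"
          using suminf_split_initial_segment[OF sf'[OF x], of h n] by simp
        also have "norm \<dots> \<le> (\<Sum>i. M (i + n) * norm h)"
          unfolding norm_minus_cancel
          by (rule norm_suminf_le[OF M(1)[OF x] sM])
        also have "\<dots> = (\<Sum>i. M (i + n)) * norm h"
          using M(2) by (intro suminf_mult2[symmetric]) (simp add: summable_iff_shift)
        also have "\<dots> \<le> e * norm h" using elim by (intro mult_right_mono) auto
        finally show "norm (sum (\<lambda>i. f' i x h) {..<n} - (\<Sum>n. f' n x h)) \<le> e * norm h" .
      qed
    qed
  qed
  then obtain g where g: "\<And>x. x \<in> S \<Longrightarrow> (\<lambda>n. f n x) sums (g x)"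
    "\<And>x. x \<in> S \<Longrightarrow> (g has_derivative (\<lambda>h. \<Sum>n. f' n x h)) (at x within S)" by blast
  show "summable (\<lambda>n. f n x)" using g(1)[OF x] sums_summable by blast
  have "(g has_derivative (\<lambda>h. \<Sum>n. f' n x h)) (at x)"
    using g(2)[OF x] at_within_open[OF x S(2)] by simp
  then show "((\<lambda>x. \<Sum>n. f n x) has_derivative (\<lambda>h. \<Sum>n. f' n x h)) (at x)"
    by (rule has_derivative_transform_within_open[OF _ S(2) x]) (use g(1) sums_unique in blast)
qed

lemma has_vector_derivative_integral_from_0:
  fixes f :: "real \<Rightarrow> 'a::banach"
  assumes f: "continuous_on UNIV f" and "0 < \<epsilon>" and 0: "\<And>r. r \<le> \<epsilon> \<Longrightarrow> f r = 0"
  shows "((\<lambda>s. integral {0..s} f) has_vector_derivative f s) (at s)" "s \<le> \<epsilon> \<Longrightarrow> integral {0..s} f = 0"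
proof -
  have z: "integral {0..s} f = 0" if "s \<le> \<epsilon>" for s
  proof -
    have "integral {0..s} f = integral {0..s} (\<lambda>_. 0)" by (intro integral_cong 0) (use that in auto)
    then show ?thesis by simp
  qed
  then show "s \<le> \<epsilon> \<Longrightarrow> integral {0..s} f = 0" .
  show "((\<lambda>s. integral {0..s} f) has_vector_derivative f s) (at s)"
  proof (cases "s < \<epsilon>")
    case True
    have "((\<lambda>s. 0) has_vector_derivative f s) (at s)" using 0[of s] True by simp
    then show ?thesis
      by (rule has_vector_derivative_transform_within_open[OF _ open_lessThan[of \<epsilon>]]) (use True z in auto)
  next
    case False
    then have s: "0 < s" using assms by simp
    have "((\<lambda>s. integral {0..s} f) has_vector_derivative f s) (at s within {0..s + 1})"
      by (rule integral_has_vector_derivative) (use continuous_on_subset[OF f] s in auto)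
    then show ?thesis using s by (simp add: at_within_Icc_at)
  qed
qed

text \<open>
  Picard iteration. Measuring the iterates with the weight \<open>exp (2 K s)\<close> makes each step gain a
  factor \<open>1/2\<close>, so the telescoping series of the iterates converges with its derivatives.
\<close>

lemma linear_ode_exists:
  fixes A :: "real \<Rightarrow> 'v::banach \<Rightarrow> 'v" and g :: "real \<Rightarrow> 'v"
  assumes lin: "\<And>s. bounded_linear (A s)"
    and bnd: "\<And>L. \<exists>K\<ge>0. \<forall>s\<in>{0..L}. \<forall>v. norm (A s v) \<le> K * norm v"
    and cont: "\<And>y. continuous_on UNIV y \<Longrightarrow> continuous_on UNIV (\<lambda>s. A s (y s))"
    and g: "continuous_on UNIV g" "0 < \<epsilon>" "\<And>s. s \<le> \<epsilon> \<Longrightarrow> g s = 0"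
  obtains y where "\<And>s. (y has_vector_derivative A s (y s) + g s) (at s)" "\<And>s. s \<le> \<epsilon> \<Longrightarrow> y s = 0"
proof -
  define J where "J f s = integral {0..s} f" for f :: "real \<Rightarrow> 'v" and s
  define Y where "Y n = rec_nat (J g) (\<lambda>_ y. J (\<lambda>r. A r (y r))) n" for n
  define h where "h n = (case n of 0 \<Rightarrow> g | Suc m \<Rightarrow> (\<lambda>r. A r (Y m r)))" for n
  have Yh: "Y n = J (h n)" for n by (cases n) (simp_all add: Y_def h_def)
  have A0: "A s 0 = 0" for s using linear_simps(3)[OF lin] .
  have J: "((J f) has_vector_derivative f s) (at s)" "s \<le> \<epsilon> \<Longrightarrow> J f s = 0" "continuous_on UNIV (J f)"
    if "continuous_on UNIV f" "\<And>s. s \<le> \<epsilon> \<Longrightarrow> f s = 0" for f s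
  proof -
    note * = has_vector_derivative_integral_from_0[OF that(1) g(2) that(2)]
    show "((J f) has_vector_derivative f s) (at s)" for s using *(1)[of s] unfolding J_def .
    then show "continuous_on UNIV (J f)"
      by (intro continuous_at_imp_continuous_on) (use has_vector_derivative_continuous in blast)
    show "s \<le> \<epsilon> \<Longrightarrow> J f s = 0" using *(2) unfolding J_def by blast
  qed
  have hY: "continuous_on UNIV (h n) \<and> (\<forall>s\<le>\<epsilon>. h n s = 0) \<and> continuous_on UNIV (Y n) \<and> (\<forall>s\<le>\<epsilon>. Y n s = 0)" for n
  proof (induction n)
    case 0
    then show ?case using J(2,3)[of g] g by (simp add: h_def Yh)
  next
    case (Suc n)
    have "continuous_on UNIV (h (Suc n))" "\<And>s. s \<le> \<epsilon> \<Longrightarrow> h (Suc n) s = 0"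
      using Suc cont A0 by (auto simp: h_def)
    then show ?case using J(2,3)[of "h (Suc n)"] by (simp add: Yh)
  qed
  have dY: "(Y n has_vector_derivative h n s) (at s)" for n s using J(1)[of "h n"] hY unfolding Yh by blast
  define y where "y s = (\<Sum>n. Y n s)" for s
  have y0: "y s = 0" if "s \<le> \<epsilon>" for s using hY that by (simp add: y_def)
  have dy: "(y has_vector_derivative A s (y s) + g s) (at s)" for s
  proof -
    define L where "L = \<bar>s\<bar> + 1"
    obtain K0 where K0: "K0 \<ge> 0" "\<And>s v. s \<in> {0..L} \<Longrightarrow> norm (A s v) \<le> K0 * norm v" using bnd by meson
    define K where "K = K0 + 1"
    have K: "K > 0" "\<And>s v. s \<in> {0..L} \<Longrightarrow> norm (A s v) \<le> K * norm v"
      using K0 by (auto simp: K_def algebra_simps intro: add_increasing)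
    have "bounded (g ` {0..L})"
      by (intro compact_imp_bounded compact_continuous_image) (use continuous_on_subset[OF g(1)] in auto)
    then obtain C where C: "C > 0" "\<And>s. s \<in> {0..L} \<Longrightarrow> norm (g s) \<le> C" by (auto simp: bounded_pos)
    have bY: "norm (Y n s) \<le> C / (2 * K) * (1/2) ^ n * exp (2 * K * s)" if "s \<in> {0..L}" for n s
      using that
    proof (induction n arbitrary: s)
      case 0
      have "norm (Y 0 s - Y 0 0) \<le> C / (2 * K) * exp (2 * K * s) - C / (2 * K) * exp (2 * K * 0)"
      proof (rule norm_increment_le[OF _ dY])
        show "((\<lambda>s. C / (2 * K) * exp (2 * K * s)) has_real_derivative C * exp (2 * K * x)) (at x)" for x
          using K(1) by (auto intro!: derivative_eq_intros)
        show "norm (h 0 x) \<le> C * exp (2 * K * x)" if "x \<in> {0..s}" for x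
        proof -
          have "norm (h 0 x) \<le> C * 1" using C 0 that by (simp add: h_def)
          also have "\<dots> \<le> C * exp (2 * K * x)" using C K that by (intro mult_left_mono) auto
          finally show ?thesis .
        qed
      qed (use 0 in auto)
      moreover have "Y 0 0 = 0" using hY g(2) by simp
      moreover have "C / (2 * K) \<ge> 0" using C K by simp
      ultimately show ?case by simp
    next
      case (Suc n)
      let ?c = "C / (2 * K) * (1/2) ^ Suc n"
      have c: "?c \<ge> 0" using C K by simp
      have "norm (Y (Suc n) s - Y (Suc n) 0) \<le> ?c * exp (2 * K * s) - ?c * exp (2 * K * 0)"
      proof (rule norm_increment_le[OF _ dY])
        show "((\<lambda>s. ?c * exp (2 * K * s)) has_real_derivative K * (C / (2 * K) * (1/2) ^ n * exp (2 * K * x))) (at x)" for x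
          by (auto intro!: derivative_eq_intros)
        show "norm (h (Suc n) x) \<le> K * (C / (2 * K) * (1/2) ^ n * exp (2 * K * x))" if x: "x \<in> {0..s}" for x
        proof -
          have xL: "x \<in> {0..L}" using x Suc.prems by auto
          have "norm (h (Suc n) x) \<le> K * norm (Y n x)" using K(2)[OF xL] by (simp add: h_def)
          also have "\<dots> \<le> K * (C / (2 * K) * (1/2) ^ n * exp (2 * K * x))"
            using K(1) Suc.IH[OF xL] by (intro mult_left_mono) auto
          finally show ?thesis .
        qed
      qed (use Suc.prems in auto)
      moreover have "Y (Suc n) 0 = 0" using hY g(2) by simp
      ultimately show ?case using c by simp
    qed
    define M where "M n = (case n of 0 \<Rightarrow> C | Suc m \<Rightarrow> K * (C / (2 * K) * (1/2) ^ m * exp (2 * K * L)))" for n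
    have bh: "norm (h n x) \<le> M n" if x: "x \<in> {-1<..<L}" for n x
    proof (cases "x < 0")
      case True
      then have "h n x = 0" using hY[of n] g(2) by auto
      then show ?thesis using C K by (cases n) (auto simp: M_def)
    next
      case False
      then have xL: "x \<in> {0..L}" using x by auto
      show ?thesis
      proof (cases n)
        case 0 then show ?thesis using C(2)[OF xL] by (simp add: M_def h_def)
      next
        case (Suc m)
        have "norm (h n x) \<le> K * norm (Y m x)" using K(2)[OF xL] Suc by (simp add: h_def)
        also have "\<dots> \<le> K * (C / (2 * K) * (1/2) ^ m * exp (2 * K * x))"
          using K(1) bY[OF xL] by (intro mult_left_mono) auto
        also have "\<dots> \<le> K * (C / (2 * K) * (1/2) ^ m * exp (2 * K * L))"
          using K(1) C(1) xL by (intro mult_left_mono) auto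
        finally show ?thesis using Suc by (simp add: M_def)
      qed
    qed
    have sM: "summable M"
    proof -
      have "summable (\<lambda>n. K * (C / (2 * K) * (1/2) ^ n * exp (2 * K * L)))"
        by (intro summable_mult summable_mult2 summable_geometric) auto
      then have "summable (\<lambda>n. M (Suc n))" by (simp add: M_def)
      then show ?thesis using summable_Suc_iff by blast
    qed
    have sin: "s \<in> {-1<..<L} \<or> s \<le> - 1" by (auto simp: L_def)
    show ?thesis
    proof (cases "s \<le> - 1")
      case True
      have "((\<lambda>_. 0) has_vector_derivative A s (y s) + g s) (at s)"
        using True y0[of s] g A0 by simp
      then show ?thesis
        by (rule has_vector_derivative_transform_within_open[OF _ open_lessThan[of 0]]) (use True y0 g(2) in auto)
    next
      case False
      then have sS: "s \<in> {-1<..<L}" using sin by blast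
      have M': "norm (r *\<^sub>R h n x) \<le> M n * norm r" if "x \<in> {-1<..<L}" for n x and r :: real
        using bh[OF that, of n] by (simp add: mult.commute mult_left_mono)
      have x0: "summable (\<lambda>n. Y n 0)" using hY g(2) by simp
      have dY': "(Y n has_derivative (\<lambda>r. r *\<^sub>R h n x)) (at x)" for n x using dY by (simp add: has_vector_derivative_def)
      have sumY: "summable (\<lambda>n. Y n s)" and der: "(y has_derivative (\<lambda>r. \<Sum>n. r *\<^sub>R h n s)) (at s)"
        using has_derivative_suminf_Mtest[of "{-1<..<L}" 0 Y "\<lambda>n x r. r *\<^sub>R h n x" M, OF _ _ _ dY' M' sM x0 sS]
        unfolding y_def by (auto simp: L_def)
      have sh: "summable (\<lambda>n. h n s)"
        by (rule summable_comparison_test'[OF sM, of 0]) (use bh[OF sS] in auto)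
      have "(\<Sum>n. h n s) = (\<Sum>n. h (Suc n) s) + h 0 s"
        using suminf_split_head[OF sh] by simp
      also have "(\<Sum>n. h (Suc n) s) = A s (y s)"
        unfolding y_def h_def using bounded_linear.suminf[OF lin sumY] by simp
      finally have "(\<Sum>n. h n s) = A s (y s) + g s" by (simp add: h_def)
      then have "(\<lambda>r. \<Sum>n. r *\<^sub>R h n s) = (\<lambda>r. r *\<^sub>R (A s (y s) + g s))"
        using suminf_scaleR_right[OF sh] by (simp add: fun_eq_iff)
      then show ?thesis using der by (simp add: has_vector_derivative_def)
    qed
  qed
  show thesis by (rule that[OF dy y0])
qed

section \<open>Growth of solutions of systems with constant coefficients\<close>

lemma norm_vector_scalar_mult: "norm (l *s v) = norm l * norm (v :: complex ^ 'm::finite)"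
  by (simp add: norm_vec_def norm_mult L2_set_right_distrib)

type_synonym 'm phase = "(complex ^ 'm) \<times> (complex ^ 'm)"

definition csc :: "complex \<Rightarrow> 'm phase \<Rightarrow> ('m::finite) phase" where
  "csc l w = (l *s fst w, l *s snd w)"

lemma csc_simps:
  "csc (l + k) w = csc l w + csc k w" "csc l (w + w') = csc l w + csc l w'"
  "csc (l * k) w = csc l (csc k w)" "csc 1 w = w" "csc 0 w = 0" "csc l 0 = 0"
  "csc (- l) w = - csc l w" "csc l (w - w') = csc l w - csc l w'"
  by (simp_all add: csc_def prod_eq_iff vec_eq_iff algebra_simps)

lemma csc_commute: "csc l (csc k w) = csc k (csc l w)"
  by (simp add: csc_simps(3)[symmetric] mult.commute)

lemma norm_csc: "norm (csc l w) = norm l * norm w"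
  by (simp add: csc_def norm_prod_def norm_vector_scalar_mult power_mult_distrib distrib_left[symmetric] real_sqrt_mult)

lemma csc_of_real: "csc (of_real r) w = r *\<^sub>R w"
  by (simp add: csc_def prod_eq_iff vec_eq_iff) (simp add: scaleR_conv_of_real)

lemma csc_scaleR: "csc l (r *\<^sub>R w) = r *\<^sub>R csc l w" "csc (r *\<^sub>R l) w = r *\<^sub>R csc l w"
  by (simp_all add: csc_def prod_eq_iff vec_eq_iff)

lemma bounded_bilinear_csc: "bounded_bilinear (csc :: complex \<Rightarrow> 'm phase \<Rightarrow> ('m::finite) phase)"
proof
  show "\<exists>K. \<forall>l (w :: 'm phase). norm (csc l w) \<le> norm l * norm w * K"
    by (intro exI[of _ 1]) (simp add: norm_csc)
qed (simp_all add: csc_simps csc_scaleR)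

locale complex_endomorphism =
  fixes A :: "'m phase \<Rightarrow> ('m::finite) phase"
  assumes lin: "bounded_linear A" and csc: "A (csc l w) = csc l (A w)"
begin

lemmas A_simps = linear_simps[OF lin]

text \<open>
  The vector \<open>p(A) w\<close>, where complex scalars act through \<open>csc\<close>.
\<close>

definition act :: "complex poly \<Rightarrow> 'm phase \<Rightarrow> 'm phase" where
  "act p w = fold_coeffs (\<lambda>l v. csc l w + A v) p 0"

lemma act_0: "act 0 w = 0" by (simp add: act_def)

lemma act_pCons: "act (pCons l p) w = csc l w + A (act p w)"
  by (cases "p = 0 \<and> l = 0") (auto simp: act_def csc_simps A_simps)

lemma act_add: "act (p + r) w = act p w + act r w"
  by (induction p r rule: poly_induct2) (simp_all add: act_0 act_pCons csc_simps A_simps)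

lemma act_smult: "act (smult l p) w = csc l (act p w)"
  by (induction p) (simp_all add: act_0 act_pCons csc_simps A_simps csc)

lemma act_mult: "act (p * r) w = act p (act r w)"
  by (induction p) (simp_all add: act_0 act_pCons csc_simps A_simps act_add act_smult)

lemma act_linear_factor: "act [:- l, 1:] w = A w - csc l w"
  by (simp add: act_pCons act_0 csc_simps A_simps)

lemma act_csc: "act p (csc l w) = csc l (act p w)"
  by (induction p) (simp_all add: act_0 act_pCons csc_simps A_simps csc csc_commute[of _ l])

lemma act_add_right: "act p (w + w') = act p w + act p w'"
  by (induction p) (simp_all add: act_0 act_pCons csc_simps A_simps)

text \<open>
  The vectors \<open>w, A w, A\<^sup>2 w, \<dots>\<close> are linearly dependent, as the space has finite dimension.
\<close>

lemma annihilating_polynomial: "\<exists>p. p \<noteq> 0 \<and> act p w = 0"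
proof (cases "inj_on (\<lambda>n. (A ^^ n) w) {..DIM('m phase)}")
  case False
  have act_monom: "act (monom 1 n) w = (A ^^ n) w" for n
    by (induction n) (simp_all add: monom_0 monom_Suc act_pCons act_0 csc_simps A_simps)
  obtain m n where mn: "m \<noteq> n" "(A ^^ m) w = (A ^^ n) w" using False by (auto simp: inj_on_def)
  have "act (monom 1 m + smult (-1) (monom 1 n)) w = 0"
    unfolding act_add act_smult act_monom mn(2) by (simp add: csc_simps)
  moreover have "monom 1 m + smult (-1) (monom 1 n) \<noteq> (0 :: complex poly)"
  proof
    assume "monom 1 m + smult (-1) (monom 1 n) = (0 :: complex poly)"
    then have "coeff (monom 1 m + smult (-1) (monom 1 n)) m = (0 :: complex)" by simp
    then show False using mn(1) by (simp add: coeff_monom split: if_splits)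
  qed
  ultimately show ?thesis by blast
next
  case True
  let ?d = "DIM('m phase)"
  let ?S = "(\<lambda>n. (A ^^ n) w) ` {..?d}"
  have act_monom: "act (monom 1 n) w = (A ^^ n) w" for n
    by (induction n) (simp_all add: monom_0 monom_Suc act_pCons act_0 csc_simps A_simps)
  have "card ?S = ?d + 1" using card_image[OF True] by simp
  then have "dependent ?S" using independent_bound[of ?S] by force
  then obtain r v where r: "v \<in> ?S" "r v \<noteq> 0" "(\<Sum>v\<in>?S. r v *\<^sub>R v) = 0"
    unfolding dependent_finite[OF finite_imageI[OF finite_atMost]] by blast
  define s where "s n = r ((A ^^ n) w)" for n
  have sum0: "(\<Sum>n\<le>?d. s n *\<^sub>R (A ^^ n) w) = 0"
    using r(3) sum.reindex[OF True, of "\<lambda>v. r v *\<^sub>R v"] by (simp add: s_def o_def)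
  define p where "p = (\<Sum>n\<le>?d. monom (complex_of_real (s n)) n)"
  have act_sum: "act (\<Sum>n\<in>I. f n) w = (\<Sum>n\<in>I. act (f n) w)" if "finite I" for f and I :: "nat set"
    using that by induction (simp_all add: act_0 act_add)
  have "act p w = (\<Sum>n\<le>?d. act (smult (complex_of_real (s n)) (monom 1 n)) w)"
    unfolding p_def by (simp add: act_sum smult_monom)
  also have "\<dots> = 0" unfolding act_smult act_monom csc_of_real by (rule sum0)
  finally have "act p w = 0" .
  moreover obtain n where n: "n \<le> ?d" "s n \<noteq> 0" using r(1,2) by (auto simp: s_def)
  have "coeff p n = complex_of_real (s n)"
    unfolding p_def coeff_sum using n by (simp add: coeff_monom sum.delta)
  then have "p \<noteq> 0" using n by auto
  ultimately show ?thesis by blast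
qed

definition eigenvalue :: "complex \<Rightarrow> bool" where "eigenvalue l \<longleftrightarrow> (\<exists>w. w \<noteq> 0 \<and> A w = csc l w)"

definition factors :: "complex list \<Rightarrow> complex poly" where "factors ls = (\<Prod>l\<leftarrow>ls. [:- l, 1:])"

text \<open>
  Factors of an annihilating polynomial that belong to numbers that are not eigenvalues act
  injectively and can be dropped.
\<close>

lemma annihilated_by_eigenvalue_factors:
  "p \<noteq> 0 \<Longrightarrow> act p w = 0 \<Longrightarrow> \<exists>ls. (\<forall>l\<in>set ls. eigenvalue l) \<and> act (factors ls) w = 0"
proof (induction "degree p" arbitrary: p w)
  case 0
  then obtain l where l: "p = [:l:]" "l \<noteq> 0" by (metis degree_eq_zeroE pCons_0_0)
  then have "csc l w = 0" using 0 by (simp add: act_pCons act_0 A_simps)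
  then have "norm l * norm w = 0" using norm_csc by (metis norm_zero)
  then have "w = 0" using l by simp
  moreover have "act 1 0 = 0" by (simp add: one_pCons act_pCons act_0 csc_simps A_simps)
  ultimately show ?case by (intro exI[of _ "[]"]) (simp add: factors_def)
next
  case (Suc n)
  have "\<not> constant (poly p)" using Suc.hyps(2) constant_degree by (metis Zero_not_Suc)
  then obtain l where "poly p l = 0" using fundamental_theorem_of_algebra by blast
  then have "[:- l, 1:] dvd p" using poly_eq_0_iff_dvd by blast
  then obtain r where r: "p = [:- l, 1:] * r" by (rule dvdE)
  then have "r \<noteq> 0" using Suc.prems by auto
  then have "degree r = n" using Suc.hyps(2) r degree_mult_eq[of "[:- l, 1:]" r] by simp
  have "act r (act [:- l, 1:] w) = 0" using Suc.prems(2) unfolding r by (metis act_mult mult.commute)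
  then obtain ls where ls: "\<forall>l\<in>set ls. eigenvalue l" "act (factors ls) (act [:- l, 1:] w) = 0"
    using Suc.hyps(1)[of r] \<open>degree r = n\<close> \<open>r \<noteq> 0\<close> by blast
  show ?case
  proof (cases "eigenvalue l")
    case True
    have "factors (l # ls) = factors ls * [:- l, 1:]" by (simp add: factors_def mult.commute)
    then have "act (factors (l # ls)) w = 0" using ls(2) act_mult by metis
    then show ?thesis using ls(1) True by (intro exI[of _ "l # ls"]) auto
  next
    case False
    have "act [:- l, 1:] (act (factors ls) w) = 0" using ls(2) by (metis act_mult mult.commute)
    then have "A (act (factors ls) w) = csc l (act (factors ls) w)" unfolding act_linear_factor by simp
    then have "act (factors ls) w = 0" using False unfolding eigenvalue_def by blast
    then show ?thesis using ls(1) by blast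
  qed
qed

lemma eigenvalue_factors_annihilate:
  obtains ls where "\<forall>l\<in>set ls. eigenvalue l" "\<And>w. act (factors ls) w = 0"
proof -
  have "\<exists>ls. (\<forall>l\<in>set ls. eigenvalue l) \<and> (\<forall>w\<in>S. act (factors ls) w = 0)" if "finite S" for S
    using that
  proof induction
    case empty
    show ?case by (intro exI[of _ "[]"]) auto
  next
    case (insert w S)
    obtain ls where ls: "\<forall>l\<in>set ls. eigenvalue l" "\<forall>w\<in>S. act (factors ls) w = 0" using insert by blast
    obtain p where "p \<noteq> 0" "act p w = 0" using annihilating_polynomial by blast
    then obtain ks where ks: "\<forall>l\<in>set ks. eigenvalue l" "act (factors ks) w = 0"
      using annihilated_by_eigenvalue_factors by blast
    have z: "act p 0 = 0" for p by (induction p) (simp_all add: act_0 act_pCons csc_simps A_simps)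
    have "factors (ks @ ls) = factors ks * factors ls" "factors (ks @ ls) = factors ls * factors ks"
      by (simp_all add: factors_def mult.commute)
    then have "\<forall>w\<in>insert w S. act (factors (ks @ ls)) w = 0" using ls(2) ks(2) z by (metis act_mult insertE)
    then show ?case using ls ks by (intro exI[of _ "ks @ ls"]) auto
  qed
  then obtain ls where ls: "\<forall>l\<in>set ls. eigenvalue l" "\<forall>w\<in>Basis. act (factors ls) w = 0"
    using finite_Basis by blast
  have "act (factors ls) w = 0" for w
  proof -
    have s: "act p (r *\<^sub>R w) = r *\<^sub>R act p w" for p r w using act_csc[of p "of_real r" w] by (simp add: csc_of_real)
    have sm: "act p (\<Sum>i\<in>I. f i) = (\<Sum>i\<in>I. act p (f i))" if "finite I" for p f and I :: "('m phase) set"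
      using that act_csc[of p 0 0] by induction (simp_all add: act_add_right csc_simps)
    have "act (factors ls) (\<Sum>b\<in>Basis. (w \<bullet> b) *\<^sub>R b) = 0" using ls(2) by (simp add: sm s)
    then show ?thesis by (simp add: euclidean_representation)
  qed
  then show thesis using that ls(1) by blast
qed

text \<open>
  The function \<open>exp (- l s) y(s)\<close> has the derivative \<open>exp (- l s) g(s)\<close>, and its size is
  integrated backwards from the final time; the gap \<open>Re l - \<nu> > 0\<close> makes this integral converge with the claimed constant.
\<close>

lemma scalar_growth:
  assumes y: "\<And>s. s \<le> s1 \<Longrightarrow> (y has_vector_derivative csc l (y s) + g s) (at s)" and y1: "y s1 = 0"
    and g: "\<And>s. s \<le> s1 \<Longrightarrow> norm (g s) \<le> H * exp (\<nu> * s)" and l: "\<nu> < Re l" and s: "s \<le> s1" and H: "0 \<le> H"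
  shows "norm (y s) \<le> H / (Re l - \<nu>) * exp (\<nu> * s)"
proof -
  let ?w = "\<lambda>s. csc (exp (- (of_real s * l))) (y s)"
  define d where "d = Re l - \<nu>"
  have d: "0 < d" "Re l = d + \<nu>" using l by (auto simp: d_def)
  have ne: "norm (exp (- (of_real s * l))) = exp (- (s * Re l))" for s by (simp add: norm_exp_eq_Re)
  have dw: "(?w has_vector_derivative csc (exp (- (of_real s * l))) (g s)) (at s)" if "s \<le> s1" for s
  proof -
    have e: "((\<lambda>s. exp (- (complex_of_real s * l))) has_vector_derivative - l * exp (- (of_real s * l))) (at s)"
      by (rule has_vector_derivative_real_field[of "\<lambda>z. exp (- (z * l))" , simplified o_def])
         (auto intro!: derivative_eq_intros)
    have "(?w has_vector_derivative csc (exp (- (of_real s * l))) (csc l (y s) + g s) + csc (- l * exp (- (of_real s * l))) (y s)) (at s)"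
      by (rule bounded_bilinear.has_vector_derivative[OF bounded_bilinear_csc e y[OF that]])
    moreover have "csc (exp (- (of_real s * l))) (csc l (y s) + g s) + csc (- l * exp (- (of_real s * l))) (y s)
        = csc (exp (- (of_real s * l))) (g s)"
      by (simp add: csc_simps csc_commute[of l])
    ultimately show ?thesis by simp
  qed
  have "norm (?w s1 - ?w s) \<le> - (H / d) * exp (- (d * s1)) - (- (H / d) * exp (- (d * s)))"
  proof (rule norm_increment_le[OF s dw])
    fix x assume x: "x \<in> {s..s1}"
    show "((\<lambda>s. - (H / d) * exp (- (d * s))) has_real_derivative H * exp (- (d * x))) (at x)"
      using d(1) by (auto intro!: derivative_eq_intros)
    have "norm (csc (exp (- (of_real x * l))) (g x)) \<le> exp (- (x * Re l)) * (H * exp (\<nu> * x))"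
      unfolding norm_csc ne using g[of x] x by (intro mult_left_mono) auto
    also have "\<dots> = H * exp (- (d * x))" by (simp add: d(2) exp_add[symmetric] algebra_simps)
    finally show "norm (csc (exp (- (of_real x * l))) (g x)) \<le> H * exp (- (d * x))" .
  qed auto
  also have "\<dots> \<le> H / d * exp (- (d * s))" using d H by simp
  finally have "exp (- (s * Re l)) * norm (y s) \<le> H / d * exp (- (d * s))"
    using y1 by (simp add: csc_simps norm_csc ne)
  then have "exp (s * Re l) * (exp (- (s * Re l)) * norm (y s)) \<le> exp (s * Re l) * (H / d * exp (- (d * s)))"
    by (intro mult_left_mono) auto
  moreover have "exp (s * Re l) * (exp (- (s * Re l)) * norm (y s)) = norm (y s)"
    by (simp add: mult.assoc[symmetric] exp_add[symmetric])
  moreover have "exp (s * Re l) * (H / d * exp (- (d * s))) = H / d * exp (\<nu> * s)"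
    by (simp add: d(2) mult.left_commute exp_add[symmetric] algebra_simps)
  ultimately show ?thesis unfolding d_def by (simp only:)
qed

text \<open>
  Splitting off one factor \<open>A - l\<close> at a time reduces the system to scalar equations \<open>y' = l y + g\<close>.
\<close>

lemma growth_of_annihilated:
  assumes "\<forall>l\<in>set ls. \<nu> < Re l"
  shows "\<exists>C\<ge>0. \<forall>y g s1 H. (\<forall>s. (y has_vector_derivative A (y s) + g s) (at s)) \<longrightarrow> (\<forall>s\<ge>s1. y s = 0) \<longrightarrow> 0 \<le> H \<longrightarrow>
      (\<forall>s\<le>s1. norm (g s) \<le> H * exp (\<nu> * s)) \<longrightarrow> (\<forall>s. act (factors ls) (y s) = 0) \<longrightarrow>
      (\<forall>s\<le>s1. norm (y s) \<le> C * H * exp (\<nu> * s))"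
  using assms
proof (induction ls)
  case Nil
  have "act 1 w = w" for w by (simp add: one_pCons act_pCons act_0 csc_simps A_simps)
  then show ?case by (intro exI[of _ 0]) (simp add: factors_def)
next
  case (Cons l ls)
  let ?Al = "\<lambda>w. A w - csc l w"
  have blA: "bounded_linear ?Al"
    using bounded_linear_sub[OF lin bounded_bilinear.bounded_linear_right[OF bounded_bilinear_csc]] .
  obtain N where N: "N \<ge> 0" "\<And>w. norm (?Al w) \<le> N * norm w"
    using bounded_linear.nonneg_bounded[OF blA] by (metis mult.commute)
  obtain C where C: "C \<ge> 0" "\<And>y g s1 H s. (\<forall>s. (y has_vector_derivative A (y s) + g s) (at s)) \<Longrightarrow> (\<forall>s\<ge>s1. y s = 0) \<Longrightarrow> 0 \<le> H \<Longrightarrow>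
      (\<forall>s\<le>s1. norm (g s) \<le> H * exp (\<nu> * s)) \<Longrightarrow> (\<forall>s. act (factors ls) (y s) = 0) \<Longrightarrow>
      s \<le> s1 \<Longrightarrow> norm (y s) \<le> C * H * exp (\<nu> * s)"
    using Cons.IH Cons.prems by auto
  have l: "\<nu> < Re l" using Cons.prems by simp
  show ?case
  proof (intro exI[of _ "(C * N + 1) / (Re l - \<nu>)"] conjI allI impI)
    show "0 \<le> (C * N + 1) / (Re l - \<nu>)" using C N l by simp
    fix y g s1 H s
    assume y: "\<forall>s. (y has_vector_derivative A (y s) + g s) (at s)" "\<forall>s\<ge>s1. y s = 0"
      and H: "0 \<le> H" and g: "\<forall>s\<le>s1. norm (g s) \<le> H * exp (\<nu> * s)"
      and ann: "\<forall>s. act (factors (l # ls)) (y s) = 0" and s: "s \<le> s1"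
    have z: "norm (?Al (y s)) \<le> C * (N * H) * exp (\<nu> * s)" if "s \<le> s1" for s
    proof (rule C(2)[of "\<lambda>s. ?Al (y s)" "\<lambda>s. ?Al (g s)" s1 "N * H"])
      show "\<forall>s. ((\<lambda>s. ?Al (y s)) has_vector_derivative A (?Al (y s)) + ?Al (g s)) (at s)"
      proof
        fix s
        have "((\<lambda>s. ?Al (y s)) has_vector_derivative ?Al (A (y s) + g s)) (at s)"
          using bounded_linear.has_vector_derivative[OF blA] y(1) by blast
        then show "((\<lambda>s. ?Al (y s)) has_vector_derivative A (?Al (y s)) + ?Al (g s)) (at s)"
          by (simp add: A_simps csc csc_simps algebra_simps)
      qed
      show "\<forall>s\<ge>s1. ?Al (y s) = 0" using y(2) by (simp add: A_simps csc_simps)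
      show "0 \<le> N * H" using N H by simp
      show "\<forall>s\<le>s1. norm (?Al (g s)) \<le> N * H * exp (\<nu> * s)"
      proof (intro allI impI)
        fix s assume "s \<le> s1"
        have "norm (?Al (g s)) \<le> N * norm (g s)" by (rule N(2))
        also have "\<dots> \<le> N * (H * exp (\<nu> * s))" using g \<open>s \<le> s1\<close> N(1) by (intro mult_left_mono) auto
        finally show "norm (?Al (g s)) \<le> N * H * exp (\<nu> * s)" by simp
      qed
      have "factors (l # ls) = factors ls * [:- l, 1:]" by (simp add: factors_def mult.commute)
      then show "\<forall>s. act (factors ls) (?Al (y s)) = 0" using ann act_mult act_linear_factor by metis
    qed (use that in auto)
    have "norm (y s) \<le> ((C * N + 1) * H) / (Re l - \<nu>) * exp (\<nu> * s)"
    proof (rule scalar_growth[where g="\<lambda>s. ?Al (y s) + g s", OF _ _ _ l s])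
      show "(y has_vector_derivative csc l (y s) + (?Al (y s) + g s)) (at s)" for s using y(1) by (simp add: algebra_simps)
      show "norm (?Al (y s) + g s) \<le> (C * N + 1) * H * exp (\<nu> * s)" if "s \<le> s1" for s
      proof -
        have "norm (?Al (y s) + g s) \<le> C * (N * H) * exp (\<nu> * s) + H * exp (\<nu> * s)"
          using z[OF that] g that by (intro norm_triangle_mono) auto
        then show ?thesis by (simp add: algebra_simps)
      qed
      show "0 \<le> (C * N + 1) * H" using C N H by simp
    qed (use y in auto)
    then show "norm (y s) \<le> (C * N + 1) / (Re l - \<nu>) * H * exp (\<nu> * s)" by simp
  qed
qed

text \<open>
  The constant depends only on \<open>A\<close> and \<open>\<nu>\<close>: neither on the final time nor on the inhomogeneity.
  This uniformity is what makes the estimate applicable to all Fourier modes at once.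
\<close>

theorem growth_bound:
  assumes "\<And>l. eigenvalue l \<Longrightarrow> \<nu> < Re l"
  obtains C where "C \<ge> 0" "\<And>y g s1 H s. (\<And>s. (y has_vector_derivative A (y s) + g s) (at s)) \<Longrightarrow> (\<And>s. s1 \<le> s \<Longrightarrow> y s = 0) \<Longrightarrow> 0 \<le> H \<Longrightarrow>
      (\<And>s. s \<le> s1 \<Longrightarrow> norm (g s) \<le> H * exp (\<nu> * s)) \<Longrightarrow> s \<le> s1 \<Longrightarrow> norm (y s) \<le> C * H * exp (\<nu> * s)"
proof -
  obtain ls where ls: "\<forall>l\<in>set ls. eigenvalue l" "\<And>w. act (factors ls) w = 0"
    using eigenvalue_factors_annihilate by blast
  then have "\<forall>l\<in>set ls. \<nu> < Re l" using assms by blast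
  from growth_of_annihilated[OF this] obtain C where C: "C \<ge> 0"
    "\<forall>y g s1 H. (\<forall>s. (y has_vector_derivative A (y s) + g s) (at s)) \<longrightarrow> (\<forall>s\<ge>s1. y s = 0) \<longrightarrow> 0 \<le> H \<longrightarrow>
      (\<forall>s\<le>s1. norm (g s) \<le> H * exp (\<nu> * s)) \<longrightarrow> (\<forall>s. act (factors ls) (y s) = 0) \<longrightarrow>
      (\<forall>s\<le>s1. norm (y s) \<le> C * H * exp (\<nu> * s))" by blast
  show thesis
  proof (rule that[OF C(1)])
    fix y g s1 H s
    assume "\<And>s. (y has_vector_derivative A (y s) + g s) (at s)" "\<And>s. s1 \<le> s \<Longrightarrow> y s = 0" "0 \<le> H"
      "\<And>s. s \<le> s1 \<Longrightarrow> norm (g s) \<le> H * exp (\<nu> * s)" "s \<le> s1"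
    then show "norm (y s) \<le> C * H * exp (\<nu> * s)" using C(2)[rule_format, of y g s1 H s] ls(2) by blast
  qed
qed

end

section \<open>Fourier series on a box\<close>

definition frequency :: "int ^ 'n \<Rightarrow> real ^ ('n::finite) \<Rightarrow> real" where
  "frequency k x = (\<Sum>j\<in>UNIV. of_int (k $ j) * x $ j)"

definition wave :: "real \<Rightarrow> int ^ 'n \<Rightarrow> real ^ ('n::finite) \<Rightarrow> complex" where
  "wave B k x = cis (pi / B * frequency k x)"

definition Cube :: "real \<Rightarrow> (real ^ 'n::finite) set" where
  "Cube B = cbox (\<chi> j. - B) (\<chi> j. B)"

lemma mem_Cube: "x \<in> Cube B \<longleftrightarrow> (\<forall>j. \<bar>x $ j\<bar> \<le> B)"
  by (auto simp: Cube_def mem_box_cart abs_le_iff minus_le_iff) 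

lemma frequency_simps:
  "frequency (k + l) x = frequency k x + frequency l x" "frequency (k - l) x = frequency k x - frequency l x"
  "frequency (- k) x = - frequency k x" "frequency 0 x = 0"
  "frequency k (x + y) = frequency k x + frequency k y" "frequency k (r *\<^sub>R x) = r * frequency k x"
  by (simp_all add: frequency_def algebra_simps sum.distrib sum_subtractf sum_negf sum_distrib_left)

lemma frequency_axis: "frequency k (axis j 1) = of_int (k $ j)" "frequency (axis j 1) x = x $ j"
  by (simp_all add: frequency_def axis_def if_distrib if_distribR sum.delta cong: if_cong)

lemma wave_add: "wave B (k + l) x = wave B k x * wave B l x"
  by (simp add: wave_def frequency_simps distrib_left cis_mult)

lemma wave_0: "wave B 0 x = 1" by (simp add: wave_def frequency_simps)

lemma norm_wave: "norm (wave B k x) = 1" by (simp add: wave_def)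

lemma has_derivative_cis: "(cis has_vector_derivative \<i> * cis s) (at s)"
proof -
  have "((\<lambda>s. exp (\<i> * complex_of_real s)) has_vector_derivative \<i> * exp (\<i> * of_real s)) (at s)"
    by (rule has_vector_derivative_real_field[of "\<lambda>z. exp (\<i> * z)", simplified o_def])
       (auto intro!: derivative_eq_intros)
  then show ?thesis by (simp add: cis_conv_exp[abs_def] cis_conv_exp)
qed

lemma bounded_linear_frequency: "bounded_linear (frequency k)"
  unfolding frequency_def
  by (intro bounded_linear_sum bounded_linear_const_mult bounded_linear_vec_nth)

lemma has_derivative_wave:
  "(wave B k has_derivative (\<lambda>h. (pi / B * frequency k h) *\<^sub>R (\<i> * wave B k x))) (at x)"
proof -
  have "((\<lambda>x. pi / B * frequency k x) has_derivative (\<lambda>h. pi / B * frequency k h)) (at x)"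
    by (intro has_derivative_mult_right bounded_linear_imp_has_derivative bounded_linear_frequency)
  from has_derivative_compose[OF this has_derivative_cis[unfolded has_vector_derivative_def]]
  show ?thesis unfolding wave_def[abs_def] .
qed

lemma continuous_on_wave: "continuous_on S (wave B k)"
  by (intro continuous_at_imp_continuous_on ballI has_derivative_continuous[OF has_derivative_wave])

lemma bounded_bilinear_vsc: "bounded_bilinear ((*s) :: complex \<Rightarrow> complex ^ 'm \<Rightarrow> complex ^ ('m::finite))"
proof
  show "\<exists>K. \<forall>l (w :: complex ^ 'm). norm (l *s w) \<le> norm l * norm w * K"
    by (intro exI[of _ 1]) (simp add: norm_vector_scalar_mult)
qed (simp_all add: vec_eq_iff algebra_simps)

lemmas vsc_simps =
  bounded_bilinear.add_left[OF bounded_bilinear_vsc] bounded_bilinear.add_right[OF bounded_bilinear_vsc]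
  bounded_bilinear.diff_left[OF bounded_bilinear_vsc] bounded_bilinear.diff_right[OF bounded_bilinear_vsc]
  bounded_bilinear.scaleR_left[OF bounded_bilinear_vsc] bounded_bilinear.scaleR_right[OF bounded_bilinear_vsc]
  bounded_bilinear.zero_left[OF bounded_bilinear_vsc] bounded_bilinear.zero_right[OF bounded_bilinear_vsc]
  bounded_bilinear.sum_right[OF bounded_bilinear_vsc] bounded_bilinear.minus_left[OF bounded_bilinear_vsc]
  bounded_bilinear.minus_right[OF bounded_bilinear_vsc]

lemma vsc_of_real: "of_real r *s (v :: complex ^ 'm::finite) = r *\<^sub>R v"
  by (simp add: vec_eq_iff) (simp add: scaleR_conv_of_real)

lemmas continuous_on_vsc = bounded_bilinear.continuous_on[OF bounded_bilinear_vsc]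
lemmas bounded_linear_vsc = bounded_bilinear.bounded_linear_right[OF bounded_bilinear_vsc]

lemma integral_vsc:
  fixes f :: "'a::euclidean_space \<Rightarrow> complex ^ 'm::finite"
  shows "f integrable_on S \<Longrightarrow> integral S (\<lambda>x. l *s f x) = l *s integral S f"
  using integral_linear[OF _ bounded_linear_vsc[of l], of f S] by (simp add: o_def)

lemma cbox_cut_upper:
  fixes a b :: "real ^ 'n::finite"
  assumes "c \<le> b $ j"
  shows "cbox a (\<chi> i. if i = j then c else b $ i) = cbox a b \<inter> {x. x $ j \<le> c}"
proof (intro set_eqI iffI)
  fix x assume "x \<in> cbox a (\<chi> i. if i = j then c else b $ i)"
  then have *: "a $ i \<le> x $ i \<and> x $ i \<le> (if i = j then c else b $ i)" for i by (simp add: mem_box_cart)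
  have "x $ i \<le> b $ i" for i using *[of i] assms by (cases "i = j") auto
  then show "x \<in> cbox a b \<inter> {x. x $ j \<le> c}" using * *[of j] by (simp add: mem_box_cart)
qed (simp add: mem_box_cart)

lemma cbox_cut_lower:
  fixes a b :: "real ^ 'n::finite"
  assumes "a $ j \<le> c"
  shows "cbox (\<chi> i. if i = j then c else a $ i) b = cbox a b \<inter> {x. c \<le> x $ j}"
proof (intro set_eqI iffI)
  fix x assume "x \<in> cbox (\<chi> i. if i = j then c else a $ i) b"
  then have *: "(if i = j then c else a $ i) \<le> x $ i \<and> x $ i \<le> b $ i" for i by (simp add: mem_box_cart)
  have "a $ i \<le> x $ i" for i using *[of i] assms by (cases "i = j") auto
  then show "x \<in> cbox a b \<inter> {x. c \<le> x $ j}" using * *[of j] by (simp add: mem_box_cart)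
qed (simp add: mem_box_cart)

lemma integral_wave_eq_0:
  fixes k :: "int ^ 'n::finite"
  assumes B: "0 < B" and k: "k \<noteq> 0"
  shows "integral (Cube B) (wave B k) = 0"
proof -
  obtain j where j: "k $ j \<noteq> 0" using k by (auto simp: vec_eq_iff)
  let ?e = "axis j 1 :: real ^ 'n" and ?f = "wave B k"
  define r where "r = B / \<bar>of_int (k $ j)\<bar>"
  have "1 \<le> \<bar>of_int (k $ j) :: real\<bar>" using j by linarith
  then have r: "0 < r" "r \<le> B" using B by (auto simp: r_def divide_le_eq)
  let ?lo = "(\<chi> i. - B) :: real ^ 'n" and ?hi = "(\<chi> i. B) :: real ^ 'n"
  let ?L = "cbox ?lo (\<chi> i. if i = j then r - B else B)" and ?M = "cbox (\<chi> i. if i = j then r - B else - B) ?hi"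
  let ?L' = "cbox (?lo + (2 * B) *\<^sub>R ?e) ((\<chi> i. if i = j then r - B else B) + (2 * B) *\<^sub>R ?e)"
  have int: "?f integrable_on cbox a b" for a b by (intro integrable_continuous continuous_on_wave)
  have hyp: "negligible {x. x $ j = c}" for c :: real
    using negligible_standard_hyperplane[of ?e c] by (simp add: inner_axis)
  have union: "integral C ?f = integral S ?f + integral T ?f"
    if "C = S \<union> T" "S \<inter> T \<subseteq> {x. x $ j = c}" "?f integrable_on S" "?f integrable_on T" for C S T c
    unfolding that(1)
    by (intro integral_unique has_integral_Un integrable_integral that negligible_subset[OF hyp that(2)])
  have LM: "?L = cbox ?lo ?hi \<inter> {x. x $ j \<le> r - B}" "?M = cbox ?lo ?hi \<inter> {x. r - B \<le> x $ j}"
    using cbox_cut_upper[of "r - B" ?hi j ?lo] cbox_cut_lower[of ?lo j "r - B" ?hi] r B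
    unfolding vec_lambda_beta by simp_all
  have "integral (Cube B) ?f = integral ?L ?f + integral ?M ?f"
  proof (rule union[where c="r - B"])
    show "Cube B = ?L \<union> ?M" "?L \<inter> ?M \<subseteq> {x. x $ j = r - B}" unfolding LM Cube_def by auto
  qed (rule int)+
  moreover have "integral (cbox (?lo + r *\<^sub>R ?e) (?hi + r *\<^sub>R ?e)) ?f = integral ?M ?f + integral ?L' ?f"
  proof (rule union[where c=B])
    have v: "(\<chi> i. if i = j then B else (?hi + r *\<^sub>R ?e) $ i) = ?hi" "?lo + r *\<^sub>R ?e = (\<chi> i. if i = j then r - B else - B)"
      "(\<chi> i. if i = j then B else (?lo + r *\<^sub>R ?e) $ i) = ?lo + (2 * B) *\<^sub>R ?e"
      "?hi + r *\<^sub>R ?e = (\<chi> i. if i = j then r - B else B) + (2 * B) *\<^sub>R ?e"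
      by (simp_all add: vec_eq_iff axis_def)
    have "?M = cbox (?lo + r *\<^sub>R ?e) (?hi + r *\<^sub>R ?e) \<inter> {x. x $ j \<le> B}"
      using cbox_cut_upper[of B "?hi + r *\<^sub>R ?e" j "?lo + r *\<^sub>R ?e"] r unfolding v(1) by (simp add: v(2)[symmetric])
    moreover have "?L' = cbox (?lo + r *\<^sub>R ?e) (?hi + r *\<^sub>R ?e) \<inter> {x. B \<le> x $ j}"
      using cbox_cut_lower[of "?lo + r *\<^sub>R ?e" j B "?hi + r *\<^sub>R ?e"] r B unfolding v(3) v(4)[symmetric] by simp
    ultimately show "cbox (?lo + r *\<^sub>R ?e) (?hi + r *\<^sub>R ?e) = ?M \<union> ?L'" "?M \<inter> ?L' \<subseteq> {x. x $ j = B}" by auto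
  qed (rule int)+
  moreover have "integral ?L' ?f = integral ?L ?f"
  proof -
    have "wave B k ((2 * B) *\<^sub>R ?e + x) = wave B k x" for x
    proof -
      have "wave B k ((2 * B) *\<^sub>R ?e + x) = cis (2 * pi * of_int (k $ j)) * wave B k x"
        unfolding wave_def cis_mult using B by (simp only: frequency_simps frequency_axis) (simp add: field_simps)
      moreover have "cis (2 * pi * of_int (k $ j)) = 1" by (rule cis_multiple_2pi) simp
      ultimately show ?thesis by simp
    qed
    then show ?thesis using integral_shift_cbox_plus[of ?lo "\<chi> i. if i = j then r - B else B" ?f "(2 * B) *\<^sub>R ?e"]
      by (simp add: o_def)
  qed
  moreover have "integral (cbox (?lo + r *\<^sub>R ?e) (?hi + r *\<^sub>R ?e)) ?f = - integral (Cube B) ?f"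
  proof -
    have "wave B k (r *\<^sub>R ?e + x) = - wave B k x" for x
    proof -
      have "pi / B * (r * of_int (k $ j)) = pi * sgn (of_int (k $ j))"
        using B j unfolding r_def by (auto simp: sgn_if abs_if)
      then have "wave B k (r *\<^sub>R ?e + x) = cis (pi * sgn (of_int (k $ j))) * wave B k x"
        by (simp add: wave_def frequency_simps frequency_axis cis_mult distrib_left)
      moreover have "cis (pi * sgn (of_int (k $ j) :: real)) = -1"
        using j by (cases "k $ j > 0") (auto simp: sgn_if cis.ctr complex_eq_iff)
      ultimately show ?thesis by simp
    qed
    then show ?thesis using integral_shift_cbox_plus[of ?lo ?hi ?f "r *\<^sub>R ?e"]
      by (simp add: o_def Cube_def)
  qed
  ultimately have "integral (Cube B) ?f = - integral (Cube B) ?f" by simp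
  then show ?thesis by simp
qed

text \<open>Powers of a function with a unique maximum concentrate at the maximum.\<close>

lemma concentration:
  fixes g :: "'a::euclidean_space \<Rightarrow> 'b::euclidean_space" and Q :: "'a \<Rightarrow> real"
  assumes Q: "continuous_on (cbox a b) Q" "\<And>x. x \<in> cbox a b \<Longrightarrow> 0 \<le> Q x"
      "\<And>x. x \<in> cbox a b \<Longrightarrow> x \<noteq> x0 \<Longrightarrow> Q x < 1" "Q x0 = 1"
    and x0: "x0 \<in> box a b" and g: "continuous_on (cbox a b) g"
    and zero: "\<And>N. integral (cbox a b) (\<lambda>x. Q x ^ N *\<^sub>R g x) = 0"
  shows "g x0 = 0"
proof (rule ccontr)
  assume ne: "g x0 \<noteq> 0"
  let ?K = "cbox a b"
  define h where "h x = g x \<bullet> g x0" for x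
  have x0K: "x0 \<in> ?K" using x0 box_subset_cbox by blast
  have ch: "continuous_on ?K h" unfolding h_def by (intro continuous_intros g)
  have cQ: "continuous_on ?K (\<lambda>x. Q x ^ N)" for N by (intro continuous_intros Q)
  have zero': "integral ?K (\<lambda>x. Q x ^ N * h x) = 0" for N
  proof -
    have "(\<lambda>x. Q x ^ N *\<^sub>R g x) integrable_on ?K" by (intro integrable_continuous continuous_intros Q g)
    from integral_linear[OF this bounded_linear_inner_left[of "g x0"]] show ?thesis
      by (simp add: o_def zero h_def)
  qed
  define \<eta> where "\<eta> = h x0 / 2"
  have eta: "\<eta> > 0" using ne by (simp add: \<eta>_def h_def)
  have op: "open {x \<in> box a b. c < f x}" if "continuous_on ?K f" for f :: "'a \<Rightarrow> real" and c
    using continuous_open_preimage[OF continuous_on_subset[OF that box_subset_cbox] open_box open_greaterThan[of c]]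
    by (simp add: vimage_def Int_def)
  let ?U = "{x \<in> box a b. \<eta> < h x}"
  have U: "open ?U" by (rule op[OF ch])
  have x0U: "x0 \<in> ?U" using x0 eta by (simp add: \<eta>_def)
  have cmp: "compact (?K - ?U)" using U by (intro compact_diff compact_cbox)
  obtain r where r: "0 < r" "r < 1" "\<And>x. x \<in> ?K - ?U \<Longrightarrow> Q x \<le> r"
  proof (cases "?K - ?U = {}")
    case True then show thesis by (intro that[of "1/2"]) auto
  next
    case False
    then obtain y where y: "y \<in> ?K - ?U" "\<And>x. x \<in> ?K - ?U \<Longrightarrow> Q x \<le> Q y"
      using continuous_attains_sup[OF cmp False continuous_on_subset[OF Q(1)]] by blast
    then have "Q y < 1" using Q(3)[of y] x0U by auto
    then show thesis using y Q(2)[of y] by (intro that[of "(Q y + 1) / 2"]) force+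
  qed
  define r' where "r' = (1 + r) / 2"
  have r': "r < r'" "r' < 1" "0 < r'" using r by (auto simp: r'_def)
  have "open (?U \<inter> {x \<in> box a b. r' < Q x})" using U op[OF Q(1)] by blast
  moreover have "x0 \<in> ?U \<inter> {x \<in> box a b. r' < Q x}" using x0U x0 Q(4) r' by auto
  ultimately obtain c d where cd: "cbox c d \<subseteq> ?U \<inter> {x \<in> box a b. r' < Q x}" "x0 \<in> box c d" "\<forall>i\<in>Basis. c \<bullet> i < d \<bullet> i"
    by (rule open_contains_cbox)
  have cdK: "cbox c d \<subseteq> ?K" using cd(1) box_subset_cbox by blast
  have content: "0 < measure lborel (cbox c d)"
    by (rule content_pos_lt[OF cd(3)])
  have "bounded (h ` ?K)" using ch by (intro compact_imp_bounded compact_continuous_image) auto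
  then obtain M where M: "M > 0" "\<And>x. x \<in> ?K \<Longrightarrow> \<bar>h x\<bar> \<le> M" by (auto simp: bounded_pos)
  have key: "\<eta> * measure lborel (cbox c d) \<le> M * measure lborel ?K * (r / r') ^ N" for N
  proof -
    have "((\<lambda>x. if x \<in> cbox c d then \<eta> * r' ^ N else 0) has_integral (measure lborel (cbox c d) *\<^sub>R (\<eta> * r' ^ N))) ?K"
      unfolding has_integral_restrict[OF cdK] by (rule has_integral_const)
    from has_integral_diff[OF this has_integral_const[of "M * r ^ N"]]
    have I: "((\<lambda>x. (if x \<in> cbox c d then \<eta> * r' ^ N else 0) - M * r ^ N) has_integral
      (measure lborel (cbox c d) *\<^sub>R (\<eta> * r' ^ N) - measure lborel ?K *\<^sub>R (M * r ^ N))) ?K" .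
    have "measure lborel (cbox c d) *\<^sub>R (\<eta> * r' ^ N) - measure lborel ?K *\<^sub>R (M * r ^ N) \<le> integral ?K (\<lambda>x. Q x ^ N * h x)"
    proof (rule has_integral_le[OF I integrable_integral])
      show "(\<lambda>x. Q x ^ N * h x) integrable_on ?K" by (intro integrable_continuous continuous_intros Q ch)
      fix x assume x: "x \<in> ?K"
      show "(if x \<in> cbox c d then \<eta> * r' ^ N else 0) - M * r ^ N \<le> Q x ^ N * h x"
      proof (cases "x \<in> ?U")
        case True
        then have h: "\<eta> < h x" by simp
        have Mr: "M * r ^ N \<ge> 0" using M r by simp
        show ?thesis
        proof (cases "x \<in> cbox c d")
          case True
          then have "r' ^ N \<le> Q x ^ N" using cd(1) r' by (intro power_mono) auto
          then have "\<eta> * r' ^ N \<le> h x * Q x ^ N" using h eta r' by (intro mult_mono) auto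
          then show ?thesis using Mr True by (simp add: mult.commute)
        next
          case False
          have "0 \<le> Q x ^ N * h x" using Q(2)[OF x] h eta by (intro mult_nonneg_nonneg) auto
          then show ?thesis using Mr False by simp
        qed
      next
        case False
        then have nc: "x \<notin> cbox c d" using cd(1) by blast
        have "\<bar>Q x ^ N * h x\<bar> \<le> r ^ N * M"
          unfolding abs_mult using r(3)[of x] Q(2)[OF x] x False M(2)[OF x] r
          by (intro mult_mono) (auto simp: power_mono)
        then show ?thesis using nc by (simp add: mult.commute abs_le_iff)
      qed
    qed
    then have "measure lborel (cbox c d) * (\<eta> * r' ^ N) \<le> measure lborel ?K * (M * r ^ N)" using zero' by simp
    then show ?thesis using r' by (simp add: power_divide field_simps)
  qed
  have "(\<lambda>N. M * measure lborel ?K * (r / r') ^ N) \<longlonglongrightarrow> M * measure lborel ?K * 0"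
    using r r' by (intro tendsto_mult tendsto_const LIMSEQ_realpow_zero) auto
  then have "\<eta> * measure lborel (cbox c d) \<le> M * measure lborel ?K * 0"
    using key by (intro LIMSEQ_le_const) auto
  then show False using eta content by (simp add: mult_le_0_iff)
qed

text \<open>
  If \<open>g\<close> did not vanish at \<open>x0\<close>, then its integral against high powers of a trigonometric polynomial
  that has its only maximum at \<open>x0\<close> would concentrate there and be nonzero.
\<close>

lemma fourier_uniqueness:
  fixes g :: "real ^ 'n::finite \<Rightarrow> complex ^ 'm::finite"
  assumes B: "0 < B" and g: "continuous_on (Cube B) g"
    and zero: "\<And>k. integral (Cube B) (\<lambda>x. wave B k x *s g x) = 0"
    and x0: "\<And>j. \<bar>x0 $ j\<bar> < B"
  shows "g x0 = 0"
proof -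
  define q where "q j x = (1 + cos (pi / B * (x $ j - x0 $ j))) / 2" for j and x :: "real ^ 'n"
  define Z where "Z h \<longleftrightarrow> continuous_on UNIV h \<and> (\<forall>k. integral (Cube B) (\<lambda>x. (of_real (h x) * wave B k x) *s g x) = 0)" for h :: "real ^ 'n \<Rightarrow> real"
  have cq: "continuous_on S (q j)" for j S unfolding q_def by (intro continuous_intros) auto
  have int: "(\<lambda>x. (of_real (h x) * wave B k x) *s g x) integrable_on Cube B" if "continuous_on UNIV h" for h k
    unfolding Cube_def using that g[unfolded Cube_def]
    by (intro integrable_continuous continuous_on_vsc continuous_on_mult continuous_on_wave continuous_on_of_real)
       (auto intro: continuous_on_subset)
  have step: "Z (\<lambda>x. q j x * h x)" if h: "Z h" for h j
    unfolding Z_def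
  proof (intro conjI allI)
    have ch: "continuous_on UNIV h" using h by (simp add: Z_def)
    then show "continuous_on UNIV (\<lambda>x. q j x * h x)" by (intro continuous_intros cq)
    fix k
    let ?e = "axis j 1 :: int ^ 'n" and ?\<theta> = "pi / B * x0 $ j"
    have split: "of_real (q j x) * wave B k x = 1/2 * wave B k x + cis (- ?\<theta>) / 4 * wave B (k + ?e) x + cis ?\<theta> / 4 * wave B (k - ?e) x" for x
    proof -
      let ?t = "pi / B * x $ j"
      have c': "complex_of_real (cos s) = (cis s + cis (- s)) / 2" for s by (simp add: complex_eq_iff)
      note c = c'[of "?t - ?\<theta>"]
      have w: "wave B (k + ?e) x = wave B k x * cis ?t" "wave B (k - ?e) x = wave B k x * cis (- ?t)"
        by (simp_all add: wave_def frequency_simps frequency_axis cis_mult distrib_left right_diff_distrib)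
      have "cis (?t - ?\<theta>) = cis ?t * cis (- ?\<theta>)" "cis (- (?t - ?\<theta>)) = cis (- ?t) * cis ?\<theta>"
        by (simp_all add: cis_mult)
      then have X: "complex_of_real (cos (?t - ?\<theta>)) = (cis ?t * cis (- ?\<theta>) + cis (- ?t) * cis ?\<theta>) / 2"
        using c by simp
      have q0: "complex_of_real (q j x) = 1/2 + complex_of_real (cos (?t - ?\<theta>)) / 2"
        unfolding q_def right_diff_distrib by (simp add: add_divide_distrib)
      have q: "complex_of_real (q j x) = 1/2 + (cis ?t * cis (- ?\<theta>) + cis (- ?t) * cis ?\<theta>) / 4"
        unfolding q0 X by simp
      show ?thesis unfolding q w by (simp add: field_simps)
    qed
    let ?G = "\<lambda>k x. (of_real (h x) * wave B k x) *s g x"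
    have "(\<lambda>x. (of_real (q j x * h x) * wave B k x) *s g x)
      = (\<lambda>x. (1/2) *s ?G k x + (cis (- ?\<theta>) / 4) *s ?G (k + ?e) x + (cis ?\<theta> / 4) *s ?G (k - ?e) x)"
    proof
      fix x
      have "of_real (q j x * h x) * wave B k x = of_real (h x) * (of_real (q j x) * wave B k x)" by simp
      then show "(of_real (q j x * h x) * wave B k x) *s g x = (1/2) *s ?G k x + (cis (- ?\<theta>) / 4) *s ?G (k + ?e) x + (cis ?\<theta> / 4) *s ?G (k - ?e) x"
        unfolding split by (simp add: vec_eq_iff algebra_simps)
    qed
    moreover have "integral (Cube B) (\<lambda>x. (1/2) *s ?G k x + (cis (- ?\<theta>) / 4) *s ?G (k + ?e) x + (cis ?\<theta> / 4) *s ?G (k - ?e) x) = 0"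
    proof -
      have i: "(\<lambda>x. l *s ?G k x) integrable_on Cube B" for l k
        using integrable_linear[OF int[OF ch] bounded_linear_vsc] by (simp add: o_def)
      have z: "integral (Cube B) (?G k) = 0" for k using h unfolding Z_def by blast
      show ?thesis
        by (subst integral_add | intro i integrable_add | subst integral_vsc[OF int[OF ch]])+ (simp add: z vsc_simps)
    qed
    ultimately show "integral (Cube B) (\<lambda>x. (of_real (q j x * h x) * wave B k x) *s g x) = 0" by simp
  qed
  define Q where "Q x = (\<Prod>j\<in>UNIV. q j x)" for x
  have prod: "Z (\<lambda>x. (\<Prod>j\<in>J. q j x) * h x)" if "finite J" "Z h" for J h
    using that
  proof (induction J)
    case (insert j J)
    then have "Z (\<lambda>x. q j x * ((\<Prod>j\<in>J. q j x) * h x))" by (intro step) auto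
    then show ?case using insert.hyps by (simp add: mult.assoc)
  qed simp
  have "Z (\<lambda>x. Q x ^ N)" for N
  proof (induction N)
    case 0
    show ?case using zero by (simp add: Z_def)
  next
    case (Suc N)
    have "Z (\<lambda>x. (\<Prod>j\<in>UNIV. q j x) * Q x ^ N)" by (rule prod[OF finite Suc])
    then show ?case by (simp add: Q_def)
  qed
  then have zero': "integral (cbox (\<chi> j. - B) (\<chi> j. B)) (\<lambda>x. Q x ^ N *\<^sub>R g x) = 0" for N
  proof -
    have "integral (Cube B) (\<lambda>x. (of_real (Q x ^ N) * wave B 0 x) *s g x) = 0"
      using \<open>Z (\<lambda>x. Q x ^ N)\<close> unfolding Z_def by blast
    then show ?thesis by (simp only: wave_0 mult_1_right vsc_of_real Cube_def)
  qed
  have q01: "0 \<le> q j x \<and> q j x \<le> 1" for j x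
  proof -
    have "- 1 \<le> cos (pi / B * (x $ j - x0 $ j))" "cos (pi / B * (x $ j - x0 $ j)) \<le> 1" by (rule cos_ge_minus_one, rule cos_le_one)
    moreover have "0 \<le> (1 + c) / 2 \<and> (1 + c) / 2 \<le> 1" if "- 1 \<le> c" "c \<le> 1" for c :: real using that by simp
    ultimately show ?thesis unfolding q_def by blast
  qed
  show ?thesis
  proof (rule concentration[OF _ _ _ _ _ _ zero'])
    show "continuous_on (cbox (\<chi> j. - B) (\<chi> j. B)) Q" unfolding Q_def by (intro continuous_intros cq)
    show "0 \<le> Q x" for x unfolding Q_def by (intro prod_nonneg) (simp add: q01)
    show "Q x0 = 1" by (simp add: Q_def q_def)
    show "x0 \<in> box (\<chi> j. - B) (\<chi> j. B)" using x0 by (auto simp: mem_box_cart abs_less_iff minus_less_iff)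
    show "continuous_on (cbox (\<chi> j. - B) (\<chi> j. B)) g" using g by (simp add: Cube_def)
    fix x assume x: "x \<in> cbox (\<chi> j. - B) (\<chi> j. B)" "x \<noteq> x0"
    then obtain j where j: "x $ j \<noteq> x0 $ j" by (auto simp: vec_eq_iff)
    let ?d = "pi / B * (x $ j - x0 $ j)"
    have "\<bar>x $ j\<bar> \<le> B" using x(1) mem_Cube[of x B] by (simp add: Cube_def)
    then have "\<bar>x $ j - x0 $ j\<bar> < 2 * B" using x0[of j] by linarith
    then have "pi / B * \<bar>x $ j - x0 $ j\<bar> < pi / B * (2 * B)" using B by (intro mult_strict_left_mono) auto
    then have "\<bar>?d\<bar> < 2 * pi" using B by (simp add: abs_mult)
    moreover have "?d \<noteq> 0" using j B by simp
    ultimately have "cos ?d \<noteq> 1"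
    proof (intro notI)
      assume "cos ?d = 1" and d: "\<bar>?d\<bar> < 2 * pi" "?d \<noteq> 0"
      then obtain n :: int where n: "?d = of_int n * 2 * pi" using cos_one_2pi_int by blast
      then have "\<bar>of_int n\<bar> * (2 * pi) < 1 * (2 * pi)" using d(1) by (simp add: abs_mult)
      then have "\<bar>of_int n :: real\<bar> < 1" by (rule mult_right_less_imp_less) simp
      then have "n = 0" by linarith
      then show False using n d(2) by simp
    qed
    then have "q j x < 1" using order.not_eq_order_implies_strict[OF _ cos_le_one[of ?d]] unfolding q_def by fastforce
    have "Q x = q j x * (\<Prod>j\<in>UNIV - {j}. q j x)" unfolding Q_def by (simp add: prod.remove)
    also have "\<dots> \<le> q j x * 1" by (intro mult_left_mono prod_le_1) (auto simp: q01)
    also have "\<dots> < 1" using \<open>q j x < 1\<close> by simp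
    finally show "Q x < 1" .
  qed
qed

section \<open>Rapidly decreasing families of coefficients\<close>

definition weight :: "int ^ 'n::finite \<Rightarrow> real" where
  "weight k = 1 + (\<Sum>j\<in>UNIV. (of_int (k $ j))\<^sup>2)"

lemma weight_ge_1: "1 \<le> weight k"
  by (auto simp: weight_def intro!: sum_nonneg)

lemma one_plus_square_le_weight: "1 + (of_int (k $ j))\<^sup>2 \<le> weight k"
  unfolding weight_def by (intro add_left_mono member_le_sum) auto

lemma abs_le_weight: "\<bar>of_int (k $ j)\<bar> \<le> weight k"
proof -
  have "\<bar>r\<bar> \<le> 1 + r\<^sup>2" for r :: real
    using zero_le_power2[of "\<bar>r\<bar> - 1"] zero_le_power2[of r] by (simp add: power2_eq_square algebra_simps)
  then show ?thesis using one_plus_square_le_weight order_trans by blast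
qed

text \<open>
  The variable \<open>s\<close> is \<open>ln t\<close>, so that the second condition says that the modes are rapidly decreasing in the
  frequency and of size \<open>t powr \<mu>\<close> near \<open>t = 0\<close>; the first one confines the functions to bounded times.
\<close>

definition decaying :: "real \<Rightarrow> (int ^ 'n::finite \<Rightarrow> real \<Rightarrow> 'b::real_normed_vector) \<Rightarrow> bool" where
  "decaying \<mu> a \<longleftrightarrow> (\<exists>s1. \<forall>k s. s1 \<le> s \<longrightarrow> a k s = 0) \<and>
     (\<forall>N. \<exists>C. \<forall>k s. weight k ^ N * norm (a k s) \<le> C * exp (\<mu> * s))"

definition mode_deriv :: "(int ^ 'n \<Rightarrow> real \<Rightarrow> 'b::real_normed_vector) \<Rightarrow> int ^ ('n::finite) \<Rightarrow> real \<Rightarrow> 'b" where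
  "mode_deriv a k s = vector_derivative (a k) (at s)"

text \<open>
  The decay is required of \<open>n\<close> derivatives in \<open>s\<close> as well.
\<close>

primrec rapid_n :: "nat \<Rightarrow> real \<Rightarrow> (int ^ 'n::finite \<Rightarrow> real \<Rightarrow> 'b::real_normed_vector) \<Rightarrow> bool" where
  "rapid_n 0 \<mu> a = decaying \<mu> a"
| "rapid_n (Suc n) \<mu> a = (decaying \<mu> a \<and> (\<forall>k s. (a k has_vector_derivative mode_deriv a k s) (at s))
     \<and> rapid_n n \<mu> (mode_deriv a))"

definition rapid :: "real \<Rightarrow> (int ^ 'n::finite \<Rightarrow> real \<Rightarrow> 'b::real_normed_vector) \<Rightarrow> bool" where
  "rapid \<mu> a \<longleftrightarrow> (\<forall>n. rapid_n n \<mu> a)"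

lemma decaying_bound:
  assumes "decaying \<mu> a" obtains C where "C \<ge> 0" "\<And>k s. weight k ^ N * norm (a k s) \<le> C * exp (\<mu> * s)"
proof -
  obtain C where C: "\<And>k s. weight k ^ N * norm (a k s) \<le> C * exp (\<mu> * s)" using assms unfolding decaying_def by blast
  have "0 \<le> weight k ^ N * norm (a k s)" for k s using weight_ge_1[of k] by simp
  then have "0 \<le> C * exp (\<mu> * 0)" using C[of 0 0] order_trans by blast
  then show thesis using that C by simp
qed

lemma decaying_mono:
  assumes a: "decaying \<mu> a" and le: "\<nu> \<le> \<mu>" shows "decaying \<nu> a"
  unfolding decaying_def
proof (intro conjI allI)
  show "\<exists>s1. \<forall>k s. s1 \<le> s \<longrightarrow> a k s = 0" using a by (simp add: decaying_def)
  then obtain s1 where s1: "\<And>k s. s1 \<le> s \<Longrightarrow> a k s = 0" by blast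
  fix N obtain C where C: "C \<ge> 0" "\<And>k s. weight k ^ N * norm (a k s) \<le> C * exp (\<mu> * s)" using decaying_bound[OF a] by blast
  have "weight k ^ N * norm (a k s) \<le> (C * exp ((\<mu> - \<nu>) * s1)) * exp (\<nu> * s)" for k s
  proof (cases "s1 \<le> s")
    case True then show ?thesis using s1 C(1) by simp
  next
    case False
    have "weight k ^ N * norm (a k s) \<le> C * exp (\<mu> * s)" by (rule C(2))
    also have "\<dots> = C * (exp ((\<mu> - \<nu>) * s) * exp (\<nu> * s))" by (simp add: exp_add[symmetric] algebra_simps)
    also have "\<dots> \<le> C * (exp ((\<mu> - \<nu>) * s1) * exp (\<nu> * s))"
      using False C(1) le by (intro mult_left_mono mult_right_mono) (auto intro: mult_left_mono)
    finally show ?thesis by (simp add: mult.assoc)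
  qed
  then show "\<exists>C. \<forall>k s. weight k ^ N * norm (a k s) \<le> C * exp (\<nu> * s)" by blast
qed

lemma decaying_add:
  assumes "decaying \<mu> a" "decaying \<mu> b" shows "decaying \<mu> (\<lambda>k s. a k s + b k s)"
  unfolding decaying_def
proof (intro conjI allI)
  obtain s1 s2 where "\<And>k s. s1 \<le> s \<Longrightarrow> a k s = 0" "\<And>k s. s2 \<le> s \<Longrightarrow> b k s = 0"
    using assms unfolding decaying_def by blast
  then show "\<exists>s1. \<forall>k s. s1 \<le> s \<longrightarrow> a k s + b k s = 0" by (intro exI[of _ "max s1 s2"]) auto
  fix N obtain C D where C: "\<And>k s. weight k ^ N * norm (a k s) \<le> C * exp (\<mu> * s)"
    and D: "\<And>k s. weight k ^ N * norm (b k s) \<le> D * exp (\<mu> * s)"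
    using assms unfolding decaying_def by meson
  have "weight k ^ N * norm (a k s + b k s) \<le> (C + D) * exp (\<mu> * s)" for k s
  proof -
    have "weight k ^ N * norm (a k s + b k s) \<le> weight k ^ N * (norm (a k s) + norm (b k s))"
      using weight_ge_1[of k] by (intro mult_left_mono norm_triangle_ineq) auto
    then show ?thesis using C[of k s] D[of k s] by (simp add: algebra_simps)
  qed
  then show "\<exists>C. \<forall>k s. weight k ^ N * norm (a k s + b k s) \<le> C * exp (\<mu> * s)" by blast
qed

lemma decaying_multiplier:
  fixes T :: "int ^ 'n::finite \<Rightarrow> 'b::real_normed_vector \<Rightarrow> 'c::real_normed_vector"
  assumes a: "decaying \<mu> a" and T: "\<And>k v. norm (T k v) \<le> C0 * weight k ^ p * norm v" "0 \<le> C0"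
  shows "decaying \<mu> (\<lambda>k s. T k (a k s))"
  unfolding decaying_def
proof (intro conjI allI)
  have T0: "T k 0 = 0" for k using T(1)[of k 0] by simp
  show "\<exists>s1. \<forall>k s. s1 \<le> s \<longrightarrow> T k (a k s) = 0" using a T0 unfolding decaying_def by metis
  fix N obtain C where C: "C \<ge> 0" "\<And>k s. weight k ^ (N + p) * norm (a k s) \<le> C * exp (\<mu> * s)" using decaying_bound[OF a] by blast
  have "weight k ^ N * norm (T k (a k s)) \<le> (C0 * C) * exp (\<mu> * s)" for k s
  proof -
    have "weight k ^ N * norm (T k (a k s)) \<le> weight k ^ N * (C0 * weight k ^ p * norm (a k s))"
      using weight_ge_1[of k] by (intro mult_left_mono T) auto
    also have "\<dots> = C0 * (weight k ^ (N + p) * norm (a k s))" by (simp add: power_add)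
    also have "\<dots> \<le> C0 * (C * exp (\<mu> * s))" by (intro mult_left_mono C T)
    finally show ?thesis by (simp add: mult.assoc)
  qed
  then show "\<exists>C. \<forall>k s. weight k ^ N * norm (T k (a k s)) \<le> C * exp (\<mu> * s)" by blast
qed

lemma decaying_exp:
  assumes a: "decaying \<mu> a" shows "decaying (\<mu> + r) (\<lambda>k s. exp (r * s) *\<^sub>R a k s)"
  unfolding decaying_def
proof (intro conjI allI)
  show "\<exists>s1. \<forall>k s. s1 \<le> s \<longrightarrow> exp (r * s) *\<^sub>R a k s = 0" using a unfolding decaying_def by auto
  fix N obtain C where C: "C \<ge> 0" "\<And>k s. weight k ^ N * norm (a k s) \<le> C * exp (\<mu> * s)" using decaying_bound[OF a] by blast
  have "weight k ^ N * norm (exp (r * s) *\<^sub>R a k s) \<le> C * exp ((\<mu> + r) * s)" for k s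
  proof -
    have "weight k ^ N * norm (exp (r * s) *\<^sub>R a k s) = exp (r * s) * (weight k ^ N * norm (a k s))" by simp
    also have "\<dots> \<le> exp (r * s) * (C * exp (\<mu> * s))" by (intro mult_left_mono C) auto
    finally show ?thesis by (simp add: exp_add[symmetric] algebra_simps)
  qed
  then show "\<exists>C. \<forall>k s. weight k ^ N * norm (exp (r * s) *\<^sub>R a k s) \<le> C * exp ((\<mu> + r) * s)" by blast
qed

lemma mode_deriv_eq: "(\<And>k s. (a k has_vector_derivative a' k s) (at s)) \<Longrightarrow> mode_deriv a = a'"
  by (simp add: mode_deriv_def fun_eq_iff vector_derivative_at)

lemma rapid_n_decaying: "rapid_n n \<mu> a \<Longrightarrow> decaying \<mu> a" by (cases n) auto

lemma rapid_n_SucI: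
  "decaying \<mu> a \<Longrightarrow> (\<And>k s. (a k has_vector_derivative a' k s) (at s)) \<Longrightarrow> rapid_n n \<mu> a' \<Longrightarrow> rapid_n (Suc n) \<mu> a"
  using mode_deriv_eq[of a a'] by simp

lemma rapid_n_SucD: "rapid_n (Suc n) \<mu> a \<Longrightarrow> rapid_n n \<mu> a"
  by (induction n arbitrary: a) auto

lemma rapid_n_mono: "rapid_n n \<mu> a \<Longrightarrow> \<nu> \<le> \<mu> \<Longrightarrow> rapid_n n \<nu> a"
  by (induction n arbitrary: a) (auto intro: decaying_mono)

lemma rapid_n_add: "rapid_n n \<mu> a \<Longrightarrow> rapid_n n \<mu> b \<Longrightarrow> rapid_n n \<mu> (\<lambda>k s. a k s + b k s)"
proof (induction n arbitrary: a b)
  case (Suc n)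
  show ?case
    by (rule rapid_n_SucI[where a'="\<lambda>k s. mode_deriv a k s + mode_deriv b k s"])
       (use Suc in \<open>auto intro: decaying_add has_vector_derivative_add\<close>)
qed (auto intro: decaying_add)

lemma rapid_n_multiplier:
  fixes T :: "int ^ 'n::finite \<Rightarrow> 'b::real_normed_vector \<Rightarrow> 'c::real_normed_vector"
  assumes bl: "\<And>k. bounded_linear (T k)" and T: "\<And>k v. norm (T k v) \<le> C0 * weight k ^ p * norm v" "0 \<le> C0"
  shows "rapid_n n \<mu> a \<Longrightarrow> rapid_n n \<mu> (\<lambda>k s. T k (a k s))"
proof (induction n arbitrary: a)
  case 0
  then show ?case using decaying_multiplier[OF _ T] by simp
next
  case (Suc n)
  show ?case
    by (rule rapid_n_SucI[where a'="\<lambda>k s. T k (mode_deriv a k s)"])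
       (use Suc decaying_multiplier[OF _ T] in \<open>auto intro: bounded_linear.has_vector_derivative[OF bl]\<close>)
qed

lemma rapid_n_linear:
  assumes "bounded_linear T" "rapid_n n \<mu> a" shows "rapid_n n \<mu> (\<lambda>k s. T (a k s))"
proof -
  obtain C where "C \<ge> 0" "\<And>v. norm (T v) \<le> norm v * C" using bounded_linear.nonneg_bounded[OF assms(1)] by blast
  then show ?thesis
    using rapid_n_multiplier[of "\<lambda>_. T" C 0, OF assms(1) _ _ assms(2)] by (simp add: mult.commute)
qed

lemma rapid_n_exp: "rapid_n n \<mu> a \<Longrightarrow> rapid_n n (\<mu> + r) (\<lambda>k s. exp (r * s) *\<^sub>R a k s)"
proof (induction n arbitrary: a)
  case 0
  then show ?case by (simp add: decaying_exp)
next
  case (Suc n)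
  show ?case
  proof (rule rapid_n_SucI[where a'="\<lambda>k s. exp (r * s) *\<^sub>R mode_deriv a k s + exp (r * s) *\<^sub>R (r *\<^sub>R a k s)"])
    show "decaying (\<mu> + r) (\<lambda>k s. exp (r * s) *\<^sub>R a k s)" using Suc.prems by (auto intro: decaying_exp)
    have "rapid_n n \<mu> (\<lambda>k s. r *\<^sub>R a k s)"
      by (rule rapid_n_linear[OF bounded_linear_scaleR_right rapid_n_SucD[OF Suc.prems]])
    then show "rapid_n n (\<mu> + r) (\<lambda>k s. exp (r * s) *\<^sub>R mode_deriv a k s + exp (r * s) *\<^sub>R (r *\<^sub>R a k s))"
      using Suc by (intro rapid_n_add Suc.IH) auto
    show "((\<lambda>s. exp (r * s) *\<^sub>R a k s) has_vector_derivative exp (r * s) *\<^sub>R mode_deriv a k s + exp (r * s) *\<^sub>R (r *\<^sub>R a k s)) (at s)" for k s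
    proof -
      have "((\<lambda>s. exp (r * s)) has_vector_derivative r * exp (r * s)) (at s)"
        by (auto intro!: derivative_eq_intros simp: has_real_derivative_iff_has_vector_derivative[symmetric])
      moreover have "(a k has_vector_derivative mode_deriv a k s) (at s)" using Suc.prems by simp
      ultimately show ?thesis
        using bounded_bilinear.has_vector_derivative[OF bounded_bilinear_scaleR] by (fastforce simp: mult.commute)
    qed
  qed
qed

lemma rapid_n_sum:
  assumes "finite I" "I \<noteq> {}" "\<And>i. i \<in> I \<Longrightarrow> rapid_n n \<mu> (a i)"
  shows "rapid_n n \<mu> (\<lambda>k s. \<Sum>i\<in>I. a i k s)"
  using assms
proof (induction I rule: finite_ne_induct)
  case (insert i I)
  then have "rapid_n n \<mu> (\<lambda>k s. a i k s + (\<Sum>i\<in>I. a i k s))" by (intro rapid_n_add) auto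
  then show ?case using insert by simp
qed simp

text \<open>
  The weight to the power of the dimension dominates a product of one-dimensional weights.
\<close>

lemma summable_inverse_weight:
  fixes e :: "nat \<Rightarrow> int ^ 'n::finite"
  assumes e: "inj e"
  shows "summable (\<lambda>n. inverse (weight (e n) ^ CARD('n)))"
proof (rule summableI_nonneg_bounded)
  define H where "H = 2 * (\<Sum>i. inverse (1 + (of_nat i)\<^sup>2 :: real))"
  have hnn: "(0::real) \<le> inverse (1 + (of_int i)\<^sup>2)" for i :: int by simp
  let ?h = "\<lambda>i::int. inverse (1 + (of_int i)\<^sup>2) :: real"
  have sm: "summable (\<lambda>i. inverse (1 + (of_nat i)\<^sup>2 :: real))"
  proof (rule summable_comparison_test')
    show "summable (\<lambda>i. 1 * inverse (real i ^ 2))" using inverse_power_summable[of 2] by (intro summable_mult) auto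
    show "norm (inverse (1 + (of_nat i)\<^sup>2 :: real)) \<le> 1 * inverse (real i ^ 2)" if "1 \<le> i" for i
    proof -
      have "inverse (1 + (real i)\<^sup>2) \<le> inverse ((real i)\<^sup>2)" using that by (intro le_imp_inverse_le) auto
      then show ?thesis by (simp add: abs_of_nonneg add_nonneg_nonneg)
    qed
  qed
  have one: "(\<Sum>i\<in>{-int M..int M}. ?h i) \<le> H" for M
  proof -
    have "{-int M..int M} \<subseteq> int ` {..M} \<union> (\<lambda>i. - int i) ` {..M}"
    proof
      fix i assume "i \<in> {-int M..int M}"
      then show "i \<in> int ` {..M} \<union> (\<lambda>i. - int i) ` {..M}"
        by (cases i rule: int_cases2) auto
    qed
    then have "(\<Sum>i\<in>{-int M..int M}. ?h i) \<le> (\<Sum>i\<in>int ` {..M} \<union> (\<lambda>i. - int i) ` {..M}. ?h i)"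
      by (intro sum_mono2) auto
    also have "\<dots> \<le> (\<Sum>i\<in>int ` {..M}. ?h i) + (\<Sum>i\<in>(\<lambda>i. - int i) ` {..M}. ?h i)"
      by (subst sum_Un) (auto intro!: sum_nonneg)
    also have "\<dots> = 2 * (\<Sum>i\<le>M. inverse (1 + (of_nat i)\<^sup>2 :: real))"
      by (subst (1 2) sum.reindex) (auto simp: inj_on_def)
    also have "\<dots> \<le> H" unfolding H_def
      using sum_le_suminf[OF sm, of "{..M}"] by simp
    finally show ?thesis .
  qed
  show "0 \<le> inverse (weight (e n) ^ CARD('n))" for n using weight_ge_1[of "e n"] by simp
  show "(\<Sum>n<m. inverse (weight (e n) ^ CARD('n))) \<le> H ^ CARD('n)" for m
  proof -
    let ?S = "e ` {..<m}"
    have "finite ((\<lambda>(k, j). nat \<bar>k $ j\<bar>) ` (?S \<times> UNIV))" by simp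
    then obtain M where M: "\<And>x. x \<in> (\<lambda>(k, j). nat \<bar>k $ j\<bar>) ` (?S \<times> UNIV) \<Longrightarrow> x \<le> M"
      using finite_nat_set_iff_bounded_le by meson
    have bd: "k $ j \<in> {-int M..int M}" if "k \<in> ?S" for k j
      using M[of "nat \<bar>k $ j\<bar>"] that by force
    have "(\<Sum>n<m. inverse (weight (e n) ^ CARD('n))) = (\<Sum>k\<in>?S. inverse (weight k ^ CARD('n)))"
      by (subst sum.reindex) (use e in \<open>auto intro: inj_on_subset\<close>)
    also have "\<dots> \<le> (\<Sum>k\<in>?S. \<Prod>j\<in>UNIV. ?h (k $ j))"
    proof (rule sum_mono)
      fix k :: "int ^ 'n"
      have "(\<Prod>j\<in>UNIV. 1 + (of_int (k $ j))\<^sup>2) \<le> (\<Prod>j\<in>(UNIV :: 'n set). weight k)"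
        by (intro prod_mono) (auto intro: one_plus_square_le_weight add_nonneg_nonneg)
      moreover have "(\<Prod>j\<in>UNIV. 1 + (of_int (k $ j))\<^sup>2 :: real) > 0" by (intro prod_pos) (auto intro: add_pos_nonneg)
      ultimately have "inverse (weight k ^ CARD('n)) \<le> inverse (\<Prod>j\<in>UNIV. 1 + (of_int (k $ j))\<^sup>2)"
        by (intro le_imp_inverse_le) auto
      then show "inverse (weight k ^ CARD('n)) \<le> (\<Prod>j\<in>UNIV. ?h (k $ j))"
        unfolding prod_inversef[symmetric] o_def .
    qed
    also have "\<dots> = (\<Sum>g\<in>(\<lambda>k. ($) k) ` ?S. \<Prod>j\<in>UNIV. ?h (g j))"
      by (subst sum.reindex) (auto simp: inj_on_def vec_nth_inject)
    also have "\<dots> \<le> (\<Sum>g\<in>Pi\<^sub>E (UNIV :: 'n set) (\<lambda>_. {-int M..int M}). \<Prod>j\<in>UNIV. ?h (g j))"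
      by (intro sum_mono2 finite_PiE prod_nonneg) (use bd in auto)
    also have "\<dots> = (\<Prod>j\<in>(UNIV :: 'n set). \<Sum>i\<in>{-int M..int M}. ?h i)"
      by (subst prod_sum_PiE) auto
    also have "\<dots> \<le> H ^ CARD('n)"
      using prod_mono[of "UNIV :: 'n set" "\<lambda>_. \<Sum>i\<in>{-int M..int M}. ?h i" "\<lambda>_. H"] one[of M] by (simp add: sum_nonneg)
    finally show ?thesis .
  qed
qed

section \<open>Functions given by Fourier series in space\<close>

lemma infinite_modes: "infinite (UNIV :: (int ^ 'n::finite) set)"
proof -
  have "inj (\<lambda>i. axis undefined (int i) :: int ^ 'n)" by (auto simp: inj_on_def axis_eq_axis)
  then have "infinite (range (\<lambda>i. axis undefined (int i) :: int ^ 'n))" by (rule range_inj_infinite)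
  then show ?thesis by (rule infinite_super[OF subset_UNIV])
qed

definition mode_enum :: "nat \<Rightarrow> int ^ 'n::finite" where "mode_enum = from_nat_into UNIV"

lemma bij_mode_enum: "bij (mode_enum :: nat \<Rightarrow> int ^ 'n::finite)"
  unfolding mode_enum_def using bij_betw_from_nat_into[OF _ infinite_modes] by simp

definition fseries :: "real \<Rightarrow> (int ^ 'n \<Rightarrow> real \<Rightarrow> complex ^ 'm) \<Rightarrow> ('n::finite) point \<Rightarrow> complex ^ ('m::finite)" where
  "fseries B a z = (\<Sum>n. wave B (mode_enum n) (snd z) *s a (mode_enum n) (ln (fst z)))"

lemma norm_wave_vsc: "norm (wave B k x *s v) = norm (v :: complex ^ 'm::finite)"
  by (simp add: norm_vector_scalar_mult norm_wave)

lemma decaying_pointwise: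
  fixes a :: "int ^ 'n::finite \<Rightarrow> real \<Rightarrow> complex ^ 'm::finite"
  assumes "decaying \<mu> a"
  obtains C where "C \<ge> 0" "\<And>k s. norm (a k s) \<le> C * exp (\<mu> * s) * inverse (weight k ^ CARD('n))"
proof -
  obtain C where C: "C \<ge> 0" "\<And>k s. weight k ^ CARD('n) * norm (a k s) \<le> C * exp (\<mu> * s)"
    using decaying_bound[OF assms] by blast
  have "norm (a k s) \<le> C * exp (\<mu> * s) * inverse (weight k ^ CARD('n))" for k s
    using C(2)[of k s] weight_ge_1[of k] by (simp add: field_simps)
  then show thesis using that C by blast
qed

lemma summable_mode_weight: "summable (\<lambda>n. inverse (weight (mode_enum n :: int ^ 'n::finite) ^ CARD('n)))"
  using summable_inverse_weight bij_mode_enum bij_is_inj by blast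

lemma summable_fseries:
  fixes a :: "int ^ 'n::finite \<Rightarrow> real \<Rightarrow> complex ^ 'm::finite"
  assumes "decaying \<mu> a"
  shows "summable (\<lambda>n. wave B (mode_enum n) x *s a (mode_enum n) s)"
proof -
  obtain C where C: "C \<ge> 0" "\<And>k s. norm (a k s) \<le> C * exp (\<mu> * s) * inverse (weight k ^ CARD('n))"
    using decaying_pointwise[OF assms] by blast
  show ?thesis
    by (rule summable_comparison_test'[OF summable_mult[OF summable_mode_weight[where 'n='n]], of 0 _ "C * exp (\<mu> * s)"])
       (simp add: norm_wave_vsc C)
qed

lemma fseries_bound:
  fixes a :: "int ^ 'n::finite \<Rightarrow> real \<Rightarrow> complex ^ 'm::finite"
  assumes "decaying \<mu> a"
  obtains C where "C > 0" "\<And>z. z \<in> spacetime \<Longrightarrow> norm (fseries B a z) \<le> C * fst z powr \<mu>"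
proof -
  obtain C where C: "C \<ge> 0" "\<And>k s. norm (a k s) \<le> C * exp (\<mu> * s) * inverse (weight k ^ CARD('n))"
    using decaying_pointwise[OF assms] by blast
  let ?w = "\<lambda>n. inverse (weight (mode_enum n :: int ^ 'n) ^ CARD('n))"
  have "norm (fseries B a z) \<le> (C * suminf ?w + 1) * fst z powr \<mu>" if z: "z \<in> spacetime" for z
  proof -
    have "norm (fseries B a z) \<le> (\<Sum>n. C * exp (\<mu> * ln (fst z)) * ?w n)"
      unfolding fseries_def
      by (rule norm_suminf_le[OF _ summable_mult[OF summable_mode_weight]]) (simp add: norm_wave_vsc C)
    also have "\<dots> = C * exp (\<mu> * ln (fst z)) * suminf ?w" by (rule suminf_mult[OF summable_mode_weight])
    also have "exp (\<mu> * ln (fst z)) = fst z powr \<mu>" using z by (simp add: powr_def spacetime_def)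
    finally have "norm (fseries B a z) \<le> C * fst z powr \<mu> * suminf ?w" .
    also have "\<dots> \<le> C * fst z powr \<mu> * suminf ?w + fst z powr \<mu>" by simp
    finally show ?thesis by (simp add: algebra_simps)
  qed
  moreover have "suminf ?w \<ge> 0" 
    by (rule suminf_nonneg[OF summable_mode_weight]) (simp add: order_trans[OF zero_le_one weight_ge_1])
  then have "C * suminf ?w + 1 > 0" using C(1) by (simp add: add_nonneg_pos)
  ultimately show thesis using that by blast
qed

lemma fseries_add:
  assumes "decaying \<mu> a" "decaying \<mu> b"
  shows "fseries B (\<lambda>k s. a k s + b k s) z = fseries B a z + fseries B b z"
  unfolding fseries_def
  by (subst suminf_add[OF summable_fseries[OF assms(1)] summable_fseries[OF assms(2)]]) (simp add: vsc_simps)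

lemma fseries_linear:
  assumes "decaying \<mu> a" "bounded_linear T" "\<And>l v. T (l *s v) = l *s T v"
  shows "fseries B (\<lambda>k s. T (a k s)) z = T (fseries B a z)"
  unfolding fseries_def
  by (subst bounded_linear.suminf[OF assms(2) summable_fseries[OF assms(1)]]) (simp add: assms(3))

lemma fseries_scaleR:
  assumes "decaying \<mu> a" shows "fseries B (\<lambda>k s. r *\<^sub>R a k s) z = r *\<^sub>R fseries B a z"
  by (rule fseries_linear[OF assms bounded_linear_scaleR_right]) (simp add: vsc_simps)

lemma fseries_sum:
  assumes "finite I" "I \<noteq> {}" "\<And>i. i \<in> I \<Longrightarrow> rapid_n n \<mu> (a i)"
  shows "fseries B (\<lambda>k s. \<Sum>i\<in>I. a i k s) z = (\<Sum>i\<in>I. fseries B (a i) z)"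
  using assms
proof (induction I rule: finite_ne_induct)
  case (insert i I)
  have "fseries B (\<lambda>k s. a i k s + (\<Sum>i\<in>I. a i k s)) z = fseries B (a i) z + fseries B (\<lambda>k s. \<Sum>i\<in>I. a i k s) z"
    by (rule fseries_add[of \<mu>]) (use insert rapid_n_decaying rapid_n_sum[of I n \<mu> a] in auto)
  then show ?case using insert by simp
qed simp

lemma fseries_exp:
  assumes "decaying \<mu> a" "z \<in> spacetime"
  shows "fseries B (\<lambda>k s. exp (r * s) *\<^sub>R a k s) z = fst z powr r *\<^sub>R fseries B a z"
proof -
  have "fseries B (\<lambda>k s. exp (r * s) *\<^sub>R a k s) z = fseries B (\<lambda>k s. exp (r * ln (fst z)) *\<^sub>R a k s) z"
    by (simp add: fseries_def)
  also have "\<dots> = exp (r * ln (fst z)) *\<^sub>R fseries B a z" by (rule fseries_scaleR[OF assms(1)])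
  finally show ?thesis using assms(2) by (simp add: powr_def spacetime_def)
qed

text \<open>
  The action of \<open>\<partial>\<^sub>j\<close> on the Fourier modes.
\<close>

definition freq_mult :: "real \<Rightarrow> 'n \<Rightarrow> (int ^ 'n \<Rightarrow> real \<Rightarrow> complex ^ 'm) \<Rightarrow> int ^ ('n::finite) \<Rightarrow> real \<Rightarrow> complex ^ ('m::finite)" where
  "freq_mult B j a k s = (\<i> * of_real (pi / B * of_int (k $ j))) *s a k s"

lemma freq_mult_bound:
  fixes v :: "complex ^ 'm::finite" and k :: "int ^ 'n::finite"
  shows "norm ((\<i> * of_real (pi / B * of_int (k $ j))) *s v) \<le> \<bar>pi / B\<bar> * weight k ^ 1 * norm v"
  unfolding norm_vector_scalar_mult norm_mult norm_of_real abs_mult power_one_right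
  using abs_le_weight[of k j] by (intro mult_right_mono) (auto intro!: divide_right_mono mult_left_mono)

lemma rapid_n_freq_mult: "rapid_n n \<mu> a \<Longrightarrow> rapid_n n \<mu> (freq_mult B j a)"
  unfolding freq_mult_def[abs_def]
  by (rule rapid_n_multiplier[OF bounded_linear_vsc freq_mult_bound]) auto

text \<open>
  Term by term differentiation, justified by the summable bounds for the modes and their derivatives.
\<close>

lemma has_derivative_fseries:
  fixes a :: "int ^ 'n::finite \<Rightarrow> real \<Rightarrow> complex ^ 'm::finite"
  assumes a: "rapid_n (Suc 0) \<mu> a" and z: "z \<in> spacetime"
  shows "(fseries B a has_derivative (\<lambda>v. (fst v / fst z) *\<^sub>R fseries B (mode_deriv a) z
    + (\<Sum>j\<in>UNIV. snd v $ j *\<^sub>R fseries B (freq_mult B j a) z))) (at z)"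
proof -
  let ?d = "CARD('n)" and ?e = "mode_enum :: nat \<Rightarrow> int ^ 'n"
  have da: "decaying \<mu> a" and da': "decaying \<mu> (mode_deriv a)"
    and der: "\<And>k s. (a k has_vector_derivative mode_deriv a k s) (at s)" using a by auto
  define t where "t = fst z"
  have t: "t > 0" using z by (simp add: t_def spacetime_def)
  define S where "S = {t/2<..<2*t} \<times> (UNIV :: (real ^ 'n) set)"
  have S: "convex S" "open S" "z \<in> S" unfolding S_def using t
    by (auto intro: convex_Times open_Times simp: t_def mem_Times_iff)
  have Spos: "fst y > t/2" "fst y > 0" "fst y < 2 * t" if "y \<in> S" for y using that t by (auto simp: S_def)
  define f where "f n y = wave B (?e n) (snd y) *s a (?e n) (ln (fst y))" for n and y :: "'n point"
  define f' where "f' n y v = wave B (?e n) (snd y) *s ((fst v / fst y) *\<^sub>R mode_deriv a (?e n) (ln (fst y)))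
      + ((pi / B * frequency (?e n) (snd v)) *\<^sub>R (\<i> * wave B (?e n) (snd y))) *s a (?e n) (ln (fst y))" for n and y v :: "'n point"
  have df: "(f n has_derivative f' n y) (at y)" if y: "y \<in> S" for n y
  proof -
    have "((\<lambda>y. ln (fst y)) has_derivative (\<lambda>v. fst v / fst y)) (at y)"
      using Spos(2)[OF y] by (auto intro!: derivative_eq_intros simp: divide_inverse)
    from has_derivative_compose[OF this der[unfolded has_vector_derivative_def]]
    have 1: "((\<lambda>y. a (?e n) (ln (fst y))) has_derivative (\<lambda>v. (fst v / fst y) *\<^sub>R mode_deriv a (?e n) (ln (fst y)))) (at y)" .
    have 2: "((\<lambda>y. wave B (?e n) (snd y)) has_derivative (\<lambda>v. (pi / B * frequency (?e n) (snd v)) *\<^sub>R (\<i> * wave B (?e n) (snd y)))) (at y)"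
      using has_derivative_compose[OF has_derivative_snd[OF has_derivative_ident] has_derivative_wave] .
    show ?thesis unfolding f_def[abs_def] f'_def[abs_def]
      by (rule bounded_bilinear.FDERIV[OF bounded_bilinear_vsc 2 1])
  qed
  define E where "E = exp (\<bar>\<mu>\<bar> * (\<bar>ln (t/2)\<bar> + \<bar>ln (2*t)\<bar>))"
  have E: "exp (\<mu> * ln (fst y)) \<le> E" if y: "y \<in> S" for y
  proof -
    have "ln (t/2) \<le> ln (fst y)" "ln (fst y) \<le> ln (2*t)" using Spos[OF y] t by auto
    then have "\<bar>ln (fst y)\<bar> \<le> \<bar>ln (t/2)\<bar> + \<bar>ln (2*t)\<bar>" by linarith
    then have "\<bar>\<mu>\<bar> * \<bar>ln (fst y)\<bar> \<le> \<bar>\<mu>\<bar> * (\<bar>ln (t/2)\<bar> + \<bar>ln (2*t)\<bar>)" by (intro mult_left_mono) auto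
    then have "\<mu> * ln (fst y) \<le> \<bar>\<mu>\<bar> * (\<bar>ln (t/2)\<bar> + \<bar>ln (2*t)\<bar>)"
      using abs_ge_self[of "\<mu> * ln (fst y)"] by (simp add: abs_mult)
    then show ?thesis unfolding E_def by simp
  qed
  obtain C1 where C1: "C1 \<ge> 0" "\<And>k s. norm (mode_deriv a k s) \<le> C1 * exp (\<mu> * s) * inverse (weight k ^ ?d)"
    using decaying_pointwise[OF da'] by blast
  obtain C2 where C2: "C2 \<ge> 0" "\<And>k s. weight k ^ Suc ?d * norm (a k s) \<le> C2 * exp (\<mu> * s)"
    using decaying_bound[OF da] by blast
  define M where "M n = (2 / t * (C1 * E) + \<bar>pi / B\<bar> * (real ?d * (C2 * E))) * inverse (weight (?e n) ^ ?d)" for n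
  have M: "norm (f' n y v) \<le> M n * norm v" if y: "y \<in> S" for n y v
  proof -
    let ?k = "?e n" and ?s = "ln (fst y)" and ?w = "inverse (weight (?e n) ^ ?d)"
    have w0: "?w \<ge> 0" "weight ?k > 0" using weight_ge_1[of ?k] by auto
    have "norm (wave B ?k (snd y) *s ((fst v / fst y) *\<^sub>R mode_deriv a ?k ?s)) \<le> norm v * (2 / t) * (C1 * E * ?w)"
    proof -
      have "norm (mode_deriv a ?k ?s) \<le> C1 * E * ?w"
        using C1(2)[of ?k ?s] E[OF y] C1(1) w0 by (meson mult_left_mono mult_right_mono order_trans)
      moreover have "\<bar>fst v / fst y\<bar> \<le> norm v * (2 / t)"
      proof -
        have "\<bar>fst v\<bar> \<le> norm v" using norm_fst_le[of "fst v" "snd v"] by simp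
        moreover have "1 / fst y \<le> 2 / t" using Spos[OF y] t by (simp add: field_simps)
        ultimately have "\<bar>fst v\<bar> * (1 / fst y) \<le> norm v * (2 / t)" using Spos(2)[OF y] by (intro mult_mono) auto
        then show ?thesis using Spos(2)[OF y] by simp
      qed
      ultimately show ?thesis unfolding norm_wave_vsc norm_scaleR using t by (intro mult_mono) auto
    qed
    moreover have "norm (((pi / B * frequency ?k (snd v)) *\<^sub>R (\<i> * wave B ?k (snd y))) *s a ?k ?s)
      \<le> \<bar>pi / B\<bar> * (real ?d * norm v) * (C2 * E * ?w)"
    proof -
      have "\<bar>frequency ?k (snd v)\<bar> \<le> (\<Sum>j\<in>(UNIV :: 'n set). weight ?k * norm v)"
        unfolding frequency_def
      proof (intro order.trans[OF sum_abs] sum_mono)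
        fix j
        have "\<bar>snd v $ j\<bar> \<le> norm v" using component_le_norm_cart[of "snd v" j] norm_snd_le[of "snd v" "fst v"] by simp
        then show "\<bar>of_int (?k $ j) * snd v $ j\<bar> \<le> weight ?k * norm v"
          unfolding abs_mult using abs_le_weight[of ?k j] w0 by (intro mult_mono) auto
      qed
      then have fr: "\<bar>frequency ?k (snd v)\<bar> \<le> real ?d * norm v * weight ?k" by (simp add: mult_ac)
      have a2: "weight ?k * norm (a ?k ?s) \<le> C2 * E * ?w"
      proof -
        have "weight ?k ^ Suc ?d * norm (a ?k ?s) \<le> C2 * E" using C2(2)[of ?k ?s] E[OF y] C2(1) by (meson mult_left_mono order_trans)
        then show ?thesis using w0 by (simp add: field_simps)
      qed
      have "norm (((pi / B * frequency ?k (snd v)) *\<^sub>R (\<i> * wave B ?k (snd y))) *s a ?k ?s)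
        = \<bar>pi / B\<bar> * \<bar>frequency ?k (snd v)\<bar> * norm (a ?k ?s)"
        by (simp add: norm_vector_scalar_mult norm_mult norm_wave abs_mult)
      also have "\<dots> \<le> \<bar>pi / B\<bar> * (real ?d * norm v * weight ?k) * norm (a ?k ?s)"
        using fr by (intro mult_right_mono mult_left_mono) auto
      also have "\<dots> = \<bar>pi / B\<bar> * (real ?d * norm v) * (weight ?k * norm (a ?k ?s))" by simp
      also have "\<dots> \<le> \<bar>pi / B\<bar> * (real ?d * norm v) * (C2 * E * ?w)"
        using a2 by (intro mult_left_mono) auto
      finally show ?thesis .
    qed
    ultimately have "norm (f' n y v) \<le> norm v * (2 / t) * (C1 * E * ?w) + \<bar>pi / B\<bar> * (real ?d * norm v) * (C2 * E * ?w)"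
      unfolding f'_def by (intro norm_triangle_mono)
    then show ?thesis unfolding M_def by (simp add: algebra_simps)
  qed
  have sM: "summable M" unfolding M_def by (intro summable_mult summable_mode_weight)
  have D: "((\<lambda>y. \<Sum>n. f n y) has_derivative (\<lambda>v. \<Sum>n. f' n z v)) (at z)"
    using has_derivative_suminf_Mtest(2)[OF S df M sM _ S(3)] summable_fseries[OF da] unfolding f_def by blast
  have "(\<Sum>n. f' n z v) = (fst v / fst z) *\<^sub>R fseries B (mode_deriv a) z
    + (\<Sum>j\<in>UNIV. snd v $ j *\<^sub>R fseries B (freq_mult B j a) z)" for v
  proof -
    let ?s = "ln (fst z)"
    have sj: "summable (\<lambda>n. wave B (?e n) (snd z) *s freq_mult B j a (?e n) ?s)" for j
      by (rule summable_fseries[OF rapid_n_decaying[OF rapid_n_freq_mult[OF a]]])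
    have s': "summable (\<lambda>n. wave B (?e n) (snd z) *s mode_deriv a (?e n) ?s)" by (rule summable_fseries[OF da'])
    have eq: "f' n z v = (fst v / fst z) *\<^sub>R (wave B (?e n) (snd z) *s mode_deriv a (?e n) ?s)
        + (\<Sum>j\<in>UNIV. snd v $ j *\<^sub>R (wave B (?e n) (snd z) *s freq_mult B j a (?e n) ?s))" for n
    proof -
      have "((pi / B * frequency (?e n) (snd v)) *\<^sub>R (\<i> * wave B (?e n) (snd z))) *s a (?e n) ?s
        = (\<Sum>j\<in>UNIV. snd v $ j *\<^sub>R (wave B (?e n) (snd z) *s freq_mult B j a (?e n) ?s))"
        unfolding frequency_def freq_mult_def
        by (simp add: vec_eq_iff sum_distrib_left sum_distrib_right) (simp add: scaleR_conv_of_real sum_distrib_left sum_distrib_right mult_ac)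
      then show ?thesis unfolding f'_def by (simp add: vsc_simps)
    qed
    have sB: "summable (\<lambda>n. \<Sum>j\<in>UNIV. snd v $ j *\<^sub>R (wave B (?e n) (snd z) *s freq_mult B j a (?e n) ?s))"
      by (intro summable_sum summable_scaleR_right sj)
    have "(\<Sum>n. f' n z v) = (\<Sum>n. (fst v / fst z) *\<^sub>R (wave B (?e n) (snd z) *s mode_deriv a (?e n) ?s))
      + (\<Sum>n. \<Sum>j\<in>UNIV. snd v $ j *\<^sub>R (wave B (?e n) (snd z) *s freq_mult B j a (?e n) ?s))"
      unfolding eq by (rule suminf_add[OF summable_scaleR_right[OF s'] sB, symmetric])
    also have "(\<Sum>n. \<Sum>j\<in>UNIV. snd v $ j *\<^sub>R (wave B (?e n) (snd z) *s freq_mult B j a (?e n) ?s))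
      = (\<Sum>j\<in>UNIV. \<Sum>n. snd v $ j *\<^sub>R (wave B (?e n) (snd z) *s freq_mult B j a (?e n) ?s))"
      by (intro suminf_sum summable_scaleR_right sj)
    finally show ?thesis unfolding fseries_def
      by (simp only: suminf_scaleR_right[OF s', symmetric] suminf_scaleR_right[OF sj, symmetric])
  qed
  then show ?thesis using D unfolding fseries_def[abs_def] f_def by simp
qed

lemma rapid_mode_deriv: "rapid \<mu> a \<Longrightarrow> rapid \<mu> (mode_deriv a)"
  unfolding rapid_def by (metis rapid_n.simps(2))

lemma rapid_freq_mult: "rapid \<mu> a \<Longrightarrow> rapid \<mu> (freq_mult B j a)"
  unfolding rapid_def by (simp add: rapid_n_freq_mult)

lemma rapid_decaying: "rapid \<mu> a \<Longrightarrow> decaying \<mu> a"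
  unfolding rapid_def using rapid_n_decaying by blast

lemma smooth_on_fseries:
  fixes a :: "int ^ 'n::finite \<Rightarrow> real \<Rightarrow> complex ^ 'm::finite"
  assumes "rapid \<mu> a"
  shows "smooth_on spacetime (fseries B a)"
proof (rule smooth_on_coinduct[where C="{fseries B a | a. \<exists>\<mu>. rapid \<mu> a}"])
  show "open (spacetime :: 'n point set)" by (rule open_spacetime)
  show "fseries B a \<in> {fseries B a | a. \<exists>\<mu>. rapid \<mu> a}" using assms by blast
  fix g :: "'n point \<Rightarrow> complex ^ 'm" and v :: "'n point" assume "g \<in> {fseries B a | a. \<exists>\<mu>. rapid \<mu> a}"
  then obtain a \<mu> where g: "g = fseries B a" and a: "rapid \<mu> a" by blast
  have a1: "rapid_n (Suc 0) \<mu> a" using a by (simp add: rapid_def)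
  note d = has_derivative_fseries[OF a1, of _ B]
  show "g differentiable at z" if "z \<in> spacetime" for z unfolding g using d[OF that] by (rule differentiableI)
  define h1 where "h1 k s = fst v *\<^sub>R (exp ((-1) * s) *\<^sub>R mode_deriv a k s)" for k s
  define h2 where "h2 k s = (\<Sum>j\<in>UNIV. snd v $ j *\<^sub>R freq_mult B j a k s)" for k s
  have r0: "rapid_n n (\<mu> + (-1)) (\<lambda>k s. exp ((-1) * s) *\<^sub>R mode_deriv a k s)" for n
    by (rule rapid_n_exp) (use rapid_mode_deriv[OF a] in \<open>simp add: rapid_def\<close>)
  have r1: "rapid_n n (\<mu> + (-1)) h1" for n
    unfolding h1_def[abs_def] by (rule rapid_n_linear[OF bounded_linear_scaleR_right r0])
  have rj: "rapid_n n (\<mu> + (-1)) (\<lambda>k s. snd v $ j *\<^sub>R freq_mult B j a k s)" for n j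
    by (rule rapid_n_linear[OF bounded_linear_scaleR_right], rule rapid_n_mono[of n \<mu>])
       (use rapid_freq_mult[OF a] in \<open>auto simp: rapid_def\<close>)
  have r2: "rapid_n n (\<mu> + (-1)) h2" for n
    unfolding h2_def[abs_def] by (rule rapid_n_sum[OF finite UNIV_not_empty rj])
  show "\<exists>h\<in>{fseries B a | a. \<exists>\<mu>. rapid \<mu> a}. \<forall>z\<in>spacetime. dir_deriv v g z = h z"
  proof (intro bexI[of _ "fseries B (\<lambda>k s. h1 k s + h2 k s)"] ballI)
    show "fseries B (\<lambda>k s. h1 k s + h2 k s) \<in> {fseries B a | a. \<exists>\<mu>. rapid \<mu> a}"
      using rapid_n_add[OF r1 r2] unfolding rapid_def by blast
    fix z :: "'n point" assume z: "z \<in> spacetime"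
    have "fseries B (\<lambda>k s. h1 k s + h2 k s) z = fseries B h1 z + fseries B h2 z"
      by (rule fseries_add[OF rapid_n_decaying[OF r1] rapid_n_decaying[OF r2]])
    also have "fseries B h1 z = fst v *\<^sub>R (fst z powr (-1) *\<^sub>R fseries B (mode_deriv a) z)"
      unfolding h1_def[abs_def] fseries_scaleR[OF rapid_n_decaying[OF r0]]
      by (subst fseries_exp[OF rapid_decaying[OF rapid_mode_deriv[OF a]] z]) simp
    also have "fseries B h2 z = (\<Sum>j\<in>UNIV. snd v $ j *\<^sub>R fseries B (freq_mult B j a) z)"
      unfolding h2_def[abs_def]
      by (subst fseries_sum[OF _ _ rj]) (simp_all add: fseries_scaleR[OF rapid_decaying[OF rapid_freq_mult[OF a]]])
    finally show "dir_deriv v g z = fseries B (\<lambda>k s. h1 k s + h2 k s) z"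
      unfolding g dir_deriv_eqI[OF d[OF z]] using z by (simp add: powr_minus spacetime_def divide_inverse)
  qed
qed

lemma t_deriv_t_fseries:
  "rapid \<mu> a \<Longrightarrow> z \<in> spacetime \<Longrightarrow> t_deriv_t (fseries B a) z = fseries B (mode_deriv a) z"
  using dir_deriv_eqI[OF has_derivative_fseries[of \<mu> a z B], of "(1, 0)"]
  by (simp add: t_deriv_t_def rapid_def spacetime_def)

lemma deriv_x_fseries:
  assumes "rapid \<mu> a" "z \<in> spacetime" shows "deriv_x j (fseries B a) z = fseries B (freq_mult B j a) z"
proof -
  have "(\<Sum>i\<in>UNIV. axis j (1::real) $ i *\<^sub>R fseries B (freq_mult B i a) z) = fseries B (freq_mult B j a) z"
    by (simp add: axis_def if_distrib if_distribR sum.delta cong: if_cong)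
  moreover have "rapid_n (Suc 0) \<mu> a" using assms(1) unfolding rapid_def by blast
  from dir_deriv_eqI[OF has_derivative_fseries[OF this assms(2), of B], of "(0, axis j 1)"]
  have "deriv_x j (fseries B a) z = (\<Sum>i\<in>UNIV. axis j (1::real) $ i *\<^sub>R fseries B (freq_mult B i a) z)" by simp
  ultimately show ?thesis by simp
qed

section \<open>Fourier coefficients of test functions\<close>

definition supported_in_box :: "real \<Rightarrow> real \<Rightarrow> real \<Rightarrow> (('n::finite) point \<Rightarrow> 'b::real_normed_vector) \<Rightarrow> bool" where
  "supported_in_box r t0 t1 F \<longleftrightarrow> smooth_on spacetime F \<and>
     (\<forall>z\<in>spacetime. F z \<noteq> 0 \<longrightarrow> t0 \<le> fst z \<and> fst z \<le> t1 \<and> snd z \<in> Cube r)"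

definition coefficients :: "real \<Rightarrow> (('n::finite) point \<Rightarrow> complex ^ ('m::finite)) \<Rightarrow> int ^ 'n \<Rightarrow> real \<Rightarrow> complex ^ 'm" where
  "coefficients B F k s = (1 / (2 * B) ^ CARD('n)) *\<^sub>R integral (Cube B) (\<lambda>x. wave B (- k) x *s F (exp s, x))"

lemma supported_in_box_dir_deriv:
  fixes F :: "('n::finite) point \<Rightarrow> 'b::real_normed_vector"
  assumes F: "supported_in_box r t0 t1 F"
  shows "supported_in_box r t0 t1 (dir_deriv v F)"
  unfolding supported_in_box_def
proof (intro conjI ballI impI)
  have sm: "smooth_on spacetime F" using F by (simp add: supported_in_box_def)
  then show "smooth_on spacetime (dir_deriv v F)" by (rule smooth_on_dir_deriv)
  fix z :: "'n point" assume z: "z \<in> spacetime" and ne: "dir_deriv v F z \<noteq> 0"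
  have cl: "closed ({t0..t1} \<times> (Cube r :: (real ^ 'n) set))" unfolding Cube_def by (intro closed_Times closed_cbox closed_real_atLeastAtMost)
  have "z \<in> {t0..t1} \<times> Cube r"
  proof (rule ccontr)
    assume out: "z \<notin> {t0..t1} \<times> Cube r"
    have "open ((spacetime :: 'n point set) - {t0..t1} \<times> Cube r)" using open_spacetime cl by (rule open_Diff)
    then have "dir_deriv v F z = dir_deriv v (\<lambda>_. 0) z"
      by (rule dir_deriv_cong) (use z out F smooth_on_differentiable[OF sm z] in \<open>auto simp: supported_in_box_def\<close>)
    then show False using ne by (simp add: dir_deriv_const)
  qed
  then show "t0 \<le> fst z" "fst z \<le> t1" "snd z \<in> Cube r" by (auto simp: mem_Times_iff)
qed

lemma supported_in_box_t_deriv_t: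
  assumes F: "supported_in_box r t0 t1 F" shows "supported_in_box r t0 t1 (t_deriv_t F)"
  using supported_in_box_dir_deriv[OF F, of "(1, 0)"] smooth_on_t_deriv_t[of F] F
  unfolding supported_in_box_def t_deriv_t_def by auto

lemma continuous_on_slice:
  assumes "smooth_on spacetime F" "0 < t" shows "continuous_on S (\<lambda>x. F (t, x))"
  by (rule continuous_on_compose2[OF smooth_on_continuous_on[OF assms(1)]])
     (use assms(2) in \<open>auto intro!: continuous_intros simp: spacetime_def\<close>)

lemma integrable_coefficient:
  fixes F :: "('n::finite) point \<Rightarrow> complex ^ ('m::finite)"
  assumes "smooth_on spacetime F"
  shows "(\<lambda>x. wave B k x *s F (exp s, x)) integrable_on Cube B"
  unfolding Cube_def by (intro integrable_continuous continuous_on_vsc continuous_on_wave continuous_on_slice assms exp_gt_zero)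

lemma has_vector_derivative_coefficients:
  fixes F :: "('n::finite) point \<Rightarrow> complex ^ ('m::finite)"
  assumes F: "smooth_on spacetime F"
  shows "(coefficients B F k has_vector_derivative coefficients B (t_deriv_t F) k s) (at s)"
proof -
  have pos: "(exp s, x) \<in> spacetime" for s and x :: "real ^ 'n" by (simp add: spacetime_def)
  have "((\<lambda>s. integral (Cube B) (\<lambda>x. wave B (- k) x *s F (exp s, x))) has_vector_derivative
      integral (Cube B) (\<lambda>x. wave B (- k) x *s t_deriv_t F (exp s, x))) (at s within UNIV)"
    unfolding Cube_def
  proof (rule leibniz_rule_vector_derivative[where U=UNIV and f="\<lambda>s x. wave B (- k) x *s F (exp s, x)"
        and fx="\<lambda>s x. wave B (- k) x *s t_deriv_t F (exp s, x)"])
    fix s :: real and x :: "real ^ 'n"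
    have "((\<lambda>t. F (t, x)) has_vector_derivative deriv_t F (exp s, x)) (at (exp s))"
      by (rule has_vector_derivative_time_slice[OF smooth_on_has_derivative[OF F pos]])
    moreover have "(exp has_vector_derivative exp s) (at s)"
      by (auto intro!: derivative_eq_intros simp: has_real_derivative_iff_has_vector_derivative[symmetric])
    ultimately have "((\<lambda>s. F (exp s, x)) has_vector_derivative t_deriv_t F (exp s, x)) (at s)"
      using vector_diff_chain_at[of exp "exp s" s "\<lambda>t. F (t, x)"] by (simp add: o_def t_deriv_t_def)
    then show "((\<lambda>s. wave B (- k) x *s F (exp s, x)) has_vector_derivative wave B (- k) x *s t_deriv_t F (exp s, x)) (at s within UNIV)"
      using bounded_linear.has_vector_derivative[OF bounded_linear_vsc] by blast
  next
    show "(\<lambda>x. wave B (- k) x *s F (exp s, x)) integrable_on cbox (\<chi> j. - B) (\<chi> j. B)" for s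
      using integrable_coefficient[OF F] unfolding Cube_def .
    show "continuous_on (UNIV \<times> cbox (\<chi> j. - B) (\<chi> j. B)) (\<lambda>(s, x). wave B (- k) x *s t_deriv_t F (exp s, x))"
      unfolding split_beta
      by (intro continuous_on_vsc continuous_on_compose2[OF continuous_on_wave[of UNIV]]
          continuous_on_compose2[OF smooth_on_continuous_on[OF smooth_on_t_deriv_t[OF F]]] continuous_intros)
        (auto simp: spacetime_def)
  qed auto
  then show ?thesis unfolding coefficients_def[abs_def]
    using bounded_linear.has_vector_derivative[OF bounded_linear_scaleR_right] by fastforce
qed

text \<open>Integration by parts; there are no boundary terms because of the support.\<close>

lemma coefficients_deriv_x:
  fixes F :: "('n::finite) point \<Rightarrow> complex ^ ('m::finite)"
  assumes F: "supported_in_box r t0 t1 F" and r: "r < B"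
  shows "coefficients B (deriv_x j F) = freq_mult B j (coefficients B F)"
proof (intro ext)
  fix k :: "int ^ 'n" and s :: real
  have sm: "smooth_on spacetime F" using F by (simp add: supported_in_box_def)
  note smj = smooth_on_dir_deriv[OF sm]
  have pos: "(exp s, x) \<in> spacetime" for x :: "real ^ 'n" by (simp add: spacetime_def)
  let ?l = "\<i> * complex_of_real (pi / B * of_int (k $ j))"
  let ?w = "\<lambda>x. wave B (- k) x *s F (exp s, x)"
  let ?wx = "\<lambda>x. wave B (- k) x *s deriv_x j F (exp s, x) - ?l *s ?w x"
  have out: "F (exp s, x) = 0" "deriv_x j F (exp s, x) = 0" if "x \<notin> Cube B" for x
  proof -
    have "x \<notin> Cube r" using that r by (auto simp: mem_Cube) (metis dual_order.trans less_imp_le)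
    then show "F (exp s, x) = 0" "deriv_x j F (exp s, x) = 0"
      using F supported_in_box_dir_deriv[OF F, of "(0, axis j 1)"] pos unfolding supported_in_box_def by force+
  qed
  have "integral (Cube B) ?wx = 0" unfolding Cube_def
  proof (rule integral_directional_derivative_eq_0[where w="?w" and e="axis j 1"])
    fix x :: "real ^ 'n"
    have 1: "((\<lambda>h. F (exp s, x + h *\<^sub>R axis j 1)) has_vector_derivative deriv_x j F (exp s, x)) (at 0)"
      by (rule has_vector_derivative_space_slice[OF smooth_on_has_derivative[OF sm pos]])
    have 2: "((\<lambda>h. wave B (- k) (x + h *\<^sub>R axis j 1)) has_vector_derivative - (?l * wave B (- k) x)) (at 0)"
    proof -
      have "((\<lambda>h::real. x + h *\<^sub>R axis j 1) has_derivative (\<lambda>h. h *\<^sub>R axis j 1)) (at 0)" by (auto intro!: derivative_eq_intros)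
      from has_derivative_compose[OF this, of "wave B (- k)"] has_derivative_wave[of B "- k" x]
      have "((\<lambda>h. wave B (- k) (x + h *\<^sub>R axis j 1)) has_derivative
         (\<lambda>h. (pi / B * frequency (- k) (h *\<^sub>R axis j 1)) *\<^sub>R (\<i> * wave B (- k) x))) (at 0)" by simp
      moreover have "(\<lambda>h. (pi / B * frequency (- k) (h *\<^sub>R axis j 1)) *\<^sub>R (\<i> * wave B (- k) x)) = (\<lambda>h. h *\<^sub>R (- (?l * wave B (- k) x)))"
        by (simp only: frequency_simps frequency_axis) (simp add: fun_eq_iff scaleR_conv_of_real)
      ultimately show ?thesis unfolding has_vector_derivative_def by simp
    qed
    have "((\<lambda>h. wave B (- k) (x + h *\<^sub>R axis j 1) *s F (exp s, x + h *\<^sub>R axis j 1)) has_vector_derivative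
      wave B (- k) (x + 0 *\<^sub>R axis j 1) *s deriv_x j F (exp s, x) + (- (?l * wave B (- k) x)) *s F (exp s, x + 0 *\<^sub>R axis j 1)) (at 0)"
      by (rule bounded_bilinear.has_vector_derivative[OF bounded_bilinear_vsc 2 1])
    moreover have "wave B (- k) (x + 0 *\<^sub>R axis j 1) *s deriv_x j F (exp s, x) + (- (?l * wave B (- k) x)) *s F (exp s, x + 0 *\<^sub>R axis j 1) = ?wx x"
      by (simp add: vec_eq_iff)
    ultimately show "((\<lambda>h. wave B (- k) (x + h *\<^sub>R axis j 1) *s F (exp s, x + h *\<^sub>R axis j 1)) has_vector_derivative ?wx x) (at 0)"
      by simp
  next
    show "continuous_on UNIV ?w" by (intro continuous_on_vsc continuous_on_wave continuous_on_slice[OF sm] exp_gt_zero)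
    show "continuous_on UNIV ?wx"
      by (intro continuous_on_diff continuous_on_vsc continuous_on_wave continuous_on_slice[OF sm] continuous_on_slice[OF smj] continuous_on_const exp_gt_zero)
    show "?w x = 0" if "x \<notin> cbox (\<chi> j. - B) (\<chi> j. B)" for x
      using out(1)[of x] that by (simp add: Cube_def vsc_simps)
    show "?wx x = 0" if "x \<notin> cbox (\<chi> j. - B) (\<chi> j. B)" for x
      using out[of x] that by (simp add: Cube_def vsc_simps)
    show "norm (axis j (1::real)) \<le> 1" by simp
  qed
  moreover have "integral (Cube B) ?wx = integral (Cube B) (\<lambda>x. wave B (- k) x *s deriv_x j F (exp s, x)) - ?l *s integral (Cube B) ?w"
  proof -
    have "(\<lambda>x. ?l *s ?w x) integrable_on Cube B"
      using integrable_linear[OF integrable_coefficient[OF sm] bounded_linear_vsc[of ?l]] unfolding o_def .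
    then show ?thesis
      unfolding integral_vsc[OF integrable_coefficient[OF sm], symmetric]
      by (intro integral_diff integrable_coefficient smj)
  qed
  ultimately have "integral (Cube B) (\<lambda>x. wave B (- k) x *s deriv_x j F (exp s, x)) = ?l *s integral (Cube B) ?w" by simp
  then show "coefficients B (deriv_x j F) k s = freq_mult B j (coefficients B F) k s"
    by (simp add: coefficients_def freq_mult_def vsc_simps)
qed

lemma coefficients_pointwise_bound:
  fixes F :: "('n::finite) point \<Rightarrow> complex ^ ('m::finite)"
  assumes F: "supported_in_box r t0 t1 F" and t0: "0 < t0" and B: "0 < B"
  obtains C where "\<forall>k s. norm (coefficients B F k s) \<le> C * exp (\<mu> * s)"
    "\<forall>k s. t1 < exp s \<longrightarrow> coefficients B F k s = 0"
proof -
  have sm: "smooth_on spacetime F" using F by (simp add: supported_in_box_def)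
  have zero: "F (exp s, x) = 0" if "\<not> (t0 \<le> exp s \<and> exp s \<le> t1)" for s x
  proof (rule ccontr)
    assume "F (exp s, x) \<noteq> 0"
    moreover have "(exp s, x) \<in> spacetime" by (simp add: spacetime_def)
    ultimately show False using F that unfolding supported_in_box_def by (metis fst_conv)
  qed
  have z: "coefficients B F k s = 0" if "\<not> (t0 \<le> exp s \<and> exp s \<le> t1)" for k s
    by (simp add: coefficients_def zero[OF that] vsc_simps)
  let ?K = "{t0..t1} \<times> (Cube B :: (real ^ 'n) set)"
  have "compact (F ` ?K)" unfolding Cube_def
    by (intro compact_continuous_image compact_Times compact_Icc compact_cbox continuous_on_subset[OF smooth_on_continuous_on[OF sm]])
       (use t0 in \<open>auto simp: spacetime_def\<close>)
  then have "bounded (F ` ?K)" by (rule compact_imp_bounded)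
  then obtain M where M: "M > 0" "\<forall>v\<in>F ` ?K. norm v \<le> M" unfolding bounded_pos by blast
  let ?V = "1 / (2 * B) ^ CARD('n)"
  let ?D = "?V * (M * measure lborel (Cube B :: (real ^ 'n) set))"
  have V: "?V \<ge> 0" using B by simp
  have D: "?D \<ge> 0" using V M by (intro mult_nonneg_nonneg) auto
  have b: "norm (coefficients B F k s) \<le> ?D" if "t0 \<le> exp s" "exp s \<le> t1" for k s
  proof -
    have "norm (integral (Cube B) (\<lambda>x. wave B (- k) x *s F (exp s, x))) \<le> M * measure lborel (Cube B :: (real ^ 'n) set)"
      unfolding Cube_def
    proof (rule integrable_bound)
      show "0 \<le> M" using M by simp
      show "(\<lambda>x. wave B (- k) x *s F (exp s, x)) integrable_on cbox (\<chi> j. - B) (\<chi> j. B)"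
        using integrable_coefficient[OF sm] unfolding Cube_def .
      show "norm (wave B (- k) x *s F (exp s, x)) \<le> M" if "x \<in> cbox (\<chi> j. - B) (\<chi> j. B)" for x
        using bspec[OF M(2), of "F (exp s, x)"] that \<open>t0 \<le> exp s\<close> \<open>exp s \<le> t1\<close> by (simp add: norm_wave_vsc Cube_def)
    qed
    then show ?thesis unfolding coefficients_def norm_scaleR using V by (simp add: mult_left_mono divide_right_mono)
  qed
  let ?E = "exp (\<bar>\<mu>\<bar> * (\<bar>ln t0\<bar> + \<bar>ln t1\<bar>))"
  have "norm (coefficients B F k s) \<le> (?D * ?E) * exp (\<mu> * s)" for k s
  proof (cases "t0 \<le> exp s \<and> exp s \<le> t1")
    case True
    have "0 < t1" using True t0 by auto
    have "ln t0 \<le> ln (exp s)" "ln (exp s) \<le> ln t1" using True t0 \<open>0 < t1\<close> by (simp_all only: ln_le_cancel_iff exp_gt_zero)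
    then have "\<bar>s\<bar> \<le> \<bar>ln t0\<bar> + \<bar>ln t1\<bar>" by simp
    then have "\<bar>\<mu>\<bar> * \<bar>s\<bar> \<le> \<bar>\<mu>\<bar> * (\<bar>ln t0\<bar> + \<bar>ln t1\<bar>)" by (intro mult_left_mono) auto
    then have "0 \<le> \<bar>\<mu>\<bar> * (\<bar>ln t0\<bar> + \<bar>ln t1\<bar>) + \<mu> * s" using abs_ge_minus_self[of "\<mu> * s"] by (simp add: abs_mult)
    then have "1 \<le> ?E * exp (\<mu> * s)" by (simp add: exp_add[symmetric])
    then have "?D * 1 \<le> ?D * (?E * exp (\<mu> * s))" using D by (rule mult_left_mono)
    moreover have "norm (coefficients B F k s) \<le> ?D" using b True by blast
    ultimately show ?thesis by linarith
  next
    case False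
    then have "coefficients B F k s = 0" using z by blast
    moreover have "0 \<le> (?D * ?E) * exp (\<mu> * s)" by (intro mult_nonneg_nonneg D) auto
    ultimately show ?thesis by (simp only: norm_zero)
  qed
  moreover have "coefficients B F k s = 0" if "t1 < exp s" for k s using z[of s k] that by simp
  ultimately show thesis using that by blast
qed

lemma supported_in_box_laplace:
  assumes F: "supported_in_box r t0 t1 F"
  shows "supported_in_box r t0 t1 (\<lambda>z. F z - (\<Sum>j\<in>UNIV. c *\<^sub>R deriv_x j (deriv_x j F) z))"
proof -
  have j: "supported_in_box r t0 t1 (deriv_x j (deriv_x j F))" for j by (intro supported_in_box_dir_deriv F)
  have "smooth_on spacetime (\<lambda>z. F z - (\<Sum>j\<in>UNIV. c *\<^sub>R deriv_x j (deriv_x j F) z))"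
    using F j unfolding supported_in_box_def
    by (intro smooth_on_diff smooth_on_sum open_spacetime smooth_on_linear_comp[OF bounded_linear_scaleR_right]) auto
  moreover have "t0 \<le> fst z \<and> fst z \<le> t1 \<and> snd z \<in> Cube r"
    if z: "z \<in> spacetime" "F z - (\<Sum>j\<in>UNIV. c *\<^sub>R deriv_x j (deriv_x j F) z) \<noteq> 0" for z
  proof (rule ccontr)
    assume "\<not> ?thesis"
    then have "F z = 0" "deriv_x j (deriv_x j F) z = 0" for j
      using F j[of j] z(1) unfolding supported_in_box_def by blast+
    then show False using z(2) by simp
  qed
  ultimately show ?thesis unfolding supported_in_box_def by blast
qed

text \<open>
  The weight is the symbol of \<open>1 - (B / \<pi>)\<^sup>2 \<Delta>\<close>. Iterating this identity bounds the coefficients by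
  any negative power of the weight.
\<close>

lemma weight_mult_coefficients:
  fixes F :: "('n::finite) point \<Rightarrow> complex ^ ('m::finite)"
  assumes F: "supported_in_box r t0 t1 F" and r: "r < B" and B: "0 < B"
  shows "coefficients B (\<lambda>z. F z - (\<Sum>j\<in>UNIV. ((B / pi)\<^sup>2) *\<^sub>R deriv_x j (deriv_x j F) z)) k s = weight k *\<^sub>R coefficients B F k s"
proof -
  have sm: "smooth_on spacetime F" using F by (simp add: supported_in_box_def)
  have smj: "smooth_on spacetime (deriv_x j (deriv_x j F))" for j by (intro smooth_on_dir_deriv sm)
  let ?V = "1 / (2 * B) ^ CARD('n)"
  let ?I = "\<lambda>G. integral (Cube B) (\<lambda>x. wave B (- k) x *s G (exp s, x))"
  have jj: "coefficients B (deriv_x j (deriv_x j F)) k s = - ((pi / B * of_int (k $ j))\<^sup>2 *\<^sub>R coefficients B F k s)" for j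
    unfolding coefficients_deriv_x[OF supported_in_box_dir_deriv[OF F] r] coefficients_deriv_x[OF F r] freq_mult_def
    by (simp add: vec_eq_iff) (simp add: scaleR_conv_of_real power2_eq_square mult_ac)
  have i: "(\<lambda>x. wave B (- k) x *s (\<Sum>j\<in>UNIV. ((B / pi)\<^sup>2) *\<^sub>R deriv_x j (deriv_x j F) (exp s, x))) integrable_on Cube B"
    unfolding vsc_simps by (intro integrable_sum integrable_cmul integrable_coefficient smj) auto
  have "?I (\<lambda>z. F z - (\<Sum>j\<in>UNIV. ((B / pi)\<^sup>2) *\<^sub>R deriv_x j (deriv_x j F) z))
    = ?I F - integral (Cube B) (\<lambda>x. wave B (- k) x *s (\<Sum>j\<in>UNIV. ((B / pi)\<^sup>2) *\<^sub>R deriv_x j (deriv_x j F) (exp s, x)))"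
    unfolding vsc_simps(4) by (rule integral_diff[OF integrable_coefficient[OF sm] i])
  also have "integral (Cube B) (\<lambda>x. wave B (- k) x *s (\<Sum>j\<in>UNIV. ((B / pi)\<^sup>2) *\<^sub>R deriv_x j (deriv_x j F) (exp s, x)))
    = (\<Sum>j\<in>UNIV. ((B / pi)\<^sup>2) *\<^sub>R ?I (deriv_x j (deriv_x j F)))"
    unfolding vsc_simps
    by (subst integral_sum) (auto intro!: integrable_cmul integrable_coefficient smj)
  finally have "coefficients B (\<lambda>z. F z - (\<Sum>j\<in>UNIV. ((B / pi)\<^sup>2) *\<^sub>R deriv_x j (deriv_x j F) z)) k s
    = coefficients B F k s - (\<Sum>j\<in>UNIV. ((B / pi)\<^sup>2) *\<^sub>R coefficients B (deriv_x j (deriv_x j F)) k s)"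
    unfolding coefficients_def by (simp add: scaleR_diff_right scaleR_sum_right mult.commute)
  also have "\<dots> = coefficients B F k s + (\<Sum>j\<in>UNIV. (of_int (k $ j))\<^sup>2) *\<^sub>R coefficients B F k s"
    unfolding jj using B by (simp add: sum_negf scaleR_sum_left power_mult_distrib power_divide)
  also have "\<dots> = weight k *\<^sub>R coefficients B F k s" by (simp add: weight_def scaleR_left_distrib)
  finally show ?thesis .
qed

lemma decaying_coefficients:
  fixes F :: "('n::finite) point \<Rightarrow> complex ^ ('m::finite)"
  assumes F: "supported_in_box r t0 t1 F" and t0: "0 < t0" and r: "r < B" and B: "0 < B"
  shows "decaying \<mu> (coefficients B F)"
  unfolding decaying_def
proof (intro conjI allI)
  show "\<exists>s1. \<forall>k s. s1 \<le> s \<longrightarrow> coefficients B F k s = 0"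
  proof (intro exI[of _ "ln (max t1 0 + 1)"] allI impI)
    fix k s assume s: "ln (max t1 0 + 1) \<le> s"
    have "max t1 0 + 1 = exp (ln (max t1 0 + 1))" by (subst exp_ln) auto
    also have "\<dots> \<le> exp s" using s by (subst exp_le_cancel_iff)
    finally have "t1 < exp s" by linarith
    moreover obtain C where "\<forall>k s. norm (coefficients B F k s) \<le> C * exp (0 * s)"
      and "\<forall>k s. t1 < exp s \<longrightarrow> coefficients B F k s = 0"
      by (rule coefficients_pointwise_bound[OF F t0 B])
    ultimately show "coefficients B F k s = 0" by blast
  qed
  fix N
  show "\<exists>C. \<forall>k s. weight k ^ N * norm (coefficients B F k s) \<le> C * exp (\<mu> * s)"
    using F
  proof (induction N arbitrary: F)
    case 0
    obtain C where "\<forall>k s. norm (coefficients B F k s) \<le> C * exp (\<mu> * s)"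
      and "\<forall>k s. t1 < exp s \<longrightarrow> coefficients B F k s = 0"
      by (rule coefficients_pointwise_bound[OF 0 t0 B])
    then show ?case by auto
  next
    case (Suc N)
    obtain C where C: "\<And>k s. weight k ^ N * norm (coefficients B (\<lambda>z. F z - (\<Sum>j\<in>UNIV. ((B / pi)\<^sup>2) *\<^sub>R deriv_x j (deriv_x j F) z)) k s) \<le> C * exp (\<mu> * s)"
      using Suc.IH[OF supported_in_box_laplace[OF Suc.prems]] by blast
    have "weight k ^ Suc N * norm (coefficients B F k s) \<le> C * exp (\<mu> * s)" for k s
      using C[of k s] weight_ge_1[of k] unfolding weight_mult_coefficients[OF Suc.prems r B] by (simp add: mult_ac)
    then show ?case by blast
  qed
qed

lemma rapid_coefficients:
  fixes F :: "('n::finite) point \<Rightarrow> complex ^ ('m::finite)"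
  assumes F: "supported_in_box r t0 t1 F" and t0: "0 < t0" and r: "r < B" and B: "0 < B"
  shows "rapid \<mu> (coefficients B F)"
proof -
  have "rapid_n n \<mu> (coefficients B F)" for n
    using F
  proof (induction n arbitrary: F)
    case 0
    then show ?case using decaying_coefficients[OF _ t0 r B] by simp
  next
    case (Suc n)
    show ?case
      by (rule rapid_n_SucI[OF decaying_coefficients[OF Suc.prems t0 r B] has_vector_derivative_coefficients
            Suc.IH[OF supported_in_box_t_deriv_t[OF Suc.prems]]])
         (use Suc.prems in \<open>simp add: supported_in_box_def\<close>)
  qed
  then show ?thesis by (simp add: rapid_def)
qed

text \<open>
  Both sides are continuous on the box and have the same Fourier coefficients, so
  \<open>fourier_uniqueness\<close> applies to their difference.
\<close>

theorem fourier_inversion: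
  fixes F :: "('n::finite) point \<Rightarrow> complex ^ ('m::finite)"
  assumes F: "supported_in_box r t0 t1 F" and t0: "0 < t0" and r: "r < B" and B: "0 < B"
    and z: "z \<in> spacetime" and x: "\<And>j. \<bar>snd z $ j\<bar> < B"
  shows "fseries B (coefficients B F) z = F z"
proof -
  define s where "s = ln (fst z)"
  have es: "exp s = fst z" using z by (simp add: s_def spacetime_def)
  have sm: "smooth_on spacetime F" using F by (simp add: supported_in_box_def)
  let ?e = "mode_enum :: nat \<Rightarrow> int ^ 'n" and ?a = "\<lambda>k. coefficients B F k s"
  have dec: "decaying 0 (coefficients B F)" by (rule decaying_coefficients[OF F t0 r B])
  define S where "S y = (\<Sum>n. wave B (?e n) y *s ?a (?e n))" for y
  define f where "f N y = (\<Sum>n<N. wave B (?e n) y *s ?a (?e n))" for N y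
  obtain C where C: "C \<ge> 0" "\<And>k s. norm (coefficients B F k s) \<le> C * exp (0 * s) * inverse (weight k ^ CARD('n))"
    using decaying_pointwise[OF dec] by blast
  have ul: "uniform_limit (Cube B) f S sequentially"
    unfolding f_def S_def
    by (rule Weierstrass_m_test[where M="\<lambda>n. C * inverse (weight (?e n) ^ CARD('n))"])
       (use C summable_mult[OF summable_mode_weight[where 'n='n], of C] in \<open>simp_all add: norm_wave_vsc\<close>)
  have cf: "continuous_on (Cube B) (f N)" for N
    unfolding f_def by (intro continuous_intros continuous_on_vsc continuous_on_wave)
  have cS: "continuous_on (Cube B) S"
    by (rule uniform_limit_theorem[OF _ ul]) (simp_all add: cf)
  let ?V = "(2 * B) ^ CARD('n)"
  have VM: "measure lborel (Cube B :: (real ^ 'n) set) = ?V"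
    using B by (simp add: Cube_def content_cbox_cart interval_ne_empty_cart)
  have "S (snd z) - F (exp s, snd z) = 0"
  proof (rule fourier_uniqueness[OF B, where g="\<lambda>y. S y - F (exp s, y)"])
    show "continuous_on (Cube B) (\<lambda>y. S y - F (exp s, y))"
      by (intro continuous_on_diff cS continuous_on_slice[OF sm] exp_gt_zero)
    show "\<bar>snd z $ j\<bar> < B" for j by (rule x)
    fix k :: "int ^ 'n"
    have iw: "integral (Cube B) (\<lambda>y. wave B k y *s (wave B l y *s v)) = (if l = - k then ?V *\<^sub>R v else 0)" for l and v :: "complex ^ 'm"
    proof -
      have "integral (Cube B) (\<lambda>y. wave B k y *s (wave B l y *s v)) = integral (Cube B) (\<lambda>y. wave B (k + l) y *s v)"
        by (simp add: wave_add vector_smult_assoc)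
      also have "\<dots> = integral (Cube B) (wave B (k + l)) *s v"
        using integral_linear[OF _ bounded_bilinear.bounded_linear_left[OF bounded_bilinear_vsc], of "wave B (k + l)" "Cube B" v]
        by (simp add: o_def Cube_def integrable_continuous continuous_on_wave)
      also have "\<dots> = (if l = - k then ?V *\<^sub>R v else 0)"
      proof (cases "l = - k")
        case True
        then have "integral (Cube B) (wave B (k + l)) = of_real ?V"
        proof -
          have "wave B (k + l) = (\<lambda>_. 1 :: complex)" using True by (simp add: fun_eq_iff wave_0)
          then show ?thesis using VM[unfolded Cube_def] by (simp add: Cube_def scaleR_conv_of_real)
        qed
        then show ?thesis using True by (simp only: vsc_of_real if_True refl)
      next
        case False
        then have "k + l \<noteq> 0" by (metis add.commute eq_neg_iff_add_eq_0)
        then have "integral (Cube B) (wave B (k + l)) = 0" by (rule integral_wave_eq_0[OF B])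
          then show ?thesis using False by (simp only: vsc_simps if_False)
      qed
      finally show ?thesis .
    qed
    have iI: "(\<lambda>y. wave B k y *s (wave B l y *s v)) integrable_on Cube B" for l and v :: "complex ^ 'm"
      unfolding Cube_def by (intro integrable_continuous continuous_on_vsc continuous_on_wave continuous_on_const)
    have ipart: "integral (Cube B) (\<lambda>y. wave B k y *s f N y) = (\<Sum>n<N. if ?e n = - k then ?V *\<^sub>R ?a (?e n) else 0)" for N
      unfolding f_def vsc_simps by (subst integral_sum[OF finite_lessThan iI]) (simp only: iw)
    have "surj ?e" by (rule bij_is_surj[OF bij_mode_enum])
    then obtain n0 where n0': "- k = ?e n0" unfolding surj_def by blast
    then have n0: "?e n0 = - k" by (rule sym)
    have ie: "inj ?e" by (rule bij_is_inj[OF bij_mode_enum])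
    have inj: "(?e n = - k) = (n = n0)" for n
    proof
      assume "?e n = - k"
      then have "?e n = ?e n0" using n0 by (rule trans[OF _ sym])
      then show "n = n0" by (rule injD[OF ie])
    qed (use n0 in blast)
    have "(\<lambda>N. integral (Cube B) (\<lambda>y. wave B k y *s f N y)) \<longlonglongrightarrow> integral (Cube B) (\<lambda>y. wave B k y *s S y)"
    proof -
      have "uniform_limit (Cube B) (\<lambda>N y. wave B k y *s f N y) (\<lambda>y. wave B k y *s S y) sequentially"
      proof (rule uniform_limitI)
        fix e :: real assume "e > 0"
        from uniform_limitD[OF ul this] show "\<forall>\<^sub>F N in sequentially. \<forall>y\<in>Cube B. dist (wave B k y *s f N y) (wave B k y *s S y) < e"
          unfolding dist_norm vsc_simps(4)[symmetric] norm_wave_vsc .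
      qed
      then have ul': "uniform_limit (cbox (\<chi> j. - B) (\<chi> j. B)) (\<lambda>N y. wave B k y *s f N y) (\<lambda>y. wave B k y *s S y) sequentially"
        unfolding Cube_def .
      have c': "continuous_on (cbox (\<chi> j. - B) (\<chi> j. B)) (\<lambda>y. wave B k y *s f N y)" for N
        using cf unfolding Cube_def by (intro continuous_on_vsc continuous_on_wave)
      obtain I J where IJ: "\<And>N. ((\<lambda>y. wave B k y *s f N y) has_integral I N) (cbox (\<chi> j. - B) (\<chi> j. B))"
        "((\<lambda>y. wave B k y *s S y) has_integral J) (cbox (\<chi> j. - B) (\<chi> j. B))" "I \<longlonglongrightarrow> J"
        using uniform_limit_integral_cbox[OF ul' c' sequentially_bot] by blast
      show ?thesis
        unfolding Cube_def by (simp only: integral_unique[OF IJ(1)] integral_unique[OF IJ(2)] IJ(3))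
    qed
    moreover have "\<forall>\<^sub>F N in sequentially. (\<Sum>n<N. if ?e n = - k then ?V *\<^sub>R ?a (?e n) else 0) = ?V *\<^sub>R ?a (- k)"
      using eventually_gt_at_top[of n0]
      by eventually_elim (simp add: inj n0)
    then have "(\<lambda>N. \<Sum>n<N. if ?e n = - k then ?V *\<^sub>R ?a (?e n) else 0) \<longlonglongrightarrow> ?V *\<^sub>R ?a (- k)"
      by (rule tendsto_eventually)
    ultimately have "integral (Cube B) (\<lambda>y. wave B k y *s S y) = ?V *\<^sub>R ?a (- k)"
      unfolding ipart using LIMSEQ_unique by blast
    also have "\<dots> = integral (Cube B) (\<lambda>y. wave B k y *s F (exp s, y))"
      using B by (simp add: coefficients_def)
    finally have "integral (Cube B) (\<lambda>y. wave B k y *s S y) = integral (Cube B) (\<lambda>y. wave B k y *s F (exp s, y))" .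
    moreover have "(\<lambda>y. wave B k y *s S y) integrable_on Cube B"
      using cS unfolding Cube_def by (intro integrable_continuous continuous_on_vsc continuous_on_wave)
    ultimately show "integral (Cube B) (\<lambda>y. wave B k y *s (S y - F (exp s, y))) = 0"
      unfolding vsc_simps(4) by (subst integral_diff) (simp_all add: integrable_coefficient[OF sm])
  qed
  then show ?thesis using es by (simp add: S_def fseries_def s_def)
qed

section \<open>The equation for the Fourier coefficients\<close>

text \<open>
  The form in which \<open>linear_ode_exists\<close> applies to the Fourier modes: the coefficients are scalar
  functions times fixed linear maps, locally bounded because the scalar functions are continuous.
\<close>

lemma linear_ode_exists_sum:
  fixes T :: "'i \<Rightarrow> 'v::banach \<Rightarrow> 'v"
  assumes I: "finite I" and \<phi>: "\<And>i. continuous_on UNIV (\<phi> i)" and T: "\<And>i. bounded_linear (T i)"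
    and g: "continuous_on UNIV g" "0 < \<epsilon>" "\<And>s. s \<le> \<epsilon> \<Longrightarrow> g s = 0"
  obtains y where "\<forall>s. (y has_vector_derivative (\<Sum>i\<in>I. \<phi> i s *\<^sub>R T i (y s)) + g s) (at s)" "\<forall>s\<le>\<epsilon>. y s = (0::'v)"
proof -
  have bnd: "\<exists>K\<ge>0. \<forall>s\<in>{0..L}. \<forall>v. norm (\<Sum>i\<in>I. \<phi> i s *\<^sub>R T i v) \<le> K * norm v" for L
  proof -
    have "\<forall>i. \<exists>P\<ge>0. \<forall>s\<in>{0..L}. \<bar>\<phi> i s\<bar> \<le> (P::real)"
    proof
      fix i
      have "bounded (\<phi> i ` {0..L})"
        by (intro compact_imp_bounded compact_continuous_image continuous_on_subset[OF \<phi>]) auto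
      then show "\<exists>P\<ge>0. \<forall>s\<in>{0..L}. \<bar>\<phi> i s\<bar> \<le> (P::real)" unfolding bounded_pos by (auto intro: less_imp_le)
    qed
    then obtain P where P: "\<And>i. P i \<ge> 0" "\<And>i s. s \<in> {0..L} \<Longrightarrow> \<bar>\<phi> i s\<bar> \<le> P i" by metis
    have "\<forall>i. \<exists>K\<ge>0. \<forall>v. norm (T i v) \<le> norm v * K" using bounded_linear.nonneg_bounded[OF T] by blast
    then obtain K where K: "\<And>i. K i \<ge> 0" "\<And>i v. norm (T i v) \<le> norm v * K i" by metis
    have "norm (\<Sum>i\<in>I. \<phi> i s *\<^sub>R T i v) \<le> (\<Sum>i\<in>I. P i * K i) * norm v" if "s \<in> {0..L}" for s v
    proof -
      have "norm (\<Sum>i\<in>I. \<phi> i s *\<^sub>R T i v) \<le> (\<Sum>i\<in>I. P i * (norm v * K i))"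
        by (intro sum_norm_le) (auto intro!: mult_mono P K that)
      also have "\<dots> = (\<Sum>i\<in>I. P i * K i) * norm v" unfolding sum_distrib_right by (simp only: mult_ac)
      finally show ?thesis .
    qed
    moreover have "(\<Sum>i\<in>I. P i * K i) \<ge> 0" using P K by (intro sum_nonneg mult_nonneg_nonneg) auto
    ultimately show ?thesis by blast
  qed
  have "\<exists>y. (\<forall>s. (y has_vector_derivative (\<Sum>i\<in>I. \<phi> i s *\<^sub>R T i (y s)) + g s) (at s)) \<and> (\<forall>s\<le>\<epsilon>. y s = 0)"
  proof (rule linear_ode_exists[of "\<lambda>s v. \<Sum>i\<in>I. \<phi> i s *\<^sub>R T i v" g \<epsilon>])
    show "bounded_linear (\<lambda>v. \<Sum>i\<in>I. \<phi> i s *\<^sub>R T i v)" for s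
      by (intro bounded_linear_sum bounded_linear_const_scaleR T)
    show "continuous_on UNIV (\<lambda>s. \<Sum>i\<in>I. \<phi> i s *\<^sub>R T i (y s))" if "continuous_on UNIV y" for y
      by (intro continuous_intros \<phi> bounded_linear.continuous_on[OF T] that)
  qed (use bnd g in auto)
  then show thesis using that by blast
qed

text \<open>
  The spatial terms of \<open>kasner_op\<close> acting on Fourier modes in the time \<open>s = ln t\<close>.
\<close>

definition spatial_part ::
  "real \<Rightarrow> real ^ 'n \<Rightarrow> ('n \<Rightarrow> complex ^ 'm ^ 'm) \<Rightarrow> (int ^ 'n \<Rightarrow> real \<Rightarrow> complex ^ 'm) \<Rightarrow> int ^ ('n::finite) \<Rightarrow> real \<Rightarrow> complex ^ ('m::finite)" where
  "spatial_part B q bx a k s =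
     (\<Sum>j\<in>UNIV. exp (q $ j * s) *\<^sub>R (bx j *v freq_mult B j a k s)
        + - (exp (2 * q $ j * s) *\<^sub>R freq_mult B j (freq_mult B j a) k s))"

lemma rapid_n_spatial_part:
  assumes a: "rapid_n n \<nu> a" and d: "\<And>j. \<delta> \<le> q $ j" "0 \<le> \<delta>"
  shows "rapid_n n (\<nu> + \<delta>) (spatial_part B q bx a)"
  unfolding spatial_part_def[abs_def]
proof (rule rapid_n_sum[OF finite UNIV_not_empty rapid_n_add])
  fix j
  have "rapid_n n (\<nu> + q $ j) (\<lambda>k s. exp (q $ j * s) *\<^sub>R (bx j *v freq_mult B j a k s))"
    by (intro rapid_n_exp rapid_n_linear[OF bounded_bilinear.bounded_linear_right[OF bounded_bilinear_matrix_vector]] rapid_n_freq_mult a)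
  then show "rapid_n n (\<nu> + \<delta>) (\<lambda>k s. exp (q $ j * s) *\<^sub>R (bx j *v freq_mult B j a k s))"
    by (rule rapid_n_mono) (use d in auto)
  have "rapid_n n (\<nu> + 2 * q $ j) (\<lambda>k s. - (exp (2 * q $ j * s) *\<^sub>R freq_mult B j (freq_mult B j a) k s))"
    by (intro rapid_n_linear[OF bounded_linear_minus[OF bounded_linear_ident]] rapid_n_exp rapid_n_freq_mult a)
  then show "rapid_n n (\<nu> + \<delta>) (\<lambda>k s. - (exp (2 * q $ j * s) *\<^sub>R freq_mult B j (freq_mult B j a) k s))"
    by (rule rapid_n_mono) (use d(1)[of j] d(2) in auto)
qed

text \<open>
  The first order system for \<open>(w, w')\<close> that belongs to \<open>w'' + b w' + c w = 0\<close>. Its eigenvalues are the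
  indicial roots.
\<close>

definition companion :: "complex ^ 'm ^ 'm \<Rightarrow> complex ^ 'm ^ 'm \<Rightarrow> 'm phase \<Rightarrow> ('m::finite) phase" where
  "companion b c w = (snd w, - (b *v snd w) - c *v fst w)"

lemma matvec_vsc: "(M :: complex ^ 'm ^ 'm::finite) *v (l *s v) = l *s (M *v v)"
  by (simp add: vec_eq_iff matrix_vector_mult_def sum_distrib_left mult_ac)

lemma bounded_linear_companion: "bounded_linear (companion b c)"
  unfolding companion_def
  by (intro bounded_linear_Pair bounded_linear_sub bounded_linear_minus bounded_linear_snd
      bounded_linear_compose[OF bounded_bilinear.bounded_linear_right[OF bounded_bilinear_matrix_vector] bounded_linear_fst]
      bounded_linear_compose[OF bounded_bilinear.bounded_linear_right[OF bounded_bilinear_matrix_vector] bounded_linear_snd])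

lemma companion_endomorphism: "complex_endomorphism (companion b c)"
proof (rule complex_endomorphism.intro)
  show "bounded_linear (companion b c)" by (rule bounded_linear_companion)
  show "companion b c (csc l w) = csc l (companion b c w)" for l w
    by (simp add: companion_def csc_def matvec_vsc vsc_simps)
qed

lemma companion_eigenvalue:
  assumes "complex_endomorphism.eigenvalue (companion b c) l"
  obtains w where "w \<noteq> 0" "(l * l) *s w + l *s (b *v w) + c *v w = 0"
proof -
  obtain y where y: "y \<noteq> 0" "companion b c y = csc l y" using assms unfolding complex_endomorphism.eigenvalue_def[OF companion_endomorphism] by blast
  have "snd y = l *s fst y \<and> - (b *v snd y) - c *v fst y = l *s snd y"
    using y(2) unfolding companion_def csc_def prod.inject .
  then have s: "snd y = l *s fst y" and e: "- (b *v snd y) - c *v fst y = l *s snd y" by blast+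
  have "fst y \<noteq> 0" using y(1) s by (auto simp: prod_eq_iff vsc_simps)
  moreover have "(l * l) *s fst y = l *s (l *s fst y)" by simp
  then have "(l * l) *s fst y = - (b *v (l *s fst y)) - c *v fst y" using e unfolding s by metis
  then have "(l * l) *s fst y + l *s (b *v fst y) + c *v fst y = 0" by (simp add: matvec_vsc)
  ultimately show thesis using that by blast
qed

lemma has_real_derivative_inner_self:
  fixes f :: "real \<Rightarrow> 'a::real_inner"
  assumes "(f has_vector_derivative f') (at s)"
  shows "((\<lambda>s. f s \<bullet> f s) has_real_derivative 2 * (f s \<bullet> f')) (at s)"
  using bounded_bilinear.has_vector_derivative[OF bounded_bilinear_inner assms assms]
  by (simp add: has_real_derivative_iff_has_vector_derivative inner_commute)

lemma inner_imaginary_vsc: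
  fixes x y :: "complex ^ 'm::finite"
  shows "x \<bullet> ((\<i> * of_real r) *s ((\<i> * of_real r) *s y)) = - (r\<^sup>2 * (x \<bullet> y))"
    and "((\<i> * of_real r) *s x) \<bullet> ((\<i> * of_real r) *s y) = r\<^sup>2 * (x \<bullet> y)"
proof -
  have "(\<i> * of_real r) *s ((\<i> * of_real r) *s y) = - (r\<^sup>2) *\<^sub>R y"
  proof -
    have "(\<i> * of_real r) * (\<i> * of_real r) = - complex_of_real (r\<^sup>2)" by (simp add: power2_eq_square complex_eq_iff)
    then show ?thesis by (simp only: vector_smult_assoc vsc_simps vsc_of_real scaleR_minus_left)
  qed
  then show "x \<bullet> ((\<i> * of_real r) *s ((\<i> * of_real r) *s y)) = - (r\<^sup>2 * (x \<bullet> y))" by simp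
  show "((\<i> * of_real r) *s x) \<bullet> ((\<i> * of_real r) *s y) = r\<^sup>2 * (x \<bullet> y)"
    unfolding inner_vec_def sum_distrib_left
    by (intro sum.cong refl) (simp add: inner_complex_def power2_eq_square algebra_simps)
qed

locale mode_equation =
  fixes B :: real and q :: "real ^ 'n::finite" and b c :: "complex ^ 'm ^ 'm::finite" and bx :: "'n \<Rightarrow> complex ^ 'm ^ 'm"
    and F :: "int ^ 'n \<Rightarrow> real \<Rightarrow> complex ^ 'm"
  assumes q: "\<And>j. 0 < q $ j" and F: "\<And>\<mu>. rapid \<mu> F"
begin

text \<open>
  Each mode solves its own linear system, backwards from the time after which all \<open>F k\<close> vanish. As
  that time is common to all modes, so is the time after which the solutions vanish.
\<close>

lemma modes_exist:
  assumes s0: "\<And>k s. s0 \<le> s \<Longrightarrow> F k s = 0"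
  obtains a a' where "\<And>k s. s0 + 1 \<le> s \<Longrightarrow> F k s = 0" "\<And>k s. s0 + 1 \<le> s \<Longrightarrow> a k s = 0" "\<And>k s. s0 + 1 \<le> s \<Longrightarrow> a' k s = 0"
    "\<And>k s. (a k has_vector_derivative a' k s) (at s)"
    "\<And>k s. (a' k has_vector_derivative F k s - b *v a' k s - c *v a k s - spatial_part B q bx a k s) (at s)"
proof -
  define s1 where "s1 = s0 + 1"
  have cF: "continuous_on UNIV (F k)" for k
    by (intro continuous_at_imp_continuous_on ballI has_vector_derivative_continuous)
       (use F[unfolded rapid_def, THEN spec, of "Suc 0"] in auto)
  have ex: "\<exists>y. (\<forall>s. (y has_vector_derivative (snd (y s), F k s - b *v snd (y s) - c *v fst (y s) - spatial_part B q bx (\<lambda>_ s. fst (y s)) k s)) (at s))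
      \<and> (\<forall>s\<ge>s1. y s = 0)" for k
  proof -
    let ?l = "\<lambda>j. \<i> * complex_of_real (pi / B * of_int (k $ j))"
    define T :: "('n + 'n) option \<Rightarrow> 'm phase \<Rightarrow> 'm phase" where
      "T i w = (case i of None \<Rightarrow> - companion b c w
        | Some (Inl j) \<Rightarrow> (0, bx j *v (?l j *s fst w))
        | Some (Inr j) \<Rightarrow> (0, - (?l j *s (?l j *s fst w))))" for i w
    define \<phi> where "\<phi> i s = (case i of None \<Rightarrow> 1 | Some (Inl j) \<Rightarrow> exp (q $ j * (s1 + 1 - s)) | Some (Inr j) \<Rightarrow> exp (2 * q $ j * (s1 + 1 - s)))"
      for i :: "('n + 'n) option" and s
    have blv: "bounded_linear (\<lambda>w :: 'm phase. l *s fst w)" for l by (rule bounded_linear_compose[OF bounded_linear_vsc bounded_linear_fst])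
    have bT: "bounded_linear (T i)" for i
    proof (cases i)
      case None
      then show ?thesis unfolding T_def using bounded_linear_minus[OF bounded_linear_companion] by simp
    next
      case (Some x)
      then show ?thesis unfolding T_def
        by (cases x) (auto intro!: bounded_linear_Pair bounded_linear_zero bounded_linear_minus blv
            bounded_linear_compose[OF bounded_linear_vsc blv]
            bounded_linear_compose[OF bounded_bilinear.bounded_linear_right[OF bounded_bilinear_matrix_vector] blv] simp del: vector_smult_assoc)
    qed
    have c\<phi>: "continuous_on UNIV (\<phi> i)" for i
    proof (cases i)
      case (Some x)
      then show ?thesis unfolding \<phi>_def by (cases x) (auto intro!: continuous_intros)
    qed (simp add: \<phi>_def)
    obtain Y where Y: "\<forall>s. (Y has_vector_derivative (\<Sum>i\<in>UNIV. \<phi> i s *\<^sub>R T i (Y s)) + (0, - F k (s1 + 1 - s))) (at s)" "\<forall>s\<le>1. Y s = 0"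
    proof (rule linear_ode_exists_sum[of UNIV \<phi> T "\<lambda>s. (0, - F k (s1 + 1 - s))" 1, OF finite c\<phi> bT])
      show "continuous_on UNIV (\<lambda>s. (0, - F k (s1 + 1 - s)))" by (intro continuous_intros continuous_on_compose2[OF cF]) auto
      show "(0, - F k (s1 + 1 - s)) = 0" if "s \<le> 1" for s using s0 that by (simp add: s1_def zero_prod_def)
    qed auto
    define y where "y s = Y (s1 + 1 - s)" for s
    have "(y has_vector_derivative (snd (y s), F k s - b *v snd (y s) - c *v fst (y s) - spatial_part B q bx (\<lambda>_ s. fst (y s)) k s)) (at s)" for s
    proof -
      have "((\<lambda>s. s1 + 1 - s) has_vector_derivative - 1) (at s)" by (auto intro!: derivative_eq_intros)
      from vector_diff_chain_at[OF this Y(1)[rule_format]]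
      have "(y has_vector_derivative - 1 *\<^sub>R ((\<Sum>i\<in>UNIV. \<phi> i (s1 + 1 - s) *\<^sub>R T i (y s)) + (0, - F k s))) (at s)"
        by (simp add: y_def[abs_def] o_def)
      moreover have "(\<Sum>i\<in>UNIV. \<phi> i (s1 + 1 - s) *\<^sub>R T i (y s)) = - companion b c (y s) + (0, spatial_part B q bx (\<lambda>_ s. fst (y s)) k s)"
      proof -
        have "(\<Sum>i\<in>UNIV. \<phi> i (s1 + 1 - s) *\<^sub>R T i (y s)) = \<phi> None (s1 + 1 - s) *\<^sub>R T None (y s)
          + (\<Sum>i\<in>UNIV. \<phi> (Some i) (s1 + 1 - s) *\<^sub>R T (Some i) (y s))"
          by (simp add: UNIV_option_conv sum.reindex)
        also have "(\<Sum>i\<in>UNIV. \<phi> (Some i) (s1 + 1 - s) *\<^sub>R T (Some i) (y s))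
          = (\<Sum>j\<in>UNIV. \<phi> (Some (Inl j)) (s1 + 1 - s) *\<^sub>R T (Some (Inl j)) (y s)) + (\<Sum>j\<in>UNIV. \<phi> (Some (Inr j)) (s1 + 1 - s) *\<^sub>R T (Some (Inr j)) (y s))"
          by (simp add: UNIV_Plus_UNIV[symmetric] sum.Plus del: UNIV_Plus_UNIV)
        also have "\<dots> = (0, spatial_part B q bx (\<lambda>_ s. fst (y s)) k s)"
          unfolding spatial_part_def freq_mult_def
          by (simp add: \<phi>_def T_def prod_eq_iff fst_sum snd_sum sum.distrib sum_subtractf sum_negf)
        finally show ?thesis by (simp add: \<phi>_def T_def)
      qed
      ultimately show ?thesis by (simp add: companion_def algebra_simps)
    qed
    moreover have "\<forall>s\<ge>s1. y s = 0" using Y(2) by (simp add: y_def)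
    ultimately show ?thesis by blast
  qed
  then obtain y where y: "\<And>k s. (y k has_vector_derivative (snd (y k s), F k s - b *v snd (y k s) - c *v fst (y k s) - spatial_part B q bx (\<lambda>_ s. fst (y k s)) k s)) (at s)"
    "\<And>k s. s1 \<le> s \<Longrightarrow> y k s = 0" by metis
  show thesis
  proof (rule that[folded s1_def, of "\<lambda>k s. fst (y k s)" "\<lambda>k s. snd (y k s)"])
    show "F k s = 0" if "s1 \<le> s" for k s using s0 that by (simp add: s1_def)
    show "((\<lambda>s. fst (y k s)) has_vector_derivative snd (y k s)) (at s)" for k s
      using bounded_linear.has_vector_derivative[OF bounded_linear_fst y(1)] by simp
    have "spatial_part B q bx (\<lambda>_ s. fst (y k s)) k s = spatial_part B q bx (\<lambda>k s. fst (y k s)) k s" for k s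
      by (simp add: spatial_part_def freq_mult_def)
    then show "((\<lambda>s. snd (y k s)) has_vector_derivative F k s - b *v snd (y k s) - c *v fst (y k s) - spatial_part B q bx (\<lambda>k s. fst (y k s)) k s) (at s)" for k s
      using bounded_linear.has_vector_derivative[OF bounded_linear_snd y(1)[of k s]] by simp
  qed (simp_all add: y(2))
qed

text \<open>
  Because the constant in \<open>energy_density_inequality\<close> does not depend on the weights, all modes grow
  at most at the same exponential rate as \<open>s \<rightarrow> -\<infinity>\<close>.
\<close>

lemma modes_energy_bound:
  assumes z: "\<And>k s. s1 \<le> s \<Longrightarrow> a k s = 0" "\<And>k s. s1 \<le> s \<Longrightarrow> a' k s = 0"
    and da: "\<And>k s. (a k has_vector_derivative a' k s) (at s)"
    and da': "\<And>k s. (a' k has_vector_derivative F k s - b *v a' k s - c *v a k s - spatial_part B q bx a k s) (at s)"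
  obtains \<nu> where "decaying \<nu> a" "decaying \<nu> a'"
proof -
  obtain K where K: "K \<ge> 0"
    "\<And>(w :: 'n \<Rightarrow> real) u us uss F ux uxs uxx.
      uss - (\<Sum>j\<in>UNIV. (w j)\<^sup>2 *\<^sub>R uxx j) + b *v us + (\<Sum>j\<in>UNIV. w j *\<^sub>R (bx j *v ux j)) + c *v u = F \<Longrightarrow>
      2 * (us \<bullet> uss) + 2 * (u \<bullet> us) + (\<Sum>j\<in>UNIV. 2 * (w j)\<^sup>2 * (ux j \<bullet> uxs j))
        \<ge> (\<Sum>j\<in>UNIV. 2 * (w j)\<^sup>2 * (us \<bullet> uxx j + ux j \<bullet> uxs j))
          - K * (u \<bullet> u + us \<bullet> us + (\<Sum>j\<in>UNIV. (w j)\<^sup>2 * (ux j \<bullet> ux j))) - F \<bullet> F"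
    using energy_density_inequality[of b bx c] by blast
  define r where "r k j = pi / B * of_int (k $ j)" for k :: "int ^ 'n" and j
  define w where "w s j = exp (q $ j * s)" for s j
  define e where "e k s = a k s \<bullet> a k s + a' k s \<bullet> a' k s + (\<Sum>j\<in>UNIV. (w s j)\<^sup>2 * ((r k j)\<^sup>2 * (a k s \<bullet> a k s)))" for k s
  define a'' where "a'' k s = F k s - b *v a' k s - c *v a k s - spatial_part B q bx a k s" for k s
  define e' where "e' k s = 2 * (a k s \<bullet> a' k s) + 2 * (a' k s \<bullet> a'' k s)
     + (\<Sum>j\<in>UNIV. (w s j)\<^sup>2 * ((r k j)\<^sup>2 * (2 * (a k s \<bullet> a' k s))) + 2 * q $ j * (w s j)\<^sup>2 * ((r k j)\<^sup>2 * (a k s \<bullet> a k s)))" for k s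
  have de: "(e k has_real_derivative e' k s) (at s)" for k s
  proof -
    have dw: "((\<lambda>s. (w s j)\<^sup>2) has_real_derivative 2 * q $ j * (w s j)\<^sup>2) (at s)" for j
      unfolding w_def by (auto intro!: derivative_eq_intros simp: power2_eq_square)
    note d1 = has_real_derivative_inner_self[OF da[of k s]] and d2 = has_real_derivative_inner_self[OF da'[of k s, folded a''_def]]
    have "((\<lambda>s. (w s j)\<^sup>2 * ((r k j)\<^sup>2 * (a k s \<bullet> a k s))) has_real_derivative
       (w s j)\<^sup>2 * ((r k j)\<^sup>2 * (2 * (a k s \<bullet> a' k s))) + 2 * q $ j * (w s j)\<^sup>2 * ((r k j)\<^sup>2 * (a k s \<bullet> a k s))) (at s)" for j
      by (rule DERIV_mult'[OF dw DERIV_cmult[OF d1]])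
    then show ?thesis unfolding e_def[abs_def] e'_def by (intro DERIV_add DERIV_sum d1 d2)
  qed
  have ineq: "- K * e k s - F k s \<bullet> F k s \<le> e' k s" for k s
  proof -
    let ?l = "\<lambda>j. \<i> * complex_of_real (r k j)"
    have fm: "freq_mult B j a k s = ?l j *s a k s" "freq_mult B j (freq_mult B j a) k s = ?l j *s (?l j *s a k s)" for j
      by (simp_all add: freq_mult_def r_def)
    have w2: "exp (2 * q $ j * s) = (w s j)\<^sup>2" for j by (simp add: w_def power2_eq_square exp_add[symmetric])
    have "a'' k s - (\<Sum>j\<in>UNIV. (w s j)\<^sup>2 *\<^sub>R (?l j *s (?l j *s a k s))) + b *v a' k s
        + (\<Sum>j\<in>UNIV. w s j *\<^sub>R (bx j *v (?l j *s a k s))) + c *v a k s = F k s"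
      unfolding a''_def spatial_part_def sum.distrib sum_negf fm w2 by (simp add: w_def)
    from K(2)[OF this, where uxs="\<lambda>j. ?l j *s a' k s"]
    have "(\<Sum>j\<in>UNIV. 2 * (w s j)\<^sup>2 * (a' k s \<bullet> (?l j *s (?l j *s a k s)) + (?l j *s a k s) \<bullet> (?l j *s a' k s)))
       - K * (a k s \<bullet> a k s + a' k s \<bullet> a' k s + (\<Sum>j\<in>UNIV. (w s j)\<^sup>2 * ((?l j *s a k s) \<bullet> (?l j *s a k s)))) - F k s \<bullet> F k s
       \<le> 2 * (a' k s \<bullet> a'' k s) + 2 * (a k s \<bullet> a' k s) + (\<Sum>j\<in>UNIV. 2 * (w s j)\<^sup>2 * ((?l j *s a k s) \<bullet> (?l j *s a' k s)))" .
    then have "- K * e k s - F k s \<bullet> F k s \<le> 2 * (a' k s \<bullet> a'' k s) + 2 * (a k s \<bullet> a' k s) + (\<Sum>j\<in>UNIV. 2 * (w s j)\<^sup>2 * ((r k j)\<^sup>2 * (a k s \<bullet> a' k s)))"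
      unfolding inner_imaginary_vsc e_def by (simp add: inner_commute[of "a' k s" "a k s"])
    also have "\<dots> \<le> e' k s"
    proof -
      have "0 \<le> (\<Sum>j\<in>UNIV. 2 * q $ j * (w s j)\<^sup>2 * ((r k j)\<^sup>2 * (a k s \<bullet> a k s)))"
        using q by (intro sum_nonneg mult_nonneg_nonneg) (auto intro: less_imp_le)
      then show ?thesis unfolding e'_def sum.distrib by (simp add: mult_ac)
    qed
    finally show ?thesis .
  qed
  have bound: "\<exists>D\<ge>0. \<forall>k s. (weight k ^ N)\<^sup>2 * e k s \<le> D * exp (- K * s)" for N
  proof -
    obtain C where C: "C \<ge> 0" "\<And>k s. weight k ^ N * norm (F k s) \<le> C * exp (1 * s)"
      using decaying_bound[OF rapid_decaying[OF F]] by blast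
    let ?D = "C\<^sup>2 / (K + 2) * exp ((K + 2) * s1)"
    have "(weight k ^ N)\<^sup>2 * e k s \<le> ?D * exp (- K * s)" for k s
    proof (cases "s1 \<le> s")
      case True
      then show ?thesis using z K(1) by (simp add: e_def)
    next
      case False
      let ?W = "(weight k ^ N)\<^sup>2"
      define h where "h s = exp (K * s) * (?W * e k s) + C\<^sup>2 / (K + 2) * exp ((K + 2) * s)" for s
      have "h s \<le> h s1"
      proof (rule DERIV_nonneg_imp_nondecreasing[of s s1 h])
        show "s \<le> s1" using False by simp
        fix x
        have "(h has_real_derivative exp (K * x) * (?W * (e' k x + K * e k x)) + C\<^sup>2 * exp ((K + 2) * x)) (at x)"
        proof -
          have exp2: "((\<lambda>s. C\<^sup>2 / m * exp (m * s)) has_real_derivative C\<^sup>2 * exp (m * x)) (at x)" if "0 < m" for m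
            using that by (auto intro!: derivative_eq_intros)
          have "((\<lambda>s. exp (K * s)) has_real_derivative K * exp (K * x)) (at x)" by (auto intro!: derivative_eq_intros)
          from DERIV_add[OF DERIV_mult'[OF this DERIV_cmult[OF de[of k x], of ?W]] exp2[of "K + 2"]]
          show ?thesis unfolding h_def[abs_def] using K(1) by (simp add: algebra_simps)
        qed
        moreover have "0 \<le> exp (K * x) * (?W * (e' k x + K * e k x)) + C\<^sup>2 * exp ((K + 2) * x)"
        proof -
          have "(weight k ^ N * norm (F k x))\<^sup>2 \<le> (C * exp (1 * x))\<^sup>2"
            using C(2)[of k x] weight_ge_1[of k] by (intro power_mono) auto
          then have FF: "?W * (F k x \<bullet> F k x) \<le> C\<^sup>2 * exp (2 * x)"
            by (simp add: power_mult_distrib power2_norm_eq_inner exp_double)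
          have "- (F k x \<bullet> F k x) \<le> e' k x + K * e k x" using ineq[of k x] by simp
          then have "?W * (- (F k x \<bullet> F k x)) \<le> ?W * (e' k x + K * e k x)" by (intro mult_left_mono) auto
          then have "- (C\<^sup>2 * exp (2 * x)) \<le> ?W * (e' k x + K * e k x)" using FF by simp
          then have "exp (K * x) * (- (C\<^sup>2 * exp (2 * x))) \<le> exp (K * x) * (?W * (e' k x + K * e k x))" by (intro mult_left_mono) auto
          moreover have "exp (K * x) * (C\<^sup>2 * exp (2 * x)) = C\<^sup>2 * exp ((K + 2) * x)" by (simp add: distrib_right exp_add)
          ultimately show ?thesis by simp
        qed
        ultimately show "\<exists>y. (h has_real_derivative y) (at x) \<and> 0 \<le> y" by blast
      qed
      moreover have "h s1 = ?D" using z by (simp add: h_def e_def)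
      moreover have "exp (K * s) * (?W * e k s) \<le> h s" using K(1) by (simp add: h_def)
      ultimately have "exp (K * s) * (?W * e k s) \<le> ?D" by linarith
      then have "exp (- K * s) * (exp (K * s) * (?W * e k s)) \<le> exp (- K * s) * ?D" by (intro mult_left_mono) auto
      moreover have "exp (- K * s) * (exp (K * s) * (?W * e k s)) = ?W * e k s" by (simp add: mult.assoc[symmetric] exp_add[symmetric])
      ultimately show ?thesis by (simp only: mult.commute)
    qed
    moreover have "?D \<ge> 0" using K(1) by simp
    ultimately show ?thesis by blast
  qed
  have "decaying (- K / 2) f"
    if f: "\<And>k s. s1 \<le> s \<Longrightarrow> f k s = 0" "\<And>k s. f k s \<bullet> f k s \<le> e k s" for f :: "int ^ 'n \<Rightarrow> real \<Rightarrow> complex ^ 'm"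
    unfolding decaying_def
  proof (intro conjI allI)
    show "\<exists>s1. \<forall>k s. s1 \<le> s \<longrightarrow> f k s = 0" using f(1) by blast
    fix N obtain D where D: "D \<ge> 0" "\<And>k s. (weight k ^ N)\<^sup>2 * e k s \<le> D * exp (- K * s)" using bound[of N] by blast
    have "weight k ^ N * norm (f k s) \<le> sqrt D * exp (- K / 2 * s)" for k s
    proof (rule power2_le_imp_le)
      have "(weight k ^ N * norm (f k s))\<^sup>2 = (weight k ^ N)\<^sup>2 * (f k s \<bullet> f k s)" by (simp add: power_mult_distrib power2_norm_eq_inner)
      also have "\<dots> \<le> (weight k ^ N)\<^sup>2 * e k s" by (intro mult_left_mono f) auto
      also have "\<dots> \<le> D * exp (- K * s)" by (rule D)
      also have "\<dots> = (sqrt D * exp (- K / 2 * s))\<^sup>2" using D(1) by (simp add: power_mult_distrib exp_double[symmetric])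
      finally show "(weight k ^ N * norm (f k s))\<^sup>2 \<le> (sqrt D * exp (- K / 2 * s))\<^sup>2" .
      show "0 \<le> sqrt D * exp (- K / 2 * s)" using D(1) by simp
    qed
    then show "\<exists>C. \<forall>k s. weight k ^ N * norm (f k s) \<le> C * exp (- K / 2 * s)" by blast
  qed
  note dec = this
  have en: "0 \<le> (\<Sum>j\<in>UNIV. (w s j)\<^sup>2 * ((r k j)\<^sup>2 * (a k s \<bullet> a k s)))" for k s by (intro sum_nonneg) simp
  have "decaying (- K / 2) a" by (rule dec) (use z en in \<open>auto simp: e_def add_nonneg_nonneg\<close>)
  moreover have "decaying (- K / 2) a'" by (rule dec) (use z en in \<open>auto simp: e_def add_nonneg_nonneg\<close>)
  ultimately show thesis by (rule that)
qed

text \<open>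
  The spatial part decays faster than the modes by the factor \<open>exp (\<delta> s)\<close> with \<open>\<delta> = min q j\<close>, so
  \<open>growth_bound\<close> for the companion system with right hand side \<open>F - spatial_part\<close> improves the rate
  by \<open>\<delta>\<close>. Finitely many such steps lead to any \<open>\<nu>\<close> below the indicial roots.
\<close>

lemma modes_growth:
  assumes z: "\<And>k s. s1 \<le> s \<Longrightarrow> a k s = 0" "\<And>k s. s1 \<le> s \<Longrightarrow> a' k s = 0" "\<And>k s. s1 \<le> s \<Longrightarrow> F k s = 0"
    and da: "\<And>k s. (a k has_vector_derivative a' k s) (at s)"
    and da': "\<And>k s. (a' k has_vector_derivative F k s - b *v a' k s - c *v a k s - spatial_part B q bx a k s) (at s)"
    and dec: "decaying \<nu>0 a" "decaying \<nu>0 a'"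
    and eig: "\<And>l w. w \<noteq> 0 \<Longrightarrow> (l * l) *s w + l *s (b *v w) + c *v w = 0 \<Longrightarrow> \<nu> < Re l"
  shows "decaying \<nu> a \<and> decaying \<nu> a'"
proof -
  define \<delta> where "\<delta> = Min (range (\<lambda>j. q $ j))"
  have \<delta>: "0 < \<delta>" "\<And>j. \<delta> \<le> q $ j" using q by (auto simp: \<delta>_def)
  have step: "decaying (\<nu>1 + \<delta>) a \<and> decaying (\<nu>1 + \<delta>) a'"
    if d: "decaying \<nu>1 a" "decaying \<nu>1 a'" and le: "\<nu>1 + \<delta> \<le> \<nu>" for \<nu>1
  proof -
    define g where "g k s = (0 :: complex ^ 'm, F k s - spatial_part B q bx a k s)" for k s
    have "decaying (\<nu>1 + \<delta>) (spatial_part B q bx a)"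
      using rapid_n_spatial_part[of 0 \<nu>1 a \<delta> q B bx] d(1) \<delta> by simp
    then have "rapid_n 0 (\<nu>1 + \<delta>) (\<lambda>k s. F k s + - spatial_part B q bx a k s)"
      using rapid_decaying[OF F] by (intro rapid_n_add rapid_n_linear[OF bounded_linear_minus[OF bounded_linear_ident]]) auto
    then have dg: "decaying (\<nu>1 + \<delta>) (\<lambda>k s. F k s - spatial_part B q bx a k s)" by simp
    have sub: "\<nu>1 + \<delta> < Re l" if ev: "complex_endomorphism.eigenvalue (companion b c) l" for l
    proof -
      obtain w where "w \<noteq> 0" "(l * l) *s w + l *s (b *v w) + c *v w = 0" using companion_eigenvalue[OF ev] by blast
      then have "\<nu> < Re l" by (rule eig)
      then show ?thesis using le by simp
    qed
    obtain G where G: "G \<ge> 0" "\<And>y g s1 H s. (\<And>s. (y has_vector_derivative companion b c (y s) + g s) (at s)) \<Longrightarrow> (\<And>s. s1 \<le> s \<Longrightarrow> y s = 0) \<Longrightarrow> 0 \<le> H \<Longrightarrow>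
      (\<And>s. s \<le> s1 \<Longrightarrow> norm (g s) \<le> H * exp ((\<nu>1 + \<delta>) * s)) \<Longrightarrow> s \<le> s1 \<Longrightarrow> norm (y s) \<le> G * H * exp ((\<nu>1 + \<delta>) * s)"
      using complex_endomorphism.growth_bound[OF companion_endomorphism, of b c "\<nu>1 + \<delta>", OF sub] by blast
    have yb: "\<exists>C. \<forall>k s. weight k ^ N * norm (a k s, a' k s) \<le> C * exp ((\<nu>1 + \<delta>) * s)" for N
    proof -
      obtain C where C: "C \<ge> 0" "\<And>k s. weight k ^ N * norm (F k s - spatial_part B q bx a k s) \<le> C * exp ((\<nu>1 + \<delta>) * s)"
        using decaying_bound[OF dg] by blast
      have "weight k ^ N * norm (a k s, a' k s) \<le> (G * C) * exp ((\<nu>1 + \<delta>) * s)" for k s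
      proof (cases "s \<le> s1")
        case True
        have W: "weight k ^ N > 0" using weight_ge_1[of k] by (intro zero_less_power) linarith
        have "norm (a k s, a' k s) \<le> G * (C / weight k ^ N) * exp ((\<nu>1 + \<delta>) * s)"
        proof (rule G(2)[of "\<lambda>s. (a k s, a' k s)" "g k" s1 "C / weight k ^ N" s, OF _ _ _ _ True])
          show "((\<lambda>s. (a k s, a' k s)) has_vector_derivative companion b c (a k s, a' k s) + g k s) (at s)" for s
            using has_vector_derivative_Pair[OF da[of k s] da'[of k s]] by (simp add: companion_def g_def algebra_simps)
          show "(a k s, a' k s) = 0" if "s1 \<le> s" for s using z that by (simp add: zero_prod_def)
          show "0 \<le> C / weight k ^ N" using C(1) W by simp
          show "norm (g k s) \<le> C / weight k ^ N * exp ((\<nu>1 + \<delta>) * s)" for s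
            using C(2)[of k s] W by (simp add: g_def norm_Pair field_simps)
        qed
        then have "weight k ^ N * norm (a k s, a' k s) \<le> weight k ^ N * (G * (C / weight k ^ N) * exp ((\<nu>1 + \<delta>) * s))"
          using W by (intro mult_left_mono) auto
        moreover have "x * (G * (C / x) * X) = G * C * X" if "0 < x" for x X :: real using that by simp
        ultimately show ?thesis using W by (simp only:)
      next
        case False
        then show ?thesis using z G(1) C(1) by (simp add: norm_Pair)
      qed
      then show ?thesis by blast
    qed
    have fin: "decaying (\<nu>1 + \<delta>) f" if f: "\<And>k s. s1 \<le> s \<Longrightarrow> f k s = 0" "\<And>k s. norm (f k s) \<le> norm (a k s, a' k s)"
      for f :: "int ^ 'n \<Rightarrow> real \<Rightarrow> complex ^ 'm"
      unfolding decaying_def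
    proof (intro conjI allI)
      show "\<exists>s1. \<forall>k s. s1 \<le> s \<longrightarrow> f k s = 0" using f(1) by blast
      fix N obtain C where C: "\<And>k s. weight k ^ N * norm (a k s, a' k s) \<le> C * exp ((\<nu>1 + \<delta>) * s)" using yb by blast
      have "weight k ^ N * norm (f k s) \<le> C * exp ((\<nu>1 + \<delta>) * s)" for k s
      proof -
        have "weight k ^ N * norm (f k s) \<le> weight k ^ N * norm (a k s, a' k s)"
          using weight_ge_1[of k] by (intro mult_left_mono f) auto
        then show ?thesis using C[of k s] by linarith
      qed
      then show "\<exists>C. \<forall>k s. weight k ^ N * norm (f k s) \<le> C * exp ((\<nu>1 + \<delta>) * s)" by blast
    qed
    show ?thesis
    proof
      show "decaying (\<nu>1 + \<delta>) a" by (rule fin) (use z norm_fst_le in auto)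
      show "decaying (\<nu>1 + \<delta>) a'" by (rule fin) (use z norm_snd_le in auto)
    qed
  qed
  have "\<nu>' \<le> \<nu>0 + of_nat n * \<delta> \<Longrightarrow> \<nu>' \<le> \<nu> \<Longrightarrow> decaying \<nu>' a \<and> decaying \<nu>' a'" for n \<nu>'
  proof (induction n arbitrary: \<nu>')
    case 0
    then show ?case using decaying_mono dec by auto
  next
    case (Suc n)
    have "\<nu>' - \<delta> \<le> \<nu>0 + of_nat n * \<delta>" "\<nu>' - \<delta> \<le> \<nu>" using Suc.prems \<delta>(1) by (auto simp: algebra_simps)
    then have "decaying (\<nu>' - \<delta>) a" "decaying (\<nu>' - \<delta>) a'" using Suc.IH by blast+
    then show ?case using step[of "\<nu>' - \<delta>"] Suc.prems(2) by simp
  qed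
  moreover obtain n where "(\<nu> - \<nu>0) / \<delta> \<le> of_nat n" using real_arch_simple by blast
  then have "\<nu> \<le> \<nu>0 + of_nat n * \<delta>" using \<delta>(1) by (simp add: field_simps)
  ultimately show ?thesis by blast
qed

text \<open>
  The equation expresses the derivatives in \<open>s\<close> by the modes and their first derivatives, so no further
  estimate is needed for the higher ones.
\<close>

lemma modes_rapid:
  assumes da: "\<And>k s. (a k has_vector_derivative a' k s) (at s)"
    and da': "\<And>k s. (a' k has_vector_derivative F k s - b *v a' k s - c *v a k s - spatial_part B q bx a k s) (at s)"
    and dec: "decaying \<nu> a" "decaying \<nu> a'"
  shows "rapid \<nu> a"
proof -
  have mv: "bounded_linear (\<lambda>v. - (M *v v))" for M :: "complex ^ 'm ^ 'm"
    by (intro bounded_linear_minus bounded_bilinear.bounded_linear_right[OF bounded_bilinear_matrix_vector])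
  have "rapid_n n \<nu> a \<and> rapid_n n \<nu> a'" for n
  proof (induction n)
    case 0
    then show ?case using dec by simp
  next
    case (Suc n)
    have "rapid_n n (\<nu> + 0) (spatial_part B q bx a)"
      by (rule rapid_n_spatial_part) (use Suc q in \<open>auto intro: less_imp_le\<close>)
    then have sp: "rapid_n n \<nu> (spatial_part B q bx a)" by simp
    have "rapid_n n \<nu> (\<lambda>k s. ((F k s + - (b *v a' k s)) + - (c *v a k s)) + - spatial_part B q bx a k s)"
      using F Suc sp unfolding rapid_def
      by (intro rapid_n_add rapid_n_linear[OF mv] rapid_n_linear[OF bounded_linear_minus[OF bounded_linear_ident]]) auto
    then have "rapid_n n \<nu> (\<lambda>k s. F k s - b *v a' k s - c *v a k s - spatial_part B q bx a k s)" by simp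
    then show ?case
      using rapid_n_SucI[OF dec(1) da] rapid_n_SucI[OF dec(2) da'] Suc by blast
  qed
  then show ?thesis by (simp add: rapid_def)
qed

theorem solution_modes:
  assumes s0: "\<And>k s. s0 \<le> s \<Longrightarrow> F k s = 0"
  obtains a where "\<exists>\<nu>. rapid \<nu> a"
    "\<forall>\<nu>. (\<forall>l w. w \<noteq> 0 \<longrightarrow> (l * l) *s w + l *s (b *v w) + c *v w = 0 \<longrightarrow> \<nu> < Re l) \<longrightarrow> rapid \<nu> a"
    "\<forall>k s. mode_deriv (mode_deriv a) k s + b *v mode_deriv a k s + c *v a k s + spatial_part B q bx a k s = F k s"
    "\<forall>k s. s0 + 1 \<le> s \<longrightarrow> a k s = 0"
proof -
  obtain a a' where z: "\<And>k s. s0 + 1 \<le> s \<Longrightarrow> F k s = 0" "\<And>k s. s0 + 1 \<le> s \<Longrightarrow> a k s = 0" "\<And>k s. s0 + 1 \<le> s \<Longrightarrow> a' k s = 0"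
    and da: "\<And>k s. (a k has_vector_derivative a' k s) (at s)"
    and da': "\<And>k s. (a' k has_vector_derivative F k s - b *v a' k s - c *v a k s - spatial_part B q bx a k s) (at s)"
    using modes_exist[OF s0] by metis
  obtain \<nu>0 where \<nu>0: "decaying \<nu>0 a" "decaying \<nu>0 a'" using modes_energy_bound[OF z(2,3) da da'] by blast
  have m: "mode_deriv a = a'" "mode_deriv a' = (\<lambda>k s. F k s - b *v a' k s - c *v a k s - spatial_part B q bx a k s)"
    by (rule mode_deriv_eq[OF da], rule mode_deriv_eq[OF da'])
  show thesis
  proof (rule that[of a])
    show "\<exists>\<nu>. rapid \<nu> a" using modes_rapid[OF da da' \<nu>0] by blast
    show "\<forall>\<nu>. (\<forall>l w. w \<noteq> 0 \<longrightarrow> (l * l) *s w + l *s (b *v w) + c *v w = 0 \<longrightarrow> \<nu> < Re l) \<longrightarrow> rapid \<nu> a"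
      using modes_growth[OF z(2,3,1) da da' \<nu>0] modes_rapid[OF da da'] by blast
    show "\<forall>k s. mode_deriv (mode_deriv a) k s + b *v mode_deriv a k s + c *v a k s + spatial_part B q bx a k s = F k s"
      unfolding m by simp
    show "\<forall>k s. s0 + 1 \<le> s \<longrightarrow> a k s = 0" using z(2) by blast
  qed
qed

end

section \<open>The backward solution and its decay\<close>

lemma t_deriv_t_cong:
  assumes "open S" "z \<in> S" "\<And>y. y \<in> S \<Longrightarrow> f y = g y" "f differentiable (at z)"
  shows "t_deriv_t f z = t_deriv_t g z"
  unfolding t_deriv_t_def using dir_deriv_cong[OF assms] by simp

lemma kasner_op_cong:
  assumes S: "open S" "S \<subseteq> spacetime" "z \<in> S" and eq: "\<And>y. y \<in> S \<Longrightarrow> u y = v y" and u: "smooth_on S u"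
  shows "kasner_op q b bx c u z = kasner_op q b bx c v z"
proof -
  have du: "dir_deriv w u y = dir_deriv w v y" if "y \<in> S" for w y
    by (rule dir_deriv_cong[OF S(1) that eq smooth_on_differentiable[OF u that]])
  then have t: "t_deriv_t u y = t_deriv_t v y" if "y \<in> S" for y using that by (simp add: t_deriv_t_def)
  have su: "smooth_on S (t_deriv_t u)" unfolding t_deriv_t_def
    by (rule smooth_on_scaleR[OF S(1) smooth_on_bounded_linear[OF bounded_linear_fst] smooth_on_dir_deriv[OF u]])
  have tt: "t_deriv_t (t_deriv_t u) z = t_deriv_t (t_deriv_t v) z"
    by (rule t_deriv_t_cong[OF S(1,3) t smooth_on_differentiable[OF su S(3)]])
  have xx: "deriv_x j (deriv_x j u) z = deriv_x j (deriv_x j v) z" for j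
    by (rule dir_deriv_cong[OF S(1,3) du smooth_on_differentiable[OF smooth_on_dir_deriv[OF u] S(3)]])
  show ?thesis unfolding kasner_op_def tt xx t[OF S(3)] du[OF S(3)] eq[OF S(3)] ..
qed

text \<open>
  Turns the partial differential equation on the torus into the equations for the modes.
\<close>

lemma kasner_op_fseries:
  fixes a :: "int ^ 'n::finite \<Rightarrow> real \<Rightarrow> complex ^ 'm::finite"
  assumes a: "rapid \<mu> a" and q: "\<And>j. 0 \<le> q $ j" and z: "z \<in> spacetime"
  shows "kasner_op q b bx c (fseries B a) z
    = fseries B (\<lambda>k s. mode_deriv (mode_deriv a) k s + b *v mode_deriv a k s + c *v a k s + spatial_part B q bx a k s) z"
proof -
  note a' = rapid_mode_deriv[OF a] note a'' = rapid_mode_deriv[OF a']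
  have ax: "rapid \<mu> (freq_mult B j a)" and axx: "rapid \<mu> (freq_mult B j (freq_mult B j a))" for j
    by (intro rapid_freq_mult a)+
  note bl = bounded_bilinear.bounded_linear_right[OF bounded_bilinear_matrix_vector]
  have sm: "smooth_on spacetime (fseries B a)" by (rule smooth_on_fseries[OF a])
  have tt: "t_deriv_t (t_deriv_t (fseries B a)) z = fseries B (mode_deriv (mode_deriv a)) z"
    using t_deriv_t_cong[OF open_spacetime z t_deriv_t_fseries[OF a] smooth_on_differentiable[OF smooth_on_t_deriv_t[OF sm] z]]
      t_deriv_t_fseries[OF a' z] by simp
  have xx: "deriv_x j (deriv_x j (fseries B a)) z = fseries B (freq_mult B j (freq_mult B j a)) z" for j
    using dir_deriv_cong[OF open_spacetime z deriv_x_fseries[OF a] smooth_on_differentiable[OF smooth_on_dir_deriv[OF sm] z]]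
      deriv_x_fseries[OF ax z] by simp
  have lin: "decaying \<mu> (\<lambda>k s. M *v f k s)" if "rapid \<mu> f" for M :: "complex ^ 'm ^ 'm" and f :: "int ^ 'n \<Rightarrow> real \<Rightarrow> complex ^ 'm"
    using rapid_n_linear[OF bl[of M], of 0 \<mu> f] rapid_decaying[OF that] by simp
  have fl: "fseries B (\<lambda>k s. M *v f k s) z = M *v fseries B f z" if "rapid \<mu> f" for M :: "complex ^ 'm ^ 'm" and f
    by (rule fseries_linear[OF rapid_decaying[OF that] bl matvec_vsc])
  have sp: "fseries B (spatial_part B q bx a) z = (\<Sum>j\<in>UNIV. fst z powr (q $ j) *\<^sub>R (bx j *v fseries B (freq_mult B j a) z))
      - (\<Sum>j\<in>UNIV. fst z powr (2 * q $ j) *\<^sub>R fseries B (freq_mult B j (freq_mult B j a)) z)"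
  proof -
    have 1: "rapid_n 0 \<mu> (\<lambda>k s. exp (q $ j * s) *\<^sub>R (bx j *v freq_mult B j a k s))" for j
      using rapid_n_mono[OF rapid_n_exp[of 0 \<mu> "\<lambda>k s. bx j *v freq_mult B j a k s" "q $ j"], of \<mu>] lin[OF ax] q by simp
    have 2: "rapid_n 0 \<mu> (\<lambda>k s. - (exp (2 * q $ j * s) *\<^sub>R freq_mult B j (freq_mult B j a) k s))" for j
      by (rule rapid_n_linear[OF bounded_linear_minus[OF bounded_linear_ident]], rule rapid_n_mono[OF rapid_n_exp[of 0 \<mu>]])
         (use rapid_decaying[OF axx] q in auto)
    have "fseries B (spatial_part B q bx a) z = (\<Sum>j\<in>UNIV. fseries B (\<lambda>k s. exp (q $ j * s) *\<^sub>R (bx j *v freq_mult B j a k s)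
         + - (exp (2 * q $ j * s) *\<^sub>R freq_mult B j (freq_mult B j a) k s)) z)"
      unfolding spatial_part_def[abs_def] by (rule fseries_sum[OF finite UNIV_not_empty rapid_n_add[OF 1 2]])
    also have "\<dots> = (\<Sum>j\<in>UNIV. fst z powr (q $ j) *\<^sub>R (bx j *v fseries B (freq_mult B j a) z)
         + - (fst z powr (2 * q $ j) *\<^sub>R fseries B (freq_mult B j (freq_mult B j a)) z))"
    proof (intro sum.cong refl)
      fix j
      have "decaying (\<mu> + 2 * q $ j) (\<lambda>k s. exp (2 * q $ j * s) *\<^sub>R freq_mult B j (freq_mult B j a) k s)"
        by (rule decaying_exp[OF rapid_decaying[OF axx]])
      from fseries_linear[OF this bounded_linear_minus[OF bounded_linear_ident]]
      have m: "fseries B (\<lambda>k s. - (exp (2 * q $ j * s) *\<^sub>R freq_mult B j (freq_mult B j a) k s)) z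
        = - fseries B (\<lambda>k s. exp (2 * q $ j * s) *\<^sub>R freq_mult B j (freq_mult B j a) k s) z" by (simp add: vsc_simps)
      have "fseries B (\<lambda>k s. exp (q $ j * s) *\<^sub>R (bx j *v freq_mult B j a k s) + - (exp (2 * q $ j * s) *\<^sub>R freq_mult B j (freq_mult B j a) k s)) z
        = fseries B (\<lambda>k s. exp (q $ j * s) *\<^sub>R (bx j *v freq_mult B j a k s)) z + fseries B (\<lambda>k s. - (exp (2 * q $ j * s) *\<^sub>R freq_mult B j (freq_mult B j a) k s)) z"
        by (rule fseries_add[OF rapid_n_decaying[OF 1] rapid_n_decaying[OF 2]])
      also have "\<dots> = fst z powr (q $ j) *\<^sub>R (bx j *v fseries B (freq_mult B j a) z) + - (fst z powr (2 * q $ j) *\<^sub>R fseries B (freq_mult B j (freq_mult B j a)) z)"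
        unfolding m fseries_exp[OF lin[OF ax] z] fl[OF ax] fseries_exp[OF rapid_decaying[OF axx] z] ..
      finally show "fseries B (\<lambda>k s. exp (q $ j * s) *\<^sub>R (bx j *v freq_mult B j a k s) + - (exp (2 * q $ j * s) *\<^sub>R freq_mult B j (freq_mult B j a) k s)) z
        = fst z powr (q $ j) *\<^sub>R (bx j *v fseries B (freq_mult B j a) z) + - (fst z powr (2 * q $ j) *\<^sub>R fseries B (freq_mult B j (freq_mult B j a)) z)" .
    qed
    finally show ?thesis by (simp add: sum.distrib sum_negf sum_subtractf)
  qed
  have dsp: "decaying \<mu> (spatial_part B q bx a)"
    using rapid_n_spatial_part[of 0 \<mu> a 0 q B bx] rapid_decaying[OF a] q by simp
  have "fseries B (\<lambda>k s. mode_deriv (mode_deriv a) k s + b *v mode_deriv a k s + c *v a k s + spatial_part B q bx a k s) z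
    = fseries B (mode_deriv (mode_deriv a)) z + b *v fseries B (mode_deriv a) z + c *v fseries B a z + fseries B (spatial_part B q bx a) z"
    unfolding fseries_add[OF decaying_add[OF decaying_add[OF rapid_decaying[OF a''] lin[OF a']] lin[OF a]] dsp]
      fseries_add[OF decaying_add[OF rapid_decaying[OF a''] lin[OF a']] lin[OF a]]
      fseries_add[OF rapid_decaying[OF a''] lin[OF a']] fl[OF a'] fl[OF a] ..
  then show ?thesis
    unfolding kasner_op_def tt xx t_deriv_t_fseries[OF a z] deriv_x_fseries[OF a z] sp by (simp add: algebra_simps)
qed

text \<open>
  The function \<open>exp (l * ln t) w\<close> does not depend on \<open>x\<close>, so the spatial terms vanish on it, and it is an
  eigenfunction of the scaling field.
\<close>

lemma indicial_root_gives_frequency: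
  fixes p :: "real ^ 'n::finite" and w :: "complex ^ 'm::finite"
  assumes P: "\<And>u z. smooth_on spacetime u \<Longrightarrow> z \<in> spacetime \<Longrightarrow> (fst z)\<^sup>2 *\<^sub>R P u z = kasner_op (\<chi> j. 1 - p $ j) b bx c u z"
    and w: "w \<noteq> 0" "(l * l) *s w + l *s (b *v w) + c *v w = 0"
  shows "qnm_frequency p P (- \<i> * l)"
proof -
  define f where "f r v z = exp (r * of_real (ln (fst z))) *s v" for r and v :: "complex ^ 'm" and z :: "'n point"
  have d: "(f r v has_derivative (\<lambda>h. (fst h / fst z) *\<^sub>R f r (r *s v) z)) (at z)" if "z \<in> spacetime" for r v z
  proof -
    have pos: "fst z > 0" using that by (simp add: spacetime_def)
    have 1: "((\<lambda>z. ln (fst z)) has_derivative (\<lambda>h. fst h / fst z)) (at z)"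
      using pos by (auto intro!: derivative_eq_intros simp: divide_inverse)
    have 2: "((\<lambda>s. exp (r * complex_of_real s)) has_vector_derivative r * exp (r * of_real s)) (at s)" for s
      by (rule has_vector_derivative_real_field[of "\<lambda>z. exp (r * z)", simplified o_def]) (auto intro!: derivative_eq_intros)
    have 3: "((\<lambda>s. exp (r * complex_of_real s) *s v) has_derivative (\<lambda>h. h *\<^sub>R ((r * exp (r * of_real s)) *s v))) (at s)" for s
      using bounded_linear.has_vector_derivative[OF bounded_bilinear.bounded_linear_left[OF bounded_bilinear_vsc] 2]
      unfolding has_vector_derivative_def .
    have "(r * exp (r * of_real s)) *s v = exp (r * of_real s) *s (r *s v)" for s by (simp add: mult.commute)
    then show ?thesis using has_derivative_compose[OF 1 3] unfolding f_def[abs_def] by (simp add: mult.commute)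
  qed
  have tf: "t_deriv_t (f r v) z = f r (r *s v) z" and xf: "deriv_x j (f r v) z = 0" if "z \<in> spacetime" for r v z j
    using dir_deriv_eqI[OF d[OF that]] that by (simp_all add: t_deriv_t_def spacetime_def)
  have f0: "f r 0 z = 0" and fs: "f r (k *s v) z = k *s f r v z" for r k v z by (simp_all add: f_def vsc_simps mult.commute)
  have sm: "smooth_on spacetime (f r v)" for r v
  proof (rule smooth_on_coinduct[where C="{f r v | r v. True}"])
    fix g :: "'n point \<Rightarrow> complex ^ 'm" and h :: "'n point" assume "g \<in> {f r v | r v. True}"
    then obtain r v where g: "g = f r v" by blast
    show "g differentiable (at z)" if "z \<in> spacetime" for z unfolding g by (rule differentiableI[OF d[OF that]])
    have "dir_deriv h g z = f (r - 1) ((of_real (fst h) * r) *s v) z" if z: "z \<in> spacetime" for z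
    proof -
      have "exp (r * of_real (ln (fst z))) = exp ((r - 1) * of_real (ln (fst z))) * complex_of_real (fst z)"
        using z by (simp add: left_diff_distrib exp_diff exp_of_real spacetime_def)
      then show ?thesis unfolding g dir_deriv_eqI[OF d[OF z]] using z
        by (simp add: f_def vec_eq_iff spacetime_def) (simp add: scaleR_conv_of_real)
    qed
    then show "\<exists>h'\<in>{f r v | r v. True}. \<forall>z\<in>spacetime. dir_deriv h g z = h' z" by blast
  qed (auto simp: open_spacetime)
  define v where "v = f l w"
  have v0: "kasner_op (\<chi> j. 1 - p $ j) b bx c v z = 0" if z: "z \<in> spacetime" for z
  proof -
    have "t_deriv_t (t_deriv_t v) z = t_deriv_t (f l (l *s w)) z"
      unfolding v_def by (rule t_deriv_t_cong[OF open_spacetime z tf smooth_on_differentiable[OF smooth_on_t_deriv_t[OF sm] z]])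
    then have tt: "t_deriv_t (t_deriv_t v) z = (l * l) *s v z" unfolding tf[OF z] fs v_def by simp
    have "deriv_x j (deriv_x j v) z = deriv_x j (\<lambda>_. 0) z" for j
      unfolding v_def by (rule dir_deriv_cong[OF open_spacetime z xf smooth_on_differentiable[OF smooth_on_dir_deriv[OF sm] z]])
    then have xx: "deriv_x j (deriv_x j v) z = 0" for j by (simp add: dir_deriv_const)
    have "kasner_op (\<chi> j. 1 - p $ j) b bx c v z = (l * l) *s v z + b *v (l *s v z) + c *v v z"
      unfolding kasner_op_def tt xx using tf[OF z, of l w] xf[OF z, of _ l w] by (simp add: v_def fs matvec_simps)
    also have "\<dots> = exp (l * of_real (ln (fst z))) *s ((l * l) *s w + l *s (b *v w) + c *v w)"
      unfolding v_def f_def by (simp add: matvec_vsc vsc_simps mult_ac)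
    finally show ?thesis using w(2) by (simp add: vsc_simps)
  qed
  have "generalized_qnm p P (- \<i> * l) v"
    unfolding generalized_qnm_def
  proof (intro conjI ballI exI[of _ "1::nat"])
    show "smooth_on spacetime v" unfolding v_def by (rule sm)
    fix z :: "'n point" assume z: "z \<in> spacetime"
    have "(fst z)\<^sup>2 *\<^sub>R P v z = 0" using P[OF sm z, of l w] v0[OF z] by (simp add: v_def)
    then show "P v z = 0" using z by (simp add: spacetime_def)
    have "scaling_field p v z = - (l *s v z)"
      unfolding scaling_field_def using tf[OF z, of l w] xf[OF z, of _ l w] by (simp add: v_def t_deriv_t_def fs)
    then show "((\<lambda>w z. scaling_field p w z + (\<i> * (- \<i> * l)) *s w z) ^^ 1) v z = 0"
      by (simp add: mult.assoc[symmetric])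
  qed simp
  moreover have "nontrivial v"
    unfolding nontrivial_def
  proof (intro bexI[of _ "(1, 0)"])
    show "v (1, 0) \<noteq> 0" using w(1) by (simp add: v_def f_def)
  qed (simp add: spacetime_def)
  ultimately show ?thesis unfolding qnm_frequency_def by blast
qed


lemma t_deriv_t_0: "t_deriv_t (\<lambda>_. 0) = (\<lambda>_. 0)"
  by (rule ext) (simp add: t_deriv_t_def dir_deriv_const)

lemma kasner_op_0: "kasner_op q b bx c (\<lambda>_. 0) z = 0"
  by (simp add: kasner_op_def t_deriv_t_0 dir_deriv_const matvec_simps)

lemma kasner_op_diff:
  assumes u: "smooth_on spacetime u" and v: "smooth_on spacetime v" and z: "z \<in> spacetime"
  shows "kasner_op q b bx c (\<lambda>z. u z - v z) z = kasner_op q b bx c u z - kasner_op q b bx c v z"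
proof -
  have d: "dir_deriv w (\<lambda>z. f z - g z) y = dir_deriv w f y - dir_deriv w g y"
    if "smooth_on spacetime f" "smooth_on spacetime g" "y \<in> spacetime" for w y and f g :: "'a point \<Rightarrow> complex ^ 'b"
    by (rule dir_deriv_eqI[OF has_derivative_diff]) (rule smooth_on_has_derivative that)+
  have t: "t_deriv_t (\<lambda>z. f z - g z) y = t_deriv_t f y - t_deriv_t g y"
    if "smooth_on spacetime f" "smooth_on spacetime g" "y \<in> spacetime" for y and f g :: "'a point \<Rightarrow> complex ^ 'b"
    unfolding t_deriv_t_def d[OF that] by (rule scaleR_right_diff_distrib)
  note sd = smooth_on_diff[OF open_spacetime u v]
  have tt: "t_deriv_t (t_deriv_t (\<lambda>z. u z - v z)) z = t_deriv_t (t_deriv_t u) z - t_deriv_t (t_deriv_t v) z"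
    using t_deriv_t_cong[OF open_spacetime z t[OF u v] smooth_on_differentiable[OF smooth_on_t_deriv_t[OF sd] z]]
      t[OF smooth_on_t_deriv_t[OF u] smooth_on_t_deriv_t[OF v] z] by simp
  have xx: "deriv_x j (deriv_x j (\<lambda>z. u z - v z)) z = deriv_x j (deriv_x j u) z - deriv_x j (deriv_x j v) z" for j
    using dir_deriv_cong[OF open_spacetime z d[OF u v] smooth_on_differentiable[OF smooth_on_dir_deriv[OF sd] z]]
      d[OF smooth_on_dir_deriv[OF u] smooth_on_dir_deriv[OF v] z] by simp
  show ?thesis unfolding kasner_op_def tt xx t[OF u v z] d[OF u v z]
    by (simp add: matvec_simps scaleR_right_diff_distrib sum_subtractf)
qed

text \<open>
  A light ray along a coordinate axis has speed \<open>t powr (q j - 1)\<close>, which is integrable at \<open>t = 0\<close>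
  since \<open>q j > 0\<close>: up to the time \<open>T\<close> it covers at most the finite distance \<open>T powr q j / q j\<close>. So
  the particle horizons are bounded, and this is what permits working on a torus.
\<close>

lemma finite_horizon_vanishing:
  fixes u :: "('n::finite) point \<Rightarrow> complex ^ ('m::finite)"
  assumes q: "\<And>j. 0 < q $ j" and u: "smooth_on spacetime u" and w: "w \<in> spacetime"
    and late: "\<And>z. T \<le> fst z \<Longrightarrow> z \<in> spacetime \<Longrightarrow> u z = 0"
    and Rh: "\<And>j. T powr (q $ j) / q $ j \<le> Rh"
    and eq: "\<And>z. z \<in> spacetime \<Longrightarrow> (\<And>i. \<bar>snd z $ i - snd w $ i\<bar> < 1 + Rh) \<Longrightarrow> kasner_op q b bx c u z = 0"
  shows "u w = 0"
proof -
  define a where "a = fst w / 2"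
  have a: "0 < a" "a < fst w" using w by (auto simp: a_def spacetime_def)
  define H :: "(real ^ 'n) set" where "H = (\<lambda>(s, i). s *\<^sub>R axis i 1) ` ({1, -1} \<times> UNIV)"
  show ?thesis
  proof (rule vanishing_from_fronts[of q u a w H 1 T b bx c])
    fix z :: "'n point"
    assume wz: "fst w \<le> fst z" and fr: "\<forall>\<eta>\<in>H. front q a \<eta> w - 1 < front q a \<eta> z"
    have z: "z \<in> spacetime" using w wz by (simp add: spacetime_def)
    show "kasner_op q b bx c u z = 0"
    proof (cases "fst z \<le> T")
      case False
      have o: "open ({z. T < fst z} \<inter> (spacetime :: 'n point set))"
        by (intro open_Int open_spacetime open_Collect_less continuous_intros)
      have "kasner_op q b bx c (\<lambda>_. 0) z = kasner_op q b bx c u z"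
        by (rule kasner_op_cong[OF o]) (use False z late in \<open>auto intro: smooth_on_const\<close>)
      then show ?thesis by (simp add: kasner_op_0)
    next
      case True
      have I: "integral {a..y} (char_speed q (s *\<^sub>R axis i 1)) = y powr (q $ i) / q $ i - a powr (q $ i) / q $ i"
        if s: "s \<in> {1, -1}" and y: "a \<le> y" for s i y
      proof (rule integral_unique[OF fundamental_theorem_of_calculus[OF y]])
        fix x assume "x \<in> {a..y}"
        then have x: "0 < x" using a by simp
        have "((\<lambda>t. t powr (q $ i) / q $ i) has_real_derivative q $ i * x powr (q $ i - 1) / q $ i) (at x)"
          by (rule DERIV_cdivide[OF has_real_derivative_powr[OF x]])
        moreover have "q $ i * x powr (q $ i - 1) / q $ i = char_speed q (s *\<^sub>R axis i 1) x"
          using s q[of i] by (auto simp: char_speed_axis[OF x])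
        ultimately show "((\<lambda>t. t powr (q $ i) / q $ i) has_vector_derivative char_speed q (s *\<^sub>R axis i 1) x) (at x within {a..y})"
          by (simp add: has_real_derivative_iff_has_vector_derivative has_vector_derivative_at_within)
      qed
      have "\<bar>snd z $ i - snd w $ i\<bar> < 1 + Rh" for i
      proof -
        have "s * (snd z $ i - snd w $ i) < 1 + Rh" if s: "s \<in> {1, -1}" for s
        proof -
          have "s *\<^sub>R axis i 1 \<in> H" using s unfolding H_def by auto
          then have "front q a (s *\<^sub>R axis i 1) w - 1 < front q a (s *\<^sub>R axis i 1) z" using fr by blast
          then have "s * (snd z $ i - snd w $ i) < 1 + (fst z powr (q $ i) / q $ i - fst w powr (q $ i) / q $ i)"
            unfolding front_def I[OF s less_imp_le[OF a(2)]] I[OF s order_trans[OF less_imp_le[OF a(2)] wz]]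
            by (simp add: inner_axis algebra_simps)
          moreover have "fst z powr (q $ i) / q $ i \<le> T powr (q $ i) / q $ i"
            using True z q[of i] by (intro divide_right_mono powr_mono2) (auto simp: spacetime_def)
          moreover have "0 \<le> fst w powr (q $ i) / q $ i" using q[of i] by simp
          ultimately show ?thesis using Rh[of i] by linarith
        qed
        from this[of 1] this[of "-1"] show ?thesis by (simp add: abs_less_iff)
      qed
      then show ?thesis by (rule eq[OF z])
    qed
  qed (use q u a late in \<open>auto simp: H_def intro: less_imp_le\<close>)
qed

definition inner_region :: "real \<Rightarrow> ('n::finite) point set" where
  "inner_region R = {z \<in> spacetime. \<forall>j. \<bar>snd z $ j\<bar> < R}"

definition outer_region :: "real \<Rightarrow> ('n::finite) point set" where
  "outer_region R = {z \<in> spacetime. \<exists>j. R < \<bar>snd z $ j\<bar>}"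

lemma open_inner_region: "open (inner_region R :: ('n::finite) point set)"
proof -
  have "open (spacetime \<inter> (\<Inter>j. {z :: 'n point. \<bar>snd z $ j\<bar> < R}))"
    by (intro open_Int open_spacetime open_INT finite ballI open_Collect_less continuous_intros)
  moreover have "inner_region R = spacetime \<inter> (\<Inter>j. {z :: 'n point. \<bar>snd z $ j\<bar> < R})" by (auto simp: inner_region_def)
  ultimately show ?thesis by simp
qed

lemma open_outer_region: "open (outer_region R :: ('n::finite) point set)"
proof -
  have "open (spacetime \<inter> (\<Union>j. {z :: 'n point. R < \<bar>snd z $ j\<bar>}))"
    by (intro open_Int open_spacetime open_UN ballI open_Collect_less continuous_intros)
  moreover have "outer_region R = spacetime \<inter> (\<Union>j. {z :: 'n point. R < \<bar>snd z $ j\<bar>})" by (auto simp: outer_region_def)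
  ultimately show ?thesis by simp
qed

lemma inner_or_outer: "R0 < R1 \<Longrightarrow> z \<in> spacetime \<Longrightarrow> z \<notin> inner_region R1 \<Longrightarrow> z \<in> outer_region R0"
  by (auto simp: inner_region_def outer_region_def not_less) (meson less_le_trans)

text \<open>
  Functions that agree with a Fourier series in the inner region and vanish outside of it. The
  series itself vanishes in the shell where the two regions overlap, so the class is closed under
  differentiation, and the bounds for the periodic series carry over.
\<close>

definition truncated_series :: "real \<Rightarrow> real \<Rightarrow> real \<Rightarrow> real \<Rightarrow> (('n::finite) point \<Rightarrow> complex ^ ('m::finite)) \<Rightarrow> bool" where
  "truncated_series R0 R1 B \<mu> g \<longleftrightarrow> (\<exists>a. rapid \<mu> a \<and>
     (\<forall>z\<in>inner_region R1 \<inter> outer_region R0. fseries B a z = 0) \<and>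
     (\<forall>z\<in>spacetime. g z = (if z \<in> inner_region R1 then fseries B a z else 0)))"

lemma truncated_series_deriv:
  fixes D :: "(('n::finite) point \<Rightarrow> complex ^ ('m::finite)) \<Rightarrow> 'n point \<Rightarrow> complex ^ 'm"
  assumes R: "R0 < R1" and g: "truncated_series R0 R1 B \<mu> g"
    and cong: "\<And>S z f g. open S \<Longrightarrow> z \<in> S \<Longrightarrow> (\<And>y. y \<in> S \<Longrightarrow> f y = g y) \<Longrightarrow> f differentiable (at z) \<Longrightarrow> D f z = D g z"
    and D0: "\<And>z. D (\<lambda>_. 0) z = 0"
    and D: "\<And>a z. rapid \<mu> a \<Longrightarrow> z \<in> spacetime \<Longrightarrow> D (fseries B a) z = fseries B (d a) z"
    and d: "\<And>a. rapid \<mu> a \<Longrightarrow> rapid \<mu> (d a)"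
  shows "truncated_series R0 R1 B \<mu> (D g)"
proof -
  obtain a where a: "rapid \<mu> a" "\<And>z. z \<in> inner_region R1 \<Longrightarrow> z \<in> outer_region R0 \<Longrightarrow> fseries B a z = 0"
    and ga: "\<And>z. z \<in> spacetime \<Longrightarrow> g z = (if z \<in> inner_region R1 then fseries B a z else 0)"
    using g unfolding truncated_series_def by blast
  have sub: "z \<in> spacetime" if "z \<in> inner_region R1 \<or> z \<in> outer_region R0" for z :: "'n point"
    using that by (auto simp: inner_region_def outer_region_def)
  have "fseries B (d a) z = 0" if z: "z \<in> inner_region R1 \<inter> outer_region R0" for z
  proof -
    have "D (\<lambda>_. 0) z = D (fseries B a) z"
      by (rule cong[OF open_Int[OF open_inner_region open_outer_region] z]) (use a(2) in auto)
    then show ?thesis using D[OF a(1)] sub z D0 by auto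
  qed
  moreover have "D g z = (if z \<in> inner_region R1 then fseries B (d a) z else 0)" if z: "z \<in> spacetime" for z
  proof (cases "z \<in> inner_region R1")
    case True
    have "D (fseries B a) z = D g z"
      by (rule cong[OF open_inner_region True])
         (use ga sub in \<open>auto intro: smooth_on_differentiable[OF smooth_on_fseries[OF a(1)] z]\<close>)
    then show ?thesis using True D[OF a(1) z] by simp
  next
    case False
    have "D (\<lambda>_. 0) z = D g z"
      by (rule cong[OF open_outer_region inner_or_outer[OF R z False]]) (use ga sub a(2) in auto)
    then show ?thesis using False D0 by simp
  qed
  ultimately show ?thesis unfolding truncated_series_def using d[OF a(1)] by blast
qed

lemma funpow_preserves: "(\<And>g. Q g \<Longrightarrow> Q (h g)) \<Longrightarrow> Q g \<Longrightarrow> Q ((h ^^ n) g)"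
  by (induction n) auto

lemma truncated_series_derivs:
  fixes g :: "('n::finite) point \<Rightarrow> complex ^ ('m::finite)"
  assumes R: "R0 < R1" and g: "truncated_series R0 R1 B \<mu> g"
  shows "truncated_series R0 R1 B \<mu> ((t_deriv_t ^^ k) (multi_deriv_x \<alpha> g))"
proof -
  have t: "truncated_series R0 R1 B \<mu> (t_deriv_t h)" if "truncated_series R0 R1 B \<mu> h" for h :: "'n point \<Rightarrow> complex ^ 'm"
  proof (rule truncated_series_deriv[where D=t_deriv_t and d=mode_deriv, OF R that])
    show "t_deriv_t f z = t_deriv_t g z"
      if "open S" "z \<in> S" "\<And>y. y \<in> S \<Longrightarrow> f y = g y" "f differentiable (at z)" for S z and f g :: "'n point \<Rightarrow> complex ^ 'm"
      by (rule t_deriv_t_cong[OF that])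
  qed (simp_all add: t_deriv_t_0 t_deriv_t_fseries rapid_mode_deriv)
  have x: "truncated_series R0 R1 B \<mu> (deriv_x j h)" if "truncated_series R0 R1 B \<mu> h" for j and h :: "'n point \<Rightarrow> complex ^ 'm"
  proof (rule truncated_series_deriv[where D="deriv_x j" and d="freq_mult B j", OF R that])
    show "deriv_x j f z = deriv_x j g z"
      if "open S" "z \<in> S" "\<And>y. y \<in> S \<Longrightarrow> f y = g y" "f differentiable (at z)" for S z and f g :: "'n point \<Rightarrow> complex ^ 'm"
      by (rule dir_deriv_cong[OF that])
  qed (simp_all add: dir_deriv_const deriv_x_fseries rapid_freq_mult)
  have "truncated_series R0 R1 B \<mu> (foldr (\<lambda>j. deriv_x j ^^ \<alpha> j) js g)" for js
    by (induction js) (auto intro: g funpow_preserves[where Q="truncated_series R0 R1 B \<mu>"] x)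
  then show ?thesis unfolding multi_deriv_x_def
    by (intro funpow_preserves[where Q="truncated_series R0 R1 B \<mu>"] t)
qed

lemma truncated_series_bound:
  assumes "truncated_series R0 R1 B \<mu> g"
  shows "\<exists>C>0. \<forall>z\<in>spacetime. norm (g z) \<le> C * fst z powr \<mu>"
proof -
  obtain a where a: "rapid \<mu> a" and ga: "\<And>z. z \<in> spacetime \<Longrightarrow> g z = (if z \<in> inner_region R1 then fseries B a z else 0)"
    using assms unfolding truncated_series_def by blast
  obtain C where C: "C > 0" "\<And>z. z \<in> spacetime \<Longrightarrow> norm (fseries B a z) \<le> C * fst z powr \<mu>"
    using fseries_bound[OF rapid_decaying[OF a], of B] by metis
  show ?thesis using C by (intro exI[of _ C]) (auto simp: ga)
qed

text \<open>
  The equation is solved on a torus of side \<open>2 B\<close> that is large compared with the horizons: the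
  periodic solution then vanishes in a shell around the source, and cutting it off in that shell
  gives the solution on the whole space.
\<close>

theorem inhomogeneous_solution:
  fixes F :: "('n::finite) point \<Rightarrow> complex ^ ('m::finite)" and q :: "real ^ 'n"
  assumes q: "\<And>j. 0 < q $ j" and F: "supported_in_box r t0 t1 F" and t0: "0 < t0"
  obtains u T where "smooth_on spacetime u" "\<And>z. z \<in> spacetime \<Longrightarrow> kasner_op q b bx c u z = F z"
    "\<And>z. z \<in> spacetime \<Longrightarrow> T \<le> fst z \<Longrightarrow> u z = 0"
    "\<And>\<nu> k \<alpha>. \<forall>l w. w \<noteq> 0 \<longrightarrow> (l * l) *s w + l *s (b *v w) + c *v w = 0 \<longrightarrow> \<nu> < Re l \<Longrightarrow>
       \<exists>C>0. \<forall>z\<in>spacetime. norm ((t_deriv_t ^^ k) (multi_deriv_x \<alpha> u) z) \<le> C * fst z powr \<nu>"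
proof -
  define s0 where "s0 = ln (\<bar>t1\<bar> + 1)"
  define T where "T = exp (s0 + 1)"
  define Rh where "Rh = (\<Sum>j\<in>UNIV. T powr (q $ j) / q $ j)"
  have Rh0: "0 \<le> Rh" unfolding Rh_def using q by (intro sum_nonneg) (simp add: less_imp_le)
  have Rh: "T powr (q $ j) / q $ j \<le> Rh" for j
    unfolding Rh_def using q by (intro member_le_sum) (auto simp: less_imp_le)
  define R0 R1 where "R0 = \<bar>r\<bar> + Rh + 1" and "R1 = \<bar>r\<bar> + Rh + 2"
  define B where "B = R1 + Rh + 1"
  have R: "R0 < R1" "R1 < B" and B: "0 < B" and rB: "r < B" using Rh0 by (auto simp: R0_def R1_def B_def)
  have Fs0: "coefficients B F k s = 0" if "s0 \<le> s" for k s
  proof -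
    have "exp s0 \<le> exp s" using that by simp
    then have "t1 < exp s" by (simp add: s0_def)
    then show ?thesis using coefficients_pointwise_bound[OF F t0 B, of 0] by blast
  qed
  have me: "mode_equation q (coefficients B F)"
    by unfold_locales (use q rapid_coefficients[OF F t0 rB B] in auto)
  obtain a where a: "\<exists>\<nu>. rapid \<nu> a"
    and rap: "\<forall>\<nu>. (\<forall>l w. w \<noteq> 0 \<longrightarrow> (l * l) *s w + l *s (b *v w) + c *v w = 0 \<longrightarrow> \<nu> < Re l) \<longrightarrow> rapid \<nu> a"
    and eqa: "\<forall>k s. mode_deriv (mode_deriv a) k s + b *v mode_deriv a k s + c *v a k s + spatial_part B q bx a k s = coefficients B F k s"
    and za: "\<forall>k s. s0 + 1 \<le> s \<longrightarrow> a k s = 0"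
    by (rule mode_equation.solution_modes[where B=B and b=b and c=c and bx=bx, OF me Fs0])
  obtain \<mu> where \<mu>: "rapid \<mu> a" using a by blast
  define U where "U = fseries B a"
  have smU: "smooth_on spacetime U" unfolding U_def by (rule smooth_on_fseries[OF \<mu>])
  have eqU: "kasner_op q b bx c U z = F z" if z: "z \<in> spacetime" and "\<And>j. \<bar>snd z $ j\<bar> < B" for z
    unfolding U_def kasner_op_fseries[OF \<mu> less_imp_le[OF q] z] using eqa fourier_inversion[OF F t0 rB B that] by simp
  have lateU: "U z = 0" if "T \<le> fst z" "z \<in> spacetime" for z
  proof -
    have "s0 + 1 \<le> ln (fst z)" using that by (simp add: T_def spacetime_def ln_ge_iff)
    then show ?thesis using za by (simp add: U_def fseries_def vsc_simps)
  qed
  have F0: "F z = 0" if "z \<in> spacetime" "\<bar>r\<bar> < \<bar>snd z $ j\<bar>" for z j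
    using F that unfolding supported_in_box_def mem_Cube by (meson abs_ge_self dual_order.trans not_le)
  have shell: "U w = 0" if "w \<in> inner_region R1" "w \<in> outer_region R0" for w
  proof -
    obtain j where j: "R0 < \<bar>snd w $ j\<bar>" using \<open>w \<in> outer_region R0\<close> by (auto simp: outer_region_def)
    have w: "w \<in> spacetime" and i: "\<bar>snd w $ i\<bar> < R1" for i using that by (auto simp: inner_region_def)
    show ?thesis
    proof (rule finite_horizon_vanishing[OF q smU w lateU Rh])
      fix z :: "'n point" assume z: "z \<in> spacetime" and d: "\<And>i. \<bar>snd z $ i - snd w $ i\<bar> < 1 + Rh"
      have "\<bar>snd z $ k\<bar> < B" for k using d[of k] i[of k] unfolding B_def by linarith
      moreover have "\<bar>r\<bar> < \<bar>snd z $ j\<bar>" using d[of j] j unfolding R0_def by linarith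
      ultimately show "kasner_op q b bx c U z = 0" using eqU[OF z] F0[OF z] by simp
    qed
  qed
  define u where "u z = (if z \<in> inner_region R1 then U z else 0)" for z
  have uo: "u z = 0" if "z \<in> outer_region R0" for z using shell that by (simp add: u_def)
  have sub: "inner_region R1 \<subseteq> (spacetime :: 'n point set)" "outer_region R0 \<subseteq> (spacetime :: 'n point set)"
    by (auto simp: inner_region_def outer_region_def)
  have cover: "spacetime = inner_region R1 \<union> (outer_region R0 :: 'n point set)"
    using sub inner_or_outer[OF R(1)] by blast
  note smI = smooth_on_subset[OF smU sub(1)]
  show thesis
  proof (rule that[of u T])
    have "smooth_on (inner_region R1) u" by (rule smooth_on_cong[OF open_inner_region _ smI]) (simp add: u_def)
    moreover have "smooth_on (outer_region R0) u"
      by (rule smooth_on_cong[OF open_outer_region _ smooth_on_const[of _ 0]]) (simp add: uo)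
    ultimately show "smooth_on spacetime u" unfolding cover by (rule smooth_on_Un[OF open_inner_region open_outer_region])
    show "u z = 0" if "z \<in> spacetime" "T \<le> fst z" for z using lateU that by (simp add: u_def)
    show "kasner_op q b bx c u z = F z" if z: "z \<in> spacetime" for z
    proof (cases "z \<in> inner_region R1")
      case True
      have "kasner_op q b bx c U z = kasner_op q b bx c u z"
        by (rule kasner_op_cong[OF open_inner_region sub(1) True _ smI]) (simp add: u_def)
      moreover have "\<bar>snd z $ j\<bar> < B" for j using True R by (auto simp: inner_region_def intro: less_trans)
      ultimately show ?thesis using eqU[OF z] by simp
    next
      case False
      then have zo: "z \<in> outer_region R0" by (rule inner_or_outer[OF R(1) z])
      have "kasner_op q b bx c (\<lambda>_. 0) z = kasner_op q b bx c u z"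
        by (rule kasner_op_cong[OF open_outer_region sub(2) zo _ smooth_on_const]) (simp add: uo)
      moreover obtain j where "R0 < \<bar>snd z $ j\<bar>" using zo by (auto simp: outer_region_def)
      then have "F z = 0" by (intro F0[OF z, of j]) (use Rh0 in \<open>simp add: R0_def\<close>)
      ultimately show ?thesis by (simp add: kasner_op_0)
    qed
    fix \<nu> k \<alpha>
    assume "\<forall>l w. w \<noteq> 0 \<longrightarrow> (l * l) *s w + l *s (b *v w) + c *v w = 0 \<longrightarrow> \<nu> < Re l"
    then have "rapid \<nu> a" using rap by blast
    then have "truncated_series R0 R1 B \<nu> u"
      unfolding truncated_series_def using shell by (intro exI[of _ a]) (simp add: u_def U_def)
    then show "\<exists>C>0. \<forall>z\<in>spacetime. norm ((t_deriv_t ^^ k) (multi_deriv_x \<alpha> u) z) \<le> C * fst z powr \<nu>"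
      by (intro truncated_series_bound[OF truncated_series_derivs[OF R(1)]])
  qed
qed

lemma compact_in_box:
  fixes K :: "('n::finite) point set"
  assumes K: "compact K" "K \<subseteq> spacetime"
  obtains t0 t1 r where "0 < t0" "\<And>z. z \<in> K \<Longrightarrow> t0 \<le> fst z \<and> fst z \<le> t1 \<and> snd z \<in> Cube r"
proof (cases "K = {}")
  case True
  then show thesis using that[of 1] by simp
next
  case False
  obtain z0 where z0: "z0 \<in> K" "\<And>z. z \<in> K \<Longrightarrow> fst z0 \<le> fst z"
    using continuous_attains_inf[OF K(1) False continuous_on_fst[OF continuous_on_id]] by auto
  obtain M where M: "\<And>z. z \<in> K \<Longrightarrow> norm z \<le> M" using compact_imp_bounded[OF K(1)] unfolding bounded_iff by blast
  have "fst z \<le> M \<and> \<bar>snd z $ j\<bar> \<le> M" if "z \<in> K" for z j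
    using M[OF that] norm_fst_le[of "fst z" "snd z"] norm_snd_le[of "snd z" "fst z"] component_le_norm_cart[of "snd z" j] by simp
  moreover have "0 < fst z0" using z0(1) K(2) by (auto simp: spacetime_def)
  ultimately show thesis using z0(2) by (intro that[of "fst z0" M M]) (auto simp: mem_Cube)
qed

theorem corollary1p19:
  fixes p :: "real ^ 'n::finite"
    and P :: "('n point \<Rightarrow> complex ^ 'm::finite) \<Rightarrow> 'n point \<Rightarrow> complex ^ 'm"
    and v\<^sub>1 f :: "'n point \<Rightarrow> complex ^ 'm"
    and \<sigma>\<^sub>1 :: complex
  assumes p_less: "\<forall>j. p $ j < 1"
    and wave: "linear_wave_operator p P"
    and comm_T: "operators_commute (scaling_field p) (\<lambda>u z. (fst z)\<^sup>2 *\<^sub>R P u z)"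
    and comm_x: "\<forall>j. operators_commute (deriv_x j) P"
    and v1: "generalized_qnm p P \<sigma>\<^sub>1 v\<^sub>1" "nontrivial v\<^sub>1"
    and largest: "\<forall>\<sigma>. qnm_frequency p P \<sigma> \<longrightarrow> Im \<sigma> \<le> Im \<sigma>\<^sub>1"
    and f: "smooth_on spacetime f" "compact (spacetime_support f)"
  shows "\<exists>u. backward_solution p P f u \<and>
    (\<forall>u'. backward_solution p P f u' \<longrightarrow> (\<forall>z\<in>spacetime. u' z = u z)) \<and>
    (\<forall>k \<alpha>. \<forall>\<epsilon>>0. \<exists>C>0. \<forall>z\<in>causal_future_axis p.
       norm ((t_deriv_t ^^ k) (multi_deriv_x \<alpha> u) z) \<le> C * fst z powr (- Im \<sigma>\<^sub>1 - \<epsilon>))"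
proof -
  obtain b bx c where P: "\<And>u z. smooth_on spacetime u \<Longrightarrow> z \<in> spacetime \<Longrightarrow> (fst z)\<^sup>2 *\<^sub>R P u z = kasner_op (\<chi> j. 1 - p $ j) b bx c u z"
    by (rule wave_operator_normal_form[OF wave comm_T comm_x]) (rule that)
  define q where "q = (\<chi> j. 1 - p $ j)"
  have q: "0 < q $ j" for j using p_less by (simp add: q_def)
  have Pq: "(fst z)\<^sup>2 *\<^sub>R P u z = kasner_op q b bx c u z" if "smooth_on spacetime u" "z \<in> spacetime" for u z
    unfolding q_def by (rule P[OF that])
  let ?K = "spacetime_support f"
  have K: "compact ?K" "?K \<subseteq> spacetime" using f by (auto simp: spacetime_support_def)
  have inK: "z \<in> spacetime_support g" if "z \<in> spacetime" "g z \<noteq> 0" for g :: "'n point \<Rightarrow> complex ^ 'm" and z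
    unfolding spacetime_support_def using that closure_subset[of "{z\<in>spacetime. g z \<noteq> 0}"] by auto
  obtain t0 t1 r where t0: "0 < t0" and box: "\<And>z. z \<in> ?K \<Longrightarrow> t0 \<le> fst z \<and> fst z \<le> t1 \<and> snd z \<in> Cube r"
    by (rule compact_in_box[OF K]) (rule that)
  define F where "F z = (fst z)\<^sup>2 *\<^sub>R f z" for z
  have "smooth_on spacetime (\<lambda>z :: 'n point. fst z *\<^sub>R (fst z *\<^sub>R f z))"
    by (intro smooth_on_scaleR[OF open_spacetime] smooth_on_bounded_linear[OF bounded_linear_fst] f)
  then have "smooth_on spacetime F" by (simp add: F_def[abs_def] power2_eq_square)
  then have F: "supported_in_box r t0 t1 F"
    unfolding supported_in_box_def using box inK by (auto simp: F_def)
  obtain u T where u: "smooth_on spacetime u" and eq: "\<And>z. z \<in> spacetime \<Longrightarrow> kasner_op q b bx c u z = F z"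
    and late: "\<And>z. z \<in> spacetime \<Longrightarrow> T \<le> fst z \<Longrightarrow> u z = 0"
    and decay: "\<And>\<nu> k \<alpha>. \<forall>l w. w \<noteq> 0 \<longrightarrow> (l * l) *s w + l *s (b *v w) + c *v w = 0 \<longrightarrow> \<nu> < Re l \<Longrightarrow>
       \<exists>C>0. \<forall>z\<in>spacetime. norm ((t_deriv_t ^^ k) (multi_deriv_x \<alpha> u) z) \<le> C * fst z powr \<nu>"
    by (rule inhomogeneous_solution[where b=b and bx=bx and c=c, OF q F t0]) (rule that)
  have F0: "F z = 0" if "z \<in> spacetime" "z \<notin> ?K" for z using inK[of z f] that by (auto simp: F_def)
  have sol: "backward_solution p P f u"
    unfolding backward_solution_def
  proof (intro conjI ballI)
    show "smooth_on spacetime u" by (rule u)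
    show "P u z = f z" if z: "z \<in> spacetime" for z
    proof -
      have "(fst z)\<^sup>2 *\<^sub>R P u z = (fst z)\<^sup>2 *\<^sub>R f z" using Pq[OF u z] eq[OF z] by (simp add: F_def)
      then show ?thesis using z by (simp add: spacetime_def)
    qed
    show "spacetime_support u \<subseteq> causal_past_of_set p ?K"
      by (rule support_in_causal_past[where b=b and bx=bx and c=c and T=T])
         (use p_less u K late eq[unfolded q_def] F0 in auto)
  qed
  have unique: "u' z = u z" if u': "backward_solution p P f u'" and z: "z \<in> spacetime" for u' z
  proof -
    have s': "smooth_on spacetime u'" using u' by (simp add: backward_solution_def)
    have eq': "kasner_op q b bx c u' y = F y" if "y \<in> spacetime" for y
      using Pq[OF s' that] u' that by (simp add: backward_solution_def F_def)
    have late': "u' y = 0" if y: "y \<in> spacetime" "t1 < fst y" for y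
    proof (rule ccontr)
      assume "u' y \<noteq> 0"
      then obtain x where x: "x \<in> ?K" "x \<in> causal_future p y"
        using u' inK[OF y(1)] unfolding backward_solution_def causal_past_of_set_def by blast
      then show False using causal_future_time_le[OF x(2)] box[OF x(1)] y(2) by linarith
    qed
    let ?d = "\<lambda>y. u' y - u y"
    have "spacetime_support ?d \<subseteq> causal_past_of_set p {}"
    proof (rule support_in_causal_past[where b=b and bx=bx and c=c and T="max T (t1 + 1)"])
      show "smooth_on spacetime ?d" by (rule smooth_on_diff[OF open_spacetime s' u])
      show "?d y = 0" if "max T (t1 + 1) \<le> fst y" "y \<in> spacetime" for y using late late' that by simp
      show "kasner_op (\<chi> j. 1 - p $ j) b bx c ?d y = 0" if "y \<in> spacetime" for y
        using kasner_op_diff[OF s' u that, of q b bx c] eq[OF that] eq'[OF that] by (simp add: q_def)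
    qed (use p_less in auto)
    then show ?thesis using inK[OF z, of ?d] by (auto simp: causal_past_of_set_def)
  qed
  have bound: "\<exists>C>0. \<forall>z\<in>causal_future_axis p. norm ((t_deriv_t ^^ k) (multi_deriv_x \<alpha> u) z) \<le> C * fst z powr (- Im \<sigma>\<^sub>1 - \<epsilon>)"
    if "0 < \<epsilon>" for k \<alpha> \<epsilon>
  proof -
    have lt: "- Im \<sigma>\<^sub>1 - \<epsilon> < Re l" if "w \<noteq> 0" "(l * l) *s w + l *s (b *v w) + c *v w = 0" for l w
    proof -
      have "qnm_frequency p P (- \<i> * l)" by (rule indicial_root_gives_frequency[OF P that])
      then have "Im (- \<i> * l) \<le> Im \<sigma>\<^sub>1" using largest by blast
      then show ?thesis using \<open>0 < \<epsilon>\<close> by simp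
    qed
    have "\<exists>C>0. \<forall>z\<in>spacetime. norm ((t_deriv_t ^^ k) (multi_deriv_x \<alpha> u) z) \<le> C * fst z powr (- Im \<sigma>\<^sub>1 - \<epsilon>)"
      by (rule decay) (use lt in blast)
    then show ?thesis unfolding causal_future_axis_def by blast
  qed
  show ?thesis by (intro exI[of _ u] conjI allI impI ballI sol unique bound)
qed

end
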